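(* Fix $\delta>0$. (a) For each positive cubefree integer $q$, choose a subgroup $H_q$ of $(\mathbb{Z}/q\mathbb{Z})^\times$ and a coset $a_qH_q\subset(\mathbb{Z}/q\mathbb{Z})^\times$, and suppose there is $c>0$ with $\#H_q\ge c\,q^{\frac12+\delta}$ for all such $q$. Then the probability measures $\mu_{a_qH_q}$ converge weakly to Lebesgue measure on $\mathbb{T}^2$ as $q\to\infty$ along cubefree integers, i.e. $\lim \int_{\mathbb{T}^2}f\,d\mu_{a_qH_q}=\int_{\mathbb{T}^2}f(x)\,dx$ for every continuous $f:\mathbb{T}^2\to\mathbb{C}$. (b) Likewise, if for each prime $q$ a subgroup $H_q$ of $(\mathbb{Z}/q\mathbb{Z})^\times$ and a coset $a_qH_q$ are chosen with $\#H_q\ge c\,q^{\delta}$ for some $c>0$ and all primes $q$, then $\mu_{a_qH_q}$ converges weakly to Lebesgue measure on $\mathbb{T}^2$ as $q\to\infty$ along primes.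
   Context: $\mathbb{T}^2=(\mathbb{R}/\mathbb{Z})^2$ with Lebesgue probability measure $dx$. A positive integer is cubefree if it is not divisible by $p^3$ for any prime $p$. For $d\in(\mathbb{Z}/q\mathbb{Z})^\times$, $\overline{d}$ denotes its inverse modulo $q$. For a subgroup $H_q\le(\mathbb{Z}/q\mathbb{Z})^\times$ and $a\in(\mathbb{Z}/q\mathbb{Z})^\times$, the probability measure $\mu_{aH_q}$ on $\mathbb{T}^2$ is defined by $\int_{\mathbb{T}^2}f\,d\mu_{aH_q}=\frac{1}{\#H_q}\sum_{d\in aH_q}f(d/q,\overline{d}/q)$. *)

theory Defs
  imports
    "HOL-Analysis.Analysis"
    "HOL-Number_Theory.Number_Theory"
    "HOL-Probability.Probability"
begin

quotient_type circle = real / "\<lambda>x y :: real. x - y \<in> \<int>"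
proof (rule equivpI)
  show "reflp (\<lambda>x y :: real. x - y \<in> \<int>)"
    by (simp add: reflp_def)
  show "symp (\<lambda>x y :: real. x - y \<in> \<int>)"
    by (metis (mono_tags, lifting) Ints_minus minus_diff_eq sympI)
  show "transp (\<lambda>x y :: real. x - y \<in> \<int>)"
  proof (rule transpI)
    fix x y z :: real
    assume "x - y \<in> \<int>" "y - z \<in> \<int>"
    then have "(x - y) + (y - z) \<in> \<int>" by (rule Ints_add)
    then show "x - z \<in> \<int>" by simp
  qed
qed

lift_definition to_circle :: "real \<Rightarrow> circle" is "\<lambda>x. x" .

lemma to_circle_eq_iff: "to_circle x = to_circle y \<longleftrightarrow> x - y \<in> \<int>"
  by transfer simp

instantiation circle :: topological_space
begin

definition open_circle :: "circle set \<Rightarrow> bool" where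
  "open_circle U \<longleftrightarrow> open (to_circle -` U)"

instance
  by standard (auto simp: open_circle_def vimage_Union)

end

lemma continuous_on_to_circle: "continuous_on A to_circle"
  by (rule continuous_on_subset[OF _ subset_UNIV])
     (simp add: continuous_on_open_vimage open_circle_def)

type_synonym torus = "circle \<times> circle"

definition to_torus :: "real \<times> real \<Rightarrow> torus" where
  "to_torus = (\<lambda>(x, y). (to_circle x, to_circle y))"

lemma continuous_on_to_torus: "continuous_on A to_torus"
  unfolding to_torus_def case_prod_beta
  by (intro continuous_on_Pair continuous_on_compose2[OF continuous_on_to_circle[of UNIV]]
        continuous_intros) auto

lemma to_torus_measurable: "to_torus \<in> borel \<rightarrow>\<^sub>M borel"
  by (rule borel_measurable_continuous_onI[OF continuous_on_to_torus])

text \<open>Here \<open>[0,1)\<^sup>2\<close> serves as a fundamental domain for the translations by pairs of integers.\<close>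

definition torus_lebesgue :: "torus measure" where
  "torus_lebesgue = distr (restrict_space lborel ({0..<1} \<times> {0..<1})) borel to_torus"

lemma unit_square_measurable: "({0..<1} \<times> {0..<1} :: (real \<times> real) set) \<in> sets lborel"
  by (simp add: borel_prod[symmetric])

lemma emeasure_unit_square: "emeasure lborel ({0..<1} \<times> {0..<1} :: (real \<times> real) set) = 1"
proof -
  have "emeasure lborel ({0..<1} \<times> {0..<1} :: (real \<times> real) set) =
      emeasure (lborel \<Otimes>\<^sub>M lborel) ({0..<1} \<times> {0..<1} :: (real \<times> real) set)"
    by (simp add: lborel_prod)
  also have "\<dots> = 1"
    by (subst lborel.emeasure_pair_measure_Times) auto
  finally show ?thesis .
qed

lemma prob_space_torus_lebesgue: "prob_space torus_lebesgue"
  unfolding torus_lebesgue_def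
proof (rule prob_space.prob_space_distr)
  show "prob_space (restrict_space lborel ({0..<1} \<times> {0..<1} :: (real \<times> real) set))"
    using unit_square_measurable emeasure_unit_square
    by (intro prob_spaceI) (simp add: emeasure_restrict_space space_restrict_space)
  show "to_torus \<in> restrict_space lborel ({0..<1} \<times> {0..<1}) \<rightarrow>\<^sub>M borel"
    using to_torus_measurable by (intro measurable_restrict_space1) simp
qed

text \<open>The torus is compact, so the test functions need not be required to be bounded.\<close>

definition torus_weak_conv :: "('i \<Rightarrow> torus measure) \<Rightarrow> torus measure \<Rightarrow> 'i filter \<Rightarrow> bool" where
  "torus_weak_conv M N F \<longleftrightarrow>
     (\<forall>f :: torus \<Rightarrow> complex. continuous_on UNIV f \<longrightarrow>
        ((\<lambda>i. integral\<^sup>L (M i) f) \<longlongrightarrow> integral\<^sup>L N f) F)"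

definition cubefree :: "nat \<Rightarrow> bool" where
  "cubefree q \<longleftrightarrow> q > 0 \<and> (\<forall>p. prime p \<longrightarrow> \<not> p ^ 3 dvd q)"

text \<open>The unit group of the ring of integers modulo \<open>q\<close>, on the representatives
  \<open>0, \<dots>, q - 1\<close>. The update of the unit element only matters for \<open>q = 1\<close>, where
  \<^const>\<open>residue_ring\<close> has its \<open>1\<close> outside the carrier \<open>{0}\<close>.\<close>

definition unit_group :: "nat \<Rightarrow> int monoid" where
  "unit_group q = units_of (residue_ring (int q) \<lparr>one := 1 mod int q\<rparr>)"

lemma unit_group_eq_residue_units:
  assumes "q > 1"
  shows "unit_group q = units_of (residue_ring (int q))"
  using assms by (simp add: unit_group_def residue_ring_def)

lemma unit_group_1:
  "unit_group 1 = \<lparr>carrier = {0}, monoid.mult = \<lambda>x y. (x * y) mod 1, one = 0\<rparr>"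
  by (auto simp: unit_group_def residue_ring_def units_of_def Units_def)

lemma mult_unit_group: "x \<otimes>\<^bsub>unit_group q\<^esub> y = (x * y) mod int q"
  by (simp add: unit_group_def units_of_def residue_ring_def)

lemma one_unit_group: "\<one>\<^bsub>unit_group q\<^esub> = 1 mod int q"
  by (simp add: unit_group_def units_of_def)

lemma carrier_unit_group:
  assumes "q > 0"
  shows "carrier (unit_group q) = {x. 0 \<le> x \<and> x < int q \<and> coprime x (int q)}"
proof (cases "q = 1")
  case True
  then show ?thesis using unit_group_1 by auto
next
  case False
  with assms have q: "q > 1" by simp
  then interpret residues "int q" "residue_ring (int q)"
    by unfold_locales simp_all
  have "carrier (unit_group q) = {x. 0 < x \<and> x < int q \<and> coprime x (int q)}"
    by (simp add: unit_group_eq_residue_units[OF q] units_of_def res_units_eq)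
  also have "\<dots> = {x. 0 \<le> x \<and> x < int q \<and> coprime x (int q)}"
    using q by (auto simp: order_le_less)
  finally show ?thesis .
qed

lemma comm_group_unit_group:
  assumes "q > 0"
  shows "comm_group (unit_group q)"
proof (cases "q = 1")
  case True
  have "comm_group \<lparr>carrier = {0 :: int}, monoid.mult = \<lambda>x y. (x * y) mod 1, one = 0\<rparr>"
    by (rule comm_groupI) auto
  then show ?thesis using True unit_group_1 by simp
next
  case False
  with assms have q: "q > 1" by simp
  then interpret residues "int q" "residue_ring (int q)"
    by unfold_locales simp_all
  show ?thesis
    using units_comm_group by (simp add: unit_group_eq_residue_units[OF q])
qed

lemma finite_carrier_unit_group: "q > 0 \<Longrightarrow> finite (carrier (unit_group q))"
  by (rule finite_subset[of _ "{0..int q}"]) (auto simp: carrier_unit_group)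

definition coset_point :: "nat \<Rightarrow> int \<Rightarrow> torus" where
  "coset_point q d =
     to_torus (of_int d / of_nat q, of_int (inv\<^bsub>unit_group q\<^esub> d) / of_nat q)"

definition coset_measure :: "nat \<Rightarrow> int set \<Rightarrow> torus measure" where
  "coset_measure q D = distr (uniform_count_measure D) borel (coset_point q)"

lemma coset_measure_integral:
  fixes f :: "torus \<Rightarrow> complex"
  assumes q: "q > 0" and H: "subgroup H (unit_group q)" and a: "a \<in> carrier (unit_group q)"
    and f: "continuous_on UNIV f"
  shows "integral\<^sup>L (coset_measure q (a <#\<^bsub>unit_group q\<^esub> H)) f =
    1 / of_nat (card H) * (\<Sum>d\<in>a <#\<^bsub>unit_group q\<^esub> H. f (coset_point q d))"
proof -
  let ?D = "a <#\<^bsub>unit_group q\<^esub> H"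
  interpret comm_group "unit_group q" by (rule comm_group_unit_group[OF q])
  have sub: "H \<subseteq> carrier (unit_group q)" using H by (rule subgroup.subset)
  then have fin: "finite H" using finite_carrier_unit_group[OF q] finite_subset by blast
  have D: "?D = (\<lambda>h. a \<otimes>\<^bsub>unit_group q\<^esub> h) ` H" by (auto simp: l_coset_def)
  have "inj_on (\<lambda>h. a \<otimes>\<^bsub>unit_group q\<^esub> h) H"
    using a sub by (intro inj_onI) (auto simp: subset_iff)
  then have card: "card ?D = card H" by (simp add: D card_image)
  have "finite ?D" using fin by (simp add: D)
  have "integral\<^sup>L (coset_measure q ?D) f =
      integral\<^sup>L (uniform_count_measure ?D) (\<lambda>d. f (coset_point q d))"
    unfolding coset_measure_def
    by (rule integral_distr)
       (auto intro: borel_measurable_continuous_onI[OF f] simp: uniform_count_measure_def)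
  also have "\<dots> = (\<Sum>d\<in>?D. (1 / real (card ?D)) *\<^sub>R f (coset_point q d))"
    unfolding uniform_count_measure_def
    by (rule lebesgue_integral_point_measure_finite[OF \<open>finite ?D\<close>]) simp
  also have "\<dots> = 1 / of_nat (card H) * (\<Sum>d\<in>?D. f (coset_point q d))"
    by (simp add: card scaleR_conv_of_real sum_distrib_left)
  finally show ?thesis .
qed

end

theory Submission
  imports Defs "HOL-Computational_Algebra.Squarefree"
begin

text \<open>By Stone--Weierstrass it suffices that for fixed \<open>(m, n) \<noteq> (0, 0)\<close> the sum of
  \<open>e((m h + n h\<^sup>-\<^sup>1) / q)\<close> over the coset is \<open>o(#H)\<close>.

  For prime \<open>q\<close> this is a sum-product phenomenon. The set of frequencies at which the measure on \<open>H\<close>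
  (or on \<open>{(h, h\<^sup>-\<^sup>1)}\<close>) has a large Fourier coefficient is invariant under \<open>H\<close>, and by Bessel's
  inequality many of its differences are large frequencies again. Balog--Szemeredi--Gowers gives a
  subset \<open>A\<close> with \<open>|A - A|\<close> comparable to \<open>|A|\<close>, which many elements of \<open>H\<close> dilate into few translates
  of itself. The set of such multipliers grows under ring operations (Glibichuk--Konyagin) until it
  has a size incompatible with a count of additive energies.

  For cubefree \<open>q = q\<^sub>1 q\<^sub>2\<^sup>2\<close> the elements of \<open>H\<close> congruent to 1 modulo \<open>q\<^sub>1 q\<^sub>2\<close> form a group
  \<open>{1 + q\<^sub>1 q\<^sub>2 g j}\<close>. If \<open>H\<close> is large modulo \<open>k = q\<^sub>2 / g\<close>, averaging over this group leaves only the few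
  solutions of a quadratic congruence modulo \<open>k\<close>. Otherwise the kernel of reduction modulo \<open>q\<^sub>2\<close> has
  more than \<open>q\<^sub>1\<^bsup>1/2 + \<kappa>\<^esup>\<close> elements modulo the squarefree \<open>q\<^sub>1\<close>, and a large sum, being constant along
  an orbit, would produce by Bessel more large frequencies than Parseval allows.\<close>

section \<open>Additive combinatorics\<close>

text \<open>Three choices shape the proof. The modulus varies and a type cannot vary with it, so the
  growth argument lives in one commutative ring: an idempotent \<open>e\<close> cuts out the ideal
  \<open>e * x = x\<close> that plays the field or the plane, and a divisor of \<open>e\<close>
  counts as invertible. The plane has zero divisors, while the quotient-set argument needs
  invertible differences; it is therefore run on sets with both coordinates injective
  (\<open>inj2\<close>). These have at most \<open>p\<close> elements, so growth must at some point
  pass to an axis, fill it, and return by adding a transversal set. For the same reason the sums in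
  \<open>h\<close> alone come first: they limit how many large frequencies can share a coordinate.
  The number of rounds depends on \<open>\<delta>\<close> only, so all losses are a fixed power of
  \<open>K = p^\<epsilon>\<close> with \<open>\<epsilon>\<close> chosen afterwards. For squarefree
  moduli the exponent 1/2 enters by counting: a positive share of all pairs of orbit points yields
  large frequencies of the untwisted sum, and only boundedly many of these fit into each of the
  \<open>Q\<close> rows. The twist itself is the phase modulo \<open>q2^2\<close>, which is additive
  on the kernel of reduction modulo \<open>q2\<close>.\<close>

definition sumset :: "'a::ab_group_add set \<Rightarrow> 'a set \<Rightarrow> 'a set" where
  "sumset A B = (\<lambda>(a, b). a + b) ` (A \<times> B)"

definition diffset :: "'a::ab_group_add set \<Rightarrow> 'a set \<Rightarrow> 'a set" where
  "diffset A B = (\<lambda>(a, b). a - b) ` (A \<times> B)"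

primrec msum :: "nat \<Rightarrow> 'a::ab_group_add set \<Rightarrow> 'a set" where
  "msum 0 B = {0}"
| "msum (Suc n) B = sumset B (msum n B)"

lemma sumsetI: "a \<in> A \<Longrightarrow> b \<in> B \<Longrightarrow> a + b \<in> sumset A B"
  by (auto simp: sumset_def)

lemma sumsetE:
  assumes "x \<in> sumset A B" obtains a b where "a \<in> A" "b \<in> B" "x = a + b"
  using assms by (auto simp: sumset_def)

lemma diffsetI: "a \<in> A \<Longrightarrow> b \<in> B \<Longrightarrow> a - b \<in> diffset A B"
  by (auto simp: diffset_def)

lemma diffsetE:
  assumes "x \<in> diffset A B" obtains a b where "a \<in> A" "b \<in> B" "x = a - b"
  using assms by (auto simp: diffset_def)

lemma finite_sumset [simp]: "finite A \<Longrightarrow> finite B \<Longrightarrow> finite (sumset A B)"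
  by (simp add: sumset_def)

lemma finite_diffset [simp]: "finite A \<Longrightarrow> finite B \<Longrightarrow> finite (diffset A B)"
  by (simp add: diffset_def)

lemma finite_msum [simp]: "finite B \<Longrightarrow> finite (msum n B)"
  by (induction n) simp_all

lemma sumset_mono: "A \<subseteq> A' \<Longrightarrow> B \<subseteq> B' \<Longrightarrow> sumset A B \<subseteq> sumset A' B'"
  by (auto simp: sumset_def)

lemma card_sumset_le: "finite A \<Longrightarrow> finite B \<Longrightarrow> card (sumset A B) \<le> card A * card B"
  unfolding sumset_def using card_image_le[of "A \<times> B" "\<lambda>(a, b). a + b"] by (simp add: card_cartesian_product)

lemma card_diffset_le: "finite A \<Longrightarrow> finite B \<Longrightarrow> card (diffset A B) \<le> card A * card B"
  unfolding diffset_def using card_image_le[of "A \<times> B" "\<lambda>(a, b). a - b"] by (simp add: card_cartesian_product)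

lemma card_msum_le: "finite B \<Longrightarrow> card (msum n B) \<le> card B ^ n"
proof (induction n)
  case (Suc n)
  then show ?case using card_sumset_le[of B "msum n B"]
    by (simp add: order_trans[OF _ mult_le_mono2])
qed simp

lemma msum_add: "x \<in> msum m B \<Longrightarrow> y \<in> msum n B \<Longrightarrow> x + y \<in> msum (m + n) B"
proof (induction m arbitrary: x)
  case (Suc m)
  then obtain a b where "a \<in> B" "b \<in> msum m B" "x = a + b" by (auto elim!: sumsetE)
  then show ?case using Suc.IH[of b] Suc.prems sumsetI[of a B "b + y" "msum (m + n) B"]
    by (simp add: add.assoc)
qed simp

lemma msum_uminus:
  assumes "\<And>x. x \<in> B \<Longrightarrow> - x \<in> B"
  shows "x \<in> msum n B \<Longrightarrow> - x \<in> msum n B"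
proof (induction n arbitrary: x)
  case (Suc n)
  then obtain a b where "a \<in> B" "b \<in> msum n B" "x = a + b" by (auto elim!: sumsetE)
  then show ?case using Suc.IH[of b] assms[of a] sumsetI[of "- a" B "- b" "msum n B"]
    by (simp add: add.commute)
qed simp

lemma msum_zero: "0 \<in> B \<Longrightarrow> 0 \<in> msum n B"
  by (induction n) (use sumsetI[of 0 B 0] in auto)

lemma msum_mono:
  assumes "0 \<in> B" "m \<le> n" shows "msum m B \<subseteq> msum n B"
proof
  fix x assume "x \<in> msum m B"
  then have "x + 0 \<in> msum (m + (n - m)) B" using msum_zero[OF assms(1)] msum_add by blast
  then show "x \<in> msum n B" using assms by simp
qed

section \<open>Sumset inequalities of Pluennecke and Ruzsa type\<close>

lemma sumset_assoc: "sumset (sumset A B) C = sumset A (sumset B C)"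
  by (auto simp: sumset_def image_iff) (metis add.assoc)+

text \<open>Petridis' induction on \<open>C\<close>. A new point \<open>c\<close> adds to
  \<open>X + B + C\<close> only what is not yet covered of \<open>X + B + c\<close>;
  \<open>Z\<close> collects the \<open>x\<close> with \<open>x + B + c\<close> already covered, and
  minimality of the ratio, applied to \<open>Z\<close>, bounds from below how much is saved. On the
  other side \<open>X + C\<close> gains exactly \<open>|X| - |W|\<close> points, and
  \<open>W\<close> lies in \<open>Z\<close>.\<close>

lemma petridis:
  fixes X B C :: "'a::ab_group_add set" and K :: real
  assumes X: "finite X" and B: "finite B"
    and min: "\<And>Z. Z \<subseteq> X \<Longrightarrow> K * card Z \<le> card (sumset Z B)"
    and eq: "card (sumset X B) = K * card X" and C: "finite C" and K: "K \<ge> 0"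
  shows "card (sumset (sumset X B) C) \<le> K * card (sumset X C)"
  using C
proof (induction C)
  case empty
  then show ?case by (simp add: sumset_def)
next
  case (insert c C)
  define sh where "sh = (\<lambda>S. (\<lambda>x::'a. x + c) ` S)"
  have csh: "card (sh S) = card S" for S by (simp add: sh_def card_image)
  have fsh: "finite S \<Longrightarrow> finite (sh S)" for S by (simp add: sh_def)
  define XB where "XB = sumset X B"
  have fXB: "finite XB" using X B by (simp add: XB_def)
  have ins: "sumset S (insert c C) = sumset S C \<union> sh S" for S
    by (auto simp: sumset_def sh_def)
  define Z where "Z = {x \<in> X. sh (sumset {x} B) \<subseteq> sumset XB C}"
  define W where "W = {x \<in> X. x + c \<in> sumset X C}"
  have ZX: "Z \<subseteq> X" "W \<subseteq> X" by (auto simp: Z_def W_def)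
  have fZ: "finite Z" "finite W" using X finite_subset ZX by auto
  have WZ: "W \<subseteq> Z"
  proof
    fix x assume "x \<in> W"
    then obtain x' c' where x: "x \<in> X" "x' \<in> X" "c' \<in> C" "x + c = x' + c'" by (auto simp: W_def sumset_def)
    have "x + b + c \<in> sumset XB C" if "b \<in> B" for b
    proof -
      have eq: "x + b + c = (x' + b) + c'" using x(4) by (simp add: algebra_simps)
      have "(x' + b) + c' \<in> sumset XB C"
        unfolding XB_def by (intro sumsetI x that)
      then show ?thesis unfolding eq .
    qed
    then show "x \<in> Z" using x by (auto simp: Z_def sh_def sumset_def)
  qed
  have ZB: "sh (sumset Z B) \<subseteq> sumset XB C"
    by (fastforce simp: Z_def sh_def sumset_def)
  have sub: "sumset XB (insert c C) \<subseteq> sumset XB C \<union> (sh XB - sh (sumset Z B))"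
    using ZB by (auto simp: ins)
  have "sumset Z B \<subseteq> XB" using ZX by (auto simp: XB_def intro: subsetD[OF sumset_mono])
  then have le1: "sh (sumset Z B) \<subseteq> sh XB" by (auto simp: sh_def)
  have "card (sumset XB (insert c C)) \<le> card (sumset XB C) + card (sh XB - sh (sumset Z B))"
    using card_mono[OF _ sub] card_Un_le fXB insert fsh
    by (meson finite_Diff finite_UnI finite_sumset le_trans)
  also have "card (sh XB - sh (sumset Z B)) = card XB - card (sumset Z B)"
    using le1 fXB fZ B by (simp add: card_Diff_subset fsh csh)
  finally have "real (card (sumset XB (insert c C))) \<le> card (sumset XB C) + (real (card XB) - card (sumset Z B))"
    using card_mono[OF fXB \<open>sumset Z B \<subseteq> XB\<close>] by linarith
  also have "\<dots> \<le> K * card (sumset X C) + (K * card X - K * card Z)"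
    using insert.IH min[of Z] ZX eq by (auto simp: XB_def)
  also have "\<dots> = K * (card (sumset X C) + real (card X) - card Z)" by (simp add: algebra_simps)
  also have "\<dots> \<le> K * (card (sumset X C) + real (card X) - card W)"
    using K WZ card_mono[OF fZ(1) WZ] by (intro mult_left_mono) auto
  also have "card (sumset X C) + real (card X) - card W \<le> card (sumset X (insert c C))"
  proof -
    have "sumset X C \<union> (sh X - sh W) \<subseteq> sumset X (insert c C)" by (auto simp: ins)
    moreover have "sumset X C \<inter> (sh X - sh W) = {}" by (auto simp: sh_def W_def)
    ultimately have "card (sumset X C) + card (sh X - sh W) \<le> card (sumset X (insert c C))"
      using X insert fsh by (metis card_Un_disjoint card_mono finite.insertI finite_Diff finite_sumset)
    moreover have "sh W \<subseteq> sh X" using ZX by (auto simp: sh_def)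
    then have "card (sh X - sh W) = card X - card W"
      using fZ by (simp add: card_Diff_subset fsh csh)
    ultimately show ?thesis by linarith
  qed
  finally show ?case using K by (simp add: XB_def mult_left_mono)
qed

text \<open>\<open>X\<close> minimises \<open>|Z + B| / |Z|\<close> over the nonempty subsets of
  \<open>A\<close>; the minimum is at most the ratio of \<open>A\<close> itself, hence at most
  \<open>K\<close>.\<close>

lemma petridis_exists:
  fixes A B :: "'a::ab_group_add set" and K :: real
  assumes A: "finite A" "A \<noteq> {}" and B: "finite B" "B \<noteq> {}" and K: "card (sumset A B) \<le> K * card A"
  obtains X where "X \<subseteq> A" "X \<noteq> {}"
    "\<And>C. finite C \<Longrightarrow> real (card (sumset (sumset X B) C)) \<le> K * card (sumset X C)"
proof -
  define f where "f = (\<lambda>X. real (card (sumset X B)) / card X)"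
  have "finite (Pow A - {{}})" "Pow A - {{}} \<noteq> {}" using A by auto
  then obtain X where X: "X \<in> Pow A - {{}}" and Xm: "\<And>Z. Z \<in> Pow A - {{}} \<Longrightarrow> f X \<le> f Z"
    using ex_is_arg_min_if_finite[of "Pow A - {{}}" f] by (auto simp: is_arg_min_linorder)
  have fX: "finite X" using X A finite_subset by auto
  then have cX: "card X > 0" using X by (simp add: card_gt_0_iff)
  have "card A > 0" using A by (simp add: card_gt_0_iff)
  then have "f A \<le> K" using K by (simp add: f_def field_simps)
  then have "f X \<le> K" using Xm[of A] A by auto
  have "real (card (sumset (sumset X B) C)) \<le> K * card (sumset X C)" if C: "finite C" for C
  proof -
    have "real (card (sumset (sumset X B) C)) \<le> f X * card (sumset X C)"
    proof (rule petridis[OF fX B(1) _ _ C])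
      fix Z assume Z: "Z \<subseteq> X"
      show "f X * card Z \<le> card (sumset Z B)"
      proof (cases "Z = {}")
        case False
        then have "card Z > 0" using Z fX finite_subset by (auto simp: card_gt_0_iff)
        moreover have "f X \<le> f Z" using Xm[of Z] Z X False by auto
        ultimately show ?thesis unfolding f_def by (simp add: field_simps)
      qed simp
    qed (use cX in \<open>auto simp: f_def\<close>)
    also have "\<dots> \<le> K * card (sumset X C)" using \<open>f X \<le> K\<close> by (intro mult_right_mono) auto
    finally show ?thesis .
  qed
  then show ?thesis using that X by auto
qed

text \<open>Fix for each difference \<open>w\<close> one representation \<open>w = u - v\<close>.
  Then \<open>(x, w)\<close> can be recovered from \<open>(x + u, x + v)\<close>, because the
  difference of the two entries is \<open>w\<close>.\<close>

lemma ruzsa_triangle: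
  fixes U V X :: "'a::ab_group_add set"
  assumes "finite U" "finite V" "finite X"
  shows "card X * card (diffset U V) \<le> card (sumset X U) * card (sumset X V)"
proof -
  define r where "r = (\<lambda>w. SOME p. p \<in> U \<times> V \<and> fst p - snd p = w)"
  have r: "r w \<in> U \<times> V \<and> fst (r w) - snd (r w) = w" if w: "w \<in> diffset U V" for w
    unfolding r_def by (rule someI_ex) (use w in \<open>auto simp: diffset_def\<close>)
  define f where "f = (\<lambda>(x, w). (x + fst (r w), x + snd (r w)))"
  have "inj_on f (X \<times> diffset U V)"
  proof (rule inj_onI)
    fix p q assume pq: "p \<in> X \<times> diffset U V" "q \<in> X \<times> diffset U V" "f p = f q"
    obtain x w y z where [simp]: "p = (x, w)" "q = (y, z)" by (cases p, cases q)
    have e: "x + fst (r w) = y + fst (r z)" "x + snd (r w) = y + snd (r z)" using pq by (auto simp: f_def)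
    have "w = (x + fst (r w)) - (x + snd (r w))" using r[of w] pq by auto
    also have "\<dots> = z" using r[of z] pq unfolding e by auto
    finally show "p = q" using e by simp
  qed
  moreover have "f ` (X \<times> diffset U V) \<subseteq> sumset X U \<times> sumset X V"
  proof
    fix z assume "z \<in> f ` (X \<times> diffset U V)"
    then obtain x w where "x \<in> X" "w \<in> diffset U V" "z = f (x, w)" by auto
    then show "z \<in> sumset X U \<times> sumset X V" using r[of w] by (auto simp: f_def mem_Times_iff intro!: sumsetI)
  qed
  ultimately have "card (X \<times> diffset U V) \<le> card (sumset X U \<times> sumset X V)"
    using assms by (intro card_inj_on_le) auto
  then show ?thesis by (simp add: card_cartesian_product)
qed

text \<open>With \<open>B = - A\<close>, every element of \<open>A + n (A - A)\<close> is a sum of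
  \<open>n\<close> elements of \<open>B\<close> minus a sum of \<open>n + 1\<close> of them. For the
  Petridis set \<open>X\<close> such sums satisfy \<open>|X + n B| \<le> K^n |X|\<close>, and the
  Ruzsa triangle inequality multiplies \<open>K^n\<close> by \<open>K^(n + 1)\<close>.\<close>

lemma plunnecke_diff:
  fixes A :: "'a::ab_group_add set" and K :: real
  assumes A: "finite A" "A \<noteq> {}" and K: "card (diffset A A) \<le> K * card A"
  shows "card (sumset A (msum n (diffset A A))) \<le> K ^ (2 * n + 1) * card A"
proof -
  define B where "B = uminus ` A"
  have B: "finite B" "B \<noteq> {}" using A by (auto simp: B_def)
  have AB: "sumset A B = diffset A A"
    by (force simp: sumset_def diffset_def B_def image_iff)
  have "card (diffset A A) > 0" using A by (auto simp: card_gt_0_iff diffset_def)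
  then have "K * card A > 0" using K by linarith
  then have K0: "K \<ge> 0" by (simp add: zero_less_mult_iff)
  obtain X where X: "X \<subseteq> A" "X \<noteq> {}" and
    P: "\<And>C. finite C \<Longrightarrow> real (card (sumset (sumset X B) C)) \<le> K * card (sumset X C)"
    using petridis_exists[OF A B] K AB by metis
  have fX: "finite X" using X A finite_subset by auto
  have it: "real (card (sumset X (msum n B))) \<le> K ^ n * card X" for n
  proof (induction n)
    case 0
    have "sumset X {0} = X" by (force simp: sumset_def)
    then show ?case by simp
  next
    case (Suc n)
    have "real (card (sumset X (msum (Suc n) B))) \<le> K * card (sumset X (msum n B))"
      using P[of "msum n B"] B by (simp add: sumset_assoc)
    also have "\<dots> \<le> K * (K ^ n * card X)" using Suc K0 by (rule mult_left_mono)
    finally show ?case by (simp add: mult.assoc)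
  qed
  have dec: "\<exists>u\<in>msum n B. \<exists>v\<in>msum n B. x = u - v" if "x \<in> msum n (diffset A A)" for x n
    using that
  proof (induction n arbitrary: x)
    case (Suc n)
    then obtain a a' y where y: "a \<in> A" "a' \<in> A" "y \<in> msum n (diffset A A)" "x = (a - a') + y"
      by (auto elim!: sumsetE diffsetE)
    then obtain u v where "u \<in> msum n B" "v \<in> msum n B" "y = u - v" using Suc.IH by blast
    moreover have "- a' + u \<in> msum (Suc n) B" "- a + v \<in> msum (Suc n) B"
      unfolding msum.simps using y calculation by (intro sumsetI; simp add: B_def)+
    moreover have "x = (- a' + u) - (- a + v)" using y calculation by (simp add: algebra_simps)
    ultimately show ?case by blast
  qed simp
  have "sumset A (msum n (diffset A A)) \<subseteq> diffset (msum n B) (msum (Suc n) B)"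
  proof
    fix z assume "z \<in> sumset A (msum n (diffset A A))"
    then obtain a x where z: "a \<in> A" "x \<in> msum n (diffset A A)" "z = a + x" by (auto elim: sumsetE)
    then obtain u v where "u \<in> msum n B" "v \<in> msum n B" "x = u - v" using dec by blast
    have "- a \<in> B" using z by (simp add: B_def)
    then have "- a + v \<in> msum (Suc n) B" unfolding msum.simps by (rule sumsetI) fact
    then have "u - (- a + v) \<in> diffset (msum n B) (msum (Suc n) B)"
      by (rule diffsetI[OF \<open>u \<in> msum n B\<close>])
    moreover have "z = u - (- a + v)" unfolding z(3) \<open>x = u - v\<close> by (simp add: algebra_simps)
    ultimately show "z \<in> diffset (msum n B) (msum (Suc n) B)" by (simp only:)
  qed
  then have "card (sumset A (msum n (diffset A A))) \<le> card (diffset (msum n B) (msum (Suc n) B))"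
    using B by (intro card_mono finite_diffset finite_msum) auto
  moreover have "real (card X * card (diffset (msum n B) (msum (Suc n) B))) \<le>
     real (card (sumset X (msum n B)) * card (sumset X (msum (Suc n) B)))"
    using ruzsa_triangle[of "msum n B" "msum (Suc n) B" X] B fX by (intro of_nat_mono) (simp del: msum.simps)
  moreover have "\<dots> \<le> (K ^ n * card X) * (K ^ Suc n * card X)"
    unfolding of_nat_mult using it[of n] it[of "Suc n"] K0 by (intro mult_mono) (auto simp del: msum.simps)
  moreover have "(K ^ n * card X) * (K ^ Suc n * card X) = card X * (K ^ (2 * n + 1) * card X)"
    by (simp add: power_add mult_2)
  moreover have "card X * real (card (sumset A (msum n (diffset A A))))
      \<le> card X * real (card (diffset (msum n B) (msum (Suc n) B)))"
    using calculation(1) by (intro mult_left_mono of_nat_mono) auto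
  ultimately have "card X * real (card (sumset A (msum n (diffset A A)))) \<le> card X * (K ^ (2 * n + 1) * card X)"
    unfolding of_nat_mult by linarith
  moreover have "card X > 0" using X fX by (simp add: card_gt_0_iff)
  ultimately have "real (card (sumset A (msum n (diffset A A)))) \<le> K ^ (2 * n + 1) * card X" by simp
  also have "\<dots> \<le> K ^ (2 * n + 1) * card A"
    using K0 X A by (intro mult_left_mono) (auto simp: card_mono)
  finally show ?thesis .
qed

text \<open>Take \<open>T\<close> maximal such that the sets \<open>t - W\<close> are disjoint;
  together they fill at most \<open>|S - W|\<close> points. For any other \<open>s\<close> the set
  \<open>s - W\<close> meets some \<open>t - W\<close>, which places \<open>s\<close> in
  \<open>t + W - W\<close>.\<close>

lemma ruzsa_covering:
  fixes S W :: "'a::ab_group_add set"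
  assumes S: "finite S" and W: "finite W" "W \<noteq> {}"
  obtains T where "T \<subseteq> S" "card T * card W \<le> card (diffset S W)" "S \<subseteq> sumset T (diffset W W)"
proof -
  define Q where "Q = (\<lambda>T. T \<subseteq> S \<and> (\<forall>t\<in>T. \<forall>t'\<in>T. t \<noteq> t' \<longrightarrow> (\<lambda>w. t - w) ` W \<inter> (\<lambda>w. t' - w) ` W = {}))"
  have "Q {}" by (simp add: Q_def)
  moreover have "\<forall>T. Q T \<longrightarrow> card T \<le> card S" using S by (auto simp: Q_def card_mono)
  ultimately obtain T where T: "Q T" and mx: "\<And>T'. Q T' \<Longrightarrow> card T' \<le> card T"
    using ex_has_greatest_nat[of Q "{}" card "Suc (card S)"] by (auto simp: less_Suc_eq_le)
  have fT: "finite T" using T S finite_subset by (auto simp: Q_def)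
  have "card (\<Union>t\<in>T. (\<lambda>w. t - w) ` W) = (\<Sum>t\<in>T. card ((\<lambda>w. t - w) ` W))"
    using T fT W by (intro card_UN_disjoint) (auto simp: Q_def)
  also have "\<dots> = card T * card W" by (simp add: card_image inj_on_def)
  finally have "card T * card W = card (\<Union>t\<in>T. (\<lambda>w. t - w) ` W)" by simp
  also have "\<dots> \<le> card (diffset S W)"
    using T S W by (intro card_mono) (auto simp: Q_def intro!: diffsetI)
  finally have 1: "card T * card W \<le> card (diffset S W)" .
  have "s \<in> sumset T (diffset W W)" if s: "s \<in> S" for s
  proof (cases "s \<in> T")
    case True
    obtain w where "w \<in> W" using W by auto
    then show ?thesis using sumsetI[OF True diffsetI[of w W w W]] by simp
  next
    case False
    have "\<not> Q (insert s T)" using mx[of "insert s T"] False fT by auto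
    then obtain t where "t \<in> T" "(\<lambda>w. t - w) ` W \<inter> (\<lambda>w. s - w) ` W \<noteq> {}"
      using T s unfolding Q_def by (metis Int_commute insert_iff insert_subset)
    then obtain w w' where w: "w \<in> W" "w' \<in> W" "t - w = s - w'" by auto
    then have "s = t + (w' - w)" by (simp add: algebra_simps)
    then show ?thesis using \<open>t \<in> T\<close> w by (auto intro!: sumsetI diffsetI)
  qed
  then show ?thesis using that[of T] T 1 by (auto simp: Q_def)
qed

section \<open>Energy counts and the Balog-Szemeredi-Gowers theorem\<close>

lemma sum_card_fibres:
  assumes "finite S" shows "(\<Sum>y\<in>f ` S. card {s\<in>S. f s = y}) = card S"
  using sum.image_gen[OF assms, of "\<lambda>_. 1::nat" f] by simp

lemma card_image_energy:
  assumes "finite S"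
  shows "(card S)\<^sup>2 \<le> card (f ` S) * card {(s, t). s \<in> S \<and> t \<in> S \<and> f s = f t}"
proof -
  let ?n = "\<lambda>y. card {s\<in>S. f s = y}"
  have "{(s, t). s \<in> S \<and> t \<in> S \<and> f s = f t} = (\<Union>y\<in>f ` S. {s\<in>S. f s = y} \<times> {s\<in>S. f s = y})" by auto
  also have "card \<dots> = (\<Sum>y\<in>f ` S. card ({s\<in>S. f s = y} \<times> {s\<in>S. f s = y}))"
    using assms by (intro card_UN_disjoint) auto
  finally have E: "card {(s, t). s \<in> S \<and> t \<in> S \<and> f s = f t} = (\<Sum>y\<in>f ` S. (?n y)\<^sup>2)"
    by (simp add: card_cartesian_product power2_eq_square)
  have "(\<Sum>y\<in>f ` S. 1 * real (?n y))\<^sup>2 \<le> (\<Sum>y\<in>f ` S. 1\<^sup>2) * (\<Sum>y\<in>f ` S. (real (?n y))\<^sup>2)"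
    by (rule Cauchy_Schwarz_ineq_sum)
  then have "(real (card S))\<^sup>2 \<le> real (card (f ` S)) * (\<Sum>y\<in>f ` S. (real (?n y))\<^sup>2)"
    using sum_card_fibres[OF assms, of f] by (simp flip: of_nat_sum)
  then have "real ((card S)\<^sup>2) \<le> real (card (f ` S) * (\<Sum>y\<in>f ` S. (?n y)\<^sup>2))" by simp
  then show ?thesis unfolding E of_nat_le_iff .
qed

lemma exists_ge_average:
  fixes f g :: "'b \<Rightarrow> real"
  assumes "finite S" "S \<noteq> {}" "sum g S \<le> sum f S"
  obtains x where "x \<in> S" "g x \<le> f x"
  using assms sum_strict_mono[of S f g] by (meson linorder_not_le)

text \<open>Gowers' argument through paths of length four. A vertex \<open>v\<close> is chosen whose
  neighbourhood contains few pairs with few common neighbours, and \<open>A\<close> keeps those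
  points of it that lie in few such pairs. Then every difference in \<open>A - A\<close> is an
  alternating sum of four elements of \<open>L\<close> in at least
  \<open>\<alpha>^5 |B|^3 / 1024\<close> ways.\<close>

lemma balog_szemeredi_gowers:
  fixes B L :: "'a::ab_group_add set" and P :: "('a \<times> 'a) set" and \<alpha> :: real
  assumes B: "finite B" "B \<noteq> {}" and L: "finite L" and P: "P \<subseteq> B \<times> B"
    and PL: "\<And>a b. (a, b) \<in> P \<Longrightarrow> a - b \<in> L"
    and \<alpha>: "\<alpha> > 0" "\<alpha> * (card B)\<^sup>2 \<le> card P"
  obtains A where "A \<subseteq> B" "\<alpha> / 4 * card B \<le> card A"
    "real (card (diffset A A)) * (\<alpha> ^ 5 * card B ^ 3) \<le> 1024 * card L ^ 4"
proof -
  define b where "b = real (card B)"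
  have b: "b > 0" using B by (simp add: b_def card_gt_0_iff)
  \<comment> \<open>With this threshold the bad pairs, counted with weight 8, take up at most half
    of the lower bound \<open>\<alpha>^2 b^3\<close> for the second moment of the neighbourhood
    sizes.\<close>
  define \<tau> where "\<tau> = \<alpha>\<^sup>2 / 16"
  define N where "N = (\<lambda>v. {a \<in> B. (a, v) \<in> P})"
  define cn where "cn = (\<lambda>a a'. {v \<in> B. (a, v) \<in> P \<and> (a', v) \<in> P})"
  define bad where "bad = {(a, a'). a \<in> B \<and> a' \<in> B \<and> real (card (cn a a')) < \<tau> * b}"
  define bv where "bv = (\<lambda>v. {p \<in> bad. fst p \<in> N v \<and> snd p \<in> N v})"
  have fin: "finite (N v)" "finite (cn a a')" "finite bad" for v a a'
    using B finite_subset[of bad "B \<times> B"] by (auto simp: N_def cn_def bad_def)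
  then have fbv: "finite (bv v)" for v by (simp add: bv_def)
  have fP: "finite P" using P B finite_subset by blast
  have "P = (\<Union>v\<in>B. (\<lambda>a. (a, v)) ` N v)" using P by (auto simp: N_def)
  also have "card \<dots> = (\<Sum>v\<in>B. card ((\<lambda>a. (a, v)) ` N v))"
    using B fin by (intro card_UN_disjoint) auto
  also have "\<dots> = (\<Sum>v\<in>B. card (N v))" by (simp add: card_image inj_on_def)
  finally have cP: "real (card P) = (\<Sum>v\<in>B. real (card (N v)))" by simp
  have "(\<Sum>v\<in>B. 1 * real (card (N v)))\<^sup>2 \<le> (\<Sum>v\<in>B. 1\<^sup>2) * (\<Sum>v\<in>B. (real (card (N v)))\<^sup>2)"
    by (rule Cauchy_Schwarz_ineq_sum)
  then have "(real (card P))\<^sup>2 \<le> b * (\<Sum>v\<in>B. (real (card (N v)))\<^sup>2)"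
    by (simp add: cP b_def)
  moreover have "(\<alpha> * b\<^sup>2)\<^sup>2 \<le> (real (card P))\<^sup>2"
    using \<alpha> b by (intro power_mono) (auto simp: b_def)
  ultimately have "b * (\<alpha>\<^sup>2 * b ^ 3) \<le> b * (\<Sum>v\<in>B. (real (card (N v)))\<^sup>2)"
    by (simp add: power_mult_distrib power2_eq_square power3_eq_cube mult_ac)
  then have N2: "\<alpha>\<^sup>2 * b ^ 3 \<le> (\<Sum>v\<in>B. (real (card (N v)))\<^sup>2)" using b by simp
  have "(\<Sum>v\<in>B. card (bv v)) = (\<Sum>v\<in>B. \<Sum>p\<in>bad. of_bool (v \<in> cn (fst p) (snd p)))"
  proof (rule sum.cong[OF refl])
    fix v assume "v \<in> B"
    then have "bv v = bad \<inter> {p. v \<in> cn (fst p) (snd p)}"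
      by (auto simp: bv_def N_def cn_def bad_def)
    then show "card (bv v) = (\<Sum>p\<in>bad. of_bool (v \<in> cn (fst p) (snd p)))"
      using fin by (simp add: sum.If_cases of_bool_def if_distrib cong: if_cong)
  qed
  also have "\<dots> = (\<Sum>p\<in>bad. \<Sum>v\<in>B. of_bool (v \<in> cn (fst p) (snd p)))" by (rule sum.swap)
  also have "\<dots> = (\<Sum>p\<in>bad. card (cn (fst p) (snd p)))"
  proof (rule sum.cong[OF refl])
    fix p
    have "B \<inter> {v. v \<in> cn (fst p) (snd p)} = cn (fst p) (snd p)" by (auto simp: cn_def)
    then show "(\<Sum>v\<in>B. of_bool (v \<in> cn (fst p) (snd p))) = card (cn (fst p) (snd p))"
      using B by (simp add: sum.If_cases of_bool_def if_distrib cong: if_cong)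
  qed
  finally have "(\<Sum>v\<in>B. real (card (bv v))) = (\<Sum>p\<in>bad. real (card (cn (fst p) (snd p))))"
    by (simp flip: of_nat_sum)
  also have "\<dots> \<le> (\<Sum>p\<in>bad. \<tau> * b)" by (intro sum_mono) (auto simp: bad_def)
  also have "\<dots> = card bad * (\<tau> * b)" by simp
  also have "\<dots> \<le> b\<^sup>2 * (\<tau> * b)"
  proof (rule mult_right_mono)
    have "card bad \<le> card (B \<times> B)" using B by (intro card_mono) (auto simp: bad_def)
    then show "real (card bad) \<le> b\<^sup>2" by (simp add: b_def card_cartesian_product power2_eq_square flip: of_nat_mult)
  qed (use b in \<open>simp add: \<tau>_def\<close>)
  finally have bvle: "(\<Sum>v\<in>B. real (card (bv v))) \<le> \<tau> * b ^ 3"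
    by (simp add: power2_eq_square power3_eq_cube mult_ac)
  have "(\<Sum>v\<in>B. \<alpha>\<^sup>2 * b\<^sup>2 / 2) = \<alpha>\<^sup>2 * b ^ 3 - 8 * (\<tau> * b ^ 3)"
    by (simp add: b_def \<tau>_def power2_eq_square power3_eq_cube)
  also have "\<dots> \<le> (\<Sum>v\<in>B. (real (card (N v)))\<^sup>2) - 8 * (\<Sum>v\<in>B. real (card (bv v)))"
    using N2 bvle by linarith
  also have "\<dots> = (\<Sum>v\<in>B. (real (card (N v)))\<^sup>2 - 8 * real (card (bv v)))"
    by (simp add: sum_subtractf sum_distrib_left)
  \<comment> \<open>The weight 8 yields at most \<open>n^2 / 8\<close> bad pairs inside
    \<open>N v\<close>, so at most half of its points can have more than \<open>n / 4\<close> bad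
    partners.\<close>
  finally obtain v where v: "v \<in> B" "\<alpha>\<^sup>2 * b\<^sup>2 / 2 \<le> (real (card (N v)))\<^sup>2 - 8 * real (card (bv v))"
    by (rule exists_ge_average[OF B])
  define n where "n = real (card (N v))"
  have ab0: "0 \<le> \<alpha>\<^sup>2 * b\<^sup>2" by simp
  have "\<alpha>\<^sup>2 * b\<^sup>2 / 4 \<le> n\<^sup>2" unfolding n_def using v ab0 of_nat_0_le_iff[of "card (bv v)"] by linarith
  then have "(\<alpha> * b / 2)\<^sup>2 \<le> n\<^sup>2" by (simp add: power_mult_distrib power_divide)
  then have nge: "\<alpha> * b / 2 \<le> n" by (rule power2_le_imp_le) (simp add: n_def)
  have n0: "n > 0" using nge mult_pos_pos[OF \<alpha>(1) b] by linarith
  have bvn: "8 * real (card (bv v)) \<le> n\<^sup>2" unfolding n_def using v ab0 by linarith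
  define bp where "bp = (\<lambda>a. {a' \<in> N v. (a, a') \<in> bad})"
  define A where "A = {a \<in> N v. 4 * real (card (bp a)) \<le> n}"
  have fA: "finite A" "A \<subseteq> N v" using fin by (auto simp: A_def)
  have fbp: "finite (bp a)" for a using fin by (simp add: bp_def)
  have "(\<Sum>a\<in>N v. card (bp a)) = card (\<Union>a\<in>N v. (\<lambda>a'. (a, a')) ` bp a)"
    using fin fbp by (subst card_UN_disjoint) (auto simp: card_image inj_on_def)
  also have "(\<Union>a\<in>N v. (\<lambda>a'. (a, a')) ` bp a) = bv v"
    by (auto simp: bp_def bv_def)
  finally have "(\<Sum>a\<in>N v. real (card (bp a))) = card (bv v)" by (simp flip: of_nat_sum)
  moreover have "(\<Sum>a\<in>N v - A. n / 4) \<le> (\<Sum>a\<in>N v - A. real (card (bp a)))"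
    by (intro sum_mono) (auto simp: A_def)
  moreover have "\<dots> \<le> (\<Sum>a\<in>N v. real (card (bp a)))" using fin by (intro sum_mono2) auto
  moreover have "(\<Sum>a\<in>N v - A. n / 4) = card (N v - A) * (n / 4)" by simp
  ultimately have "card (N v - A) * (n / 4) \<le> n\<^sup>2 / 8" using bvn by linarith
  then have "card (N v - A) * n \<le> (n / 2) * n" by (simp add: power2_eq_square mult_ac)
  then have "real (card (N v - A)) \<le> n / 2" using n0 by (rule mult_right_le_imp_le)
  moreover have "card A \<le> card (N v)" using fA fin by (intro card_mono) auto
  ultimately have Age: "n / 2 \<le> card A" using fA fin by (simp add: card_Diff_subset n_def)
  have A1: "\<alpha> / 4 * card B \<le> card A" using Age nge by (simp add: b_def)
  define r where "r = (\<lambda>z. SOME p. p \<in> A \<times> A \<and> fst p - snd p = z)"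
  have r: "r z \<in> A \<times> A \<and> fst (r z) - snd (r z) = z" if z: "z \<in> diffset A A" for z
    unfolding r_def by (rule someI_ex) (use z in \<open>auto simp: diffset_def\<close>)
  define Tr where "Tr = (\<lambda>z. SIGMA a':{a' \<in> N v. (fst (r z), a') \<notin> bad \<and> (snd (r z), a') \<notin> bad}.
      cn (fst (r z)) a' \<times> cn (snd (r z)) a')"
  have Trge: "\<alpha> ^ 5 * b ^ 3 / 1024 \<le> card (Tr z)" if z: "z \<in> diffset A A" for z
  proof -
    define a where "a = fst (r z)"
    define c where "c = snd (r z)"
    have ac: "a \<in> A" "c \<in> A" using r[OF z] by (auto simp: a_def c_def mem_Times_iff)
    then have acB: "a \<in> B" "c \<in> B" using fA by (auto simp: N_def)
    define G where "G = {a' \<in> N v. (a, a') \<notin> bad \<and> (c, a') \<notin> bad}"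
    have fG: "finite G" using fin by (simp add: G_def)
    have "N v \<subseteq> G \<union> (bp a \<union> bp c)" by (auto simp: G_def bp_def)
    then have "card (N v) \<le> card (G \<union> (bp a \<union> bp c))" using fG fbp by (intro card_mono) auto
    also have "\<dots> \<le> card G + (card (bp a) + card (bp c))"
      by (meson add_left_mono card_Un_le le_trans)
    finally have "n \<le> card G + (card (bp a) + card (bp c))" by (simp add: n_def flip: of_nat_add)
    then have Gge: "n / 2 \<le> card G" using ac by (simp add: A_def)
    have "card (Tr z) = (\<Sum>a'\<in>G. card (cn a a') * card (cn c a'))"
      using fG fin by (simp add: Tr_def card_SigmaI card_cartesian_product flip: a_def c_def G_def)
    then have "real (card (Tr z)) = (\<Sum>a'\<in>G. real (card (cn a a')) * card (cn c a'))" by simp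
    also have "\<dots> \<ge> (\<Sum>a'\<in>G. (\<tau> * b) * (\<tau> * b))"
      using acB b by (intro sum_mono mult_mono) (auto simp: G_def bad_def \<tau>_def N_def)
    also have "(\<Sum>a'\<in>G. (\<tau> * b) * (\<tau> * b)) = card G * (\<tau> * b)\<^sup>2" by (simp add: power2_eq_square)
    finally have "card G * (\<tau> * b)\<^sup>2 \<le> card (Tr z)" .
    moreover have "(\<alpha> * b / 4) * (\<tau> * b)\<^sup>2 \<le> card G * (\<tau> * b)\<^sup>2"
      using Gge nge by (intro mult_right_mono) auto
    moreover have "(\<alpha> * b / 4) * (\<tau> * b)\<^sup>2 = \<alpha> ^ 5 * b ^ 3 / 1024"
      by (simp add: \<tau>_def power2_eq_square power3_eq_cube eval_nat_numeral)
    ultimately show ?thesis by linarith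
  qed
  \<comment> \<open>For \<open>r z = (c, d)\<close> one has
    \<open>z = (c - v1) - (a' - v1) - ((d - v2) - (a' - v2))\<close>. So the four elements of
    \<open>L\<close> determine \<open>z\<close>, hence \<open>c\<close> and \<open>d\<close>, then
    \<open>v1\<close>, \<open>v2\<close> and \<open>a'\<close>.\<close>
  define f where "f = (\<lambda>(z, a', (v1, v2)). (fst (r z) - v1, a' - v1, snd (r z) - v2, a' - v2))"
  have fTr: "finite (Tr z)" for z using fin by (simp add: Tr_def)
  have fD: "finite (diffset A A)" using fA by simp
  have "inj_on f (SIGMA z:diffset A A. Tr z)"
  proof (rule inj_onI)
    fix p q assume pq: "p \<in> (SIGMA z:diffset A A. Tr z)" "q \<in> (SIGMA z:diffset A A. Tr z)" "f p = f q"
    obtain z a v1 v2 where p: "p = (z, a, (v1, v2))" by (cases p) auto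
    obtain z' a' v1' v2' where q: "q = (z', a', (v1', v2'))" by (cases q) auto
    have e: "fst (r z) - v1 = fst (r z') - v1'" "a - v1 = a' - v1'"
      "snd (r z) - v2 = snd (r z') - v2'" "a - v2 = a' - v2'" using pq by (auto simp: p q f_def)
    have rz: "fst (r z) - snd (r z) = z" "fst (r z') - snd (r z') = z'"
      using r pq(1,2) by (auto simp: p q)
    have "z = (fst (r z) - v1) - (a - v1) - ((snd (r z) - v2) - (a - v2))"
      by (simp add: rz)
    also have "\<dots> = z'" unfolding e by (simp add: rz)
    finally have "z = z'" .
    then show "p = q" using e by (simp add: p q)
  qed
  moreover have "f ` (SIGMA z:diffset A A. Tr z) \<subseteq> L \<times> L \<times> L \<times> L"
    by (auto simp: f_def Tr_def cn_def intro!: PL)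
  ultimately have "card (SIGMA z:diffset A A. Tr z) \<le> card (L \<times> L \<times> L \<times> L)"
    using L by (intro card_inj_on_le) auto
  then have "(\<Sum>z\<in>diffset A A. card (Tr z)) \<le> card L ^ 4"
    using fD fTr by (simp add: card_SigmaI card_cartesian_product eval_nat_numeral)
  then have "(\<Sum>z\<in>diffset A A. real (card (Tr z))) \<le> card L ^ 4"
    by (metis of_nat_mono of_nat_sum)
  moreover have "(\<Sum>z\<in>diffset A A. \<alpha> ^ 5 * b ^ 3 / 1024) \<le> (\<Sum>z\<in>diffset A A. real (card (Tr z)))"
    by (intro sum_mono Trge)
  ultimately have "real (card (diffset A A)) * (\<alpha> ^ 5 * b ^ 3 / 1024) \<le> card L ^ 4" by simp
  then have "real (card (diffset A A)) * (\<alpha> ^ 5 * card B ^ 3) \<le> 1024 * card L ^ 4"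
    by (simp add: b_def field_simps)
  moreover have "A \<subseteq> B" using fA by (auto simp: N_def)
  ultimately show ?thesis using A1 that by blast
qed

section \<open>Growth of sets of multipliers\<close>

definition mult_energy :: "'a::comm_ring_1 \<Rightarrow> 'a set \<Rightarrow> nat" where
  "mult_energy x Y = card {(s, t). s \<in> Y \<times> Y \<and> t \<in> Y \<times> Y \<and> fst s + x * snd s = fst t + x * snd t}"

lemma mult_energy_ge:
  assumes "finite Y"
  shows "card Y ^ 4 \<le> card ((\<lambda>(y, y'). y + x * y') ` (Y \<times> Y)) * mult_energy x Y"
  using card_image_energy[of "Y \<times> Y" "\<lambda>(y, y'). y + x * y'"] assms
  by (simp add: mult_energy_def card_cartesian_product case_prod_beta power2_eq_square eval_nat_numeral)

text \<open>In a solution of \<open>a + x b = c + x d\<close> an invertible \<open>d - b\<close>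
  determines \<open>x\<close>, which leaves at most \<open>|Y|^4\<close> solutions. If
  \<open>d - b\<close> is not invertible, neither is \<open>a - c = (d - b) x\<close>, so
  \<open>(a, c)\<close> and \<open>(d, b)\<close> both belong to the set of non-invertible
  differences.\<close>

lemma sum_mult_energy_le:
  fixes e :: "'a::comm_ring_1"
  assumes X: "finite X" "\<And>x. x \<in> X \<Longrightarrow> e * x = x" and Y: "finite Y"
  shows "(\<Sum>x\<in>X. mult_energy x Y) \<le>
    card Y ^ 4 + card X * (card {(a, b). a \<in> Y \<and> b \<in> Y \<and> \<not> (\<exists>w. (a - b) * w = e)})\<^sup>2"
proof -
  define N where "N = {(a, b). a \<in> Y \<and> b \<in> Y \<and> \<not> (\<exists>w. (a - b) * w = e)}"
  define E where "E = (\<lambda>x. {(s, t). s \<in> Y \<times> Y \<and> t \<in> Y \<times> Y \<and> fst s + x * snd s = fst t + x * snd t})"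
  define S where "S = (SIGMA x:X. E x)"
  define U where "U = {(x, (s, t)) \<in> S. \<exists>w. (snd t - snd s) * w = e}"
  have fE: "finite (E x)" for x
    by (rule finite_subset[of _ "(Y \<times> Y) \<times> (Y \<times> Y)"]) (use Y in \<open>auto simp: E_def\<close>)
  have fS: "finite S" using X fE by (simp add: S_def)
  have fN: "finite N" by (rule finite_subset[of _ "Y \<times> Y"]) (use Y in \<open>auto simp: N_def\<close>)
  have "(\<Sum>x\<in>X. mult_energy x Y) = card S"
    using X fE by (simp add: S_def card_SigmaI mult_energy_def E_def)
  also have "card S = card U + card (S - U)"
  proof -
    have "U \<subseteq> S" by (auto simp: U_def)
    then show ?thesis using fS by (metis card_Diff_subset card_mono finite_subset le_add_diff_inverse)
  qed
  also have "card U \<le> card ((Y \<times> Y) \<times> (Y \<times> Y))"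
  proof (rule card_inj_on_le[of snd])
    show "inj_on snd U"
    proof (rule inj_onI)
      fix p q assume pq: "p \<in> U" "q \<in> U" "snd p = snd q"
      obtain x a b c d where p: "p = (x, ((a, b), (c, d)))" by (cases p) auto
      obtain x' where q: "q = (x', ((a, b), (c, d)))" using pq p by (cases q) auto
      have x: "x \<in> X" "x' \<in> X" "a + x * b = c + x * d" "a + x' * b = c + x' * d"
        using pq by (auto simp: p q U_def S_def E_def)
      obtain w where w: "(d - b) * w = e" using pq by (auto simp: p q U_def)
      have "x * (d - b) = a - c" "x' * (d - b) = a - c" using x by (auto simp: algebra_simps)
      then have "x * ((d - b) * w) = x' * ((d - b) * w)" by (metis mult.assoc)
      then have "e * x = e * x'" unfolding w by (simp only: mult.commute)
      then show "p = q" unfolding p q assms(2)[OF x(1)] assms(2)[OF x(2)] by simp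
    qed
  qed (use Y in \<open>auto simp: U_def S_def E_def\<close>)
  also have "card ((Y \<times> Y) \<times> (Y \<times> Y)) = card Y ^ 4"
    by (simp add: card_cartesian_product eval_nat_numeral)
  also have "card (S - U) \<le> card (X \<times> (N \<times> N))"
  proof (rule card_inj_on_le[of "\<lambda>(x, ((a, b), (c, d))). (x, ((a, c), (d, b)))"])
    show "inj_on (\<lambda>(x, ((a, b), (c, d))). (x, ((a, c), (d, b)))) (S - U)" by (auto intro!: inj_onI)
    show "(\<lambda>(x, ((a, b), (c, d))). (x, ((a, c), (d, b)))) ` (S - U) \<subseteq> X \<times> (N \<times> N)"
    proof
      fix z assume "z \<in> (\<lambda>(x, ((a, b), (c, d))). (x, ((a, c), (d, b)))) ` (S - U)"
      then obtain x a b c d where p: "(x, ((a, b), (c, d))) \<in> S - U" and z: "z = (x, ((a, c), (d, b)))" by auto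
      have x: "x \<in> X" "a \<in> Y" "b \<in> Y" "c \<in> Y" "d \<in> Y" "a + x * b = c + x * d"
        using p by (auto simp: S_def E_def)
      have nu: "\<not> (\<exists>w. (d - b) * w = e)" using p by (auto simp: U_def)
      have ac: "a - c = (d - b) * x" using x by (simp add: algebra_simps)
      have "\<not> (\<exists>w. (a - c) * w = e)" using nu unfolding ac by (metis mult.assoc)
      then show "z \<in> X \<times> (N \<times> N)" using x nu by (auto simp: z N_def)
    qed
  qed (use X fN in auto)
  also have "card (X \<times> (N \<times> N)) = card X * (card N)\<^sup>2"
    by (simp add: card_cartesian_product power2_eq_square)
  finally show ?thesis by (simp add: N_def)
qed

text \<open>Glibichuk-Konyagin dichotomy for the set \<open>Q\<close> of quotients of differences of
  \<open>Y\<close>. If \<open>Q\<close> is not closed under adding \<open>e\<close> and multiplying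
  by \<open>t\<close>, some \<open>\<xi>'\<close> outside \<open>Q\<close> makes
  \<open>y + \<xi>' y'\<close> injective on \<open>Y \<times> Y\<close>, since a coincidence would
  exhibit \<open>\<xi>'\<close> as a quotient. Otherwise \<open>Q\<close> is all of
  \<open>I\<close>, and averaging the energies over \<open>I\<close> finds a quotient
  \<open>\<xi>\<close> for which \<open>y + \<xi> y'\<close> takes many values. Multiplying by
  \<open>c - d\<close> clears the denominator, so that only ring operations on \<open>Y\<close> and
  \<open>t\<close> remain.\<close>

lemma glibichuk_konyagin_step:
  fixes e t :: "'a::comm_ring_1"
  assumes e: "e * e = e" and I: "I = {x. e * x = x}" "finite I" and Y: "Y \<subseteq> I" "2 \<le> card Y"
    and units: "\<And>a b. a \<in> Y \<Longrightarrow> b \<in> Y \<Longrightarrow> a \<noteq> b \<Longrightarrow> \<exists>w. (a - b) * w = e"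
    and t: "t \<in> I"
    and gen: "\<And>Q. Q \<subseteq> I \<Longrightarrow> 0 \<in> Q \<Longrightarrow> (\<And>x. x \<in> Q \<Longrightarrow> x + e \<in> Q) \<Longrightarrow> (\<And>x. x \<in> Q \<Longrightarrow> t * x \<in> Q) \<Longrightarrow> Q = I"
  obtains a b c d u where "a \<in> Y" "b \<in> Y" "c \<in> Y" "d \<in> Y" "u \<in> {a - b, a - b + (c - d), t * (a - b)}"
    "min (card I) ((card Y)\<^sup>2) \<le> 2 * card ((\<lambda>(y, y'). (c - d) * y + u * y') ` (Y \<times> Y))"
proof -
  have fY: "finite Y" using Y I finite_subset by auto
  have eI: "e * x = x" if "x \<in> I" for x using that I by simp
  have I_diff: "x - y \<in> I" "x + y \<in> I" "x * y \<in> I" "y * x \<in> I" if "x \<in> I" "y \<in> I" for x y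
    using that I by (auto simp: algebra_simps) (metis mult.assoc)+
  have cancel: "x = y" if "v * x = v * y" "x \<in> I" "y \<in> I" "v * w = e" for x y v w
  proof -
    have "(v * w) * x = (v * w) * y" using that(1) by (metis mult.assoc mult.commute)
    then show ?thesis using that eI by simp
  qed
  define Q where "Q = {\<xi> \<in> I. \<exists>a\<in>Y. \<exists>b\<in>Y. \<exists>c\<in>Y. \<exists>d\<in>Y. c \<noteq> d \<and> (c - d) * \<xi> = a - b}"
  obtain c0 d0 where cd0: "c0 \<in> Y" "d0 \<in> Y" "c0 \<noteq> d0"
    using Y(2) fY by (metis card_le_Suc0_iff_eq not_less_eq_eq numeral_2_eq_2)
  have "0 \<in> I" using I by simp
  moreover have "(c0 - d0) * 0 = c0 - c0" by simp
  ultimately have "0 \<in> Q" using cd0 unfolding Q_def by blast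
  show ?thesis
  proof (cases "\<exists>\<xi>\<in>Q. \<xi> + e \<notin> Q \<or> t * \<xi> \<notin> Q")
    case True
    then obtain \<xi> \<xi>' where x: "\<xi> \<in> Q" "\<xi>' \<in> {\<xi> + e, t * \<xi>}" "\<xi>' \<notin> Q" by auto
    then obtain a b c d where abcd: "a \<in> Y" "b \<in> Y" "c \<in> Y" "d \<in> Y" "c \<noteq> d" "(c - d) * \<xi> = a - b" "\<xi> \<in> I"
      by (auto simp: Q_def)
    have eI': "e \<in> I" using e I by simp
    have x'I: "\<xi>' \<in> I" using x(2) abcd(7) t eI' I_diff by auto
    define u where "u = (c - d) * \<xi>'"
    have "(c - d) * e = c - d" using eI[of "c - d"] I_diff abcd Y by (metis mult.commute subsetD)
    then have u: "u \<in> {a - b, a - b + (c - d), t * (a - b)}"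
      using x(2) abcd(6) by (auto simp: u_def distrib_left mult.left_commute)
    obtain w where w: "(c - d) * w = e" using units abcd by blast
    have "inj_on (\<lambda>(y, y'). (c - d) * y + u * y') (Y \<times> Y)"
    proof (rule inj_onI)
      fix p q assume pq: "p \<in> Y \<times> Y" "q \<in> Y \<times> Y"
        "(\<lambda>(y, y'). (c - d) * y + u * y') p = (\<lambda>(y, y'). (c - d) * y + u * y') q"
      obtain y y' z z' where [simp]: "p = (y, y')" "q = (z, z')" by (cases p, cases q)
      have m: "y \<in> Y" "y' \<in> Y" "z \<in> Y" "z' \<in> Y" using pq by auto
      then have mI: "y \<in> I" "y' \<in> I" "z \<in> I" "z' \<in> I" using Y by auto
      have "(c - d) * y + (c - d) * \<xi>' * y' = (c - d) * z + (c - d) * \<xi>' * z'" using pq by (simp add: u_def)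
      then have "(c - d) * (y - z) = (c - d) * (\<xi>' * (z' - y'))" by (simp add: algebra_simps)
      then have yz: "y - z = (z' - y') * \<xi>'"
        using cancel[OF _ _ _ w] I_diff mI x'I by (metis mult.commute)
      have "z' = y'"
      proof (rule ccontr)
        assume "z' \<noteq> y'"
        then have "\<xi>' \<in> Q" unfolding Q_def using m x'I yz by (intro CollectI conjI bexI[of _ y] bexI[of _ z] bexI[of _ z'] bexI[of _ y']) auto
        then show False using x by simp
      qed
      then show "p = q" using yz by simp
    qed
    then have "card ((\<lambda>(y, y'). (c - d) * y + u * y') ` (Y \<times> Y)) = (card Y)\<^sup>2"
      by (simp add: card_image card_cartesian_product power2_eq_square)
    then show ?thesis using that[OF abcd(1-4) u] by simp
  next
    case False
    moreover have "Q \<subseteq> I" by (auto simp: Q_def)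
    ultimately have QI: "Q = I" using \<open>0 \<in> Q\<close> by (intro gen) blast+
    have N: "{(a, b). a \<in> Y \<and> b \<in> Y \<and> \<not> (\<exists>w. (a - b) * w = e)} \<subseteq> (\<lambda>y. (y, y)) ` Y" using units by auto
    have N': "card {(a, b). a \<in> Y \<and> b \<in> Y \<and> \<not> (\<exists>w. (a - b) * w = e)} \<le> card Y"
      using card_mono[OF _ N] card_image_le[OF fY, of "\<lambda>y. (y, y)"] fY by simp
    have "(\<Sum>x\<in>I. mult_energy x Y) \<le> card Y ^ 4 + card I * (card Y)\<^sup>2"
      using sum_mult_energy_le[OF I(2) eI fY] N' by (meson add_left_mono le_trans mult_le_mono2 power_mono zero_le)
    then have "card I * (\<Sum>x\<in>I. mult_energy x Y) \<le> card I * (card Y ^ 4 + card I * (card Y)\<^sup>2)"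
      by (rule mult_le_mono2)
    then have "real (card I * (\<Sum>x\<in>I. mult_energy x Y)) \<le> real (card I * (card Y ^ 4 + card I * (card Y)\<^sup>2))"
      by (rule of_nat_mono)
    then have av: "(\<Sum>x\<in>I. real (card I * mult_energy x Y)) \<le> (\<Sum>x\<in>I. real (card Y ^ 4 + card I * (card Y)\<^sup>2))"
      by (simp add: sum_distrib_left)
    have "I \<noteq> {}" using \<open>0 \<in> I\<close> by blast
    from exists_ge_average[OF I(2) this av]
    obtain \<xi> where \<xi>: "\<xi> \<in> I" "real (card I * mult_energy \<xi> Y) \<le> real (card Y ^ 4 + card I * (card Y)\<^sup>2)" .
    have "\<xi> \<in> Q" using \<xi>(1) QI by simp
    then obtain a b c d where abcd: "a \<in> Y" "b \<in> Y" "c \<in> Y" "d \<in> Y" "c \<noteq> d" "(c - d) * \<xi> = a - b"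
      by (auto simp: Q_def)
    obtain w where w: "(c - d) * w = e" using units abcd by blast
    define P where "P = (\<lambda>(y, y'). y + \<xi> * y') ` (Y \<times> Y)"
    have PI: "P \<subseteq> I"
    proof
      fix z assume "z \<in> P"
      then obtain y y' where "y \<in> Y" "y' \<in> Y" "z = y + \<xi> * y'" by (auto simp: P_def)
      then show "z \<in> I" using I_diff \<xi>(1) subsetD[OF Y(1)] by simp
    qed
    have dist: "(c - d) * y + (a - b) * y' = (c - d) * (y + \<xi> * y')" for y y'
      unfolding abcd(6)[symmetric] by (simp add: distrib_left mult.assoc)
    have "(\<lambda>(y, y'). (c - d) * y + (a - b) * y') ` (Y \<times> Y) = (\<lambda>z. (c - d) * z) ` P"
      unfolding P_def image_image by (intro image_cong refl) (auto simp only: dist split: prod.split)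
    moreover have "inj_on (\<lambda>z. (c - d) * z) P" using cancel[OF _ _ _ w] PI by (intro inj_onI) auto
    ultimately have cP: "card ((\<lambda>(y, y'). (c - d) * y + (a - b) * y') ` (Y \<times> Y)) = card P"
      by (simp add: card_image)
    have "card Y ^ 4 \<le> card P * mult_energy \<xi> Y" using mult_energy_ge[OF fY] by (simp add: P_def)
    then have "card I * card Y ^ 4 \<le> card P * (card I * mult_energy \<xi> Y)"
      using mult_le_mono2 by (metis mult.left_commute)
    also have "\<dots> \<le> card P * (card Y ^ 4 + card I * (card Y)\<^sup>2)"
      using \<xi>(2) by (intro mult_le_mono2) (simp only: of_nat_le_iff)
    finally have le: "card I * card Y ^ 4 \<le> card P * (card Y ^ 4 + card I * (card Y)\<^sup>2)" .
    have Y0: "(card Y)\<^sup>2 > 0" using Y by simp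
    have "card I * (card Y)\<^sup>2 \<le> card P * ((card Y)\<^sup>2 + card I)"
    proof -
      have "(card Y)\<^sup>2 * (card I * (card Y)\<^sup>2) \<le> (card Y)\<^sup>2 * (card P * ((card Y)\<^sup>2 + card I))"
        using le by (simp add: algebra_simps power2_eq_square eval_nat_numeral)
      then show ?thesis using Y0 by simp
    qed
    moreover have "card I > 0" using I(2) \<open>0 \<in> I\<close> card_gt_0_iff by blast
    ultimately have "min (card I) ((card Y)\<^sup>2) \<le> 2 * card P"
    proof -
      define i s q where isq: "i = card I" "s = (card Y)\<^sup>2" "q = card P"
      have h: "i * s \<le> q * (s + i)" "i > 0" "s > 0"
        using \<open>card I * (card Y)\<^sup>2 \<le> card P * ((card Y)\<^sup>2 + card I)\<close> \<open>card I > 0\<close> Y0 by (auto simp: isq)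
      have "min i s * max i s = i * s" by (simp add: min_def max_def)
      also have "\<dots> \<le> q * (2 * max i s)" using h(1) by (rule order_trans) (intro mult_le_mono2, simp)
      finally have "min i s * max i s \<le> (2 * q) * max i s" by (simp add: mult_ac)
      then show ?thesis using h by (simp add: isq)
    qed
    then show ?thesis using that[OF abcd(1-4), of "a - b"] cP by simp
  qed
qed

section \<open>Multipliers of a set with small doubling\<close>

locale small_doubling =
  fixes A :: "'a::comm_ring_1 set" and M :: real
  assumes fin_A: "finite A" and A_ne: "A \<noteq> {}" and M1: "M \<ge> 1"
    and dbl: "card (diffset A A) \<le> M * card A"
begin

text \<open>One exponent controls both the number of translates and the size of the covering set.
  Ring operations on multipliers then cost only a change of \<open>n\<close>, and \<open>n\<close>
  alone enters the final bounds.\<close>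

definition good :: "nat \<Rightarrow> 'a \<Rightarrow> bool" where
  "good n x \<longleftrightarrow> (\<exists>T. finite T \<and> real (card T) \<le> M ^ n \<and> (\<lambda>a. x * a) ` A \<subseteq> sumset T (msum n (diffset A A)))"

abbreviation "D \<equiv> diffset A A"

lemma D_zero: "0 \<in> D"
proof -
  obtain a where "a \<in> A" using A_ne by auto
  then show ?thesis using diffsetI[of a A a A] by simp
qed

lemma D_uminus: "x \<in> D \<Longrightarrow> - x \<in> D"
  by (elim diffsetE) (simp add: diffsetI)

lemma mono_msum: "m \<le> n \<Longrightarrow> msum m D \<subseteq> msum n D"
  by (rule msum_mono[OF D_zero])

lemma msum_diff: "x \<in> msum m D \<Longrightarrow> y \<in> msum n D \<Longrightarrow> x - y \<in> msum (m + n) D"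
  using msum_add[of x m D "- y" n] msum_uminus[OF D_uminus, of y n] by simp

lemma good_mono: "good m x \<Longrightarrow> m \<le> n \<Longrightarrow> good n x"
  unfolding good_def using mono_msum[of m n] sumset_mono[OF order_refl] power_increasing[of m n M] M1
  by (meson order_trans)

lemma good_add:
  assumes "good m x" "good n y" shows "good (m + n) (x + y)"
proof -
  obtain S where S: "finite S" "real (card S) \<le> M ^ m" "(\<lambda>a. x * a) ` A \<subseteq> sumset S (msum m D)"
    using assms by (auto simp: good_def)
  obtain T where T: "finite T" "real (card T) \<le> M ^ n" "(\<lambda>a. y * a) ` A \<subseteq> sumset T (msum n D)"
    using assms by (auto simp: good_def)
  have "real (card (sumset S T)) \<le> real (card S) * real (card T)" using card_sumset_le S T by (metis of_nat_mono of_nat_mult)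
  also have "\<dots> \<le> M ^ m * M ^ n" using S T M1 by (intro mult_mono) auto
  finally have c: "real (card (sumset S T)) \<le> M ^ (m + n)" by (simp add: power_add)
  have "(x + y) * a \<in> sumset (sumset S T) (msum (m + n) D)" if a: "a \<in> A" for a
  proof -
    obtain s d where s: "s \<in> S" "d \<in> msum m D" "x * a = s + d" using S a by (auto elim!: sumsetE)
    obtain t d' where t: "t \<in> T" "d' \<in> msum n D" "y * a = t + d'" using T a by (auto elim!: sumsetE)
    have "(x + y) * a = (s + t) + (d + d')" using s t by (simp add: algebra_simps)
    then show ?thesis using s t msum_add sumsetI by metis
  qed
  then have "(\<lambda>a. (x + y) * a) ` A \<subseteq> sumset (sumset S T) (msum (m + n) D)" by (rule image_subsetI)
  then show ?thesis using c S(1) T(1) unfolding good_def by (intro exI[of _ "sumset S T"]) simp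
qed

lemma good_uminus:
  assumes "good m x" shows "good m (- x)"
proof -
  obtain S where S: "finite S" "real (card S) \<le> M ^ m" "(\<lambda>a. x * a) ` A \<subseteq> sumset S (msum m D)"
    using assms by (auto simp: good_def)
  have "- x * a \<in> sumset (uminus ` S) (msum m D)" if a: "a \<in> A" for a
  proof -
    obtain s d where s: "s \<in> S" "d \<in> msum m D" "x * a = s + d" using S a by (auto elim!: sumsetE)
    have "- x * a = (- s) + (- d)" using s by (simp add: algebra_simps)
    then show ?thesis using s msum_uminus[OF D_uminus] by (metis imageI sumsetI)
  qed
  then have "(\<lambda>a. - x * a) ` A \<subseteq> sumset (uminus ` S) (msum m D)" by (rule image_subsetI)
  moreover have "real (card (uminus ` S)) \<le> M ^ m" using S by (simp add: card_image)
  ultimately show ?thesis using S(1) unfolding good_def by (intro exI[of _ "uminus ` S"]) simp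
qed

lemma good_diff: "good m x \<Longrightarrow> good n y \<Longrightarrow> good (m + n) (x - y)"
  using good_add[OF _ good_uminus, of m x n y] by simp

text \<open>\<open>y A\<close> is covered by translates of \<open>n D\<close>, and
  \<open>x D\<close> by translates of \<open>2 m D\<close> with shifts from \<open>S - S\<close>.
  Dilating each of the \<open>n\<close> summands gives at most \<open>M^(2 m n)\<close> shifts and
  the set \<open>2 m n D\<close>.\<close>

lemma good_mult:
  assumes "good m x" "good n y" shows "good (n + 2 * m * n) (x * y)"
proof -
  obtain S where S: "finite S" "real (card S) \<le> M ^ m" "(\<lambda>a. x * a) ` A \<subseteq> sumset S (msum m D)"
    using assms by (auto simp: good_def)
  obtain T where T: "finite T" "real (card T) \<le> M ^ n" "(\<lambda>a. y * a) ` A \<subseteq> sumset T (msum n D)"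
    using assms by (auto simp: good_def)
  define V where "V = diffset S S"
  have V: "finite V" using S by (simp add: V_def)
  have "real (card V) \<le> real (card S) * real (card S)"
    unfolding V_def using card_diffset_le[OF S(1) S(1)] by (metis of_nat_mono of_nat_mult)
  also have "\<dots> \<le> M ^ m * M ^ m" using S M1 by (intro mult_mono) auto
  finally have cV: "real (card V) \<le> M ^ (2 * m)" by (simp add: mult_2 power_add)
  define W where "W = sumset ((\<lambda>t. x * t) ` T) (msum n V)"
  have xm: "x * d \<in> sumset (msum k V) (msum (2 * m * k) D)" if "d \<in> msum k D" for d k
    using that
  proof (induction k arbitrary: d)
    case 0
    then show ?case by (auto simp: sumset_def)
  next
    case (Suc k)
    then obtain a a' d' where d: "a \<in> A" "a' \<in> A" "d' \<in> msum k D" "d = (a - a') + d'"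
      by (auto elim!: sumsetE diffsetE)
    obtain s p where s: "s \<in> S" "p \<in> msum m D" "x * a = s + p" using S d(1) by (auto elim!: sumsetE)
    obtain s' p' where s': "s' \<in> S" "p' \<in> msum m D" "x * a' = s' + p'" using S d(2) by (auto elim!: sumsetE)
    obtain v r where v: "v \<in> msum k V" "r \<in> msum (2 * m * k) D" "x * d' = v + r"
      using Suc.IH[OF d(3)] by (auto elim: sumsetE)
    have "x * d = (x * a - x * a') + x * d'" unfolding d(4) by (simp add: algebra_simps)
    also have "\<dots> = ((s - s') + v) + ((p - p') + r)"
      unfolding s(3) s'(3) v(3) by (simp add: algebra_simps)
    finally have "x * d = ((s - s') + v) + ((p - p') + r)" .
    moreover have "(s - s') + v \<in> msum (Suc k) V"
      unfolding msum.simps V_def using s s' v by (intro sumsetI diffsetI) (auto simp: V_def)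
    moreover have "(p - p') + r \<in> msum (m + m + 2 * m * k) D"
      using s s' v by (intro msum_add msum_diff)
    moreover have "m + m + 2 * m * k = 2 * m * Suc k" by simp
    ultimately show ?case using sumsetI by metis
  qed
  have "real (card W) \<le> real (card T) * real (card V) ^ n"
  proof -
    have "card W \<le> card ((\<lambda>t. x * t) ` T) * card (msum n V)"
      unfolding W_def using T V by (intro card_sumset_le) auto
    also have "\<dots> \<le> card T * card V ^ n" using T V by (intro mult_le_mono card_image_le card_msum_le)
    finally show ?thesis by (metis of_nat_mono of_nat_mult of_nat_power)
  qed
  also have "\<dots> \<le> M ^ n * (M ^ (2 * m)) ^ n" using T cV M1 by (intro mult_mono power_mono) auto
  finally have c: "real (card W) \<le> M ^ (n + 2 * m * n)" by (simp add: power_add power_mult)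
  have "x * y * a \<in> sumset W (msum (n + 2 * m * n) D)" if a: "a \<in> A" for a
  proof -
    obtain t d where t: "t \<in> T" "d \<in> msum n D" "y * a = t + d" using T a by (auto elim!: sumsetE)
    obtain v r where v: "v \<in> msum n V" "r \<in> msum (2 * m * n) D" "x * d = v + r"
      using xm[OF t(2)] by (auto elim: sumsetE)
    have "x * y * a = x * (y * a)" by (simp add: mult.assoc)
    also have "\<dots> = (x * t + v) + r" unfolding t(3) distrib_left v(3) by (simp add: add.assoc)
    finally have "x * y * a = (x * t + v) + r" .
    moreover have "x * t + v \<in> W" unfolding W_def using t v by (intro sumsetI) auto
    moreover have "r \<in> msum (n + 2 * m * n) D" using v(2) mono_msum[of "2 * m * n" "n + 2 * m * n"] by auto
    ultimately show ?thesis using sumsetI by metis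
  qed
  then have "(\<lambda>a. x * y * a) ` A \<subseteq> sumset W (msum (n + 2 * m * n) D)" by (rule image_subsetI)
  moreover have "finite W" using T V by (simp add: W_def)
  ultimately show ?thesis using c unfolding good_def by (intro exI[of _ W]) simp
qed

text \<open>\<open>A + x A\<close> lies in the translates of \<open>A + n (A - A)\<close> by
  \<open>T\<close>: the factor \<open>M^n\<close> comes from \<open>T\<close>, the exponent
  \<open>2 n + 1\<close> from \<open>plunnecke_diff\<close>.\<close>

lemma good_card:
  assumes "good n x"
  shows "card ((\<lambda>(y, y'). y + x * y') ` (A \<times> A)) \<le> M ^ (3 * n + 1) * card A"
proof -
  obtain T where T: "finite T" "real (card T) \<le> M ^ n" "(\<lambda>a. x * a) ` A \<subseteq> sumset T (msum n D)"
    using assms by (auto simp: good_def)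
  have "(\<lambda>(y, y'). y + x * y') ` (A \<times> A) \<subseteq> sumset T (sumset A (msum n D))"
  proof
    fix z assume "z \<in> (\<lambda>(y, y'). y + x * y') ` (A \<times> A)"
    then obtain y y' where y: "y \<in> A" "y' \<in> A" "z = y + x * y'" by auto
    then obtain t d where t: "t \<in> T" "d \<in> msum n D" "x * y' = t + d" using T by (auto elim!: sumsetE)
    have "z = t + (y + d)" unfolding y(3) t(3) by (simp add: algebra_simps)
    moreover have "t + (y + d) \<in> sumset T (sumset A (msum n D))" by (intro sumsetI t y)
    ultimately show "z \<in> sumset T (sumset A (msum n D))" by (simp only:)
  qed
  then have "card ((\<lambda>(y, y'). y + x * y') ` (A \<times> A)) \<le> card (sumset T (sumset A (msum n D)))"
    using T fin_A by (intro card_mono) auto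
  also have "\<dots> \<le> card T * card (sumset A (msum n D))" using T fin_A by (intro card_sumset_le) auto
  finally have "real (card ((\<lambda>(y, y'). y + x * y') ` (A \<times> A))) \<le> card T * real (card (sumset A (msum n D)))"
    by (metis of_nat_mono of_nat_mult)
  also have "\<dots> \<le> M ^ n * (M ^ (2 * n + 1) * card A)"
    using T plunnecke_diff[OF fin_A A_ne dbl, of n] M1 by (intro mult_mono) auto
  also have "\<dots> = M ^ (3 * n + 1) * card A"
    by (simp add: mult.assoc[symmetric] power_add[symmetric])
  finally show ?thesis .
qed

text \<open>A good multiplier makes \<open>A + x A\<close> small, so its energy is at least
  \<open>|A|^3 / M^(3 n + 1)\<close>, while \<open>sum_mult_energy_le\<close> bounds the total
  energy. \<open>R\<close> measures the non-invertible differences; it will be 1 in a field and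
  \<open>2 / c\<close> in the plane. Once \<open>|A|\<close> exceeds
  \<open>2 M^(3 n + 1) R^2\<close>, the set \<open>A\<close> has at least
  \<open>|X| / (2 M^(3 n + 1))\<close> elements.\<close>

lemma good_count:
  fixes R :: real
  assumes X: "finite X" "\<And>x. x \<in> X \<Longrightarrow> e * x = x" "\<And>x. x \<in> X \<Longrightarrow> good n x"
    and R: "real (card {(a, b). a \<in> A \<and> b \<in> A \<and> \<not> (\<exists>w. (a - b) * w = e)}) \<le> R * card A"
  shows "card X * card A \<le> M ^ (3 * n + 1) * (real (card A) ^ 2 + card X * R\<^sup>2)"
proof -
  define q where "q = real (card A)"
  have q: "q > 0" using fin_A A_ne by (simp add: q_def card_gt_0_iff)
  define B where "B = M ^ (3 * n + 1)"
  have B: "B > 0" using M1 by (simp add: B_def)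
  have "q ^ 3 / B \<le> mult_energy x A" if x: "x \<in> X" for x
  proof -
    have "q ^ 4 \<le> real (card ((\<lambda>(y, y'). y + x * y') ` (A \<times> A))) * mult_energy x A"
      using mult_energy_ge[OF fin_A, of x] unfolding q_def by (metis of_nat_mono of_nat_mult of_nat_power)
    also have "\<dots> \<le> (B * q) * mult_energy x A"
      using good_card[OF X(3)[OF x]] by (intro mult_right_mono) (auto simp: B_def q_def)
    finally have "q * q ^ 3 \<le> q * (B * mult_energy x A)" by (simp add: eval_nat_numeral mult_ac)
    then have "q ^ 3 \<le> B * mult_energy x A" using q by simp
    then show ?thesis using B by (simp add: field_simps)
  qed
  then have "(\<Sum>x\<in>X. q ^ 3 / B) \<le> (\<Sum>x\<in>X. real (mult_energy x A))" by (rule sum_mono)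
  also have "\<dots> = real (\<Sum>x\<in>X. mult_energy x A)" by simp
  also have "\<dots> \<le> real (card A ^ 4 + card X * (card {(a, b). a \<in> A \<and> b \<in> A \<and> \<not> (\<exists>w. (a - b) * w = e)})\<^sup>2)"
    by (intro of_nat_mono sum_mult_energy_le X fin_A)
  also have "\<dots> \<le> q ^ 4 + card X * (R * q)\<^sup>2"
    using R by (auto simp: q_def intro!: mult_left_mono power_mono)
  finally have "card X * q ^ 3 \<le> B * (q ^ 4 + card X * (R * q)\<^sup>2)" using B by (simp add: field_simps)
  then have "q\<^sup>2 * (card X * q) \<le> q\<^sup>2 * (B * (q\<^sup>2 + card X * R\<^sup>2))"
    by (simp add: algebra_simps eval_nat_numeral)
  then show ?thesis using q by (simp add: q_def B_def)
qed

text \<open>The operations add up to the order \<open>2 n + 12 n^2 + 8 n^3\<close>;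
  \<open>1000 n^4\<close> is a convenient upper bound.\<close>

lemma good_gk:
  assumes n: "n \<ge> 1" and g: "good n a" "good n b" "good n c" "good n d" "good n y" "good n y'" "good n t"
    and u: "u \<in> {a - b, a - b + (c - d), t * (a - b)}"
  shows "good (1000 * n ^ 4) ((c - d) * y + u * y')"
proof -
  have n2: "n \<le> n * n" "n * n \<le> n ^ 4" "n * n * n \<le> n ^ 4" "n \<le> n ^ 4"
    using n by (simp_all add: eval_nat_numeral)
  have ab: "good (n + n) (a - b)" "good (n + n) (c - d)" using g good_diff by blast+
  have t: "good (4 * n + 4 * (n * n)) (t * (a - b))"
    by (rule good_mono[OF good_mult[OF g(7) ab(1)]]) (simp add: algebra_simps)
  have s: "good (4 * n + 4 * (n * n)) (a - b + (c - d))" by (rule good_mono[OF good_add[OF ab]]) simp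
  have r: "good (4 * n + 4 * (n * n)) (a - b)" by (rule good_mono[OF ab(1)]) simp
  have "good (4 * n + 4 * (n * n)) u" using u t s r by auto
  then have "good (n + 2 * (4 * n + 4 * (n * n)) * n) (u * y')" using good_mult g by blast
  moreover have "good (n + 2 * (n + n) * n) ((c - d) * y)" using good_mult ab g by blast
  ultimately have "good ((n + 2 * (n + n) * n) + (n + 2 * (4 * n + 4 * (n * n)) * n)) ((c - d) * y + u * y')"
    by (intro good_add)
  then show ?thesis by (rule good_mono) (use n2 in \<open>simp add: algebra_simps\<close>)
qed

definition goods :: "nat \<Rightarrow> 'a \<Rightarrow> 'a set" where
  "goods n e = {x. e * x = x \<and> good n x}"

end

definition gk_order :: "nat \<Rightarrow> nat" where "gk_order n = 1000 * n ^ 4"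

lemma gk_order_ge: "n \<ge> 1 \<Longrightarrow> n \<le> gk_order n"
  using power_increasing[of 1 4 n] by (simp add: gk_order_def)

lemma gk_order_pow_ge: "n \<ge> 1 \<Longrightarrow> n \<le> (gk_order ^^ i) n"
proof (induction i)
  case (Suc i)
  then show ?case using gk_order_ge[of "(gk_order ^^ i) n"] by simp
qed simp

text \<open>General position in a product of two fields: two distinct points differ in both
  coordinates, so all nonzero differences are invertible (\<open>unit_diff\<close>).\<close>

definition inj2 :: "'a::comm_ring_1 \<Rightarrow> 'a \<Rightarrow> 'a set \<Rightarrow> bool" where
  "inj2 e1 e2 Y \<longleftrightarrow> inj_on (\<lambda>x. e1 * x) Y \<and> inj_on (\<lambda>x. e2 * x) Y"

section \<open>Growth inside a field\<close>

context small_doubling begin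

lemma goods_mono: "m \<le> n \<Longrightarrow> goods m e \<subseteq> goods n e"
  using good_mono by (auto simp: goods_def)

text \<open>Each quotient-set step squares the number of multipliers up to a factor 2, until half of
  the ideal is reached. From a start of \<open>2 m\<close> this gives at least a factor
  \<open>m\<close> per round, enough for \<open>i\<close> rounds to fill the ideal when
  \<open>m^i\<close> exceeds its size. The order reached depends on \<open>i\<close> and
  \<open>n\<close> only.\<close>

lemma grow_line:
  fixes e :: 'a
  assumes e: "e * e = e" and fin: "finite {x. e * x = x}"
    and fld: "\<And>x. e * x = x \<Longrightarrow> x \<noteq> 0 \<Longrightarrow> \<exists>w. x * w = e"
    and gen: "\<And>Q. Q \<subseteq> {x. e * x = x} \<Longrightarrow> 0 \<in> Q \<Longrightarrow> (\<And>x. x \<in> Q \<Longrightarrow> x + e \<in> Q) \<Longrightarrow> Q = {x. e * x = x}"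
    and n: "n \<ge> 1" and m: "m \<ge> 1" and start: "2 * m \<le> card (goods n e)"
  shows "min (card {x. e * x = x}) (4 * m * m ^ i) \<le> 2 * card (goods ((gk_order ^^ i) n) e)"
proof (induction i)
  case 0
  then show ?case using start by simp
next
  case (Suc i)
  define k where "k = (gk_order ^^ i) n"
  have k1: "n \<le> k" using gk_order_pow_ge[OF n] by (simp add: k_def)
  then have "k \<ge> 1" using n by simp
  note k = k1 this gk_order_ge[OF this]
  define Y where "Y = goods k e"
  have fg: "finite (goods l e)" for l by (rule finite_subset[OF _ fin]) (auto simp: goods_def)
  have YI: "Y \<subseteq> {x. e * x = x}" by (auto simp: Y_def goods_def)
  have eY: "e * y = y" if "y \<in> Y" for y using that YI by auto
  have mono: "card Y \<le> card (goods (gk_order k) e)" unfolding Y_def using k by (intro card_mono fg goods_mono)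
  have cY: "2 * m \<le> card Y" using start card_mono[OF fg goods_mono[OF k(1)]] unfolding Y_def by linarith
  show ?case
  proof (cases "card {x. e * x = x} \<le> 2 * card Y")
    case True
    then show ?thesis using mono by (simp add: k_def)
  next
    case False
    then have big: "4 * m * m ^ i \<le> 2 * card Y" using Suc.IH by (simp add: k_def Y_def min_def split: if_splits)
    have units: "\<exists>w. (a - b) * w = e" if "a \<in> Y" "b \<in> Y" "a \<noteq> b" for a b
      using that by (intro fld) (auto simp: right_diff_distrib eY)
    \<comment> \<open>With \<open>t = e\<close>, closure under multiplication by \<open>t\<close> is
      automatic; adding \<open>e\<close> already generates the whole ideal.\<close>
    have gen': "Q = {x. e * x = x}" if "Q \<subseteq> {x. e * x = x}" "0 \<in> Q" "\<And>x. x \<in> Q \<Longrightarrow> x + e \<in> Q" "\<And>x. x \<in> Q \<Longrightarrow> e * x \<in> Q" for Q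
      using gen that by blast
    have "2 \<le> card Y" using cY m by simp
    from glibichuk_konyagin_step[OF e refl fin YI this units _ gen']
    obtain a b c d u where abcd: "a \<in> Y" "b \<in> Y" "c \<in> Y" "d \<in> Y" "u \<in> {a - b, a - b + (c - d), e * (a - b)}"
      and le: "min (card {x. e * x = x}) ((card Y)\<^sup>2) \<le> 2 * card ((\<lambda>(y, y'). (c - d) * y + u * y') ` (Y \<times> Y))"
      using e by blast
    have "e * (a - b) = a - b" using abcd(1,2) by (simp add: right_diff_distrib eY)
    \<comment> \<open>\<open>e\<close> itself need not be good, but \<open>e * (a - b)\<close> is
      just \<open>a - b\<close>. So any good element, here \<open>a\<close>, may fill the slot of
      \<open>t\<close> in \<open>good_gk\<close>.\<close>
    then have u: "u \<in> {a - b, a - b + (c - d), a * (a - b)}" using abcd by auto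
    have "(\<lambda>(y, y'). (c - d) * y + u * y') ` (Y \<times> Y) \<subseteq> goods (gk_order k) e"
    proof
      fix z assume "z \<in> (\<lambda>(y, y'). (c - d) * y + u * y') ` (Y \<times> Y)"
      then obtain y y' where y: "y \<in> Y" "y' \<in> Y" "z = (c - d) * y + u * y'" by auto
      have "good (1000 * k ^ 4) ((c - d) * y + u * y')"
        using abcd y k by (intro good_gk[OF _ _ _ _ _ _ _ _ u]) (auto simp: Y_def goods_def)
      moreover have "e * z = e * ((c - d) * y) + e * (u * y')" unfolding y(3) by (rule distrib_left)
      then have "e * z = z" using y eY by (simp add: mult.left_commute[of e])
      ultimately show "z \<in> goods (gk_order k) e" by (simp add: goods_def y(3) gk_order_def)
    qed
    then have "min (card {x. e * x = x}) ((card Y)\<^sup>2) \<le> 2 * card (goods (gk_order k) e)"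
      using le card_mono[OF fg] by (meson le_trans mult_le_mono2)
    moreover have "4 * m * m ^ Suc i \<le> (card Y)\<^sup>2"
    proof -
      have "(2 * m * m ^ i) * (2 * m * m ^ i) \<le> card Y * card Y" using big by (intro mult_le_mono) auto
      moreover have "4 * m * m ^ Suc i \<le> (2 * m * m ^ i) * (2 * m * m ^ i)" using m by simp
      ultimately show ?thesis unfolding power2_eq_square by (rule order_trans[rotated])
    qed
    ultimately show ?thesis by (simp add: k_def)
  qed
qed

end

text \<open>\<open>e1\<close> and \<open>e2\<close> are the axes of a product of two fields with
  \<open>p\<close> elements each. Adding \<open>e\<close> to 0 never leaves the diagonal; the
  element \<open>t\<close> is there to generate the rest of the plane together with
  \<open>e\<close>.\<close>

locale plane_growth = small_doubling +
  fixes e1 e2 t :: 'a and p :: nat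
  assumes e1: "e1 * e1 = e1" and e2: "e2 * e2 = e2" and e12: "e1 * e2 = 0"
    and fin: "finite {x. (e1 + e2) * x = x}"
    and card1: "card {x. e1 * x = x} = p" and card2: "card {x. e2 * x = x} = p"
    and card12: "card {x. (e1 + e2) * x = x} = p\<^sup>2"
    and fld1: "\<And>x. e1 * x = x \<Longrightarrow> x \<noteq> 0 \<Longrightarrow> \<exists>w. x * w = e1"
    and fld2: "\<And>x. e2 * x = x \<Longrightarrow> x \<noteq> 0 \<Longrightarrow> \<exists>w. x * w = e2"
    and gen1: "\<And>Q. Q \<subseteq> {x. e1 * x = x} \<Longrightarrow> 0 \<in> Q \<Longrightarrow> (\<And>x. x \<in> Q \<Longrightarrow> x + e1 \<in> Q) \<Longrightarrow> Q = {x. e1 * x = x}"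
    and gen2: "\<And>Q. Q \<subseteq> {x. e2 * x = x} \<Longrightarrow> 0 \<in> Q \<Longrightarrow> (\<And>x. x \<in> Q \<Longrightarrow> x + e2 \<in> Q) \<Longrightarrow> Q = {x. e2 * x = x}"
    and gen: "\<And>Q. Q \<subseteq> {x. (e1 + e2) * x = x} \<Longrightarrow> 0 \<in> Q \<Longrightarrow> (\<And>x. x \<in> Q \<Longrightarrow> x + (e1 + e2) \<in> Q) \<Longrightarrow>
       (\<And>x. x \<in> Q \<Longrightarrow> t * x \<in> Q) \<Longrightarrow> Q = {x. (e1 + e2) * x = x}"
begin

abbreviation "e \<equiv> e1 + e2"

lemma ee: "e * e = e"
  using e1 e2 e12 by (simp add: algebra_simps)

lemma e1e: "e1 * e = e1" "e2 * e = e2" "e2 * e1 = 0"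
  using e1 e2 e12 by (simp_all add: algebra_simps)

lemma axis_sub: "e1 * x = x \<Longrightarrow> e * x = x" "e2 * x = x \<Longrightarrow> e * x = x"
  by (metis e1e(1) mult.commute mult.assoc) (metis e1e(2) mult.commute mult.assoc)

lemma unit_plane:
  assumes "e1 * v \<noteq> 0" "e2 * v \<noteq> 0" shows "\<exists>w. v * w = e"
proof -
  have "e1 * (e1 * v) = e1 * v" "e2 * (e2 * v) = e2 * v" using e1 e2 by (simp_all flip: mult.assoc)
  then obtain w1 w2 where w: "e1 * v * w1 = e1" "e2 * v * w2 = e2" using fld1 fld2 assms by metis
  have "v * (e1 * w1 + e2 * w2) = e1 * v * w1 + e2 * v * w2" by (simp add: algebra_simps)
  then show ?thesis using w by metis
qed

lemma unit_diff: "inj2 e1 e2 Y \<Longrightarrow> a \<in> Y \<Longrightarrow> b \<in> Y \<Longrightarrow> a \<noteq> b \<Longrightarrow> \<exists>w. (a - b) * w = e"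
  by (intro unit_plane) (auto simp: inj2_def inj_on_def right_diff_distrib)

lemma fin_axis: "finite {x. e1 * x = x}" "finite {x. e2 * x = x}"
  using axis_sub by (auto intro: finite_subset[OF _ fin])

lemma fin_goods: "f \<in> {e1, e2, e} \<Longrightarrow> finite (goods n f)"
  using fin fin_axis by (auto simp: goods_def)

lemma card_inj2:
  assumes "inj2 e1 e2 Y" shows "card Y \<le> p"
proof -
  have "(\<lambda>x. e1 * x) ` Y \<subseteq> {x. e1 * x = x}" using e1 by (auto simp flip: mult.assoc)
  then show ?thesis using assms card_inj_on_le[OF _ _ fin_axis(1)] card1 by (auto simp: inj2_def)
qed

text \<open>Subtracting \<open>y\<close> moves the fibre through \<open>y\<close> onto the other
  axis and doubles the order.\<close>

lemma fibre_bound: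
  assumes Z: "Z \<subseteq> goods k e" and y: "y \<in> Z" and f: "(f = e1 \<and> g = e2) \<or> (f = e2 \<and> g = e1)"
  shows "card {z \<in> Z. f * z = f * y} \<le> card (goods (2 * k) g)"
proof (rule card_inj_on_le[of "\<lambda>z. z - y"])
  show "(\<lambda>z. z - y) ` {z \<in> Z. f * z = f * y} \<subseteq> goods (2 * k) g"
  proof
    fix v assume "v \<in> (\<lambda>z. z - y) ` {z \<in> Z. f * z = f * y}"
    then obtain z where z: "z \<in> Z" "f * z = f * y" "v = z - y" by auto
    have "e * z = z" "e * y = y" "good k z" "good k y" using z y Z by (auto simp: goods_def)
    then have v: "e * v = v" "good (k + k) v" using z good_diff by (auto simp: right_diff_distrib)
    have "f * v = 0" using z by (simp add: right_diff_distrib)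
    moreover have "f + g = e" using f by (auto simp: add.commute)
    ultimately have "g * v = v" using v(1) by (metis add_0 distrib_right)
    then show "v \<in> goods (2 * k) g" using v by (simp add: goods_def mult_2)
  qed
qed (use f fin_goods in auto)

text \<open>The quotient-set step yields a set \<open>Z\<close> of at least \<open>|Y|^2 / 2\<close>
  multipliers, since \<open>|Y| \<le> p\<close> decides the minimum, but points of \<open>Z\<close>
  may share a coordinate. Thin \<open>Z\<close> to a maximal \<open>inj2\<close> subset
  \<open>T\<close>; every other point then shares a coordinate with a point of \<open>T\<close>. If
  each axis holds fewer than \<open>2 m\<close> multipliers, a point of \<open>T\<close> accounts
  for at most \<open>4 m\<close> points of \<open>Z\<close>, so
  \<open>|T| \<ge> |Y|^2 / (8 m) \<ge> 2 m |Y|\<close>.\<close>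

lemma grow_plane_step:
  assumes Y: "Y \<subseteq> goods n e" "inj2 e1 e2 Y" and t: "t \<in> goods n e" and n: "n \<ge> 1" and m: "m \<ge> 1" "16 * m\<^sup>2 \<le> card Y"
  shows "(\<exists>f\<in>{e1, e2}. 2 * m \<le> card (goods (2 * gk_order n) f)) \<or>
    (\<exists>Y'\<subseteq>goods (gk_order n) e. inj2 e1 e2 Y' \<and> 2 * m * card Y \<le> card Y')"
  unfolding disj_imp
proof
  assume no: "\<not> (\<exists>f\<in>{e1, e2}. 2 * m \<le> card (goods (2 * gk_order n) f))"
  have YI: "Y \<subseteq> {x. e * x = x}" using Y by (auto simp: goods_def)
  have "1 \<le> m\<^sup>2" using m by simp
  then have c2: "2 \<le> card Y" using m(2) by linarith
  have tI: "t \<in> {x. e * x = x}" using t by (auto simp: goods_def)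
  from glibichuk_konyagin_step[OF ee refl fin YI c2 unit_diff[OF Y(2)] tI gen] obtain a b c d u where abcd: "a \<in> Y" "b \<in> Y" "c \<in> Y" "d \<in> Y" "u \<in> {a - b, a - b + (c - d), t * (a - b)}"
    and le: "min (card {x. e * x = x}) ((card Y)\<^sup>2) \<le> 2 * card ((\<lambda>(y, y'). (c - d) * y + u * y') ` (Y \<times> Y))"
    by blast
  define Z where "Z = (\<lambda>(y, y'). (c - d) * y + u * y') ` (Y \<times> Y)"
  have ZG: "Z \<subseteq> goods (gk_order n) e"
  proof
    fix z assume "z \<in> Z"
    then obtain y y' where y: "y \<in> Y" "y' \<in> Y" "z = (c - d) * y + u * y'" by (auto simp: Z_def)
    have "good (1000 * n ^ 4) ((c - d) * y + u * y')"
      using abcd y Y(1) n t by (intro good_gk[OF _ _ _ _ _ _ _ _ abcd(5)]) (auto simp: goods_def)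
    moreover have "e * z = e * ((c - d) * y) + e * (u * y')" unfolding y(3) by (rule distrib_left)
    then have "e * z = (c - d) * (e * y) + u * (e * y')" by (simp only: mult.left_commute[of e])
    moreover have "e * y = y" "e * y' = y'" using y YI by auto
    ultimately have "good (1000 * n ^ 4) z" "e * z = z" by (simp_all only: y(3))
    then show "z \<in> goods (gk_order n) e" by (simp add: goods_def gk_order_def)
  qed
  have fZ: "finite Z" using finite_subset[OF ZG] fin_goods by auto
  have "(card Y)\<^sup>2 \<le> p\<^sup>2" using card_inj2[OF Y(2)] by (rule power_mono) simp
  then have cZ: "(card Y)\<^sup>2 \<le> 2 * card Z" using le by (simp add: card12 Z_def)
  define P where "P = (\<lambda>Y'. Y' \<subseteq> Z \<and> inj2 e1 e2 Y')"
  have "P {}" by (simp add: P_def inj2_def)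
  moreover have "\<forall>T. P T \<longrightarrow> card T < Suc (card Z)" using fZ by (auto simp: P_def card_mono less_Suc_eq_le)
  ultimately obtain T where T: "P T" and mx: "\<And>T'. P T' \<Longrightarrow> card T' \<le> card T"
    using ex_has_greatest_nat[of P "{}" card "Suc (card Z)"] by blast
  have fT: "finite T" "T \<subseteq> Z" using T fZ finite_subset by (auto simp: P_def)
  have "Z \<subseteq> (\<Union>y\<in>T. {z \<in> Z. e1 * z = e1 * y} \<union> {z \<in> Z. e2 * z = e2 * y})"
  proof
    fix z assume z: "z \<in> Z"
    show "z \<in> (\<Union>y\<in>T. {z \<in> Z. e1 * z = e1 * y} \<union> {z \<in> Z. e2 * z = e2 * y})"
    proof (cases "z \<in> T")
      case False
      then have "\<not> P (insert z T)" using mx[of "insert z T"] fT by auto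
      then have "\<not> inj2 e1 e2 (insert z T)" using T z by (auto simp: P_def)
      then show ?thesis using T False z unfolding P_def inj2_def inj_on_insert by auto
    qed (use z in auto)
  qed
  then have "card Z \<le> card (\<Union>y\<in>T. {z \<in> Z. e1 * z = e1 * y} \<union> {z \<in> Z. e2 * z = e2 * y})"
    using fT fZ by (intro card_mono) auto
  also have "\<dots> \<le> (\<Sum>y\<in>T. card ({z \<in> Z. e1 * z = e1 * y} \<union> {z \<in> Z. e2 * z = e2 * y}))"
    by (rule card_UN_le[OF fT(1)])
  also have "\<dots> \<le> (\<Sum>y\<in>T. 4 * m)"
  proof (rule sum_mono)
    fix y assume "y \<in> T"
    then have y: "y \<in> Z" using fT by auto
    have "card {z \<in> Z. e1 * z = e1 * y} \<le> 2 * m" "card {z \<in> Z. e2 * z = e2 * y} \<le> 2 * m"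
      using fibre_bound[OF ZG y, of e1 e2] fibre_bound[OF ZG y, of e2 e1] no by auto
    then show "card ({z \<in> Z. e1 * z = e1 * y} \<union> {z \<in> Z. e2 * z = e2 * y}) \<le> 4 * m"
      using card_Un_le[of "{z \<in> Z. e1 * z = e1 * y}" "{z \<in> Z. e2 * z = e2 * y}"] by linarith
  qed
  finally have "card Z \<le> 4 * m * card T" by (simp add: mult.commute)
  then have "card Y * card Y \<le> 8 * m * card T" using cZ by (simp add: power2_eq_square)
  moreover have "16 * m\<^sup>2 * card Y \<le> card Y * card Y" using m(2) by (rule mult_le_mono1)
  ultimately have "16 * m\<^sup>2 * card Y \<le> 8 * m * card T" by (rule order_trans[rotated])
  moreover have "16 * m\<^sup>2 * card Y = (8 * m) * (2 * m * card Y)" by (simp add: power2_eq_square)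
  ultimately have "(8 * m) * (2 * m * card Y) \<le> (8 * m) * card T" by (simp only:)
  then have "2 * m * card Y \<le> card T" using m by simp
  then show "\<exists>Y'\<subseteq>goods (gk_order n) e. inj2 e1 e2 Y' \<and> 2 * m * card Y \<le> card Y'"
    using T ZG by (auto simp: P_def)
qed

text \<open>An \<open>inj2\<close> set has at most \<open>p\<close> elements, so growth by
  \<open>2 m\<close> per round cannot last \<open>i\<close> rounds when \<open>p < m^i\<close>. The
  axis alternative must therefore occur, and it persists to later orders by monotonicity.\<close>

lemma grow_plane_axis:
  assumes S: "S \<subseteq> goods 1 e" "inj2 e1 e2 S" "t \<in> S" and m: "m \<ge> 1" "16 * m\<^sup>2 \<le> card S" and i: "p < m ^ i"
  shows "\<exists>f\<in>{e1, e2}. 2 * m \<le> card (goods (2 * (gk_order ^^ i) 1) f)"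
proof -
  have "(\<exists>f\<in>{e1, e2}. 2 * m \<le> card (goods (2 * (gk_order ^^ i) 1) f)) \<or>
    (\<exists>Y\<subseteq>goods ((gk_order ^^ i) 1) e. inj2 e1 e2 Y \<and> (2 * m) ^ i * card S \<le> card Y)" for i
  proof (induction i)
    case 0
    show ?case using S by auto
  next
    case (Suc i)
    define k where "k = (gk_order ^^ i) 1"
    have "1 \<le> k" using gk_order_pow_ge[of 1] by (simp add: k_def)
    note k = this gk_order_ge[OF this]
    from Suc.IH show ?case
    proof (elim disjE bexE exE conjE)
      fix f assume f: "f \<in> {e1, e2}" "2 * m \<le> card (goods (2 * (gk_order ^^ i) 1) f)"
      have "card (goods (2 * k) f) \<le> card (goods (2 * gk_order k) f)"
        using k f fin_goods by (intro card_mono goods_mono) auto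
      then have "2 * m \<le> card (goods (2 * gk_order k) f)" using f(2) unfolding k_def by linarith
      then show ?thesis using f(1) unfolding k_def funpow.simps comp_apply by blast
    next
      fix Y assume Y: "Y \<subseteq> goods ((gk_order ^^ i) 1) e" "inj2 e1 e2 Y" "(2 * m) ^ i * card S \<le> card Y"
      have tk: "t \<in> goods k e" using S goods_mono[OF k(1)] by auto
      have "1 * card S \<le> (2 * m) ^ i * card S" using m by (intro mult_le_mono1) simp
      then have "16 * m\<^sup>2 \<le> card Y" using m Y(3) by linarith
      from grow_plane_step[OF Y(1)[folded k_def] Y(2) tk k(1) m(1) this]
      show ?thesis
      proof (elim disjE exE conjE)
        fix Y' assume Y': "Y' \<subseteq> goods (gk_order k) e" "inj2 e1 e2 Y'" "2 * m * card Y \<le> card Y'"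
        have "2 * m * ((2 * m) ^ i * card S) \<le> 2 * m * card Y" using Y(3) by (rule mult_le_mono2)
        then have "2 * m * ((2 * m) ^ i * card S) \<le> card Y'" using Y'(3) by (rule order_trans)
        then have "(2 * m) ^ Suc i * card S \<le> card Y'" by (simp only: power_Suc mult.assoc)
        then show ?thesis using Y'(1,2) unfolding k_def funpow.simps comp_apply by blast
      qed (simp add: k_def)
    qed
  qed
  then show ?thesis
  proof (elim meta_allE[of _ i] disjE exE conjE)
    fix Y assume Y: "inj2 e1 e2 Y" "(2 * m) ^ i * card S \<le> card Y"
    have "1 \<le> m\<^sup>2" using m(1) by simp
    then have "1 \<le> card S" using m(2) by linarith
    then have "m ^ i * 1 \<le> (2 * m) ^ i * card S"
      by (intro mult_le_mono power_mono) auto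
    then show ?thesis using Y card_inj2[OF Y(1)] i by linarith
  qed
qed

text \<open>Once an axis has \<open>2 m\<close> multipliers, \<open>grow_line\<close> fills half of
  it. Adding these to \<open>S\<close>, which projects injectively to the other axis, gives a direct
  sum with at least \<open>p |S| / 2\<close> elements. The nested iterates of
  \<open>gk_order\<close> record the two stages: growth until an axis is populated, then growth
  along that axis.\<close>

lemma grow_plane:
  assumes S: "S \<subseteq> goods 1 e" "inj2 e1 e2 S" "t \<in> S" and m: "m \<ge> 1" "16 * m\<^sup>2 \<le> card S" and i: "p < m ^ i"
  shows "p * card S \<le> 2 * card (goods (2 * (gk_order ^^ i) (2 * (gk_order ^^ i) 1)) e)"
proof -
  define k where "k = 2 * (gk_order ^^ i) 1"
  define N where "N = (gk_order ^^ i) k"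
  have k: "1 \<le> k" using gk_order_pow_ge[of 1 i] by (simp add: k_def)
  have N: "1 \<le> N" using gk_order_pow_ge[OF k, of i] k by (simp add: N_def)
  obtain f where f: "f \<in> {e1, e2}" "2 * m \<le> card (goods k f)"
    using grow_plane_axis[OF assms] by (auto simp: k_def)
  have "m ^ i \<le> 4 * m * m ^ i" using m by simp
  then have "p \<le> 4 * m * m ^ i" using i by linarith
  moreover have "min p (4 * m * m ^ i) \<le> 2 * card (goods N f)"
  proof (cases "f = e1")
    case True
    from grow_line[OF e1 fin_axis(1) fld1 gen1 k m(1) f(2)[unfolded True], of i]
    show ?thesis unfolding True N_def card1 .
  next
    case False
    then have f2: "f = e2" using f by simp
    from grow_line[OF e2 fin_axis(2) fld2 gen2 k m(1) f(2)[unfolded f2], of i]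
    show ?thesis unfolding f2 N_def card2 .
  qed
  ultimately have fN: "p \<le> 2 * card (goods N f)" by linarith
  obtain g where g: "(f = e1 \<and> g = e2) \<or> (f = e2 \<and> g = e1)" using f by auto
  have gf: "g * f = 0" "inj_on (\<lambda>x. g * x) S" using g e12 e1e S by (auto simp: inj2_def)
  have fe: "e * x = x" if "f * x = x" for x using axis_sub f that by auto
  have gz: "g * x = 0" if "f * x = x" for x using gf that by (metis mult.assoc mult_zero_left)
  have inj: "inj_on (\<lambda>(u, s). u + s) (goods N f \<times> S)"
  proof (rule inj_onI)
    fix a b assume ab: "a \<in> goods N f \<times> S" "b \<in> goods N f \<times> S" "(\<lambda>(u, s). u + s) a = (\<lambda>(u, s). u + s) b"
    obtain u s u' s' where [simp]: "a = (u, s)" "b = (u', s')" by (cases a, cases b)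
    have fu: "f * u = u" "f * u' = u'" and "s \<in> S" "s' \<in> S" "u + s = u' + s'" using ab by (auto simp: goods_def)
    have "g * s = g * (u + s)" "g * s' = g * (u' + s')"
      by (simp_all only: distrib_left gz[OF fu(1)] gz[OF fu(2)] add_0)
    then have "g * s = g * s'" using \<open>u + s = u' + s'\<close> by (simp only:)
    then have "s = s'" using gf(2) \<open>s \<in> S\<close> \<open>s' \<in> S\<close> by (simp add: inj_on_def)
    then show "a = b" using \<open>u + s = u' + s'\<close> by simp
  qed
  have "(\<lambda>(u, s). u + s) ` (goods N f \<times> S) \<subseteq> goods (2 * N) e"
  proof
    fix z assume "z \<in> (\<lambda>(u, s). u + s) ` (goods N f \<times> S)"
    then obtain u s where us: "u \<in> goods N f" "s \<in> S" "z = u + s" by auto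
    have "good 1 s" "e * s = s" using us S by (auto simp: goods_def)
    then have "good N s" using N good_mono by blast
    then have "good (N + N) z" using us good_add by (auto simp: goods_def)
    moreover have "e * u = u" using us fe by (simp add: goods_def)
    then have "e * z = z" using us \<open>e * s = s\<close> by (simp add: distrib_left[of e])
    ultimately show "z \<in> goods (2 * N) e" by (simp add: goods_def mult_2)
  qed
  then have "card (goods N f \<times> S) \<le> card (goods (2 * N) e)"
    using inj fin_goods by (intro card_inj_on_le) auto
  then have "card (goods N f) * card S \<le> card (goods (2 * N) e)" by (simp add: card_cartesian_product)
  moreover have "p * card S \<le> 2 * card (goods N f) * card S" using fN by (rule mult_le_mono1)
  ultimately have "p * card S \<le> 2 * card (goods (2 * N) e)" by linarith
  then show ?thesis unfolding N_def k_def .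
qed

end

section \<open>Large Fourier coefficients of a multiplicative group\<close>

text \<open>The dual form: the weights \<open>c i\<close> align the phases of the inner products,
  Cauchy-Schwarz in \<open>z\<close> removes \<open>u\<close>, and expanding the square leaves the
  correlations of the \<open>f i\<close> among themselves. No orthogonality is assumed.\<close>

lemma bessel:
  fixes f :: "'i \<Rightarrow> 'z \<Rightarrow> complex" and u :: "'z \<Rightarrow> complex"
  assumes F: "finite F" and Z: "finite Z" and u: "\<And>z. z \<in> Z \<Longrightarrow> norm (u z) \<le> 1"
  shows "(\<Sum>i\<in>F. norm (\<Sum>z\<in>Z. u z * f i z))\<^sup>2 \<le>
    card Z * (\<Sum>i\<in>F. \<Sum>j\<in>F. norm (\<Sum>z\<in>Z. f i z * cnj (f j z)))"
proof -
  define S where "S = (\<lambda>i. \<Sum>z\<in>Z. u z * f i z)"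
  define c where "c = (\<lambda>i. cnj (sgn (S i)))"
  define G where "G = (\<lambda>z. \<Sum>i\<in>F. c i * f i z)"
  have c1: "norm (c i) \<le> 1" for i by (simp add: c_def norm_sgn)
  have cS: "c i * S i = of_real (norm (S i))" for i
    by (cases "S i = 0") (auto simp: c_def sgn_div_norm scaleR_conv_of_real complex_norm_square[symmetric]
        mult.commute power2_eq_square field_simps)
  have "of_real (\<Sum>i\<in>F. norm (S i)) = (\<Sum>i\<in>F. c i * S i)" by (simp add: cS)
  also have "\<dots> = (\<Sum>i\<in>F. \<Sum>z\<in>Z. u z * (c i * f i z))" by (simp add: S_def sum_distrib_left mult_ac)
  also have "\<dots> = (\<Sum>z\<in>Z. \<Sum>i\<in>F. u z * (c i * f i z))" by (rule sum.swap)
  also have "\<dots> = (\<Sum>z\<in>Z. u z * G z)" by (simp add: G_def sum_distrib_left)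
  finally have eq: "complex_of_real (\<Sum>i\<in>F. norm (S i)) = (\<Sum>z\<in>Z. u z * G z)" .
  have "(\<Sum>i\<in>F. norm (S i)) = norm (complex_of_real (\<Sum>i\<in>F. norm (S i)))"
    by (simp only: norm_of_real abs_of_nonneg sum_nonneg norm_ge_zero)
  also have "\<dots> \<le> (\<Sum>z\<in>Z. norm (u z * G z))" unfolding eq by (rule norm_sum)
  also have "\<dots> \<le> (\<Sum>z\<in>Z. 1 * norm (G z))" unfolding norm_mult
    by (intro sum_mono mult_right_mono u) auto
  finally have "(\<Sum>i\<in>F. norm (S i))\<^sup>2 \<le> (\<Sum>z\<in>Z. 1 * norm (G z))\<^sup>2" by (intro power_mono sum_nonneg) auto
  also have "\<dots> \<le> (\<Sum>z\<in>Z. 1\<^sup>2) * (\<Sum>z\<in>Z. (norm (G z))\<^sup>2)" by (rule Cauchy_Schwarz_ineq_sum)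
  also have "\<dots> = card Z * (\<Sum>z\<in>Z. (norm (G z))\<^sup>2)" by simp
  also have "(\<Sum>z\<in>Z. (norm (G z))\<^sup>2) \<le> (\<Sum>i\<in>F. \<Sum>j\<in>F. norm (\<Sum>z\<in>Z. f i z * cnj (f j z)))"
  proof -
    have "complex_of_real (\<Sum>z\<in>Z. (norm (G z))\<^sup>2) = (\<Sum>z\<in>Z. G z * cnj (G z))"
      by (simp add: complex_norm_square del: of_real_power)
    also have "\<dots> = (\<Sum>z\<in>Z. \<Sum>i\<in>F. \<Sum>j\<in>F. (c i * cnj (c j)) * (f i z * cnj (f j z)))"
      by (simp add: G_def sum_product mult_ac)
    also have "\<dots> = (\<Sum>i\<in>F. \<Sum>j\<in>F. \<Sum>z\<in>Z. (c i * cnj (c j)) * (f i z * cnj (f j z)))"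
      by (subst sum.swap, rule sum.cong[OF refl], subst sum.swap) simp
    also have "\<dots> = (\<Sum>i\<in>F. \<Sum>j\<in>F. (c i * cnj (c j)) * (\<Sum>z\<in>Z. f i z * cnj (f j z)))"
      by (simp add: sum_distrib_left)
    finally have eq2: "complex_of_real (\<Sum>z\<in>Z. (norm (G z))\<^sup>2) = \<dots>" .
    have "(\<Sum>z\<in>Z. (norm (G z))\<^sup>2) = norm (complex_of_real (\<Sum>z\<in>Z. (norm (G z))\<^sup>2))"
      by (simp only: norm_of_real abs_of_nonneg sum_nonneg zero_le_power2)
    also have "\<dots> \<le> (\<Sum>i\<in>F. \<Sum>j\<in>F. norm ((c i * cnj (c j)) * (\<Sum>z\<in>Z. f i z * cnj (f j z))))"
      unfolding eq2 by (intro order_trans[OF norm_sum] sum_mono norm_sum)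
    also have "\<dots> \<le> (\<Sum>i\<in>F. \<Sum>j\<in>F. 1 * norm (\<Sum>z\<in>Z. f i z * cnj (f j z)))"
      unfolding norm_mult using c1
      by (intro sum_mono mult_right_mono mult_le_one) auto
    finally show ?thesis by simp
  qed
  finally show ?thesis by (simp add: S_def mult_left_mono)
qed

text \<open>By \<open>bessel\<close> the mean correlation over all pairs is at least
  \<open>\<eta>^2 |Z|\<close>. No correlation exceeds \<open>|Z|\<close>, so at least a share
  \<open>\<eta>^2 / 2\<close> of the pairs reaches half of that mean bound.\<close>

lemma bessel_pairs:
  fixes f :: "'i \<Rightarrow> 'z \<Rightarrow> complex" and u :: "'z \<Rightarrow> complex" and \<eta> :: real
  assumes F: "finite F" and Z: "finite Z" "Z \<noteq> {}" and u: "\<And>z. z \<in> Z \<Longrightarrow> norm (u z) \<le> 1"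
    and f: "\<And>i z. i \<in> F \<Longrightarrow> z \<in> Z \<Longrightarrow> norm (f i z) \<le> 1"
    and \<eta>: "\<eta> \<ge> 0" "\<And>i. i \<in> F \<Longrightarrow> \<eta> * card Z \<le> norm (\<Sum>z\<in>Z. u z * f i z)"
  shows "\<eta>\<^sup>2 / 2 * (card F)\<^sup>2 \<le>
    card {(i, j). i \<in> F \<and> j \<in> F \<and> \<eta>\<^sup>2 / 2 * card Z \<le> norm (\<Sum>z\<in>Z. f i z * cnj (f j z))}"
proof -
  define C where "C = (\<lambda>p. norm (\<Sum>z\<in>Z. f (fst p) z * cnj (f (snd p) z)))"
  define P where "P = {p \<in> F \<times> F. \<eta>\<^sup>2 / 2 * card Z \<le> C p}"
  define z where "z = real (card Z)"
  have z: "z > 0" using Z by (simp add: z_def card_gt_0_iff)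
  have fP: "finite P" "P \<subseteq> F \<times> F" using F by (auto simp: P_def)
  have C1: "C p \<le> z" if p: "p \<in> F \<times> F" for p
  proof -
    have "C p \<le> (\<Sum>z\<in>Z. norm (f (fst p) z * cnj (f (snd p) z)))" unfolding C_def by (rule norm_sum)
    also have "\<dots> \<le> (\<Sum>z\<in>Z. 1)" using p f
      by (intro sum_mono) (auto simp: norm_mult intro!: mult_le_one)
    finally show ?thesis by (simp add: z_def)
  qed
  have "(\<eta> * z * card F)\<^sup>2 \<le> (\<Sum>i\<in>F. norm (\<Sum>z\<in>Z. u z * f i z))\<^sup>2"
  proof (rule power_mono)
    have "(\<Sum>i\<in>F. \<eta> * z) \<le> (\<Sum>i\<in>F. norm (\<Sum>z\<in>Z. u z * f i z))" using \<eta> by (intro sum_mono) (auto simp: z_def)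
    then show "\<eta> * z * card F \<le> (\<Sum>i\<in>F. norm (\<Sum>z\<in>Z. u z * f i z))" by (simp add: mult.commute)
  qed (use \<eta> z in auto)
  also have "\<dots> \<le> z * (\<Sum>p\<in>F \<times> F. C p)"
    using bessel[OF F Z(1), of u f] u by (simp add: z_def C_def sum.cartesian_product case_prod_beta)
  also have "(\<Sum>p\<in>F \<times> F. C p) = (\<Sum>p\<in>P. C p) + (\<Sum>p\<in>F \<times> F - P. C p)"
    using sum.subset_diff[OF fP(2), of C] F by (simp add: add.commute)
  also have "\<dots> \<le> (\<Sum>p\<in>P. z) + (\<Sum>p\<in>F \<times> F - P. \<eta>\<^sup>2 / 2 * z)"
    using C1 fP by (intro add_mono sum_mono) (auto simp: P_def z_def)
  also have "\<dots> \<le> card P * z + (card F)\<^sup>2 * (\<eta>\<^sup>2 / 2 * z)"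
  proof -
    have "card (F \<times> F - P) \<le> (card F)\<^sup>2" using F card_mono[of "F \<times> F" "F \<times> F - P"]
      by (simp add: card_cartesian_product power2_eq_square)
    then have "real (card (F \<times> F - P)) * (\<eta>\<^sup>2 / 2 * z) \<le> real ((card F)\<^sup>2) * (\<eta>\<^sup>2 / 2 * z)"
      using z by (intro mult_right_mono of_nat_mono) auto
    then show ?thesis by simp
  qed
  finally have "(\<eta> * z * card F)\<^sup>2 \<le> z * (card P * z + (card F)\<^sup>2 * (\<eta>\<^sup>2 / 2 * z))" using z by simp
  then have "z\<^sup>2 * (\<eta>\<^sup>2 * (card F)\<^sup>2) \<le> z\<^sup>2 * (card P + (card F)\<^sup>2 * (\<eta>\<^sup>2 / 2))"
    by (simp add: power_mult_distrib power2_eq_square algebra_simps)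
  then have "\<eta>\<^sup>2 * (card F)\<^sup>2 \<le> card P + (card F)\<^sup>2 * (\<eta>\<^sup>2 / 2)"
    using z by (simp only: mult_le_cancel_left_pos zero_less_power)
  moreover have "{(i, j). i \<in> F \<and> j \<in> F \<and> \<eta>\<^sup>2 / 2 * card Z \<le> norm (\<Sum>z\<in>Z. f i z * cnj (f j z))} = P"
    by (auto simp: P_def C_def)
  ultimately show ?thesis by (simp add: algebra_simps)
qed

text \<open>Differences of frequencies at level \<open>\<eta>\<close> are often frequencies at level \<open>\<eta>\<^sup>2 / 2\<close>.\<close>

primrec spec_level :: "real \<Rightarrow> nat \<Rightarrow> real" where
  "spec_level \<eta> 0 = \<eta>"
| "spec_level \<eta> (Suc j) = (spec_level \<eta> j)\<^sup>2 / 2"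

lemma spec_level_bounds:
  assumes "0 < \<eta>" "\<eta> \<le> 1"
  shows "0 < spec_level \<eta> j" "spec_level \<eta> j \<le> 1" "spec_level \<eta> (Suc j) \<le> spec_level \<eta> j"
proof -
  have *: "0 < spec_level \<eta> j \<and> spec_level \<eta> j \<le> 1" for j
  proof (induction j)
    case (Suc j)
    then have "(spec_level \<eta> j)\<^sup>2 \<le> 1" by (simp add: power_le_one)
    then show ?case using Suc by simp
  qed (use assms in auto)
  then show "0 < spec_level \<eta> j" "spec_level \<eta> j \<le> 1" by auto
  have "spec_level \<eta> j * spec_level \<eta> j \<le> 1 * spec_level \<eta> j" using * by (intro mult_right_mono) (auto intro: less_imp_le)
  then show "spec_level \<eta> (Suc j) \<le> spec_level \<eta> j" using *[of j] by (simp add: power2_eq_square)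
qed

lemma spec_level_antimono:
  assumes "0 < \<eta>" "\<eta> \<le> 1" shows "i \<le> j \<Longrightarrow> spec_level \<eta> j \<le> spec_level \<eta> i"
  by (rule lift_Suc_antimono_le) (use spec_level_bounds[OF assms] in auto)

text \<open>A subgroup \<open>G\<close> of the units of the ideal of \<open>e\<close>, with an
  additive character that is nondegenerate on the ideal. The same setting serves a group on a line
  and the graph of inversion in the plane.\<close>

locale spectral =
  fixes e :: "'a::comm_ring_1" and \<psi> :: "'a \<Rightarrow> complex" and G :: "'a set"
  assumes e: "e * e = e" and fin_I: "finite {x. e * x = x}"
    and \<psi>_add: "\<psi> (x + y) = \<psi> x * \<psi> y" and \<psi>_norm: "norm (\<psi> x) = 1"
    and orth: "e * x = x \<Longrightarrow> x \<noteq> 0 \<Longrightarrow> (\<Sum>\<xi>\<in>{x. e * x = x}. \<psi> (\<xi> * x)) = 0"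
    and G_sub: "G \<subseteq> {x. e * x = x}" and e_G: "e \<in> G"
    and G_mult: "g \<in> G \<Longrightarrow> h \<in> G \<Longrightarrow> g * h \<in> G" and G_inv: "g \<in> G \<Longrightarrow> \<exists>h\<in>G. g * h = e"
begin

abbreviation "I \<equiv> {x. e * x = x}"

definition ft :: "'a \<Rightarrow> real" where "ft \<xi> = norm (\<Sum>g\<in>G. \<psi> (\<xi> * g)) / card G"

definition spec :: "real \<Rightarrow> 'a set" where "spec \<eta> = {\<xi> \<in> I. \<eta> \<le> ft \<xi>}"

lemma G_e: "g \<in> G \<Longrightarrow> e * g = g" using G_sub by auto

lemma fin_G: "finite G" by (rule finite_subset[OF G_sub fin_I])

lemma card_G: "card G > 0" using fin_G e_G card_gt_0_iff by blast

lemma fin_spec: "finite (spec \<eta>)" using fin_I by (simp add: spec_def)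

lemma \<psi>_0: "\<psi> 0 = 1"
  using \<psi>_add[of 0 0] \<psi>_norm[of 0] by auto

lemma \<psi>_cnj: "cnj (\<psi> x) = \<psi> (- x)"
proof -
  have "\<psi> x * \<psi> (- x) = 1" using \<psi>_add[of x "- x"] \<psi>_0 by simp
  moreover have "\<psi> x * cnj (\<psi> x) = 1" using \<psi>_norm[of x] by (simp add: complex_norm_square[symmetric])
  ultimately show ?thesis by (metis mult_cancel_left mult_zero_left zero_neq_one)
qed

lemma G_cancel: "g \<in> G \<Longrightarrow> e * x = x \<Longrightarrow> e * y = y \<Longrightarrow> g * x = g * y \<Longrightarrow> x = y"
  by (metis G_inv mult.assoc mult.commute)

lemma G_image:
  assumes "g \<in> G" shows "bij_betw (\<lambda>x. g * x) G G"
proof -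
  have "inj_on (\<lambda>x. g * x) G" using G_cancel[OF assms] G_sub by (intro inj_onI) blast
  moreover have "(\<lambda>x. g * x) ` G \<subseteq> G" using G_mult assms by auto
  ultimately show ?thesis using endo_inj_surj[OF fin_G] by (auto simp: bij_betw_def)
qed

lemma ft_mult: "g \<in> G \<Longrightarrow> ft (g * \<xi>) = ft \<xi>"
proof -
  assume g: "g \<in> G"
  have "(\<Sum>h\<in>G. \<psi> (\<xi> * h)) = (\<Sum>h\<in>G. \<psi> (\<xi> * (g * h)))"
    by (rule sum.reindex_bij_betw[OF G_image[OF g], symmetric])
  then show ?thesis by (simp add: ft_def mult_ac)
qed

lemma spec_mult: "g \<in> G \<Longrightarrow> \<xi> \<in> spec \<eta> \<Longrightarrow> g * \<xi> \<in> spec \<eta>"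
  by (auto simp: spec_def ft_mult) (metis mult.left_commute)

lemma parseval: "(\<Sum>\<xi>\<in>I. (ft \<xi>)\<^sup>2) = card I / card G"
proof -
  have "(\<Sum>\<xi>\<in>I. complex_of_real ((norm (\<Sum>g\<in>G. \<psi> (\<xi> * g)))\<^sup>2))
    = (\<Sum>\<xi>\<in>I. \<Sum>g\<in>G. \<Sum>h\<in>G. \<psi> (\<xi> * (g - h)))"
    by (simp add: complex_norm_square sum_product \<psi>_cnj \<psi>_add[symmetric] right_diff_distrib del: of_real_power)
  also have "\<dots> = (\<Sum>g\<in>G. \<Sum>h\<in>G. \<Sum>\<xi>\<in>I. \<psi> (\<xi> * (g - h)))"
    by (subst sum.swap, rule sum.cong[OF refl], subst sum.swap) simp
  also have "\<dots> = (\<Sum>g\<in>G. \<Sum>h\<in>G. if g = h then of_nat (card I) else 0)"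
  proof (intro sum.cong refl)
    fix g h assume gh: "g \<in> G" "h \<in> G"
    then have "e * (g - h) = g - h" by (simp add: right_diff_distrib G_e)
    then show "(\<Sum>\<xi>\<in>I. \<psi> (\<xi> * (g - h))) = (if g = h then of_nat (card I) else 0)"
      using orth[of "g - h"] by (simp add: \<psi>_0)
  qed
  also have "\<dots> = of_nat (card G * card I)" using fin_G by (simp add: sum.delta)
  finally have "complex_of_real (\<Sum>\<xi>\<in>I. (norm (\<Sum>g\<in>G. \<psi> (\<xi> * g)))\<^sup>2) = complex_of_real (real (card G * card I))" by simp
  then have "(\<Sum>\<xi>\<in>I. (norm (\<Sum>g\<in>G. \<psi> (\<xi> * g)))\<^sup>2) = real (card G * card I)" by (simp only: of_real_eq_iff)
  then show ?thesis using card_G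
    by (simp add: ft_def power_divide sum_divide_distrib[symmetric] power2_eq_square)
qed

lemma card_spec: "card (spec \<eta>) * \<eta>\<^sup>2 \<le> card I / card G" if "\<eta> \<ge> 0" for \<eta> :: real
proof -
  have "(\<Sum>\<xi>\<in>spec \<eta>. \<eta>\<^sup>2) \<le> (\<Sum>\<xi>\<in>spec \<eta>. (ft \<xi>)\<^sup>2)"
    using that by (intro sum_mono power_mono) (auto simp: spec_def)
  also have "\<dots> \<le> (\<Sum>\<xi>\<in>I. (ft \<xi>)\<^sup>2)" using fin_I by (intro sum_mono2) (auto simp: spec_def)
  finally show ?thesis by (simp add: parseval)
qed

text \<open>For characters, the correlation of the frequencies \<open>i\<close> and \<open>j\<close>
  is the coefficient at \<open>i - j\<close>, so \<open>bessel_pairs\<close> speaks of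
  differences.\<close>

lemma spec_pairs:
  assumes F: "F \<subseteq> spec \<eta>" and \<eta>: "\<eta> \<ge> 0"
  shows "\<eta>\<^sup>2 / 2 * (card F)\<^sup>2 \<le> card {(i, j). i \<in> F \<and> j \<in> F \<and> i - j \<in> spec (\<eta>\<^sup>2 / 2)}"
proof -
  have FI: "F \<subseteq> I" using F by (auto simp: spec_def)
  have fF: "finite F" using F fin_spec finite_subset by blast
  have "G \<noteq> {}" using e_G by auto
  have "\<eta>\<^sup>2 / 2 * (card F)\<^sup>2 \<le>
    card {(i, j). i \<in> F \<and> j \<in> F \<and> \<eta>\<^sup>2 / 2 * card G \<le> norm (\<Sum>g\<in>G. \<psi> (i * g) * cnj (\<psi> (j * g)))}"
    using F card_G
    by (intro bessel_pairs[of F G "\<lambda>_. 1", OF fF fin_G \<open>G \<noteq> {}\<close>])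
       (auto simp: \<psi>_norm \<eta> spec_def ft_def field_simps)
  also have "{(i, j). i \<in> F \<and> j \<in> F \<and> \<eta>\<^sup>2 / 2 * card G \<le> norm (\<Sum>g\<in>G. \<psi> (i * g) * cnj (\<psi> (j * g)))}
    = {(i, j). i \<in> F \<and> j \<in> F \<and> i - j \<in> spec (\<eta>\<^sup>2 / 2)}"
  proof -
    have "i - j \<in> spec (\<eta>\<^sup>2 / 2) \<longleftrightarrow> \<eta>\<^sup>2 / 2 * card G \<le> norm (\<Sum>g\<in>G. \<psi> (i * g) * cnj (\<psi> (j * g)))"
      if "i \<in> F" "j \<in> F" for i j
    proof -
      have "e * i = i" "e * j = j" using that FI by auto
      then have "e * (i - j) = i - j" by (simp add: right_diff_distrib)
      moreover have "\<psi> (i * g) * cnj (\<psi> (j * g)) = \<psi> ((i - j) * g)" for g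
        by (simp add: \<psi>_cnj \<psi>_add[symmetric] left_diff_distrib)
      ultimately show ?thesis using card_G by (simp add: spec_def ft_def field_simps)
    qed
    then show ?thesis by auto
  qed
  finally show ?thesis .
qed

text \<open>If each spectrum exceeded \<open>K\<close> times the one before, the \<open>J\<close>-th
  would have at least \<open>K^J > card I\<close> elements.\<close>

lemma spec_stagnation:
  fixes K :: real
  assumes K: "K \<ge> 1" "K ^ J > card I" and ne: "spec \<eta> \<noteq> {}"
  obtains j where "j < J" "card (spec (spec_level \<eta> (Suc j))) \<le> K * card (spec (spec_level \<eta> j))"
proof (rule ccontr)
  assume no: "\<not> thesis"
  have gr: "K * card (spec (spec_level \<eta> j)) \<le> card (spec (spec_level \<eta> (Suc j)))" if j: "j < J" for j
    using no \<open>\<And>j. j < J \<Longrightarrow> card (spec (spec_level \<eta> (Suc j))) \<le> K * card (spec (spec_level \<eta> j)) \<Longrightarrow> thesis\<close>[OF j]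
    by linarith
  have "j \<le> J \<Longrightarrow> K ^ j \<le> card (spec (spec_level \<eta> j))" for j
  proof (induction j)
    case 0
    have "card (spec \<eta>) > 0" using ne fin_spec by (simp add: card_gt_0_iff)
    then show ?case by simp
  next
    case (Suc j)
    then have "K * K ^ j \<le> K * card (spec (spec_level \<eta> j))" using K by (intro mult_left_mono) auto
    then show ?case using gr[of j] Suc.prems by simp
  qed
  from this[of J] have "K ^ J \<le> card (spec (spec_level \<eta> J))" by simp
  also have "\<dots> \<le> card I" using fin_I by (intro of_nat_mono card_mono) (auto simp: spec_def)
  finally show False using K by simp
qed

text \<open>The set \<open>A\<close> from \<open>balog_szemeredi_gowers\<close> is not invariant,
  but all dilates \<open>h A\<close> lie in the invariant set \<open>B\<close>, where they have
  density at least \<open>c / 4\<close>. On average two dilates share \<open>c / 4 |A|\<close>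
  points. After division by a suitable \<open>h0\<close>, a share \<open>c / 8\<close> of the group
  satisfies \<open>|s A \<inter> A| \<ge> c / 8 |A|\<close>, and Ruzsa covering with
  \<open>W = s A \<inter> A\<close> shows that such \<open>s\<close> are good of order 1.\<close>

lemma invariant_balog_szemeredi_gowers:
  fixes K c :: real
  assumes B: "B \<subseteq> I" "B \<noteq> {}" "\<And>g b. g \<in> G \<Longrightarrow> b \<in> B \<Longrightarrow> g * b \<in> B"
    and L: "finite L" "card L \<le> K * card B" and c: "0 < c" "c \<le> 1" and K: "K \<ge> 1"
    and P: "c * (card B)\<^sup>2 \<le> card {(a, b). a \<in> B \<and> b \<in> B \<and> a - b \<in> L}"
  obtains A S where "A \<subseteq> B" "c / 4 * card B \<le> card A" "small_doubling A (32768 * K ^ 4 / c ^ 7)"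
    "S \<subseteq> G" "c / 8 * card G \<le> card S" "\<And>s. s \<in> S \<Longrightarrow> small_doubling.good A (32768 * K ^ 4 / c ^ 7) 1 s"
proof -
  \<comment> \<open>32768 is 1024 from \<open>balog_szemeredi_gowers\<close>, times 4 from
    \<open>|B| \<le> 4 |A| / c\<close>, times 8 from the overlap \<open>c / 8\<close> in the
    covering step; the powers of \<open>c\<close> add up as 5 + 1 + 1. One \<open>M\<close> thus
    bounds both the doubling and the number of translates.\<close>
  define M where "M = 32768 * K ^ 4 / c ^ 7"
  have fB: "finite B" by (rule finite_subset[OF B(1) fin_I])
  define b where "b = real (card B)"
  have b: "b > 0" using fB B by (simp add: b_def card_gt_0_iff)
  obtain A where A: "A \<subseteq> B" "c / 4 * card B \<le> card A"
    and AA: "real (card (diffset A A)) * (c ^ 5 * card B ^ 3) \<le> 1024 * card L ^ 4"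
    by (rule balog_szemeredi_gowers[OF fB B(2) L(1) _ _ c(1) P]) blast+
  have fA: "finite A" by (rule finite_subset[OF A(1) fB])
  define a where "a = real (card A)"
  have a: "c / 4 * b \<le> a" using A by (simp add: a_def b_def)
  have "0 < c / 4 * b" using c b by simp
  then have a0: "a > 0" using a by linarith
  then have Ane: "A \<noteq> {}" by (auto simp: a_def)
  define d where "d = real (card (diffset A A))"
  have "d * (c ^ 5 * b ^ 3) \<le> 1024 * (K * b) ^ 4"
    using AA L(2) by (auto simp: d_def b_def intro: order_trans[OF _ mult_left_mono[OF power_mono]])
  then have "b ^ 3 * (d * c ^ 5) \<le> b ^ 3 * (1024 * K ^ 4 * b)"
    by (simp add: power_mult_distrib eval_nat_numeral mult_ac)
  then have "d * c ^ 5 \<le> 1024 * K ^ 4 * b" using b by (simp only: mult_le_cancel_left_pos zero_less_power)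
  then have "d * c ^ 5 * c \<le> 1024 * K ^ 4 * b * c" using c by (intro mult_right_mono) auto
  also have "\<dots> \<le> 1024 * K ^ 4 * (4 * a)" unfolding mult.assoc[of "1024 * K ^ 4"]
    using a K by (intro mult_left_mono) (auto simp: mult.commute)
  finally have d: "d * c ^ 6 \<le> 4096 * K ^ 4 * a" by (simp add: eval_nat_numeral mult_ac)
  have c6: "c ^ 7 \<le> c ^ 6" using c by (intro power_decreasing) auto
  have "d * c ^ 7 \<le> d * c ^ 6" using c6 by (intro mult_left_mono) (auto simp: d_def)
  also have "\<dots> \<le> 32768 * K ^ 4 * a" using d a0 K by (intro order_trans[OF d]) auto
  finally have dM: "d \<le> M * a" using c by (simp add: M_def field_simps)
  have M1: "M \<ge> 1"
  proof -
    have "c ^ 7 \<le> 1" using c by (simp add: power_le_one)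
    moreover have "1 \<le> K ^ 4" using K by (simp add: one_le_power)
    ultimately have "c ^ 7 \<le> 32768 * K ^ 4" by linarith
    then show ?thesis using c by (simp add: M_def)
  qed
  interpret sd: small_doubling A M
    using fA Ane M1 dM by unfold_locales (auto simp: d_def a_def)
  define g where "g = real (card G)"
  have g0: "g > 0" using card_G by (simp add: g_def)
  have AI: "A \<subseteq> I" using A B by auto
  have injA: "inj_on (\<lambda>x. h * x) A" if "h \<in> G" for h
    using G_cancel[OF that] AI by (intro inj_onI) blast
  define hA where "hA = (\<lambda>h. (\<lambda>x. h * x) ` A)"
  have hA: "finite (hA h)" "hA h \<subseteq> B" "card (hA h) = card A" if "h \<in> G" for h
    using that B A fA by (auto simp: hA_def card_image[OF injA])
  define cc where "cc = (\<lambda>x. {h \<in> G. x \<in> hA h})"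
  have sw: "(\<Sum>h\<in>G. real (card (hA h \<inter> X))) = (\<Sum>x\<in>X. real (card (cc x)))" if X: "finite X" for X
  proof -
    have "(\<Sum>h\<in>G. card (hA h \<inter> X)) = (\<Sum>h\<in>G. \<Sum>x\<in>X. of_bool (x \<in> hA h))"
      using X by (intro sum.cong refl) (simp add: of_bool_def sum.If_cases Int_commute Collect_mem_eq)
    also have "\<dots> = (\<Sum>x\<in>X. \<Sum>h\<in>G. of_bool (x \<in> hA h))" by (rule sum.swap)
    also have "\<dots> = (\<Sum>x\<in>X. card (cc x))"
      using fin_G by (intro sum.cong refl) (simp add: of_bool_def sum.If_cases cc_def Collect_conj_eq)
    finally show ?thesis by (metis of_nat_sum)
  qed
  have "(\<Sum>x\<in>B. real (card (cc x))) = g * a"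
    using sw[OF fB] hA by (simp add: Int_absorb2 g_def a_def)
  then have "(g * a)\<^sup>2 = (\<Sum>x\<in>B. 1 * real (card (cc x)))\<^sup>2" by simp
  also have "\<dots> \<le> (\<Sum>x\<in>B. 1\<^sup>2) * (\<Sum>x\<in>B. (real (card (cc x)))\<^sup>2)" by (rule Cauchy_Schwarz_ineq_sum)
  also have "\<dots> = b * (\<Sum>x\<in>B. real (card (cc x)) * real (card (cc x)))" by (simp add: b_def power2_eq_square)
  also have "(\<Sum>x\<in>B. real (card (cc x)) * real (card (cc x))) = (\<Sum>x\<in>B. \<Sum>h\<in>G. of_bool (x \<in> hA h) * real (card (cc x)))"
  proof (intro sum.cong refl)
    fix x
    have "(\<Sum>h\<in>G. of_bool (x \<in> hA h) * real (card (cc x))) = (\<Sum>h\<in>G. of_bool (x \<in> hA h)) * real (card (cc x))"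
      by (rule sum_distrib_right[symmetric])
    also have "(\<Sum>h\<in>G. of_bool (x \<in> hA h)) = real (card (cc x))"
      using fin_G by (simp add: of_bool_def sum.If_cases cc_def Collect_conj_eq)
    finally show "real (card (cc x)) * real (card (cc x)) = (\<Sum>h\<in>G. of_bool (x \<in> hA h) * real (card (cc x)))" by simp
  qed
  also have "\<dots> = (\<Sum>h\<in>G. \<Sum>x\<in>B. of_bool (x \<in> hA h) * real (card (cc x)))" by (rule sum.swap)
  also have "\<dots> = (\<Sum>h\<in>G. \<Sum>x\<in>hA h. real (card (cc x)))"
  proof (rule sum.cong[OF refl])
    fix h assume "h \<in> G"
    then have "B \<inter> {x. x \<in> hA h} = hA h" using hA by auto
    then show "(\<Sum>x\<in>B. of_bool (x \<in> hA h) * real (card (cc x))) = (\<Sum>x\<in>hA h. real (card (cc x)))"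
      using fB by (simp add: of_bool_def sum.If_cases if_distrib[of "\<lambda>t. t * _"] cong: if_cong)
  qed
  also have "\<dots> = (\<Sum>h\<in>G. \<Sum>h'\<in>G. real (card (hA h' \<inter> hA h)))"
    using sw hA by (intro sum.cong[OF refl]) auto
  finally have "(g * a)\<^sup>2 \<le> b * (\<Sum>h\<in>G. \<Sum>h'\<in>G. real (card (hA h' \<inter> hA h)))" .
  moreover have "b * c \<le> 4 * a" using a by (simp add: mult.commute)
  then have "(b * c) * (g\<^sup>2 * a) \<le> (4 * a) * (g\<^sup>2 * a)" using a0 by (intro mult_right_mono) auto
  ultimately have "b * (c / 4 * g\<^sup>2 * a) \<le> b * (\<Sum>h\<in>G. \<Sum>h'\<in>G. real (card (hA h' \<inter> hA h)))"
    by (simp add: power2_eq_square mult_ac)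
  then have "c / 4 * g\<^sup>2 * a \<le> (\<Sum>h\<in>G. \<Sum>h'\<in>G. real (card (hA h' \<inter> hA h)))"
    using b by (simp only: mult_le_cancel_left_pos)
  then have "(\<Sum>h\<in>G. c / 4 * g * a) \<le> (\<Sum>h\<in>G. \<Sum>h'\<in>G. real (card (hA h' \<inter> hA h)))"
    by (simp add: g_def power2_eq_square mult_ac)
  from exists_ge_average[OF fin_G _ this] e_G
  obtain h0 where h0: "h0 \<in> G" "c / 4 * g * a \<le> (\<Sum>h'\<in>G. real (card (hA h' \<inter> hA h0)))" by auto
  define Q where "Q = {h \<in> G. c / 8 * a \<le> card (hA h \<inter> hA h0)}"
  have fQ: "finite Q" "Q \<subseteq> G" using fin_G by (auto simp: Q_def)
  have "(\<Sum>h'\<in>G. real (card (hA h' \<inter> hA h0))) =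
      (\<Sum>h'\<in>Q. real (card (hA h' \<inter> hA h0))) + (\<Sum>h'\<in>G - Q. real (card (hA h' \<inter> hA h0)))"
    using sum.subset_diff[OF fQ(2) fin_G, of "\<lambda>h'. real (card (hA h' \<inter> hA h0))"] by (simp add: add.commute)
  also have "\<dots> \<le> (\<Sum>h'\<in>Q. a) + (\<Sum>h'\<in>G - Q. c / 8 * a)"
  proof (intro add_mono sum_mono)
    fix h assume "h \<in> Q"
    then show "real (card (hA h \<inter> hA h0)) \<le> a"
      using hA[of h] fQ card_mono[of "hA h" "hA h \<inter> hA h0"] by (auto simp: a_def)
  qed (auto simp: Q_def)
  also have "\<dots> \<le> card Q * a + g * (c / 8 * a)"
  proof -
    have "card (G - Q) \<le> card G" using fin_G by (intro card_mono) auto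
    then have "real (card (G - Q)) * (c / 8 * a) \<le> g * (c / 8 * a)"
      unfolding g_def using c a0 by (intro mult_right_mono of_nat_mono) auto
    then show ?thesis by simp
  qed
  finally have "c / 4 * g * a \<le> card Q * a + g * (c / 8 * a)" using h0 by linarith
  then have "a * (c / 8 * g) \<le> a * card Q" by (simp add: algebra_simps)
  then have cQ: "c / 8 * g \<le> card Q" using a0 by (simp only: mult_le_cancel_left_pos)
  obtain k0 where k0: "k0 \<in> G" "h0 * k0 = e" using G_inv h0 by blast
  define S where "S = (\<lambda>h. k0 * h) ` Q"
  have SG: "S \<subseteq> G" using fQ k0 G_mult by (auto simp: S_def)
  have "inj_on (\<lambda>h. k0 * h) Q" using G_image[OF k0(1)] fQ by (auto simp: bij_betw_def inj_on_subset)
  then have cS: "card S = card Q" by (simp add: S_def card_image)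
  have good: "sd.good 1 s" if s: "s \<in> S" for s
  proof -
    obtain h where h: "h \<in> Q" "s = k0 * h" using s by (auto simp: S_def)
    have sG: "s \<in> G" using s SG by auto
    define W where "W = hA s \<inter> A"
    have "(\<lambda>x. k0 * x) ` (hA h \<inter> hA h0) \<subseteq> W"
    proof
      fix z assume "z \<in> (\<lambda>x. k0 * x) ` (hA h \<inter> hA h0)"
      then obtain x x' where x: "x \<in> A" "x' \<in> A" "h * x = h0 * x'" "z = k0 * (h * x)" by (auto simp: hA_def)
      have "z = s * x" using x h by (simp add: mult.assoc)
      moreover have "z = (h0 * k0) * x'" using x(3,4) by (simp add: mult_ac)
      then have "z = x'" using k0 AI x by auto
      ultimately show "z \<in> W" using x by (auto simp: W_def hA_def)
    qed
    moreover have "inj_on (\<lambda>x. k0 * x) (hA h \<inter> hA h0)"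
      using G_cancel[OF k0(1)] hA[of h] hA[of h0] h h0 fQ B by (intro inj_onI) blast
    moreover have fW: "finite W" using fA by (simp add: W_def)
    ultimately have "card (hA h \<inter> hA h0) \<le> card W" by (meson card_inj_on_le)
    then have Wge: "c / 8 * a \<le> card W" using h by (simp add: Q_def)
    have "0 < c / 8 * a" using c a0 by simp
    then have W0: "card W > 0" using Wge by linarith
    then have "W \<noteq> {}" by auto
    obtain T where T: "T \<subseteq> hA s" "card T * card W \<le> card (diffset (hA s) W)" "hA s \<subseteq> sumset T (diffset W W)"
      using ruzsa_covering[OF hA(1)[OF sG] fW \<open>W \<noteq> {}\<close>] by metis
    have fT: "finite T" by (rule finite_subset[OF T(1) hA(1)[OF sG]])
    have "diffset (hA s) W \<subseteq> (\<lambda>x. s * x) ` diffset A A"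
    proof
      fix z assume "z \<in> diffset (hA s) W"
      then obtain x x' where "x \<in> A" "x' \<in> A" "z = s * x - s * x'"
        by (auto simp: diffset_def W_def hA_def)
      then show "z \<in> (\<lambda>x. s * x) ` diffset A A"
        by (auto intro!: image_eqI[of _ _ "x - x'"] diffsetI simp: right_diff_distrib)
    qed
    then have "card (diffset (hA s) W) \<le> card ((\<lambda>x. s * x) ` diffset A A)" using fA by (intro card_mono) auto
    also have "\<dots> \<le> card (diffset A A)" using fA by (intro card_image_le) auto
    finally have "card T * card W \<le> card (diffset A A)" using T by linarith
    then have "real (card T) * card W \<le> d" by (simp add: d_def flip: of_nat_mult)
    moreover have "real (card T) * (c / 8 * a) \<le> real (card T) * card W" using Wge by (intro mult_left_mono) auto
    ultimately have "real (card T) * (c / 8 * a) \<le> d" by linarith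
    then have "real (card T) * (c / 8 * a) * c ^ 6 \<le> d * c ^ 6" using c by (intro mult_right_mono) auto
    also have "\<dots> \<le> 4096 * K ^ 4 * a" by (rule d)
    finally have "a * (real (card T) * c ^ 7) \<le> a * (32768 * K ^ 4)" by (simp add: eval_nat_numeral mult_ac)
    then have "real (card T) * c ^ 7 \<le> 32768 * K ^ 4" using a0 by (simp only: mult_le_cancel_left_pos)
    then have cT: "real (card T) \<le> M" using c by (simp add: M_def field_simps)
    have "diffset W W \<subseteq> diffset A A" by (auto simp: W_def diffset_def)
    moreover have "msum 1 (diffset A A) = diffset A A" by (force simp: sumset_def)
    ultimately have "hA s \<subseteq> sumset T (msum 1 (diffset A A))" using T(3) sumset_mono[OF order_refl] by (metis order_trans)
    then show ?thesis unfolding sd.good_def using fT cT by (intro exI[of _ T]) (simp add: hA_def)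
  qed
  show ?thesis
    using that[of A S] A SG cQ cS good sd.small_doubling_axioms by (simp add: M_def g_def)
qed

text \<open>At a stagnating level the spectrum \<open>B\<close> is invariant under \<open>G\<close>
  and has at least \<open>|G|\<close> elements, because the orbit of \<open>\<xi>\<close> is free.
  By \<open>spec_pairs\<close> many of its differences lie in the next spectrum, which is at most
  \<open>K\<close> times larger. The last level \<open>c\<close> bounds all earlier ones from below,
  so it can serve as the single density.\<close>

lemma spec_structure:
  fixes \<eta> K c :: real
  assumes \<xi>: "\<xi> \<in> spec \<eta>" "inj_on (\<lambda>g. g * \<xi>) G" and \<eta>: "0 < \<eta>" "\<eta> \<le> 1"
    and K: "K \<ge> 1" "K ^ J > card I" and c: "c = spec_level \<eta> J"
  obtains j A S where "j < J" "A \<subseteq> spec (spec_level \<eta> j)" "c / 4 * card G \<le> card A"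
    "small_doubling A (32768 * K ^ 4 / c ^ 7)" "S \<subseteq> G" "c / 8 * card G \<le> card S"
    "\<forall>s\<in>S. small_doubling.good A (32768 * K ^ 4 / c ^ 7) 1 s"
proof -
  obtain j where j: "j < J" "card (spec (spec_level \<eta> (Suc j))) \<le> K * card (spec (spec_level \<eta> j))"
    using spec_stagnation[OF K, of \<eta>] \<xi>(1) by auto
  define B where "B = spec (spec_level \<eta> j)"
  have c01: "0 < c" "c \<le> 1" using spec_level_bounds[OF \<eta>] by (simp_all add: c)
  have "spec_level \<eta> j \<le> \<eta>" using spec_level_antimono[OF \<eta>, of 0 j] by simp
  then have sub: "spec \<eta> \<subseteq> B" by (auto simp: B_def spec_def)
  have "(\<lambda>g. g * \<xi>) ` G \<subseteq> B" using sub spec_mult[OF _ \<xi>(1)] by auto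
  then have GB: "card G \<le> card B" using card_inj_on_le[OF \<xi>(2)] fin_spec by (simp add: B_def)
  have cj: "c \<le> (spec_level \<eta> j)\<^sup>2 / 2"
    using spec_level_antimono[OF \<eta>, of "Suc j" J] j(1) by (simp add: c)
  have "c * (card B)\<^sup>2 \<le> (spec_level \<eta> j)\<^sup>2 / 2 * (card B)\<^sup>2" using cj by (intro mult_right_mono) auto
  also have "\<dots> \<le> card {(a, b). a \<in> B \<and> b \<in> B \<and> a - b \<in> spec (spec_level \<eta> (Suc j))}"
    using spec_pairs[of B "spec_level \<eta> j"] spec_level_bounds(1)[OF \<eta>, of j] by (simp add: B_def)
  finally have P: "c * (card B)\<^sup>2 \<le> card {(a, b). a \<in> B \<and> b \<in> B \<and> a - b \<in> spec (spec_level \<eta> (Suc j))}" .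
  have B: "B \<subseteq> I" "B \<noteq> {}" "\<And>g b. g \<in> G \<Longrightarrow> b \<in> B \<Longrightarrow> g * b \<in> B"
    using sub \<xi>(1) spec_mult by (auto simp: B_def) (auto simp: spec_def)
  show ?thesis
  proof (rule invariant_balog_szemeredi_gowers[OF B fin_spec j(2)[folded B_def] c01 K(1) P])
    fix A S assume AS: "A \<subseteq> B" "c / 4 * card B \<le> card A" "small_doubling A (32768 * K ^ 4 / c ^ 7)"
      "S \<subseteq> G" "c / 8 * card G \<le> card S" "\<And>s. s \<in> S \<Longrightarrow> small_doubling.good A (32768 * K ^ 4 / c ^ 7) 1 s"
    have "c / 4 * card G \<le> c / 4 * card B" using GB c01 by (intro mult_left_mono) auto
    then have "c / 4 * card G \<le> card A" using AS(2) by linarith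
    moreover have "\<forall>s\<in>S. small_doubling.good A (32768 * K ^ 4 / c ^ 7) 1 s" using AS(6) by (rule ballI)
    ultimately show ?thesis using that[OF j(1) AS(1)[unfolded B_def] _ AS(3,4,5)] by blast
  qed
qed

text \<open>At least half of the ideal consists of multipliers of \<open>A\<close>, so
  \<open>good_count\<close> with \<open>R = 1\<close> gives \<open>card I < 4 B |A|\<close>, where
  \<open>B\<close> is the power of \<open>M\<close> in the conclusion. But \<open>A\<close> lies in
  a large spectrum, and Parseval gives \<open>|A| c |G| \<le> card I\<close>. The two clash once
  \<open>c |G| > 8 B\<close>.\<close>

lemma line_bound:
  fixes \<eta> K c :: real
  assumes fld: "\<And>x. e * x = x \<Longrightarrow> x \<noteq> 0 \<Longrightarrow> \<exists>w. x * w = e"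
    and gen: "\<And>Q. Q \<subseteq> I \<Longrightarrow> 0 \<in> Q \<Longrightarrow> (\<And>x. x \<in> Q \<Longrightarrow> x + e \<in> Q) \<Longrightarrow> Q = I"
    and \<xi>: "\<xi> \<in> spec \<eta>" "\<xi> \<noteq> 0" and \<eta>: "0 < \<eta>" "\<eta> \<le> 1"
    and K: "K \<ge> 1" "K ^ J > card I" and c: "c = spec_level \<eta> J"
    and m: "m \<ge> 1" "16 * real m \<le> c * card G" and i: "card I < m ^ i"
  shows "c * card G \<le> 8 * (32768 * K ^ 4 / c ^ 7) ^ (3 * (gk_order ^^ i) 1 + 1)"
proof -
  have "inj_on (\<lambda>g. g * \<xi>) G"
  proof (rule inj_onI)
    fix g h assume gh: "g \<in> G" "h \<in> G" "g * \<xi> = h * \<xi>"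
    obtain w where w: "\<xi> * w = e" using fld[of \<xi>] \<xi> by (auto simp: spec_def)
    have "g * (\<xi> * w) = h * (\<xi> * w)" using gh(3) by (metis mult.assoc)
    then show "g = h" using G_e[OF gh(1)] G_e[OF gh(2)] by (simp add: w mult.commute)
  qed
  from spec_structure[OF \<xi>(1) this \<eta> K c]
  obtain j A S where j: "j < J" and A: "A \<subseteq> spec (spec_level \<eta> j)" "c / 4 * card G \<le> card A"
    "small_doubling A (32768 * K ^ 4 / c ^ 7)" and S: "S \<subseteq> G" "c / 8 * card G \<le> card S"
    "\<forall>s\<in>S. small_doubling.good A (32768 * K ^ 4 / c ^ 7) 1 s" .
  define M where "M = 32768 * K ^ 4 / c ^ 7"
  interpret sd: small_doubling A M using A(3) by (simp add: M_def)
  define N where "N = (gk_order ^^ i) 1"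
  define X where "X = sd.goods N e"
  have c01: "0 < c" "c \<le> 1" using spec_level_bounds[OF \<eta>] by (simp_all add: c)
  have fgoods: "finite (sd.goods k e)" for k by (rule finite_subset[OF _ fin_I]) (auto simp: sd.goods_def)
  have "sd.good 1 s" if "s \<in> S" for s using bspec[OF S(3) that] by (simp only: M_def)
  then have "S \<subseteq> sd.goods 1 e" using S(1) G_e by (auto simp: sd.goods_def)
  then have "card S \<le> card (sd.goods 1 e)" by (intro card_mono fgoods)
  moreover have "2 * real m \<le> card S" using S(2) m(2) by linarith
  ultimately have start: "2 * m \<le> card (sd.goods 1 e)" by linarith
  have "min (card I) (4 * m * m ^ i) \<le> 2 * card X"
    unfolding X_def N_def by (rule sd.grow_line[OF e fin_I fld gen order_refl m(1) start])
  moreover have "m ^ i \<le> 4 * m * m ^ i" using m by simp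
  ultimately have pX: "card I \<le> 2 * card X" using i by linarith
  have AI: "A \<subseteq> I" using A(1) by (auto simp: spec_def)
  have "{(a, b). a \<in> A \<and> b \<in> A \<and> \<not> (\<exists>w. (a - b) * w = e)} \<subseteq> (\<lambda>a. (a, a)) ` A"
  proof (clarsimp simp: image_iff)
    fix a b assume ab: "a \<in> A" "b \<in> A" "\<forall>w. (a - b) * w \<noteq> e"
    have "e * a = a" "e * b = b" using ab AI by auto
    then have "e * (a - b) = a - b" by (simp add: right_diff_distrib)
    then show "b = a" using fld[of "a - b"] ab by auto
  qed
  then have "card {(a, b). a \<in> A \<and> b \<in> A \<and> \<not> (\<exists>w. (a - b) * w = e)} \<le> card ((\<lambda>a. (a, a)) ` A)"
    using sd.fin_A by (intro card_mono) auto
  also have "\<dots> \<le> card A" using sd.fin_A by (rule card_image_le)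
  finally have R: "real (card {(a, b). a \<in> A \<and> b \<in> A \<and> \<not> (\<exists>w. (a - b) * w = e)}) \<le> 1 * real (card A)" by simp
  define B where "B = M ^ (3 * N + 1)"
  have "0 < M" using sd.M1 by linarith
  then have B: "B > 0" unfolding B_def by (rule zero_less_power)
  have Xe: "e * x = x" "sd.good N x" if "x \<in> X" for x using that by (auto simp: X_def sd.goods_def)
  have "card X * card A \<le> B * ((real (card A))\<^sup>2 + real (card X) * 1\<^sup>2)"
    unfolding B_def using fgoods[of N] by (intro sd.good_count[OF _ Xe R]) (simp_all only: X_def)
  then have cnt: "card X * card A \<le> B * (real (card A) ^ 2 + card X)" by simp
  have "c \<le> (spec_level \<eta> j)\<^sup>2 / 2" using spec_level_antimono[OF \<eta>, of "Suc j" J] j by (simp add: c)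
  then have cj: "c \<le> (spec_level \<eta> j)\<^sup>2" using zero_le_power2[of "spec_level \<eta> j"] by linarith
  have "card A \<le> card (spec (spec_level \<eta> j))" using A(1) fin_spec by (rule card_mono[rotated])
  then have "real (card A) * c \<le> card (spec (spec_level \<eta> j)) * (spec_level \<eta> j)\<^sup>2"
    using cj c01 by (intro mult_mono) auto
  also have "\<dots> \<le> card I / card G" using card_spec spec_level_bounds(1)[OF \<eta>, of j] by simp
  finally have Ale: "real (card A) * c * card G \<le> card I" using card_G by (simp add: field_simps)
  define a x g where "a = real (card A)" and "x = real (card X)" and "g = real (card G)"
  have a0: "a > 0" using sd.fin_A sd.A_ne by (simp add: a_def card_gt_0_iff)
  have h: "x * a \<le> B * (a\<^sup>2 + x)" "card I \<le> 2 * x" "a * c * g \<le> card I" "c / 4 * g \<le> a"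
    using cnt pX Ale A(2) by (auto simp: a_def x_def g_def)
  have I0: "0 < real (card I)" using fin_I G_sub e_G by (auto simp: card_gt_0_iff)
  have x0: "x > 0" using h(2) I0 by linarith
  show ?thesis
  proof (rule ccontr)
    assume "\<not> ?thesis"
    then have big: "8 * B < c * g" by (simp add: B_def M_def N_def g_def)
    then have "2 * B < a" using h(4) by linarith
    then have "x * (2 * B) < x * a" using x0 by (rule mult_strict_left_mono)
    then have "x * a < 2 * B * a\<^sup>2" using h(1) by (simp add: algebra_simps)
    then have "a * x < a * (2 * B * a)" by (simp add: power2_eq_square mult_ac)
    then have xa: "x < 2 * B * a" using a0 by (simp only: mult_less_cancel_left_pos)
    have "a * (8 * B) < a * (c * g)" using big a0 by (rule mult_strict_left_mono)
    then have "8 * B * a < card I" using h(3) by (simp add: mult_ac)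
    moreover have "real (card I) < 4 * B * a" using h(2) xa by linarith
    ultimately show False using B a0 mult_pos_pos[OF B a0] by (simp add: mult.assoc)
  qed
qed

text \<open>In the plane the non-invertible differences must be controlled. Points of
  \<open>A\<close> with a common coordinate would by \<open>spec_pairs\<close> produce large
  frequencies on an axis, which \<open>lines\<close> excludes, unless there are at most
  \<open>1 / c\<close> of them. This gives \<open>R = 2 / c\<close> for \<open>good_count\<close>
  and \<open>|A| \<le> p / c\<close>, against at least \<open>p |S| / 2\<close> multipliers from
  \<open>grow_plane\<close>. \<open>E\<close> collects the elements of \<open>G\<close> that may
  fail to generate the plane together with \<open>e\<close>.\<close>

lemma plane_bound:
  fixes \<eta> K c :: real
  assumes e12: "e = e1 + e2" and i1: "e1 * e1 = e1" and i2: "e2 * e2 = e2" and i12: "e1 * e2 = 0"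
    and card1: "card {x. e1 * x = x} = p" and card2: "card {x. e2 * x = x} = p" and card12: "card I = p\<^sup>2"
    and fld1: "\<And>x. e1 * x = x \<Longrightarrow> x \<noteq> 0 \<Longrightarrow> \<exists>w. x * w = e1"
    and fld2: "\<And>x. e2 * x = x \<Longrightarrow> x \<noteq> 0 \<Longrightarrow> \<exists>w. x * w = e2"
    and gen1: "\<And>Q. Q \<subseteq> {x. e1 * x = x} \<Longrightarrow> 0 \<in> Q \<Longrightarrow> (\<And>x. x \<in> Q \<Longrightarrow> x + e1 \<in> Q) \<Longrightarrow> Q = {x. e1 * x = x}"
    and gen2: "\<And>Q. Q \<subseteq> {x. e2 * x = x} \<Longrightarrow> 0 \<in> Q \<Longrightarrow> (\<And>x. x \<in> Q \<Longrightarrow> x + e2 \<in> Q) \<Longrightarrow> Q = {x. e2 * x = x}"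
    and gen: "\<And>t Q. t \<in> G \<Longrightarrow> t \<notin> E \<Longrightarrow> Q \<subseteq> I \<Longrightarrow> 0 \<in> Q \<Longrightarrow> (\<And>x. x \<in> Q \<Longrightarrow> x + e \<in> Q) \<Longrightarrow>
       (\<And>x. x \<in> Q \<Longrightarrow> t * x \<in> Q) \<Longrightarrow> Q = I"
    and E: "finite E" "card E \<le> 2" and inj: "inj2 e1 e2 G"
    and \<xi>: "\<xi> \<in> spec \<eta>" "inj_on (\<lambda>g. g * \<xi>) G" and \<eta>: "0 < \<eta>" "\<eta> \<le> 1"
    and K: "K \<ge> 1" "K ^ J > card I" and c: "c = spec_level \<eta> J"
    and lines: "\<And>\<xi>. e * \<xi> = \<xi> \<Longrightarrow> \<xi> \<noteq> 0 \<Longrightarrow> e1 * \<xi> = 0 \<or> e2 * \<xi> = 0 \<Longrightarrow> ft \<xi> < c"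
    and m: "m \<ge> 1" "128 * (real m)\<^sup>2 \<le> c * card G" and i: "p < m ^ i"
  shows "c ^ 3 * card G \<le> 32 * (32768 * K ^ 4 / c ^ 7) ^ (3 * (2 * (gk_order ^^ i) (2 * (gk_order ^^ i) 1)) + 1)"
proof -
  from spec_structure[OF \<xi> \<eta> K c]
  obtain j A S where j: "j < J" and A: "A \<subseteq> spec (spec_level \<eta> j)" "c / 4 * card G \<le> card A"
    "small_doubling A (32768 * K ^ 4 / c ^ 7)" and S: "S \<subseteq> G" "c / 8 * card G \<le> card S"
    "\<forall>s\<in>S. small_doubling.good A (32768 * K ^ 4 / c ^ 7) 1 s" .
  define M where "M = 32768 * K ^ 4 / c ^ 7"
  interpret sd: small_doubling A M using A(3) by (simp add: M_def)
  have c01: "0 < c" "c \<le> 1" using spec_level_bounds[OF \<eta>] by (simp_all add: c)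
  have "16 * (real m)\<^sup>2 \<le> card S" using S(2) m(2) by linarith
  then have "real (16 * m\<^sup>2) \<le> real (card S)" by simp
  then have mS: "16 * m\<^sup>2 \<le> card S" by (simp only: of_nat_le_iff)
  have "1 \<le> m\<^sup>2" using m(1) by simp
  then have "card E < card S" using mS E by linarith
  then have "\<not> S \<subseteq> E" using card_mono[OF E(1), of S] by linarith
  then obtain t where t: "t \<in> S" "t \<notin> E" by blast
  have tG: "t \<in> G" using t S by blast
  interpret pg: plane_growth A M e1 e2 t p
    by unfold_locales
      (fact i1 i2 i12 card1 card2 fld1 fld2 gen1 gen2 fin_I[unfolded e12] card12[unfolded e12]
        gen[OF tG t(2), unfolded e12])+
  define N where "N = 2 * (gk_order ^^ i) (2 * (gk_order ^^ i) 1)"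
  define X where "X = sd.goods N e"
  have fgoods: "finite (sd.goods k e)" for k by (rule finite_subset[OF _ fin_I]) (auto simp: sd.goods_def)
  have "sd.good 1 s" if "s \<in> S" for s using bspec[OF S(3) that] by (simp only: M_def)
  then have "S \<subseteq> sd.goods 1 e" using S(1) G_e by (auto simp: sd.goods_def)
  then have Sg: "S \<subseteq> sd.goods 1 (e1 + e2)" by (simp only: e12)
  have injS: "inj2 e1 e2 S" using inj S(1) by (auto simp: inj2_def intro: inj_on_subset)
  have pX: "p * card S \<le> 2 * card X"
    unfolding X_def N_def e12 by (rule pg.grow_plane[OF Sg injS t(1) m(1) mS i])
  have AI: "A \<subseteq> I" using A(1) by (auto simp: spec_def)
  have cj: "c \<le> (spec_level \<eta> j)\<^sup>2 / 2"
    using spec_level_antimono[OF \<eta>, of "Suc j" J] j by (simp add: c)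
  have fibre: "real (card F) \<le> 1 / c" if F: "F \<subseteq> A" "\<And>x y. x \<in> F \<Longrightarrow> y \<in> F \<Longrightarrow> f * x = f * y" "f = e1 \<or> f = e2" for F f
  proof -
    have fF: "finite F" using F sd.fin_A finite_subset by blast
    have "{(i, k). i \<in> F \<and> k \<in> F \<and> i - k \<in> spec ((spec_level \<eta> j)\<^sup>2 / 2)} \<subseteq> (\<lambda>x. (x, x)) ` F"
    proof (clarsimp simp: image_iff)
      fix x y assume xy: "x \<in> F" "y \<in> F" "x - y \<in> spec ((spec_level \<eta> j)\<^sup>2 / 2)"
      show "y = x"
      proof (rule ccontr)
        assume "y \<noteq> x"
        moreover have "f * (x - y) = 0" using F(2)[OF xy(1,2)] by (simp add: right_diff_distrib)
        ultimately have "ft (x - y) < c" using lines[of "x - y"] xy(3) F(3) by (auto simp: spec_def)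
        then show False using xy(3) cj by (simp add: spec_def)
      qed
    qed
    then have "card {(i, k). i \<in> F \<and> k \<in> F \<and> i - k \<in> spec ((spec_level \<eta> j)\<^sup>2 / 2)} \<le> card ((\<lambda>x. (x, x)) ` F)"
      using fF by (intro card_mono) auto
    also have "\<dots> \<le> card F" using fF by (rule card_image_le)
    finally have le: "card {(i, k). i \<in> F \<and> k \<in> F \<and> i - k \<in> spec ((spec_level \<eta> j)\<^sup>2 / 2)} \<le> card F" .
    have "c * (card F)\<^sup>2 \<le> (spec_level \<eta> j)\<^sup>2 / 2 * (card F)\<^sup>2" using cj by (intro mult_right_mono) auto
    also have "\<dots> \<le> card {(i, k). i \<in> F \<and> k \<in> F \<and> i - k \<in> spec ((spec_level \<eta> j)\<^sup>2 / 2)}"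
      using F(1) A(1) spec_level_bounds(1)[OF \<eta>, of j] by (intro spec_pairs) auto
    finally have "c * real ((card F)\<^sup>2) \<le> card F" using le by linarith
    then have le2: "real (card F) * (c * card F) \<le> real (card F) * 1" by (simp add: power2_eq_square mult_ac)
    show ?thesis
    proof (cases "card F = 0")
      case False
      then have "c * card F \<le> 1" using le2 by (simp only: mult_le_cancel_left_pos of_nat_0_less_iff neq0_conv)
      then show ?thesis using c01 by (simp add: field_simps)
    qed (use c01 in simp)
  qed
  have "real (card A) = (\<Sum>y\<in>(\<lambda>x. e1 * x) ` A. real (card {s \<in> A. e1 * s = y}))"
    using sum_card_fibres[OF sd.fin_A, of "\<lambda>x. e1 * x"] by (metis of_nat_sum)
  also have "\<dots> \<le> (\<Sum>y\<in>(\<lambda>x. e1 * x) ` A. 1 / c)" by (intro sum_mono fibre[of _ e1]) auto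
  also have "\<dots> = card ((\<lambda>x. e1 * x) ` A) * (1 / c)" by simp
  also have "\<dots> \<le> p * (1 / c)"
  proof -
    have "(\<lambda>x. e1 * x) ` A \<subseteq> {x. e1 * x = x}" using i1 by (auto simp flip: mult.assoc)
    then have "card ((\<lambda>x. e1 * x) ` A) \<le> p" using card_mono[OF pg.fin_axis(1)] card1 by metis
    then show ?thesis using c01 by (intro mult_right_mono) auto
  qed
  finally have Ale: "real (card A) \<le> p / c" by simp
  define N0 where "N0 = {(a, b). a \<in> A \<and> b \<in> A \<and> \<not> (\<exists>w. (a - b) * w = e)}"
  define T where "T = (\<lambda>a. {b \<in> A. e1 * b = e1 * a} \<union> {b \<in> A. e2 * b = e2 * a})"
  have fT: "finite (T a)" for a using sd.fin_A by (simp add: T_def)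
  have "N0 \<subseteq> (SIGMA a:A. T a)"
  proof (clarsimp simp: N0_def T_def)
    fix a b assume ab: "\<forall>w. (a - b) * w \<noteq> e" "e2 * b \<noteq> e2 * a"
    have "e2 * (a - b) \<noteq> 0" using ab(2) by (simp add: right_diff_distrib)
    then have "e1 * (a - b) = 0" using pg.unit_plane[of "a - b"] ab(1) unfolding e12 by blast
    then show "e1 * b = e1 * a" by (simp add: right_diff_distrib)
  qed
  then have "card N0 \<le> card (SIGMA a:A. T a)" using sd.fin_A fT by (intro card_mono) auto
  also have "\<dots> = (\<Sum>a\<in>A. card (T a))" using sd.fin_A fT by (simp add: card_SigmaI)
  finally have "real (card N0) \<le> (\<Sum>a\<in>A. real (card (T a)))" by (metis of_nat_mono of_nat_sum)
  also have "\<dots> \<le> (\<Sum>a\<in>A. 2 / c)"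
  proof (rule sum_mono)
    fix a
    have "real (card (T a)) \<le> card {b \<in> A. e1 * b = e1 * a} + card {b \<in> A. e2 * b = e2 * a}"
      unfolding T_def by (intro of_nat_mono card_Un_le)
    also have "\<dots> \<le> 1 / c + 1 / c" unfolding of_nat_add
      by (intro add_mono fibre[of _ e1] fibre[of _ e2]) auto
    finally show "real (card (T a)) \<le> 2 / c" by simp
  qed
  finally have R: "real (card {(a, b). a \<in> A \<and> b \<in> A \<and> \<not> (\<exists>w. (a - b) * w = e)}) \<le> 2 / c * card A"
    by (simp add: N0_def mult.commute)
  define B where "B = M ^ (3 * N + 1)"
  have "0 < M" using sd.M1 by linarith
  then have B: "B > 0" unfolding B_def by (rule zero_less_power)
  have Xe: "e * x = x" "sd.good N x" if "x \<in> X" for x using that by (auto simp: X_def sd.goods_def)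
  have cnt: "card X * card A \<le> B * (real (card A) ^ 2 + card X * (2 / c)\<^sup>2)"
    unfolding B_def using fgoods[of N] by (intro sd.good_count[OF _ Xe R]) (simp_all only: X_def)
  define a x g s where "a = real (card A)" and "x = real (card X)" and "g = real (card G)" and "s = real (card S)"
  have a0: "a > 0" using sd.fin_A sd.A_ne by (simp add: a_def card_gt_0_iff)
  have ps: "p * s \<le> 2 * x" using pX unfolding s_def x_def by (metis of_nat_mono of_nat_mult of_nat_numeral)
  have h: "x * a \<le> B * (a\<^sup>2 + x * (2 / c)\<^sup>2)" "a \<le> p / c" "c / 4 * g \<le> a" "c / 8 * g \<le> s"
    using cnt Ale A(2) S(2) by (auto simp: a_def x_def g_def s_def)
  have p0: "0 < real p"
  proof (rule ccontr)
    assume "\<not> ?thesis"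
    then have "card I = 0" using card12 by simp
    then show False using fin_I G_sub e_G by auto
  qed
  have s0: "s > 0" using t(1) S(1) fin_G finite_subset by (auto simp: s_def card_gt_0_iff)
  have x0: "x > 0" using ps mult_pos_pos[OF p0 s0] by linarith
  show ?thesis
  proof (rule ccontr)
    assume "\<not> ?thesis"
    then have big: "32 * B < c ^ 3 * g" by (simp add: B_def M_def N_def g_def)
    have "c\<^sup>2 * (c * g) \<le> c\<^sup>2 * (4 * a)" using h(3) by (intro mult_left_mono) auto
    then have "8 * B < c\<^sup>2 * a" using big by (simp add: power3_eq_cube power2_eq_square mult_ac)
    then have "x * (8 * B) < x * (c\<^sup>2 * a)" using x0 by (rule mult_strict_left_mono)
    then have "2 * (B * (x * (2 / c)\<^sup>2)) < x * a" using c01 by (simp add: power_divide field_simps)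
    then have "x * a < 2 * B * a\<^sup>2" using h(1) by (simp add: distrib_left)
    then have "a * x < a * (2 * B * a)" by (simp add: power2_eq_square mult_ac)
    then have xa: "x < 2 * B * a" using a0 by (simp only: mult_less_cancel_left_pos)
    \<comment> \<open>From \<open>p |S| \<le> 2 x < 4 B |A|\<close> and
      \<open>|A| \<le> p / c\<close> there remains \<open>c |S| < 4 B\<close>, whereas
      \<open>|S| \<ge> c |G| / 8\<close>.\<close>
    have "2 * B * a \<le> 2 * B * (p / c)" using B h(2) by (intro mult_left_mono) auto
    then have "p * s < 4 * B * (p / c)" using ps xa by linarith
    then have "p * (s * c) < p * (4 * B)" using c01 by (simp add: field_simps)
    then have "s * c < 4 * B" using p0 by (simp only: mult_less_cancel_left_pos)
    moreover have "c / 8 * g * c \<le> s * c" using h(4) c01 by (intro mult_right_mono) auto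
    moreover have "c / 8 * g * c = c\<^sup>2 * g / 8" by (simp add: power2_eq_square)
    ultimately have "c\<^sup>2 * g < 32 * B" by linarith
    moreover have "c ^ 3 * g \<le> c\<^sup>2 * g" using c01 by (intro mult_right_mono power_decreasing) (auto simp: g_def)
    ultimately show False using big by linarith
  qed
qed

end

section \<open>Exponential sums modulo a prime\<close>

definition ue :: "real \<Rightarrow> complex" where "ue x = cis (2 * pi * x)"

lemma ue_add: "ue (x + y) = ue x * ue y"
  by (simp add: ue_def cis_mult distrib_left)

lemma ue_0 [simp]: "ue 0 = 1"
  by (simp add: ue_def)

lemma norm_ue [simp]: "norm (ue x) = 1"
  by (simp add: ue_def)

lemma cnj_ue: "cnj (ue x) = ue (- x)"
  by (simp add: ue_def cis_cnj)

lemma ue_eq_1_iff: "ue x = 1 \<longleftrightarrow> x \<in> \<int>"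
proof
  assume "ue x = 1"
  then have "cos (2 * pi * x) = 1" by (simp add: ue_def complex_eq_iff)
  then obtain n :: int where "2 * pi * x = of_int n * 2 * pi" unfolding cos_one_2pi_int by auto
  then have "x = of_int n" by simp
  then show "x \<in> \<int>" by simp
qed (simp add: ue_def)

lemma ue_of_int [simp]: "ue (of_int n) = 1"
  by (simp add: ue_eq_1_iff)

lemma ue_power: "ue x ^ n = ue (of_nat n * x)"
  by (simp add: ue_def Complex.DeMoivre mult.left_commute)

lemma ue_cong:
  fixes a b :: int and q :: nat
  assumes "[a = b] (mod int q)"
  shows "ue (of_int a / of_nat q) = ue (of_int b / of_nat q)"
proof (cases "q = 0")
  case False
  obtain k where "a = b + int q * k" using assms by (metis cong_iff_lin cong_sym)
  then have "of_int a / of_nat q = of_int b / of_nat q + real_of_int k" using False by (simp add: field_simps)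
  then show ?thesis by (simp add: ue_add)
qed (use assms in simp)

lemma ue_quotient_eq_1_iff:
  fixes a :: int and q :: nat
  assumes "q > 0"
  shows "ue (of_int a / of_nat q) = 1 \<longleftrightarrow> int q dvd a"
proof
  assume "ue (of_int a / of_nat q) = 1"
  then obtain n where "of_int a / of_nat q = real_of_int n" by (auto simp: ue_eq_1_iff elim: Ints_cases)
  then have "real_of_int a = real_of_int (n * int q)" using assms by (simp add: field_simps)
  then have "a = n * int q" by (simp only: of_int_eq_iff)
  then show "int q dvd a" by simp
next
  assume "int q dvd a"
  then have "ue (of_int a / of_nat q) = ue (of_int 0 / of_nat q)" by (intro ue_cong) (simp add: cong_0_iff)
  then show "ue (of_int a / of_nat q) = 1" by simp
qed

lemma sum_ue:
  fixes a :: int and q :: nat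
  assumes "q > 0"
  shows "(\<Sum>u\<in>{0..<int q}. ue (of_int (u * a) / of_nat q)) = (if int q dvd a then of_nat q else 0)"
proof -
  define z where "z = ue (of_int a / of_nat q)"
  have "{0..<int q} = int ` {..<q}"
    by (auto simp: image_iff intro!: bexI[of _ "nat _"])
  then have "(\<Sum>u\<in>{0..<int q}. ue (of_int (u * a) / of_nat q)) = (\<Sum>u<q. ue (of_int (int u * a) / of_nat q))"
    by (simp add: sum.reindex)
  also have "\<dots> = (\<Sum>u<q. z ^ u)" by (simp add: z_def ue_power)
  also have "\<dots> = (if int q dvd a then of_nat q else 0)"
  proof (cases "int q dvd a")
    case True
    then have "z = 1" using ue_quotient_eq_1_iff[OF assms] by (simp add: z_def)
    then show ?thesis using True by simp
  next
    case False
    then have "z \<noteq> 1" using ue_quotient_eq_1_iff[OF assms] by (simp add: z_def)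
    moreover have "z ^ q = ue (of_int a)" using assms by (simp add: z_def ue_power)
    ultimately show ?thesis using False by (simp add: geometric_sum)
  qed
  finally show ?thesis .
qed

section \<open>Subgroups of units as sets of representatives\<close>

abbreviation minv :: "nat \<Rightarrow> int \<Rightarrow> int" where "minv q x \<equiv> modular_inverse (int q) x"

text \<open>Congruences instead of the structure \<open>unit_group q\<close> make it easy to pass to
  a divisor of \<open>q\<close>; \<open>1 mod int q\<close> keeps the case \<open>q = 1\<close>,
  where the unit is represented by 0.\<close>

definition modgrp :: "nat \<Rightarrow> int set \<Rightarrow> bool" where
  "modgrp q H \<longleftrightarrow> q > 0 \<and> H \<subseteq> {0..<int q} \<and> 1 mod int q \<in> H \<and>
     (\<forall>x\<in>H. \<forall>y\<in>H. x * y mod int q \<in> H) \<and> (\<forall>x\<in>H. \<exists>y\<in>H. [x * y = 1] (mod int q))"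

lemma minv_cong: "coprime x (int q) \<Longrightarrow> [x * minv q x = 1] (mod int q)"
  by (rule cong_modular_inverse1) (simp add: coprime_commute)

lemma minv_unique:
  assumes "[x * y = 1] (mod int q)" shows "[minv q x = y] (mod int q)"
proof -
  have "coprime x (int q)" using assms by (meson coprime_iff_invertible_int)
  then have i: "[x * minv q x = 1] (mod int q)" by (rule minv_cong)
  have "[minv q x * (x * y) = minv q x * 1] (mod int q)" using assms by (rule cong_scalar_left)
  moreover have "[y * (x * minv q x) = y * 1] (mod int q)" using i by (rule cong_scalar_left)
  ultimately show ?thesis by (simp add: mult_ac) (meson cong_sym cong_trans)
qed

lemma minv_mult:
  assumes "coprime x (int q)" "coprime y (int q)"
  shows "[minv q (x * y) = minv q x * minv q y] (mod int q)"
proof (rule minv_unique)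
  have "[(x * minv q x) * (y * minv q y) = 1 * 1] (mod int q)"
    by (intro cong_mult minv_cong assms)
  then show "[x * y * (minv q x * minv q y) = 1] (mod int q)" by (simp add: mult_ac)
qed

lemma minv_cong_arg:
  assumes "[x = y] (mod int q)" "coprime x (int q)" shows "[minv q x = minv q y] (mod int q)"
proof (rule minv_unique)
  have cy: "coprime y (int q)" using assms cong_imp_coprime by blast
  have "[x * minv q y = y * minv q y] (mod int q)" using assms(1) by (rule cong_scalar_right)
  then show "[x * minv q y = 1] (mod int q)" using minv_cong[OF cy] cong_trans by blast
qed

lemma eq_if_cong:
  fixes x y :: int
  assumes "[x = y] (mod int q)" "x \<in> {0..<int q}" "y \<in> {0..<int q}" shows "x = y"
  using assms unfolding Cong.cong_def by simp

lemma modgrp_finite: "modgrp q H \<Longrightarrow> finite H"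
  by (auto simp: modgrp_def intro: finite_subset)

lemma modgrp_pos: "modgrp q H \<Longrightarrow> q > 0" by (simp add: modgrp_def)

lemma modgrp_range: "modgrp q H \<Longrightarrow> x \<in> H \<Longrightarrow> x \<in> {0..<int q}" by (auto simp: modgrp_def)

lemma modgrp_one: "modgrp q H \<Longrightarrow> 1 mod int q \<in> H" by (simp add: modgrp_def)

lemma modgrp_mult: "modgrp q H \<Longrightarrow> x \<in> H \<Longrightarrow> y \<in> H \<Longrightarrow> x * y mod int q \<in> H" by (simp add: modgrp_def)

lemma modgrp_card: "modgrp q H \<Longrightarrow> card H > 0"
  using modgrp_one modgrp_finite card_gt_0_iff by blast

lemma modgrp_coprime: "modgrp q H \<Longrightarrow> x \<in> H \<Longrightarrow> coprime x (int q)"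
  unfolding modgrp_def by (meson coprime_iff_invertible_int)

lemma modgrp_minv_cong: "modgrp q H \<Longrightarrow> x \<in> H \<Longrightarrow> [x * minv q x = 1] (mod int q)"
  using modgrp_coprime minv_cong by blast

lemma modgrp_minv:
  assumes "modgrp q H" "x \<in> H" shows "minv q x \<in> H"
proof -
  obtain y where y: "y \<in> H" "[x * y = 1] (mod int q)" using assms by (auto simp: modgrp_def)
  have "minv q x \<in> {0..<int q}"
    using modgrp_pos[OF assms(1)] by (simp add: modular_inverse_int_nonneg modular_inverse_int_less)
  then have "minv q x = y" using minv_unique[OF y(2)] modgrp_range[OF assms(1) y(1)] eq_if_cong by blast
  then show ?thesis using y by simp
qed

lemma modgrp_mult_bij:
  assumes H: "modgrp q H" and g: "g \<in> H"
  shows "bij_betw (\<lambda>x. g * x mod int q) H H"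
proof -
  have "inj_on (\<lambda>x. g * x mod int q) H"
  proof (rule inj_onI)
    fix x y assume xy: "x \<in> H" "y \<in> H" "g * x mod int q = g * y mod int q"
    then have "[g * x = g * y] (mod int q)" unfolding Cong.cong_def by blast
    then have "[x = y] (mod int q)" using cong_mult_lcancel modgrp_coprime[OF H g] by blast
    then show "x = y" using modgrp_range[OF H] xy eq_if_cong by blast
  qed
  moreover have "(\<lambda>x. g * x mod int q) ` H \<subseteq> H" using modgrp_mult[OF H g] by auto
  ultimately show ?thesis using endo_inj_surj[OF modgrp_finite[OF H]] by (auto simp: bij_betw_def)
qed

lemma modgrp_minv_bij:
  assumes H: "modgrp q H" shows "bij_betw (minv q) H H"
proof -
  have "inj_on (minv q) H"
  proof (rule inj_onI)
    fix x y assume xy: "x \<in> H" "y \<in> H" "minv q x = minv q y"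
    have "[minv q x * x = minv q x * y] (mod int q)"
      using modgrp_minv_cong[OF H xy(1)] modgrp_minv_cong[OF H xy(2)] xy(3)
      by (metis cong_sym cong_trans mult.commute)
    then have "[x = y] (mod int q)"
      using cong_mult_lcancel modgrp_coprime[OF H modgrp_minv[OF H xy(1)]] by blast
    then show "x = y" using modgrp_range[OF H] xy eq_if_cong by blast
  qed
  moreover have "minv q ` H \<subseteq> H" using modgrp_minv[OF H] by auto
  ultimately show ?thesis using endo_inj_surj[OF modgrp_finite[OF H]] by (auto simp: bij_betw_def)
qed

lemma powr_dominates:
  fixes a b C :: real
  assumes "a < b"
  obtains P :: nat where "\<forall>p\<ge>P. C * real p powr a < real p powr b"
proof -
  have "filterlim (\<lambda>p::nat. real p powr (b - a)) at_top at_top"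
  proof (rule filterlim_cong[THEN iffD1, OF refl refl])
    show "filterlim (\<lambda>p::nat. exp ((b - a) * ln (real p))) at_top at_top"
      using assms by (intro filterlim_compose[OF exp_at_top] filterlim_tendsto_pos_mult_at_top[OF tendsto_const]
          filterlim_compose[OF ln_at_top filterlim_real_sequentially]) auto
    show "eventually (\<lambda>p::nat. exp ((b - a) * ln (real p)) = real p powr (b - a)) at_top"
      using eventually_gt_at_top[of 0] by eventually_elim (simp add: powr_def)
  qed
  then have "eventually (\<lambda>p::nat. C < real p powr (b - a)) at_top" by (auto simp: filterlim_at_top_dense)
  then obtain P where P: "\<And>p. p \<ge> P \<Longrightarrow> C < real p powr (b - a)" by (auto simp: eventually_at_top_linorder)
  have "C * real p powr a < real p powr b" if "p \<ge> max P 1" for p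
  proof -
    have "C * real p powr a < real p powr (b - a) * real p powr a"
      using P[of p] that by (intro mult_strict_right_mono) auto
    then show ?thesis by (simp flip: powr_add)
  qed
  then show ?thesis using that by blast
qed

lemma lt_mult_Suc_ceiling:
  fixes x y :: real
  assumes "y > 0" shows "x < y * real (nat \<lceil>x / y\<rceil> + 1)"
proof -
  have "x = y * (x / y)" using assms by simp
  also have "\<dots> \<le> y * real (nat \<lceil>x / y\<rceil>)" using assms by (intro mult_left_mono real_nat_ceiling_ge) auto
  also have "\<dots> < y * real (nat \<lceil>x / y\<rceil> + 1)" using assms by (intro mult_strict_left_mono) auto
  finally show ?thesis .
qed

text \<open>This records the order in which constants are fixed. \<open>\<delta>\<close> gives the
  number of rounds and hence the exponent \<open>N\<close>; \<open>\<epsilon>\<close> makes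
  \<open>(K^4)^N = p^(\<delta> / 2)\<close> for \<open>K = p^\<epsilon>\<close>; \<open>J\<close>
  makes \<open>K^J\<close> exceed \<open>p^2\<close>, the size of the plane; and then
  \<open>c\<close> does not depend on \<open>p\<close>. With \<open>m\<close> about
  \<open>p^(\<delta> / 4)\<close>, each requirement on \<open>g\<close> compares at most a constant
  times \<open>p^(\<delta> / 2)\<close> with \<open>p^\<delta>\<close>.\<close>

lemma growth_parameters:
  fixes \<delta> c0 \<eta> :: real and N :: nat
  assumes \<delta>: "\<delta> > 0" and c0: "c0 > 0" and \<eta>: "0 < \<eta>" "\<eta> \<le> 1" and N: "N \<ge> 1"
  defines "\<epsilon> \<equiv> \<delta> / (8 * N)"
  defines "c \<equiv> spec_level \<eta> (nat \<lceil>2 / \<epsilon>\<rceil> + 1)"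
  obtains P :: nat where "P \<ge> 2"
    "\<forall>p\<ge>P. \<forall>g. c0 * real p powr \<delta> \<le> g \<longrightarrow>
      1 \<le> real p powr \<epsilon> \<and> real p ^ 2 < (real p powr \<epsilon>) ^ (nat \<lceil>2 / \<epsilon>\<rceil> + 1) \<and>
      1 \<le> nat \<lceil>real p powr (\<delta> / 4)\<rceil> \<and> p < nat \<lceil>real p powr (\<delta> / 4)\<rceil> ^ (nat \<lceil>4 / \<delta>\<rceil> + 1) \<and>
      16 * real (nat \<lceil>real p powr (\<delta> / 4)\<rceil>) \<le> c * g \<and> 128 * (real (nat \<lceil>real p powr (\<delta> / 4)\<rceil>))\<^sup>2 \<le> c * g \<and>
      32 * (32768 * (real p powr \<epsilon>) ^ 4 / c ^ 7) ^ N < c ^ 3 * g"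
proof -
  have c: "0 < c" unfolding c_def by (rule spec_level_bounds(1)[OF \<eta>])
  have d2: "\<delta> / 2 < \<delta>" using \<delta> by simp
  have \<epsilon>: "\<epsilon> > 0" using \<delta> N by (simp add: \<epsilon>_def)
  obtain P1 where P1: "\<forall>p\<ge>P1. (512 / (c * c0)) * real p powr (\<delta> / 2) < real p powr \<delta>"
    by (rule powr_dominates[OF d2])
  obtain P2 where P2: "\<forall>p\<ge>P2. (32 * (32768 / c ^ 7) ^ N / (c ^ 3 * c0)) * real p powr (\<delta> / 2) < real p powr \<delta>"
    by (rule powr_dominates[OF d2])
  show ?thesis
  proof (rule that[of "max 2 (max P1 P2)"], goal_cases)
    case 2
    show ?case
    proof (intro allI impI)
    fix p :: nat and g :: real assume p: "p \<ge> max 2 (max P1 P2)" and g: "c0 * real p powr \<delta> \<le> g"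
    have p1: "real p > 1" using p by auto
    define K where "K = real p powr \<epsilon>"
    define m where "m = nat \<lceil>real p powr (\<delta> / 4)\<rceil>"
    have K1: "1 \<le> K" using p1 \<epsilon> by (simp add: K_def ge_one_powr_ge_zero)
    have pd: "1 \<le> real p powr (\<delta> / 4)" using p1 \<delta> by (simp add: ge_one_powr_ge_zero)
    have mlo: "real p powr (\<delta> / 4) \<le> m" unfolding m_def by (rule real_nat_ceiling_ge)
    have mhi: "real m \<le> 2 * real p powr (\<delta> / 4)" unfolding m_def using pd by linarith
    have m1: "1 \<le> m" using mlo pd by linarith
    have KJ: "real p ^ 2 < K ^ (nat \<lceil>2 / \<epsilon>\<rceil> + 1)"
    proof -
      have "2 < \<epsilon> * real (nat \<lceil>2 / \<epsilon>\<rceil> + 1)"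
        by (rule lt_mult_Suc_ceiling[OF \<epsilon>])
      then have "real p powr 2 < real p powr (\<epsilon> * real (nat \<lceil>2 / \<epsilon>\<rceil> + 1))" using p1 by (simp only: powr_less_cancel_iff)
      also have "\<dots> = K ^ (nat \<lceil>2 / \<epsilon>\<rceil> + 1)" using p1 unfolding K_def by (simp only: powr_powr[symmetric] powr_realpow powr_gt_zero)
      finally show ?thesis using p1 by (simp add: powr_numeral)
    qed
    have mi: "p < m ^ (nat \<lceil>4 / \<delta>\<rceil> + 1)"
    proof -
      have "1 < (\<delta> / 4) * real (nat \<lceil>4 / \<delta>\<rceil> + 1)"
        using lt_mult_Suc_ceiling[OF \<delta>, of 4] by simp
      then have "real p powr 1 < real p powr ((\<delta> / 4) * real (nat \<lceil>4 / \<delta>\<rceil> + 1))" using p1 by (simp only: powr_less_cancel_iff)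
      also have "\<dots> = (real p powr (\<delta> / 4)) ^ (nat \<lceil>4 / \<delta>\<rceil> + 1)" using p1 by (simp only: powr_powr[symmetric] powr_realpow powr_gt_zero)
      also have "\<dots> \<le> real m ^ (nat \<lceil>4 / \<delta>\<rceil> + 1)" using mlo by (intro power_mono) auto
      finally have "real p < real (m ^ (nat \<lceil>4 / \<delta>\<rceil> + 1))" using p1 by simp
      then show ?thesis by (simp only: of_nat_less_iff)
    qed
    have half: "real p powr (\<delta> / 2) = (real p powr (\<delta> / 4))\<^sup>2"
      using p1 by (simp add: power2_eq_square flip: powr_add)
    have cg: "512 * real p powr (\<delta> / 2) \<le> c * g"
    proof -
      have "512 * real p powr (\<delta> / 2) \<le> c * (c0 * real p powr \<delta>)"
        using P1[rule_format, of p] p c c0 by (simp add: field_simps)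
      also have "\<dots> \<le> c * g" using g c by (intro mult_left_mono) auto
      finally show ?thesis .
    qed
    have m2: "(real m)\<^sup>2 \<le> 4 * real p powr (\<delta> / 2)"
    proof -
      have "(real m)\<^sup>2 \<le> (2 * real p powr (\<delta> / 4))\<^sup>2" using mhi by (intro power_mono) auto
      then show ?thesis by (simp add: half power_mult_distrib)
    qed
    have "128 * (real m)\<^sup>2 \<le> c * g" using m2 cg by linarith
    moreover have "real m * 1 \<le> real m * real m" using m1 by (intro mult_left_mono) auto
    then have "16 * real m \<le> 128 * (real m)\<^sup>2" by (simp add: power2_eq_square)
    moreover have "32 * (32768 * K ^ 4 / c ^ 7) ^ N < c ^ 3 * g"
    proof -
      have "(K ^ 4) ^ N = K ^ (4 * N)" by (rule power_mult[symmetric])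
      also have "\<dots> = K powr real (4 * N)" using K1 by (intro powr_realpow[symmetric]) linarith
      also have "\<dots> = real p powr (\<delta> / 2)" using N by (simp add: K_def powr_powr \<epsilon>_def)
      finally have "32 * (32768 * K ^ 4 / c ^ 7) ^ N = 32 * (32768 / c ^ 7) ^ N * real p powr (\<delta> / 2)"
        by (simp add: power_mult_distrib power_divide)
      also have "\<dots> < c ^ 3 * (c0 * real p powr \<delta>)"
        using P2[rule_format, of p] p c c0 by (simp add: divide_less_eq mult_ac)
      also have "\<dots> \<le> c ^ 3 * g" using g c by (intro mult_left_mono) auto
      finally show ?thesis .
    qed
    ultimately have "16 * real m \<le> c * g" "128 * (real m)\<^sup>2 \<le> c * g"
      "32 * (32768 * K ^ 4 / c ^ 7) ^ N < c ^ 3 * g" by linarith+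
    then show "1 \<le> real p powr \<epsilon> \<and> real p ^ 2 < (real p powr \<epsilon>) ^ (nat \<lceil>2 / \<epsilon>\<rceil> + 1) \<and>
      1 \<le> nat \<lceil>real p powr (\<delta> / 4)\<rceil> \<and> p < nat \<lceil>real p powr (\<delta> / 4)\<rceil> ^ (nat \<lceil>4 / \<delta>\<rceil> + 1) \<and>
      16 * real (nat \<lceil>real p powr (\<delta> / 4)\<rceil>) \<le> c * g \<and> 128 * (real (nat \<lceil>real p powr (\<delta> / 4)\<rceil>))\<^sup>2 \<le> c * g \<and>
      32 * (32768 * (real p powr \<epsilon>) ^ 4 / c ^ 7) ^ N < c ^ 3 * g"
      using K1 KJ m1 mi cg unfolding K_def m_def by blast
    qed
  qed simp
qed

text \<open>A single commutative ring that contains all planes \<open>(\<int>/q)\<^sup>2\<close>, \<open>q \<in> \<nat>\<close>, as ideals generated by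
  idempotents: the product of two copies of every \<open>\<int>/q\<close>. The plane at \<open>q\<close> is the set of
  elements \<open>emb q a b\<close>.\<close>

quotient_type resfam = "bool \<Rightarrow> nat \<Rightarrow> int" / "\<lambda>f g. \<forall>i q. [f i q = g i q] (mod int q)"
proof (rule equivpI)
  show "reflp (\<lambda>f g :: bool \<Rightarrow> nat \<Rightarrow> int. \<forall>i q. [f i q = g i q] (mod int q))" by (simp add: reflp_def)
  show "symp (\<lambda>f g :: bool \<Rightarrow> nat \<Rightarrow> int. \<forall>i q. [f i q = g i q] (mod int q))" by (simp add: symp_def cong_sym_eq)
  show "transp (\<lambda>f g :: bool \<Rightarrow> nat \<Rightarrow> int. \<forall>i q. [f i q = g i q] (mod int q))"
    using cong_trans unfolding transp_def by blast
qed

instantiation resfam :: comm_ring_1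
begin

lift_definition zero_resfam :: resfam is "\<lambda>i q. 0" .
lift_definition one_resfam :: resfam is "\<lambda>i q. 1" .
lift_definition plus_resfam :: "resfam \<Rightarrow> resfam \<Rightarrow> resfam" is "\<lambda>f g i q. f i q + g i q" by (simp add: cong_add)
lift_definition uminus_resfam :: "resfam \<Rightarrow> resfam" is "\<lambda>f i q. - f i q" by (simp add: cong_minus_minus_iff)
lift_definition minus_resfam :: "resfam \<Rightarrow> resfam \<Rightarrow> resfam" is "\<lambda>f g i q. f i q - g i q" by (simp add: cong_diff)
lift_definition times_resfam :: "resfam \<Rightarrow> resfam \<Rightarrow> resfam" is "\<lambda>f g i q. f i q * g i q" by (simp add: cong_mult)

instance
proof
  fix a b c :: resfam
  show "a * b * c = a * (b * c)" by transfer (simp add: mult.assoc)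
  show "a * b = b * a" by transfer (simp add: mult.commute)
  show "1 * a = a" by transfer simp
  show "a + b + c = a + (b + c)" by transfer (simp add: add.assoc)
  show "a + b = b + a" by transfer (simp add: add.commute)
  show "0 + a = a" by transfer simp
  show "- a + a = 0" by transfer simp
  show "a - b = a + - b" by transfer simp
  show "(a + b) * c = a * c + b * c" by transfer (simp add: distrib_right)
  show "(0 :: resfam) \<noteq> 1" by transfer (auto simp: Cong.cong_def intro!: exI[of _ 2])
qed

end

section \<open>Lines and planes inside the product ring\<close>

lift_definition emb :: "nat \<Rightarrow> int \<Rightarrow> int \<Rightarrow> resfam" is
  "\<lambda>p a b i q. if q = p then (if i then b else a) else 0" .

text \<open>Adding the two coordinates makes \<open>chr p (emb p m n * emb p h h')\<close> the phase
  \<open>(m h + n h') / p\<close>. Frequencies and group elements thus live in the same ring, as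
  \<open>spectral\<close> requires.\<close>

lift_definition chr :: "nat \<Rightarrow> resfam \<Rightarrow> complex" is
  "\<lambda>p f. ue (of_int (f False p + f True p) / of_nat p)"
  by (intro ue_cong cong_add) auto

lemma emb_add: "emb p a b + emb p c d = emb p (a + c) (b + d)"
  by transfer auto

lemma emb_mult: "emb p a b * emb p c d = emb p (a * c) (b * d)"
  by transfer auto

lemma emb_0: "emb p 0 0 = 0"
  by transfer auto

lemma emb_eq_iff: "emb p a b = emb p c d \<longleftrightarrow> [a = c] (mod int p) \<and> [b = d] (mod int p)"
  by transfer (auto split: if_splits)

lemma chr_add: "chr p (x + y) = chr p x * chr p y"
  by transfer (simp add: add_divide_distrib algebra_simps flip: ue_add)

lemma norm_chr: "norm (chr p x) = 1"
  by transfer simp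

lemma chr_emb: "chr p (emb p a b) = ue (of_int (a + b) / of_nat p)"
  by transfer simp

lemma plane_iff: "emb p 1 1 * x = x \<longleftrightarrow> (\<exists>a b. x = emb p a b)"
proof
  show "\<exists>a b. x = emb p a b" if "emb p 1 1 * x = x"
    using that
  proof (transfer, goal_cases)
    case (1 p f)
    show ?case
    proof (rule exI[of _ "f False p"], rule exI[of _ "f True p"], intro allI)
      fix i q
      show "[f i q = (if q = p then if i then f True p else f False p else 0)] (mod int q)"
        using 1[rule_format, of q i] by (auto simp: cong_sym_eq)
    qed
  qed
qed (auto simp: emb_mult)

lemma axis1_iff: "emb p 1 0 * x = x \<longleftrightarrow> (\<exists>a. x = emb p a 0)"
proof
  assume "emb p 1 0 * x = x"
  moreover have "emb p 1 1 * emb p 1 0 = emb p 1 0" by (simp add: emb_mult)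
  ultimately have "emb p 1 1 * x = x" by (metis mult.assoc)
  then obtain a b where "x = emb p a b" by (auto simp: plane_iff)
  then have "x = emb p a 0" using \<open>emb p 1 0 * x = x\<close> by (simp add: emb_mult)
  then show "\<exists>a. x = emb p a 0" by blast
qed (auto simp: emb_mult)

lemma axis2_iff: "emb p 0 1 * x = x \<longleftrightarrow> (\<exists>b. x = emb p 0 b)"
proof
  assume "emb p 0 1 * x = x"
  moreover have "emb p 1 1 * emb p 0 1 = emb p 0 1" by (simp add: emb_mult)
  ultimately have "emb p 1 1 * x = x" by (metis mult.assoc)
  then obtain a b where "x = emb p a b" by (auto simp: plane_iff)
  then have "x = emb p 0 b" using \<open>emb p 0 1 * x = x\<close> by (simp add: emb_mult)
  then show "\<exists>b. x = emb p 0 b" by blast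
qed (auto simp: emb_mult)

lemma emb_mod: "emb p a b = emb p (a mod int p) (b mod int p)"
  by (simp add: emb_eq_iff)

context
  fixes p :: nat
  assumes p0: "p > 0"
begin

lemma plane_eq: "{x. emb p 1 1 * x = x} = (\<lambda>(a, b). emb p a b) ` ({0..<int p} \<times> {0..<int p})"
  using p0 emb_mod[of p] by (auto simp: plane_iff emb_mult intro!: image_eqI[of _ _ "(_ mod int p, _ mod int p)"])

lemma axis1_eq: "{x. emb p 1 0 * x = x} = (\<lambda>a. emb p a 0) ` {0..<int p}"
  using p0 emb_mod[of p _ 0] by (auto simp: axis1_iff emb_mult intro!: image_eqI[of _ _ "_ mod int p"])

lemma axis2_eq: "{x. emb p 0 1 * x = x} = (\<lambda>b. emb p 0 b) ` {0..<int p}"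
  using p0 emb_mod[of p 0] by (auto simp: axis2_iff emb_mult intro!: image_eqI[of _ _ "_ mod int p"])

lemma inj_emb:
  "inj_on (\<lambda>(a, b). emb p a b) ({0..<int p} \<times> {0..<int p})"
  "inj_on (\<lambda>a. emb p a 0) {0..<int p}" "inj_on (\<lambda>b. emb p 0 b) {0..<int p}"
  by (auto simp: inj_on_def emb_eq_iff intro: eq_if_cong)

lemma card_plane: "card {x. emb p 1 1 * x = x} = p\<^sup>2"
  by (simp add: plane_eq card_image[OF inj_emb(1)] card_cartesian_product power2_eq_square)

lemma card_axis1: "card {x. emb p 1 0 * x = x} = p"
  by (simp add: axis1_eq card_image[OF inj_emb(2)])

lemma card_axis2: "card {x. emb p 0 1 * x = x} = p"
  by (simp add: axis2_eq card_image[OF inj_emb(3)])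

lemma chr_orth_plane:
  assumes "emb p 1 1 * x = x" "x \<noteq> 0"
  shows "(\<Sum>\<xi>\<in>{x. emb p 1 1 * x = x}. chr p (\<xi> * x)) = 0"
proof -
  obtain a b where x: "x = emb p a b" using assms by (auto simp: plane_iff)
  have ab: "\<not> int p dvd a \<or> \<not> int p dvd b"
    using assms(2) by (auto simp: x emb_0[of p, symmetric] emb_eq_iff cong_0_iff)
  have "(\<Sum>\<xi>\<in>{x. emb p 1 1 * x = x}. chr p (\<xi> * x)) =
      (\<Sum>(u, v)\<in>{0..<int p} \<times> {0..<int p}. chr p (emb p u v * x))"
    unfolding plane_eq by (subst sum.reindex[OF inj_emb(1)]) (simp add: case_prod_beta)
  also have "\<dots> = (\<Sum>(u, v)\<in>{0..<int p} \<times> {0..<int p}. ue (of_int (u * a) / of_nat p) * ue (of_int (v * b) / of_nat p))"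
    by (simp add: x emb_mult chr_emb add_divide_distrib flip: ue_add)
  also have "\<dots> = (\<Sum>u\<in>{0..<int p}. ue (of_int (u * a) / of_nat p)) * (\<Sum>v\<in>{0..<int p}. ue (of_int (v * b) / of_nat p))"
    by (simp add: sum_product sum.cartesian_product)
  also have "\<dots> = 0" using ab by (auto simp only: sum_ue[OF p0] if_False mult_zero_left mult_zero_right)
  finally show ?thesis .
qed

lemma chr_orth_axis:
  assumes "emb p 1 0 * x = x" "x \<noteq> 0"
  shows "(\<Sum>\<xi>\<in>{x. emb p 1 0 * x = x}. chr p (\<xi> * x)) = 0"
proof -
  obtain a where x: "x = emb p a 0" using assms by (auto simp: axis1_iff)
  have a: "\<not> int p dvd a" using assms(2) by (auto simp: x emb_0[of p, symmetric] emb_eq_iff cong_0_iff)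
  have "(\<Sum>\<xi>\<in>{x. emb p 1 0 * x = x}. chr p (\<xi> * x)) = (\<Sum>u\<in>{0..<int p}. chr p (emb p u 0 * x))"
    unfolding axis1_eq by (subst sum.reindex[OF inj_emb(2)]) simp
  also have "\<dots> = (\<Sum>u\<in>{0..<int p}. ue (of_int (u * a) / of_nat p))" by (simp add: x emb_mult chr_emb)
  also have "\<dots> = 0" using a by (simp only: sum_ue[OF p0] if_False)
  finally show ?thesis .
qed

lemma spectral_axis:
  assumes H: "modgrp p H"
  shows "spectral (emb p 1 0) (chr p) ((\<lambda>h. emb p h 0) ` H)"
proof
  show "emb p 1 0 * emb p 1 0 = emb p 1 0" by (simp add: emb_mult)
  show "finite {x. emb p 1 0 * x = x}" by (simp add: axis1_eq)
  show "(\<Sum>\<xi>\<in>{x. emb p 1 0 * x = x}. chr p (\<xi> * x)) = 0" if "emb p 1 0 * x = x" "x \<noteq> 0" for x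
    using chr_orth_axis that .
  show "emb p 1 0 \<in> (\<lambda>h. emb p h 0) ` H"
    using modgrp_one[OF H] emb_mod[of p 1 0] by (intro image_eqI[of _ _ "1 mod int p"]) auto
  show "g * h \<in> (\<lambda>h. emb p h 0) ` H" if gh: "g \<in> (\<lambda>h. emb p h 0) ` H" "h \<in> (\<lambda>h. emb p h 0) ` H" for g h
  proof -
    obtain x y where xy: "x \<in> H" "y \<in> H" "g = emb p x 0" "h = emb p y 0" using gh by auto
    then have "g * h = emb p (x * y mod int p) 0" by (simp add: emb_mult emb_eq_iff)
    then show ?thesis using modgrp_mult[OF H xy(1,2)] by auto
  qed
  show "\<exists>h\<in>(\<lambda>h. emb p h 0) ` H. g * h = emb p 1 0" if g: "g \<in> (\<lambda>h. emb p h 0) ` H" for g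
  proof -
    obtain x where x: "x \<in> H" "g = emb p x 0" using g by auto
    then have "g * emb p (minv p x) 0 = emb p 1 0" using modgrp_minv_cong[OF H x(1)] by (simp add: emb_mult emb_eq_iff)
    then show ?thesis using modgrp_minv[OF H x(1)] by auto
  qed
qed (auto simp: chr_add norm_chr emb_mult)

lemma spectral_plane:
  assumes H: "modgrp p H"
  shows "spectral (emb p 1 1) (chr p) ((\<lambda>h. emb p h (minv p h)) ` H)"
proof
  show "emb p 1 1 * emb p 1 1 = emb p 1 1" by (simp add: emb_mult)
  show "finite {x. emb p 1 1 * x = x}" by (simp add: plane_eq)
  show "(\<Sum>\<xi>\<in>{x. emb p 1 1 * x = x}. chr p (\<xi> * x)) = 0" if "emb p 1 1 * x = x" "x \<noteq> 0" for x
    using chr_orth_plane that .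
  have "[1 mod int p * 1 = 1] (mod int p)" by simp
  from minv_unique[OF this] have "[minv p (1 mod int p) = 1] (mod int p)" .
  then have "emb p 1 1 = emb p (1 mod int p) (minv p (1 mod int p))" by (simp add: emb_eq_iff cong_sym_eq)
  then show "emb p 1 1 \<in> (\<lambda>h. emb p h (minv p h)) ` H" using modgrp_one[OF H] by blast
  show "g * h \<in> (\<lambda>h. emb p h (minv p h)) ` H"
    if gh: "g \<in> (\<lambda>h. emb p h (minv p h)) ` H" "h \<in> (\<lambda>h. emb p h (minv p h)) ` H" for g h
  proof -
    obtain x y where xy: "x \<in> H" "y \<in> H" "g = emb p x (minv p x)" "h = emb p y (minv p y)" using gh by auto
    have "[minv p (x * y) = minv p x * minv p y] (mod int p)" using modgrp_coprime[OF H] xy by (intro minv_mult)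
    moreover have "[minv p (x * y) = minv p (x * y mod int p)] (mod int p)"
      using modgrp_coprime[OF H] xy by (intro minv_cong_arg) auto
    ultimately have "g * h = emb p (x * y mod int p) (minv p (x * y mod int p))"
      using xy by (simp add: emb_mult emb_eq_iff) (meson cong_sym cong_trans)
    then show ?thesis using modgrp_mult[OF H xy(1,2)] by auto
  qed
  show "\<exists>h\<in>(\<lambda>h. emb p h (minv p h)) ` H. g * h = emb p 1 1" if g: "g \<in> (\<lambda>h. emb p h (minv p h)) ` H" for g
  proof -
    obtain x where x: "x \<in> H" "g = emb p x (minv p x)" using g by auto
    have y: "minv p x \<in> H" using modgrp_minv[OF H x(1)] .
    have "g * emb p (minv p x) (minv p (minv p x)) = emb p 1 1"
      using modgrp_minv_cong[OF H x(1)] modgrp_minv_cong[OF H y] by (simp add: x(2) emb_mult emb_eq_iff)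
    then show ?thesis using y by auto
  qed
qed (auto simp: chr_add norm_chr emb_mult)

lemma inj_emb_grp:
  assumes H: "modgrp p H"
  shows "inj_on (\<lambda>h. emb p h 0) H" "inj_on (\<lambda>h. emb p h (minv p h)) H"
proof -
  show "inj_on (\<lambda>h. emb p h 0) H" "inj_on (\<lambda>h. emb p h (minv p h)) H"
    using modgrp_range[OF H] eq_if_cong by (auto simp: inj_on_def emb_eq_iff)
qed

end

lemma gen_axis1:
  assumes "Q \<subseteq> {x. emb p 1 0 * x = x}" "0 \<in> Q" "\<And>x. x \<in> Q \<Longrightarrow> x + emb p 1 0 \<in> Q" "p > 0"
  shows "Q = {x. emb p 1 0 * x = x}"
proof -
  have k: "emb p (int k) 0 \<in> Q" for k
  proof (induction k)
    case (Suc k)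
    from assms(3)[OF Suc.IH] show ?case by (simp add: emb_add add.commute)
  qed (simp add: emb_0 assms(2))
  have "emb p a 0 \<in> Q" for a
    using k[of "nat (a mod int p)"] assms(4) emb_mod[of p a 0] by simp
  then show ?thesis using assms(1) by (auto simp: axis1_iff)
qed

lemma gen_axis2:
  assumes "Q \<subseteq> {x. emb p 0 1 * x = x}" "0 \<in> Q" "\<And>x. x \<in> Q \<Longrightarrow> x + emb p 0 1 \<in> Q" "p > 0"
  shows "Q = {x. emb p 0 1 * x = x}"
proof -
  have k: "emb p 0 (int k) \<in> Q" for k
  proof (induction k)
    case (Suc k)
    from assms(3)[OF Suc.IH] show ?case by (simp add: emb_add add.commute)
  qed (simp add: emb_0 assms(2))
  have "emb p 0 a \<in> Q" for a
    using k[of "nat (a mod int p)"] assms(4) emb_mod[of p 0 a] by simp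
  then show ?thesis using assms(1) by (auto simp: axis2_iff)
qed

lemma prime_inverse:
  assumes "prime p" "\<not> int p dvd a" obtains b where "[a * b = 1] (mod int p)"
proof -
  have "coprime a (int p)"
    using assms by (metis coprime_commute prime_imp_coprime prime_int_nat_transfer prime_nat_int_transfer)
  then show ?thesis using that minv_cong by blast
qed

text \<open>\<open>Q\<close> contains \<open>k t + l\<close> for all natural \<open>k\<close> and
  \<open>l\<close>. The system \<open>t1 k + l = a\<close>, \<open>t2 k + l = b\<close> is solvable
  modulo \<open>p\<close> because its determinant \<open>t1 - t2\<close> is invertible.\<close>

lemma gen_plane:
  assumes Q: "Q \<subseteq> {x. emb p 1 1 * x = x}" "0 \<in> Q" "\<And>x. x \<in> Q \<Longrightarrow> x + emb p 1 1 \<in> Q"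
    "\<And>x. x \<in> Q \<Longrightarrow> emb p t1 t2 * x \<in> Q" and p: "prime p" and t: "\<not> [t1 = t2] (mod int p)"
  shows "Q = {x. emb p 1 1 * x = x}"
proof -
  have p0: "p > 0" using p by (simp add: prime_gt_0_nat)
  have step: "emb p (a + int k) (b + int k) \<in> Q" if "emb p a b \<in> Q" for a b k
  proof (induction k)
    case (Suc k)
    from Q(3)[OF Suc.IH] show ?case by (simp add: emb_add algebra_simps)
  qed (use that in simp)
  have kl: "emb p (t1 * int k + int l) (t2 * int k + int l) \<in> Q" for k l
  proof -
    have "emb p (int k) (int k) \<in> Q" using step[of 0 0 k] Q(2) emb_0[of p] by simp
    from Q(4)[OF this] show ?thesis using step by (simp add: emb_mult)
  qed
  have "\<not> int p dvd t1 - t2" using t by (simp add: cong_iff_dvd_diff)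
  then obtain s where s: "[(t1 - t2) * s = 1] (mod int p)" using prime_inverse[OF p] by blast
  have "emb p a b \<in> Q" for a b
  proof -
    define k where "k = nat ((a - b) * s mod int p)"
    define l where "l = nat ((a - t1 * int k) mod int p)"
    have k: "[int k = (a - b) * s] (mod int p)" using p0 by (simp add: k_def)
    have l: "[int l = a - t1 * int k] (mod int p)" using p0 by (simp add: l_def)
    have 1: "[t1 * int k + int l = t1 * int k + (a - t1 * int k)] (mod int p)" using l by (intro cong_add) auto
    have "[(t1 - t2) * int k = (t1 - t2) * ((a - b) * s)] (mod int p)" using k by (rule cong_scalar_left)
    moreover have "[(a - b) * ((t1 - t2) * s) = (a - b) * 1] (mod int p)" using s by (rule cong_scalar_left)
    ultimately have d: "[(t1 - t2) * int k = a - b] (mod int p)" by (simp add: mult_ac) (meson cong_trans)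
    have "[t1 * int k + int l - (t1 - t2) * int k = a - (a - b)] (mod int p)"
      using 1 d by (intro cong_diff) auto
    then have 2: "[t2 * int k + int l = b] (mod int p)" by (simp add: algebra_simps)
    have "emb p a b = emb p (t1 * int k + int l) (t2 * int k + int l)"
      using 1 2 by (simp add: emb_eq_iff cong_sym_eq)
    then show ?thesis using kl by simp
  qed
  then show ?thesis using Q(1) by (auto simp: plane_iff)
qed

lemma fld_axis1:
  assumes "prime p" "emb p 1 0 * x = x" "x \<noteq> 0" shows "\<exists>w. x * w = emb p 1 0"
proof -
  obtain a where x: "x = emb p a 0" using assms(2) by (auto simp: axis1_iff)
  then have "\<not> int p dvd a" using assms(3) by (auto simp: emb_0[of p, symmetric] emb_eq_iff cong_0_iff)
  then obtain b where "[a * b = 1] (mod int p)" using prime_inverse[OF assms(1)] by blast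
  then have "x * emb p b 0 = emb p 1 0" by (simp add: x emb_mult emb_eq_iff)
  then show ?thesis by blast
qed

lemma fld_axis2:
  assumes "prime p" "emb p 0 1 * x = x" "x \<noteq> 0" shows "\<exists>w. x * w = emb p 0 1"
proof -
  obtain a where x: "x = emb p 0 a" using assms(2) by (auto simp: axis2_iff)
  then have "\<not> int p dvd a" using assms(3) by (auto simp: emb_0[of p, symmetric] emb_eq_iff cong_0_iff)
  then obtain b where "[a * b = 1] (mod int p)" using prime_inverse[OF assms(1)] by blast
  then have "x * emb p 0 b = emb p 0 1" by (simp add: x emb_mult emb_eq_iff)
  then show ?thesis by blast
qed

lemma ft_axis:
  assumes H: "modgrp p H" and p0: "p > 0"
  shows "spectral.ft (chr p) ((\<lambda>h. emb p h 0) ` H) (emb p m 0) =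
    norm (\<Sum>h\<in>H. ue (of_int (m * h) / of_nat p)) / card H"
proof -
  interpret spectral "emb p 1 0" "chr p" "(\<lambda>h. emb p h 0) ` H" by (rule spectral_axis[OF p0 H])
  show ?thesis
    unfolding ft_def by (simp add: sum.reindex[OF inj_emb_grp(1)[OF p0 H]] card_image[OF inj_emb_grp(1)[OF p0 H]] emb_mult chr_emb)
qed

lemma ft_plane:
  assumes H: "modgrp p H" and p0: "p > 0"
  shows "spectral.ft (chr p) ((\<lambda>h. emb p h (minv p h)) ` H) (emb p m n) =
    norm (\<Sum>h\<in>H. ue (of_int (m * h + n * minv p h) / of_nat p)) / card H"
proof -
  interpret spectral "emb p 1 1" "chr p" "(\<lambda>h. emb p h (minv p h)) ` H" by (rule spectral_plane[OF p0 H])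
  show ?thesis
    unfolding ft_def by (simp add: sum.reindex[OF inj_emb_grp(2)[OF p0 H]] card_image[OF inj_emb_grp(2)[OF p0 H]] emb_mult chr_emb)
qed

text \<open>A coefficient of size \<open>\<eta>\<close> would put \<open>m\<close> into the spectrum
  and trigger \<open>line_bound\<close>, whose conclusion contradicts the last inequality of
  \<open>growth_parameters\<close> for large \<open>p\<close>.\<close>

lemma prime_line_sum_small:
  fixes \<delta> c0 \<eta> :: real
  assumes \<delta>: "\<delta> > 0" and c0: "c0 > 0" and \<eta>: "0 < \<eta>" "\<eta> \<le> 1"
  obtains P :: nat where "\<forall>p\<ge>P. \<forall>H m. prime p \<longrightarrow> modgrp p H \<longrightarrow> c0 * real p powr \<delta> \<le> card H \<longrightarrow>
    \<not> int p dvd m \<longrightarrow> norm (\<Sum>h\<in>H. ue (of_int (m * h) / of_nat p)) < \<eta> * card H"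
proof -
  define i where "i = nat \<lceil>4 / \<delta>\<rceil> + 1"
  define N where "N = 3 * (gk_order ^^ i) 1 + 1"
  define \<epsilon> where "\<epsilon> = \<delta> / (8 * N)"
  define J where "J = nat \<lceil>2 / \<epsilon>\<rceil> + 1"
  define c where "c = spec_level \<eta> J"
  have "N \<ge> 1" by (simp add: N_def)
  from growth_parameters[OF \<delta> c0 \<eta> this]
  obtain P :: nat where P: "P \<ge> 2" "\<forall>p\<ge>P. \<forall>g. c0 * real p powr \<delta> \<le> g \<longrightarrow>
      1 \<le> real p powr \<epsilon> \<and> real p ^ 2 < (real p powr \<epsilon>) ^ J \<and>
      1 \<le> nat \<lceil>real p powr (\<delta> / 4)\<rceil> \<and> p < nat \<lceil>real p powr (\<delta> / 4)\<rceil> ^ i \<and>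
      16 * real (nat \<lceil>real p powr (\<delta> / 4)\<rceil>) \<le> c * g \<and> 128 * (real (nat \<lceil>real p powr (\<delta> / 4)\<rceil>))\<^sup>2 \<le> c * g \<and>
      32 * (32768 * (real p powr \<epsilon>) ^ 4 / c ^ 7) ^ N < c ^ 3 * g"
    unfolding \<epsilon>_def[symmetric] J_def[symmetric] i_def[symmetric] c_def[symmetric] by blast
  have c01: "0 < c" "c \<le> 1" unfolding c_def by (rule spec_level_bounds[OF \<eta>])+
  have "norm (\<Sum>h\<in>H. ue (of_int (m * h) / of_nat p)) < \<eta> * card H"
    if p: "p \<ge> P" "prime p" and H: "modgrp p H" "c0 * real p powr \<delta> \<le> card H" and m: "\<not> int p dvd m" for p H m
  proof (rule ccontr)
    assume big: "\<not> ?thesis"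
    have p0: "p > 0" using p(2) by (rule prime_gt_0_nat)
    interpret spectral "emb p 1 0" "chr p" "(\<lambda>h. emb p h 0) ` H" by (rule spectral_axis[OF p0 H(1)])
    have cG: "card ((\<lambda>h. emb p h 0) ` H) = card H" by (rule card_image[OF inj_emb_grp(1)[OF p0 H(1)]])
    have cH: "card H > 0" by (rule modgrp_card[OF H(1)])
    have \<xi>: "emb p m 0 \<in> spec \<eta>" using big cH
      by (simp add: spec_def ft_axis[OF H(1) p0] emb_mult field_simps)
    have \<xi>0: "emb p m 0 \<noteq> 0" using m by (auto simp: emb_0[of p, symmetric] emb_eq_iff cong_0_iff)
    define M where "M = nat \<lceil>real p powr (\<delta> / 4)\<rceil>"
    note par = P(2)[rule_format, OF p(1) H(2), folded M_def]
    have "real p * 1 \<le> real p * real p" using p0 by (intro mult_left_mono) auto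
    then have KJ: "real (card {x. emb p 1 0 * x = x}) < (real p powr \<epsilon>) ^ J"
      using par by (simp add: card_axis1[OF p0] power2_eq_square)
    have fld: "\<And>x. emb p 1 0 * x = x \<Longrightarrow> x \<noteq> 0 \<Longrightarrow> \<exists>w. x * w = emb p 1 0" using fld_axis1[OF p(2)] .
    have gen: "\<And>Q. Q \<subseteq> {x. emb p 1 0 * x = x} \<Longrightarrow> 0 \<in> Q \<Longrightarrow> (\<And>x. x \<in> Q \<Longrightarrow> x + emb p 1 0 \<in> Q) \<Longrightarrow>
        Q = {x. emb p 1 0 * x = x}" using gen_axis1 p0 by blast
    have "c * card H \<le> 8 * (32768 * (real p powr \<epsilon>) ^ 4 / c ^ 7) ^ N"
      unfolding N_def cG[symmetric]
    proof (rule line_bound[OF fld gen \<xi> \<xi>0 \<eta> _ KJ c_def])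
      show "M \<ge> 1" "1 \<le> real p powr \<epsilon>" "16 * real M \<le> c * card ((\<lambda>h. emb p h 0) ` H)"
        "card {x. emb p 1 0 * x = x} < M ^ i"
        using par by (simp_all add: cG card_axis1[OF p0])
    qed
    moreover have "c ^ 3 * card H \<le> c ^ 1 * card H" using c01 by (intro mult_right_mono power_decreasing) auto
    moreover have "0 \<le> (32768 * (real p powr \<epsilon>) ^ 4 / c ^ 7) ^ N" using c01 by simp
    ultimately show False using par by simp
  qed
  then show ?thesis using that by blast
qed

text \<open>The line estimate is applied at the level \<open>c\<close> instead of
  \<open>\<eta>\<close>, so that axis frequencies are absent from every spectrum that occurs in
  \<open>plane_bound\<close>. This is legitimate because \<open>c\<close> depends on
  \<open>\<eta>\<close> and \<open>\<delta>\<close> only.\<close>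

lemma prime_plane_sum_small:
  fixes \<delta> c0 \<eta> :: real
  assumes \<delta>: "\<delta> > 0" and c0: "c0 > 0" and \<eta>: "0 < \<eta>" "\<eta> \<le> 1"
  obtains P :: nat where "\<forall>p\<ge>P. \<forall>H m n. prime p \<longrightarrow> modgrp p H \<longrightarrow> c0 * real p powr \<delta> \<le> card H \<longrightarrow>
    \<not> int p dvd m \<longrightarrow> \<not> int p dvd n \<longrightarrow> norm (\<Sum>h\<in>H. ue (of_int (m * h + n * minv p h) / of_nat p)) < \<eta> * card H"
proof -
  define i where "i = nat \<lceil>4 / \<delta>\<rceil> + 1"
  define N where "N = 3 * (2 * (gk_order ^^ i) (2 * (gk_order ^^ i) 1)) + 1"
  define \<epsilon> where "\<epsilon> = \<delta> / (8 * N)"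
  define J where "J = nat \<lceil>2 / \<epsilon>\<rceil> + 1"
  define c where "c = spec_level \<eta> J"
  have "N \<ge> 1" by (simp add: N_def)
  from growth_parameters[OF \<delta> c0 \<eta> this]
  obtain P1 :: nat where P1: "P1 \<ge> 2" "\<forall>p\<ge>P1. \<forall>g. c0 * real p powr \<delta> \<le> g \<longrightarrow>
      1 \<le> real p powr \<epsilon> \<and> real p ^ 2 < (real p powr \<epsilon>) ^ J \<and>
      1 \<le> nat \<lceil>real p powr (\<delta> / 4)\<rceil> \<and> p < nat \<lceil>real p powr (\<delta> / 4)\<rceil> ^ i \<and>
      16 * real (nat \<lceil>real p powr (\<delta> / 4)\<rceil>) \<le> c * g \<and> 128 * (real (nat \<lceil>real p powr (\<delta> / 4)\<rceil>))\<^sup>2 \<le> c * g \<and>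
      32 * (32768 * (real p powr \<epsilon>) ^ 4 / c ^ 7) ^ N < c ^ 3 * g"
    unfolding \<epsilon>_def[symmetric] J_def[symmetric] i_def[symmetric] c_def[symmetric] by blast
  have c01: "0 < c" "c \<le> 1" unfolding c_def by (rule spec_level_bounds[OF \<eta>])+
  obtain P2 :: nat where P2: "\<forall>p\<ge>P2. \<forall>H m. prime p \<longrightarrow> modgrp p H \<longrightarrow> c0 * real p powr \<delta> \<le> card H \<longrightarrow>
    \<not> int p dvd m \<longrightarrow> norm (\<Sum>h\<in>H. ue (of_int (m * h) / of_nat p)) < c * card H"
    by (rule prime_line_sum_small[OF \<delta> c0 c01])
  have "norm (\<Sum>h\<in>H. ue (of_int (m * h + n * minv p h) / of_nat p)) < \<eta> * card H"
    if p: "p \<ge> max P1 P2" "prime p" and H: "modgrp p H" "c0 * real p powr \<delta> \<le> card H"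
      and m: "\<not> int p dvd m" and n: "\<not> int p dvd n" for p H m n
  proof (rule ccontr)
    assume big: "\<not> ?thesis"
    have p0: "p > 0" using p(2) by (rule prime_gt_0_nat)
    define G where "G = (\<lambda>h. emb p h (minv p h)) ` H"
    interpret spectral "emb p 1 1" "chr p" G unfolding G_def by (rule spectral_plane[OF p0 H(1)])
    have cG: "card G = card H" unfolding G_def by (rule card_image[OF inj_emb_grp(2)[OF p0 H(1)]])
    have cH: "card H > 0" by (rule modgrp_card[OF H(1)])
    have ftH: "ft (emb p a b) = norm (\<Sum>h\<in>H. ue (of_int (a * h + b * minv p h) / of_nat p)) / card H" for a b
      unfolding G_def by (rule ft_plane[OF H(1) p0])
    have \<xi>: "emb p m n \<in> spec \<eta>" using big cH
      by (simp add: spec_def ftH emb_mult field_simps)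
    have cop: "coprime m (int p)"
      using m p(2) by (metis coprime_commute prime_imp_coprime prime_int_nat_transfer prime_nat_int_transfer)
    have inj\<xi>: "inj_on (\<lambda>g. g * emb p m n) G"
    proof (rule inj_onI)
      fix g g' assume g: "g \<in> G" "g' \<in> G" "g * emb p m n = g' * emb p m n"
      obtain h h' where h: "h \<in> H" "g = emb p h (minv p h)" "h' \<in> H" "g' = emb p h' (minv p h')"
        using g by (auto simp: G_def)
      have "[h * m = h' * m] (mod int p)" using g(3) by (simp add: h emb_mult emb_eq_iff)
      then have "[h = h'] (mod int p)" using cong_mult_rcancel[OF cop] by blast
      then have "h = h'" using modgrp_range[OF H(1)] h eq_if_cong by blast
      then show "g = g'" using h by simp
    qed
    \<comment> \<open>\<open>h\<close> agrees with its inverse modulo a prime only for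
      \<open>h = 1\<close> and \<open>h = -1\<close>; for all other elements the two coordinates
      differ and \<open>gen_plane\<close> applies.\<close>
    define E where "E = {emb p 1 1, emb p (-1) (-1)}"
    have E: "finite E" "card E \<le> 2" by (auto simp: E_def card_insert_if)
    have gen: "Q = {x. emb p 1 1 * x = x}" if t: "t \<in> G" "t \<notin> E" and Q: "Q \<subseteq> {x. emb p 1 1 * x = x}" "0 \<in> Q"
      "\<And>x. x \<in> Q \<Longrightarrow> x + emb p 1 1 \<in> Q" "\<And>x. x \<in> Q \<Longrightarrow> t * x \<in> Q" for t Q
    proof -
      obtain h where h: "h \<in> H" "t = emb p h (minv p h)" using t(1) by (auto simp: G_def)
      have "\<not> [h = minv p h] (mod int p)"
      proof
        assume eq: "[h = minv p h] (mod int p)"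
        have "[h * h = h * minv p h] (mod int p)" using eq by (rule cong_scalar_left)
        then have "[h * h = 1] (mod int p)" using modgrp_minv_cong[OF H(1) h(1)] cong_trans by blast
        then have "int p dvd (h - 1) * (h + 1)" by (simp add: cong_iff_dvd_diff algebra_simps)
        then have "int p dvd h - 1 \<or> int p dvd h + 1" using p(2) by (simp add: prime_dvd_mult_iff)
        then have "[h = 1] (mod int p) \<or> [h = -1] (mod int p)" by (auto simp: cong_iff_dvd_diff)
        then have "t = emb p 1 1 \<or> t = emb p (-1) (-1)"
          using eq unfolding h(2) emb_eq_iff by (meson cong_sym cong_trans)
        then show False using t(2) by (simp add: E_def)
      qed
      from gen_plane[OF Q(1-3) _ p(2) this] show ?thesis using Q(4) by (simp add: h(2))
    qed
    have inj: "inj2 (emb p 1 0) (emb p 0 1) G"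
      unfolding inj2_def
    proof (intro conjI inj_onI)
      fix g g' assume g: "g \<in> G" "g' \<in> G"
      obtain h h' where h: "h \<in> H" "g = emb p h (minv p h)" "h' \<in> H" "g' = emb p h' (minv p h')"
        using g by (auto simp: G_def)
      show "g = g'" if "emb p 1 0 * g = emb p 1 0 * g'"
      proof -
        have "[h = h'] (mod int p)" using that by (simp add: h emb_mult emb_eq_iff)
        then have "h = h'" using modgrp_range[OF H(1)] h eq_if_cong by blast
        then show ?thesis using h by simp
      qed
      show "g = g'" if "emb p 0 1 * g = emb p 0 1 * g'"
      proof -
        have "[minv p h = minv p h'] (mod int p)" using that by (simp add: h emb_mult emb_eq_iff)
        then have "minv p h = minv p h'" using modgrp_range[OF H(1)] modgrp_minv[OF H(1)] h eq_if_cong by blast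
        then have "h = h'" using modgrp_minv_bij[OF H(1)] h by (auto simp: bij_betw_def inj_on_def)
        then show ?thesis using h by simp
      qed
    qed
    have lines: "ft \<xi> < c" if x: "emb p 1 1 * \<xi> = \<xi>" "\<xi> \<noteq> 0" "emb p 1 0 * \<xi> = 0 \<or> emb p 0 1 * \<xi> = 0" for \<xi>
    proof -
      obtain a b where ab: "\<xi> = emb p a b" using x(1) by (auto simp: plane_iff)
      have small: "norm (\<Sum>h\<in>H. ue (of_int (a * h) / of_nat p)) < c * card H" if "\<not> int p dvd a" for a
        using P2 p H that by auto
      have "int p dvd a \<or> int p dvd b" using x(3) by (auto simp: ab emb_mult emb_0[of p, symmetric] emb_eq_iff cong_0_iff)
      moreover have "\<not> (int p dvd a \<and> int p dvd b)" using x(2) by (auto simp: ab emb_0[of p, symmetric] emb_eq_iff cong_0_iff)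
      ultimately consider "int p dvd a" "\<not> int p dvd b" | "int p dvd b" "\<not> int p dvd a" by blast
      then have "norm (\<Sum>h\<in>H. ue (of_int (a * h + b * minv p h) / of_nat p)) < c * card H"
      proof cases
        case 1
        have "(\<Sum>h\<in>H. ue (of_int (a * h + b * minv p h) / of_nat p)) = (\<Sum>h\<in>H. ue (of_int (b * minv p h) / of_nat p))"
          using 1(1) by (intro sum.cong refl ue_cong) (simp add: cong_iff_dvd_diff)
        also have "\<dots> = (\<Sum>h\<in>H. ue (of_int (b * h) / of_nat p))"
          by (rule sum.reindex_bij_betw[OF modgrp_minv_bij[OF H(1)]])
        finally show ?thesis using small[OF 1(2)] by (simp only:)
      next
        case 2
        have "(\<Sum>h\<in>H. ue (of_int (a * h + b * minv p h) / of_nat p)) = (\<Sum>h\<in>H. ue (of_int (a * h) / of_nat p))"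
          using 2(1) by (intro sum.cong refl ue_cong) (simp add: cong_iff_dvd_diff)
        then show ?thesis using small[OF 2(2)] by (simp only:)
      qed
      then show ?thesis using cH by (simp add: ab ftH field_simps)
    qed
    define M where "M = nat \<lceil>real p powr (\<delta> / 4)\<rceil>"
    have "p \<ge> P1" using p(1) by simp
    note par = P1(2)[rule_format, OF this H(2), folded M_def]
    have KJ: "real (card {x. emb p 1 1 * x = x}) < (real p powr \<epsilon>) ^ J"
      using par by (simp add: card_plane[OF p0])
    have "c ^ 3 * card G \<le> 32 * (32768 * (real p powr \<epsilon>) ^ 4 / c ^ 7) ^ N"
      unfolding N_def
    proof (rule plane_bound[OF _ _ _ _ card_axis1[OF p0] card_axis2[OF p0] card_plane[OF p0] fld_axis1[OF p(2)]
          fld_axis2[OF p(2)] _ _ gen E inj \<xi> inj\<xi> \<eta> _ KJ c_def lines])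
      show "Q = {x. emb p 1 0 * x = x}" if "Q \<subseteq> {x. emb p 1 0 * x = x}" "0 \<in> Q" "\<And>x. x \<in> Q \<Longrightarrow> x + emb p 1 0 \<in> Q" for Q
        using gen_axis1[OF that p0] .
      show "Q = {x. emb p 0 1 * x = x}" if "Q \<subseteq> {x. emb p 0 1 * x = x}" "0 \<in> Q" "\<And>x. x \<in> Q \<Longrightarrow> x + emb p 0 1 \<in> Q" for Q
        using gen_axis2[OF that p0] .
      show "M \<ge> 1" "1 \<le> real p powr \<epsilon>" "128 * (real M)\<^sup>2 \<le> c * card G" "p < M ^ i"
        using par by (simp_all add: cG)
    qed (simp_all add: emb_add emb_mult emb_0)
    then show False using par by (simp add: cG)
  qed
  then show ?thesis using that by blast
qed

section \<open>Trigonometric polynomials on the torus\<close>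

lift_definition circle_ue :: "circle \<Rightarrow> complex" is ue
proof -
  fix x y :: real assume "x - y \<in> \<int>"
  then have "ue (x - y) = 1" by (simp add: ue_eq_1_iff)
  then show "ue x = ue y" using ue_add[of "x - y" y] by simp
qed

lemma circle_ue_to_circle: "circle_ue (to_circle x) = ue x"
  by transfer simp

lemma to_circle_surj: obtains x where "s = to_circle x"
  by (transfer) auto

lemma inj_circle_ue: "inj circle_ue"
proof (rule injI)
  fix s t assume st: "circle_ue s = circle_ue t"
  obtain x where x: "s = to_circle x" by (rule to_circle_surj)
  obtain y where y: "t = to_circle y" by (rule to_circle_surj)
  have "ue (x - y) = ue x * cnj (ue y)" by (simp add: cnj_ue flip: ue_add)
  also have "\<dots> = 1" using st by (simp add: x y circle_ue_to_circle complex_norm_square[symmetric])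
  finally show "s = t" by (simp add: ue_eq_1_iff x y to_circle_eq_iff)
qed

lemma norm_circle_ue [simp]: "norm (circle_ue s) = 1"
  by transfer simp

lemma circle_ue_nonzero [simp]: "circle_ue s \<noteq> 0"
  using norm_circle_ue[of s] by (metis norm_zero zero_neq_one)

lemma continuous_on_ue: "continuous_on A ue"
  unfolding ue_def by (intro continuous_intros)

lemma continuous_on_circle_ue: "continuous_on A circle_ue"
proof (rule continuous_on_subset[OF _ subset_UNIV])
  have "open (circle_ue -` U)" if "open U" for U
  proof -
    have "to_circle -` (circle_ue -` U) = ue -` U" by (auto simp: circle_ue_to_circle)
    moreover have "open (ue -` U)" using continuous_on_ue[of UNIV] that by (simp add: continuous_on_open_vimage)
    ultimately show ?thesis by (simp add: open_circle_def)
  qed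
  then show "continuous_on UNIV circle_ue" by (simp add: continuous_on_open_vimage)
qed

text \<open>An embedding of the torus into a Euclidean space, where the Stone-Weierstrass theorem
  for polynomial functions applies to the compact image.\<close>

definition torus_ue :: "torus \<Rightarrow> complex \<times> complex" where
  "torus_ue x = (circle_ue (fst x), circle_ue (snd x))"

lemma continuous_on_torus_ue: "continuous_on A torus_ue"
  unfolding torus_ue_def
  by (intro continuous_on_Pair continuous_on_compose2[OF continuous_on_circle_ue[of UNIV]] continuous_intros) auto

lemma inj_torus_ue: "inj torus_ue"
  using inj_circle_ue by (auto simp: torus_ue_def inj_def prod_eq_iff)

lemma to_torus_surj: obtains x y where "s = to_torus (x, y)"
  by (metis surj_pair to_circle_surj to_torus_def case_prod_conv)

lemma compact_torus: "compact (UNIV :: torus set)"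
proof -
  have "UNIV \<subseteq> to_torus ` ({0..1} \<times> {0..1})"
  proof
    fix s :: torus
    obtain x y where s: "s = to_torus (x, y)" by (rule to_torus_surj)
    have "to_torus (x, y) = to_torus (frac x, frac y)"
      by (simp add: to_torus_def to_circle_eq_iff frac_def)
    moreover have "(frac x, frac y) \<in> {0..1} \<times> {0..1}" using frac_lt_1[of x] frac_lt_1[of y] by (simp add: less_imp_le)
    ultimately show "s \<in> to_torus ` ({0..1} \<times> {0..1})" using s by blast
  qed
  then have "to_torus ` ({0..1} \<times> {0..1}) = UNIV" by blast
  moreover have "compact (to_torus ` ({0..1} \<times> {0..1}))"
    by (intro compact_continuous_image continuous_on_to_torus compact_Times) auto
  ultimately show ?thesis by simp
qed

definition tchar :: "int \<Rightarrow> int \<Rightarrow> torus \<Rightarrow> complex" where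
  "tchar m n x = circle_ue (fst x) powi m * circle_ue (snd x) powi n"

lemma ue_powi: "ue x powi m = ue (of_int m * x)"
proof -
  have "ue x * ue (- x) = 1" by (simp flip: ue_add)
  then have "inverse (ue x) = ue (- x)" by (rule inverse_unique)
  then show ?thesis by (simp add: power_int_def ue_power)
qed

lemma tchar_to_torus: "tchar m n (to_torus (x, y)) = ue (of_int m * x + of_int n * y)"
  by (simp add: tchar_def to_torus_def circle_ue_to_circle ue_powi ue_add)

lemma tchar_mult: "tchar m n x * tchar m' n' x = tchar (m + m') (n + n') x"
  by (simp add: tchar_def power_int_add)

text \<open>Trigonometric polynomials in inductive form: limits then need to be checked only on
  multiples of characters and on sums.\<close>

inductive trig :: "(torus \<Rightarrow> complex) \<Rightarrow> bool" where
  trig_char: "trig (\<lambda>x. c * tchar m n x)"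
| trig_add: "trig f \<Longrightarrow> trig g \<Longrightarrow> trig (\<lambda>x. f x + g x)"

lemma trig_const: "trig (\<lambda>x. c)"
  using trig_char[of c 0 0] by (simp add: tchar_def)

lemma trig_mult_char: "trig f \<Longrightarrow> trig (\<lambda>x. c * tchar m n x * f x)"
proof (induction rule: trig.induct)
  case (trig_char d k l)
  have eq: "(\<lambda>x. c * tchar m n x * (d * tchar k l x)) = (\<lambda>x. (c * d) * tchar (m + k) (n + l) x)"
    by (rule ext) (simp add: tchar_mult[symmetric])
  show ?case unfolding eq by (rule trig.trig_char)
next
  case (trig_add f g)
  then show ?case using trig.trig_add by (simp add: distrib_left)
qed

lemma trig_mult: "trig f \<Longrightarrow> trig g \<Longrightarrow> trig (\<lambda>x. f x * g x)"
proof (induction rule: trig.induct)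
  case (trig_char c m n)
  then show ?case by (rule trig_mult_char)
next
  case (trig_add f h)
  then show ?case using trig.trig_add by (simp add: distrib_right)
qed

lemma trig_cmult: "trig f \<Longrightarrow> trig (\<lambda>x. c * f x)"
  using trig_mult[OF trig_const] .

lemma inverse_circle_ue: "inverse (circle_ue s) = cnj (circle_ue s)"
proof -
  have "circle_ue s * cnj (circle_ue s) = 1" by (simp add: complex_norm_square[symmetric])
  then show ?thesis by (simp add: inverse_unique)
qed

lemma trig_parts:
  "trig (\<lambda>x. of_real (Re (circle_ue (fst x))))" "trig (\<lambda>x. of_real (Im (circle_ue (fst x))))"
  "trig (\<lambda>x. of_real (Re (circle_ue (snd x))))" "trig (\<lambda>x. of_real (Im (circle_ue (snd x))))"
proof -
  have re: "complex_of_real (Re z) = (1 / 2) * z + (1 / 2) * cnj z" for z by (simp add: complex_eq_iff)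
  have im: "complex_of_real (Im z) = (- \<i> / 2) * z + (\<i> / 2) * cnj z" for z by (simp add: complex_eq_iff)
  have 1: "trig (\<lambda>x. a * circle_ue (fst x) + b * cnj (circle_ue (fst x)))" for a b
    using trig_add[OF trig_char[of a 1 0] trig_char[of b "-1" 0]]
    by (simp add: tchar_def power_int_minus inverse_circle_ue)
  have 2: "trig (\<lambda>x. a * circle_ue (snd x) + b * cnj (circle_ue (snd x)))" for a b
    using trig_add[OF trig_char[of a 0 1] trig_char[of b 0 "-1"]]
    by (simp add: tchar_def power_int_minus inverse_circle_ue)
  show "trig (\<lambda>x. of_real (Re (circle_ue (fst x))))" "trig (\<lambda>x. of_real (Im (circle_ue (fst x))))"
    "trig (\<lambda>x. of_real (Re (circle_ue (snd x))))" "trig (\<lambda>x. of_real (Im (circle_ue (snd x))))"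
    unfolding re im by (rule 1 2)+
qed

text \<open>A real linear functional on pairs of complex numbers is a combination of the real and
  imaginary parts of the coordinates, and on the unit circle these are combinations of a character
  and its inverse.\<close>

lemma trig_real_polynomial:
  "real_polynomial_function r \<Longrightarrow> trig (\<lambda>x. complex_of_real (r (torus_ue x)))"
proof (induction rule: real_polynomial_function.induct)
  case (linear h)
  interpret bounded_linear h by fact
  have h: "h (z, w) = Re z * h (1, 0) + Im z * h (\<i>, 0) + Re w * h (0, 1) + Im w * h (0, \<i>)" for z w
  proof -
    have "(z, w) = Re z *\<^sub>R (1, 0) + Im z *\<^sub>R (\<i>, 0) + Re w *\<^sub>R (0, 1) + Im w *\<^sub>R (0, \<i>)"
      by (simp add: complex_eq_iff)
    then show ?thesis by (simp only: add scaleR real_scaleR_def)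
  qed
  have "trig (\<lambda>x. of_real (h (1, 0)) * of_real (Re (circle_ue (fst x))) + of_real (h (\<i>, 0)) * of_real (Im (circle_ue (fst x)))
     + of_real (h (0, 1)) * of_real (Re (circle_ue (snd x))) + of_real (h (0, \<i>)) * of_real (Im (circle_ue (snd x))))"
    by (intro trig_add trig_cmult trig_parts)
  moreover have "complex_of_real (h (torus_ue x)) = of_real (h (1, 0)) * of_real (Re (circle_ue (fst x))) + of_real (h (\<i>, 0)) * of_real (Im (circle_ue (fst x)))
     + of_real (h (0, 1)) * of_real (Re (circle_ue (snd x))) + of_real (h (0, \<i>)) * of_real (Im (circle_ue (snd x)))" for x
    unfolding torus_ue_def by (subst h) (simp add: mult_ac)
  ultimately show ?case by (simp only:)
next
  case (const c)
  show ?case by (rule trig_const)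
next
  case (add f g)
  then show ?case using trig_add by simp
next
  case (mult f g)
  then show ?case using trig_mult by simp
qed

text \<open>The function is transported to the image of \<open>torus_ue\<close>; the inverse map is
  continuous there because the torus is compact.\<close>

lemma trig_dense:
  fixes f :: "torus \<Rightarrow> complex"
  assumes f: "continuous_on UNIV f" and \<epsilon>: "\<epsilon> > 0"
  obtains T where "trig T" "\<forall>x. norm (f x - T x) < \<epsilon>"
proof -
  define K where "K = range torus_ue"
  define g where "g = f \<circ> the_inv torus_ue"
  have "continuous_on K (the_inv torus_ue)"
    unfolding K_def by (rule continuous_on_inv[OF continuous_on_torus_ue compact_torus])
      (simp add: the_inv_f_f[OF inj_torus_ue])
  then have "continuous_on K g" unfolding g_def
    by (rule continuous_on_compose[OF _ continuous_on_subset[OF f subset_UNIV]])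
  moreover have "compact K" unfolding K_def by (intro compact_continuous_image continuous_on_torus_ue compact_torus)
  ultimately obtain h where h: "polynomial_function h" "\<And>z. z \<in> K \<Longrightarrow> norm (g z - h z) < \<epsilon>"
    using Stone_Weierstrass_polynomial_function[of K g \<epsilon>] \<epsilon> by blast
  have "real_polynomial_function (Re \<circ> h)" "real_polynomial_function (Im \<circ> h)"
    using h(1) bounded_linear_Re bounded_linear_Im by (auto simp: polynomial_function_def)
  from trig_add[OF trig_real_polynomial[OF this(1)] trig_cmult[OF trig_real_polynomial[OF this(2)], of \<i>]]
  have "trig (\<lambda>x. h (torus_ue x))" by (simp flip: complex_eq)
  moreover have "norm (f x - h (torus_ue x)) < \<epsilon>" for x
    using h(2)[of "torus_ue x"] by (simp add: K_def g_def the_inv_f_f[OF inj_torus_ue])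
  ultimately show ?thesis using that by blast
qed

section \<open>Integration on the torus and Weyl's criterion\<close>

interpretation torus: prob_space torus_lebesgue
  by (rule prob_space_torus_lebesgue)

lemma torus_integrable:
  fixes f :: "torus \<Rightarrow> complex"
  assumes f: "continuous_on UNIV f" shows "integrable torus_lebesgue f"
proof -
  have "compact (range f)" using f compact_torus by (rule compact_continuous_image)
  then obtain B where "\<And>x. norm (f x) \<le> B" using compact_imp_bounded by (metis bounded_iff rangeI)
  moreover have "f \<in> borel_measurable torus_lebesgue"
    using borel_measurable_continuous_onI[OF f] by (simp add: torus_lebesgue_def)
  ultimately show ?thesis by (intro torus.integrable_const_bound[of _ B]) auto
qed

lemma continuous_on_tchar: "continuous_on A (tchar m n)"
  unfolding tchar_def
  by (intro continuous_on_mult continuous_on_power_int continuous_on_compose2[OF continuous_on_circle_ue[of UNIV]] continuous_intros) auto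

lemma trig_continuous: "trig f \<Longrightarrow> continuous_on UNIV f"
  by (induction rule: trig.induct) (auto intro!: continuous_intros continuous_on_tchar)

lemma integral_ue_unit_interval:
  fixes m :: int
  assumes "m \<noteq> 0"
  shows "(\<integral>x. indicator {0..<1} x *\<^sub>R ue (of_int m * x) \<partial>lborel) = 0"
proof -
  define F where "F = (\<lambda>x::real. ue (of_int m * x) / (2 * pi * of_int m * \<i>))"
  have D: "(F has_vector_derivative ue (of_int m * x)) (at x within A)" for x A
  proof -
    have "((\<lambda>x::real. exp (of_real x * (\<i> * (2 * pi * of_int m)))) has_vector_derivative
        (\<i> * (2 * pi * of_int m)) * exp (of_real x * (\<i> * (2 * pi * of_int m)))) (at x within A)"
      by (rule exp_scaleR_has_vector_derivative_right[of "\<i> * (2 * pi * of_int m)", unfolded scaleR_conv_of_real, THEN has_vector_derivative_eq_rhs]) (simp add: mult_ac)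
    moreover have "exp (of_real x * (\<i> * (2 * pi * of_int m))) = ue (of_int m * x)" for x
      by (simp add: ue_def cis_conv_exp mult_ac)
    ultimately have "((\<lambda>x. ue (of_int m * x)) has_vector_derivative
        (\<i> * (2 * pi * of_int m)) * ue (of_int m * x)) (at x within A)" by (simp only:)
    from has_vector_derivative_divide[OF this, of "2 * pi * of_int m * \<i>"]
    show ?thesis unfolding F_def using assms by (simp add: mult_ac)
  qed
  have "(\<integral>x. indicator {0..1} x *\<^sub>R ue (of_int m * x) \<partial>lborel) = F 1 - F 0"
    by (rule integral_FTC_Icc) (use D in \<open>auto intro!: continuous_on_compose2[OF continuous_on_ue[of UNIV]] continuous_intros\<close>)
  also have "\<dots> = 0" by (simp add: F_def)
  also have "(\<integral>x. indicator {0..1} x *\<^sub>R ue (of_int m * x) \<partial>lborel) = (\<integral>x. indicator {0..<1} x *\<^sub>R ue (of_int m * x) \<partial>lborel)"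
  proof (rule integral_cong_AE)
    have "(\<lambda>x. ue (of_int m * x)) \<in> borel_measurable lborel"
      using borel_measurable_continuous_onI[OF continuous_on_compose2[OF continuous_on_ue[of UNIV]], of "\<lambda>x. of_int m * x"]
      by (simp add: continuous_intros)
    then show "(\<lambda>x. indicator {0..1} x *\<^sub>R ue (of_int m * x)) \<in> borel_measurable lborel"
      "(\<lambda>x. indicator {0..<1} x *\<^sub>R ue (of_int m * x)) \<in> borel_measurable lborel"
      by (auto intro!: borel_measurable_scaleR)
    show "AE x in lborel. indicator {0..1} x *\<^sub>R ue (of_int m * x) = indicator {0..<1} x *\<^sub>R ue (of_int m * x)"
      using AE_lborel_singleton[of "1::real"] by eventually_elim (auto simp: indicator_def)
  qed
  finally show ?thesis .
qed

lemma integral_tchar: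
  assumes "m \<noteq> 0 \<or> n \<noteq> 0" shows "integral\<^sup>L torus_lebesgue (tchar m n) = 0"
proof -
  let ?S = "{0..<1} \<times> {0..<1} :: (real \<times> real) set"
  define k where "k = (\<lambda>(x, y). (indicator {0..<1} x *\<^sub>R ue (of_int m * x)) * (indicator {0..<1} y *\<^sub>R ue (of_int n * y)))"
  have "integral\<^sup>L torus_lebesgue (tchar m n) = (\<integral>x. tchar m n (to_torus x) \<partial>restrict_space lborel ?S)"
    unfolding torus_lebesgue_def
    by (rule integral_distr)
       (use to_torus_measurable in \<open>auto intro!: measurable_restrict_space1 borel_measurable_continuous_onI continuous_on_tchar\<close>)
  also have "\<dots> = (\<integral>x. indicator ?S x *\<^sub>R tchar m n (to_torus x) \<partial>lborel)"
    using unit_square_measurable by (subst integral_restrict_space) auto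
  also have keq: "(\<lambda>x. indicator ?S x *\<^sub>R tchar m n (to_torus x)) = k"
    by (rule ext) (auto simp: k_def tchar_to_torus ue_add indicator_def)
  also have "integral\<^sup>L lborel k = integral\<^sup>L (lborel \<Otimes>\<^sub>M lborel) k"
    by (simp only: lborel_prod)
  also have "\<dots> = (\<integral>x. \<integral>y. k (x, y) \<partial>lborel \<partial>lborel)"
  proof (rule lborel_pair.integral_fst'[symmetric])
    have "integrable lborel (\<lambda>x. indicator ?S x *\<^sub>R tchar m n (to_torus x))"
    proof (rule integrableI_bounded_set_indicator[where B = 1])
      show "?S \<in> sets lborel" by (rule unit_square_measurable)
      show "emeasure lborel ?S < \<infinity>" by (simp add: emeasure_unit_square)
      show "(\<lambda>x. tchar m n (to_torus x)) \<in> borel_measurable lborel"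
        using measurable_compose[OF to_torus_measurable borel_measurable_continuous_onI[OF continuous_on_tchar]] by simp
      show "AE x in lborel. x \<in> ?S \<longrightarrow> norm (tchar m n (to_torus x)) \<le> 1"
        by (simp add: tchar_def norm_mult norm_power_int)
    qed
    then show "integrable (lborel \<Otimes>\<^sub>M lborel) k" unfolding keq lborel_prod .
  qed
  also have "\<dots> = (\<integral>x. indicator {0..<1} x *\<^sub>R ue (of_int m * x) \<partial>lborel) * (\<integral>y. indicator {0..<1} y *\<^sub>R ue (of_int n * y) \<partial>lborel)"
    by (simp only: k_def prod.case integral_mult_right_zero integral_mult_left_zero)
  also have "\<dots> = 0" using assms integral_ue_unit_interval by auto
  finally show ?thesis .
qed

lemma coset_point_inv:
  assumes "q > 0" "d \<in> carrier (unit_group q)" shows "inv\<^bsub>unit_group q\<^esub> d = minv q d"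
proof -
  interpret comm_group "unit_group q" by (rule comm_group_unit_group[OF assms(1)])
  have d: "0 \<le> d" "d < int q" "coprime d (int q)" using assms by (auto simp: carrier_unit_group)
  have "[d * minv q d = 1] (mod int q)" by (rule minv_cong[OF d(3)])
  moreover have "minv q d \<in> carrier (unit_group q)"
    using assms(1) coprime_modular_inverse[OF d(3)]
    by (simp add: carrier_unit_group modular_inverse_int_nonneg modular_inverse_int_less)
  ultimately show ?thesis
    using inv_unique'[of d "minv q d"] assms(2)
    by (simp add: mult_unit_group one_unit_group Cong.cong_def mult.commute)
qed

text \<open>Weyl's criterion: averages and integral are linear in the test function, agree in the
  limit on characters, and change by no more than the uniform distance of two test functions.
  Density of \<open>trig\<close> extends the limit to all continuous functions.\<close>

lemma torus_weak_conv_criterion: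
  fixes H :: "nat \<Rightarrow> int set" and a :: "nat \<Rightarrow> int"
  assumes H: "\<And>q. q \<in> S \<Longrightarrow> q > 0 \<and> subgroup (H q) (unit_group q) \<and> a q \<in> carrier (unit_group q)"
    and lim: "\<And>m n :: int. m \<noteq> 0 \<or> n \<noteq> 0 \<Longrightarrow>
      ((\<lambda>q. 1 / of_nat (card (H q)) * (\<Sum>d\<in>a q <#\<^bsub>unit_group q\<^esub> H q.
        ue (of_int (m * d + n * minv q d) / of_nat q))) \<longlongrightarrow> 0) (sequentially \<sqinter> principal S)"
  shows "torus_weak_conv (\<lambda>q. coset_measure q (a q <#\<^bsub>unit_group q\<^esub> H q)) torus_lebesgue (sequentially \<sqinter> principal S)"
proof -
  define F where "F = sequentially \<sqinter> principal S"
  define D where "D = (\<lambda>q. a q <#\<^bsub>unit_group q\<^esub> H q)"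
  define av where "av = (\<lambda>(f :: torus \<Rightarrow> complex) q. 1 / of_nat (card (H q)) * (\<Sum>d\<in>D q. f (coset_point q d)))"
  have inS: "eventually (\<lambda>q. q \<in> S) F" by (simp add: F_def eventually_inf_principal)
  have D: "card (D q) = card (H q)" "card (H q) > 0" "D q \<subseteq> carrier (unit_group q)" if q: "q \<in> S" for q
  proof -
    interpret comm_group "unit_group q" using comm_group_unit_group H[OF q] by blast
    have sub: "H q \<subseteq> carrier (unit_group q)" using H[OF q] subgroup.subset by blast
    have Dq: "D q = (\<lambda>h. a q \<otimes>\<^bsub>unit_group q\<^esub> h) ` H q" by (auto simp: D_def l_coset_def)
    have "inj_on (\<lambda>h. a q \<otimes>\<^bsub>unit_group q\<^esub> h) (H q)"
      using H[OF q] sub by (intro inj_onI) (auto simp: subset_iff)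
    then show "card (D q) = card (H q)" by (simp add: Dq card_image)
    show "card (H q) > 0"
      using H[OF q] sub finite_carrier_unit_group subgroup.one_closed finite_subset by (metis card_gt_0_iff empty_iff)
    show "D q \<subseteq> carrier (unit_group q)" using H[OF q] sub by (auto simp: Dq)
  qed
  have av_close: "norm (av f q - av g q) \<le> \<epsilon>" if q: "q \<in> S" and fg: "\<And>x. norm (f x - g x) < \<epsilon>"
    for f g :: "torus \<Rightarrow> complex" and q \<epsilon>
  proof -
    have "av f q - av g q = 1 / of_nat (card (H q)) * (\<Sum>d\<in>D q. f (coset_point q d) - g (coset_point q d))"
      by (simp add: av_def sum_subtractf right_diff_distrib)
    also have "norm \<dots> = 1 / card (H q) * norm (\<Sum>d\<in>D q. f (coset_point q d) - g (coset_point q d))"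
      by (simp add: norm_mult norm_divide)
    also have "\<dots> \<le> 1 / card (H q) * (card (D q) * \<epsilon>)"
      by (intro mult_left_mono sum_norm_bound less_imp_le[OF fg]) auto
    also have "\<dots> = \<epsilon>" using D[OF q] by simp
    finally show ?thesis .
  qed
  have trig_lim: "trig f \<Longrightarrow> (av f \<longlongrightarrow> integral\<^sup>L torus_lebesgue f) F" for f
  proof (induction rule: trig.induct)
    case (trig_char c m n)
    show ?case
    proof (cases "m = 0 \<and> n = 0")
      case True
      have "eventually (\<lambda>q. av (\<lambda>x. c * tchar m n x) q = c) F"
        using inS by eventually_elim (use True D in \<open>simp add: av_def tchar_def\<close>)
      moreover have "integral\<^sup>L torus_lebesgue (\<lambda>x. c * tchar m n x) = c"
        using True torus.prob_space by (simp add: tchar_def)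
      ultimately show ?thesis by (simp only: tendsto_eventually)
    next
      case False
      have "tchar m n (coset_point q d) = ue (of_int (m * d + n * minv q d) / of_nat q)"
        if "q \<in> S" "d \<in> D q" for q d
        using coset_point_inv[of q d] H[OF that(1)] D(3)[OF that(1)] that(2)
        by (auto simp: coset_point_def tchar_to_torus add_divide_distrib)
      then have "eventually (\<lambda>q. c * (1 / of_nat (card (H q)) * (\<Sum>d\<in>D q. ue (of_int (m * d + n * minv q d) / of_nat q))) =
          av (\<lambda>x. c * tchar m n x) q) F"
        using inS by (auto elim!: eventually_mono simp: av_def sum_distrib_left)
      moreover have "((\<lambda>q. c * (1 / of_nat (card (H q)) * (\<Sum>d\<in>D q. ue (of_int (m * d + n * minv q d) / of_nat q)))) \<longlongrightarrow> c * 0) F"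
        unfolding F_def D_def using False by (intro tendsto_mult tendsto_const lim) blast
      moreover have "integral\<^sup>L torus_lebesgue (\<lambda>x. c * tchar m n x) = 0"
        using integral_tchar[of m n] False by simp
      ultimately show ?thesis by (simp only: mult_zero_right Lim_transform_eventually)
    qed
  next
    case (trig_add f g)
    have "av (\<lambda>x. f x + g x) = (\<lambda>q. av f q + av g q)"
      by (rule ext) (simp only: av_def sum.distrib distrib_left)
    moreover have "integral\<^sup>L torus_lebesgue (\<lambda>x. f x + g x) = integral\<^sup>L torus_lebesgue f + integral\<^sup>L torus_lebesgue g"
      using trig_add.hyps by (intro Bochner_Integration.integral_add torus_integrable trig_continuous)
    ultimately show ?case using tendsto_add[OF trig_add.IH] by simp
  qed
  have main: "(av f \<longlongrightarrow> integral\<^sup>L torus_lebesgue f) F" if f: "continuous_on UNIV f" for f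
  proof (rule tendstoI)
    fix \<epsilon> :: real assume \<epsilon>: "\<epsilon> > 0"
    then have e4: "\<epsilon> / 4 > 0" by simp
    obtain T where T: "trig T" and T': "\<forall>x. norm (f x - T x) < \<epsilon> / 4"
      by (rule trig_dense[OF f e4])
    note T = T T'[rule_format]
    have "norm (integral\<^sup>L torus_lebesgue (\<lambda>x. f x - T x)) \<le> (\<integral>x. norm (f x - T x) \<partial>torus_lebesgue)"
      by (rule integral_norm_bound)
    also have "\<dots> \<le> (\<integral>x. \<epsilon> / 4 \<partial>torus_lebesgue)"
      by (intro integral_mono integrable_norm torus_integrable continuous_on_diff f trig_continuous[OF T(1)]
          less_imp_le[OF T(2)]) auto
    also have "\<dots> = \<epsilon> / 4" using torus.prob_space by simp
    finally have I: "norm (integral\<^sup>L torus_lebesgue f - integral\<^sup>L torus_lebesgue T) \<le> \<epsilon> / 4"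
      using Bochner_Integration.integral_diff[OF torus_integrable[OF f] torus_integrable[OF trig_continuous[OF T(1)]]] by simp
    have "eventually (\<lambda>q. dist (av T q) (integral\<^sup>L torus_lebesgue T) < \<epsilon> / 4) F"
      using trig_lim[OF T(1)] e4 by (rule tendstoD)
    then show "eventually (\<lambda>q. dist (av f q) (integral\<^sup>L torus_lebesgue f) < \<epsilon>) F"
      using inS
    proof eventually_elim
      case (elim q)
      have "norm (av f q - integral\<^sup>L torus_lebesgue f) = norm ((av f q - av T q) + (av T q - integral\<^sup>L torus_lebesgue T)
          - (integral\<^sup>L torus_lebesgue f - integral\<^sup>L torus_lebesgue T))" by simp
      also have "\<dots> \<le> norm (av f q - av T q) + norm (av T q - integral\<^sup>L torus_lebesgue T)
          + norm (integral\<^sup>L torus_lebesgue f - integral\<^sup>L torus_lebesgue T)"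
        by (rule order_trans[OF norm_triangle_ineq4 add_right_mono[OF norm_triangle_ineq]])
      also have "\<dots> < \<epsilon>"
        using av_close[OF elim(2), of f T "\<epsilon> / 4", OF T(2)] elim(1)[unfolded dist_norm] I \<epsilon> by linarith
      finally show ?case by (simp add: dist_norm)
    qed
  qed
  show ?thesis
    unfolding torus_weak_conv_def
  proof (intro allI impI)
    fix f :: "torus \<Rightarrow> complex" assume f: "continuous_on UNIV f"
    have "eventually (\<lambda>q. av f q = integral\<^sup>L (coset_measure q (a q <#\<^bsub>unit_group q\<^esub> H q)) f) F"
      using inS by eventually_elim (use H f in \<open>simp add: coset_measure_integral av_def D_def\<close>)
    then show "((\<lambda>q. integral\<^sup>L (coset_measure q (a q <#\<^bsub>unit_group q\<^esub> H q)) f) \<longlongrightarrow> integral\<^sup>L torus_lebesgue f)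
        (sequentially \<sqinter> principal S)"
      unfolding F_def[symmetric] by (rule Lim_transform_eventually[OF main[OF f]])
  qed
qed

section \<open>Exponential sums modulo a squarefree number\<close>

definition red :: "nat \<Rightarrow> int set \<Rightarrow> int set" where
  "red d H = (\<lambda>h. h mod int d) ` H"

definition kern :: "nat \<Rightarrow> int set \<Rightarrow> int set" where
  "kern d H = {h \<in> H. [h = 1] (mod int d)}"

lemma cong_dvd_mod: "[x = y] (mod int q) \<Longrightarrow> d dvd q \<Longrightarrow> [x = y] (mod int d)"
  by (rule cong_dvd_modulus) auto

lemma mod_cong_dvd: "d dvd q \<Longrightarrow> [x mod int q = x] (mod int d)"
  by (rule cong_dvd_mod[of _ _ q]) auto

lemma kern_sub: "kern d H \<subseteq> H" by (auto simp: kern_def)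

lemma modgrp_kern:
  assumes H: "modgrp q H" and d: "d dvd q" shows "modgrp q (kern d H)"
  unfolding modgrp_def
proof (intro conjI ballI)
  show "q > 0" "kern d H \<subseteq> {0..<int q}" using H by (auto simp: modgrp_def kern_def)
  show "1 mod int q \<in> kern d H" using modgrp_one[OF H] mod_cong_dvd[OF d] by (simp add: kern_def)
  fix x assume x: "x \<in> kern d H"
  then have x': "x \<in> H" "[x = 1] (mod int d)" by (auto simp: kern_def)
  {
    fix y assume y: "y \<in> kern d H"
    have "[x * y = 1 * 1] (mod int d)" using x y by (intro cong_mult) (auto simp: kern_def)
    then have "[x * y mod int q = 1] (mod int d)" using mod_cong_dvd[OF d] cong_trans by fastforce
    then show "x * y mod int q \<in> kern d H" using x y modgrp_mult[OF H] by (simp add: kern_def)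
  }
  have i: "[x * minv q x = 1] (mod int q)" by (rule modgrp_minv_cong[OF H x'(1)])
  have "[x * minv q x = 1 * minv q x] (mod int d)" using x'(2) by (rule cong_scalar_right)
  then have "[minv q x = x * minv q x] (mod int d)" by (simp only: mult_1 cong_sym)
  from cong_trans[OF this cong_dvd_mod[OF i d]] have "[minv q x = 1] (mod int d)" .
  then have "minv q x \<in> kern d H" using modgrp_minv[OF H x'(1)] by (simp add: kern_def)
  then show "\<exists>y\<in>kern d H. [x * y = 1] (mod int q)" using i by blast
qed

lemma modgrp_red:
  assumes H: "modgrp q H" and d: "d dvd q" shows "modgrp d (red d H)"
  unfolding modgrp_def
proof (intro conjI ballI)
  show d0: "d > 0" using modgrp_pos[OF H] d by (rule dvd_pos_nat)
  show "red d H \<subseteq> {0..<int d}" using d0 by (auto simp: red_def)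
  have "1 mod int d = (1 mod int q) mod int d" using mod_cong_dvd[OF d, of 1] by (simp add: Cong.cong_def)
  then show "1 mod int d \<in> red d H" using modgrp_one[OF H] by (auto simp: red_def)
  fix x assume "x \<in> red d H"
  then obtain h where h: "h \<in> H" "x = h mod int d" by (auto simp: red_def)
  {
    fix y assume "y \<in> red d H"
    then obtain g where g: "g \<in> H" "y = g mod int d" by (auto simp: red_def)
    have "x * y mod int d = (h * g) mod int d" by (simp add: h g mod_mult_eq)
    also have "\<dots> = (h * g mod int q) mod int d" using mod_cong_dvd[OF d, of "h * g"] by (simp add: Cong.cong_def)
    finally show "x * y mod int d \<in> red d H" using modgrp_mult[OF H h(1) g(1)] by (auto simp: red_def)
  }
  have "[h * minv q h = 1] (mod int d)" using modgrp_minv_cong[OF H h(1)] d by (rule cong_dvd_mod)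
  then have "[x * (minv q h mod int d) = 1] (mod int d)" by (simp add: h Cong.cong_def mod_mult_eq)
  then show "\<exists>y\<in>red d H. [x * y = 1] (mod int d)" using modgrp_minv[OF H h(1)] by (auto simp: red_def)
qed

lemma card_fibre:
  assumes H: "modgrp q H" and d: "d dvd q" and h: "h \<in> H"
  shows "card {x \<in> H. x mod int d = h mod int d} = card (kern d H)"
proof -
  have b: "bij_betw (\<lambda>x. h * x mod int q) H H" by (rule modgrp_mult_bij[OF H h])
  have cop: "coprime h (int d)" using modgrp_coprime[OF H h] d by (meson coprime_divisors dvd_refl of_nat_dvd_iff)
  have iff: "(h * x mod int q) mod int d = h mod int d \<longleftrightarrow> [x = 1] (mod int d)" for x
  proof -
    have "(h * x mod int q) mod int d = h mod int d \<longleftrightarrow> [h * x = h * 1] (mod int d)"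
      using mod_cong_dvd[OF d, of "h * x"] by (simp add: Cong.cong_def)
    also have "\<dots> \<longleftrightarrow> [x = 1] (mod int d)" by (rule cong_mult_lcancel[OF cop])
    finally show ?thesis .
  qed
  have "(\<lambda>x. h * x mod int q) ` kern d H = {x \<in> H. x mod int d = h mod int d}"
  proof
    show "(\<lambda>x. h * x mod int q) ` kern d H \<subseteq> {x \<in> H. x mod int d = h mod int d}"
      using iff modgrp_mult[OF H h] by (auto simp: kern_def)
    show "{x \<in> H. x mod int d = h mod int d} \<subseteq> (\<lambda>x. h * x mod int q) ` kern d H"
    proof
      fix y assume y: "y \<in> {x \<in> H. x mod int d = h mod int d}"
      then obtain x where "x \<in> H" "y = h * x mod int q" using b by (auto simp: bij_betw_def)
      then show "y \<in> (\<lambda>x. h * x mod int q) ` kern d H" using y iff[of x] by (auto simp: kern_def)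
    qed
  qed
  moreover have "inj_on (\<lambda>x. h * x mod int q) (kern d H)"
    using b kern_sub by (auto simp: bij_betw_def intro: inj_on_subset)
  ultimately show ?thesis by (metis card_image)
qed

lemma card_red_kern:
  assumes H: "modgrp q H" and d: "d dvd q"
  shows "card H = card (red d H) * card (kern d H)"
proof -
  have "card H = (\<Sum>y\<in>red d H. card {x \<in> H. x mod int d = y})"
    using sum_card_fibres[OF modgrp_finite[OF H], of "\<lambda>x. x mod int d"] by (simp add: red_def)
  also have "\<dots> = (\<Sum>y\<in>red d H. card (kern d H))"
    using card_fibre[OF H d] by (intro sum.cong refl) (auto simp: red_def)
  finally show ?thesis by simp
qed

lemma card_cong_pairs:
  assumes H: "modgrp q H" and d: "d dvd q"
  shows "card {(x, y). x \<in> H \<and> y \<in> H \<and> [x = y] (mod int d)} = card H * card (kern d H)"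
proof -
  have "{(x, y). x \<in> H \<and> y \<in> H \<and> [x = y] (mod int d)} = (SIGMA x:H. {y \<in> H. y mod int d = x mod int d})"
    by (auto simp: Cong.cong_def)
  then show ?thesis using modgrp_finite[OF H] card_fibre[OF H d] by (simp add: card_SigmaI)
qed

lemma finite_red: "finite H \<Longrightarrow> finite (red d H)" by (simp add: red_def)

lemma kern_mult:
  assumes "coprime d g" shows "kern g (kern d H) = kern (d * g) H"
  using assms by (auto simp: kern_def intro: coprime_cong_mult cong_dvd_modulus[of _ _ "int d * int g"])

text \<open>Both sides equal \<open>|H| / |kern Q H|\<close>, once computed directly and once
  through the intermediate group \<open>kern g H\<close>.\<close>

lemma card_red_split:
  assumes H: "modgrp q H" and g: "g dvd Q" and Q: "Q dvd q"
  shows "card (red Q H) = card (red g H) * card (red Q (kern g H))"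
proof -
  have gq: "g dvd q" using g Q by (rule dvd_trans)
  have K: "modgrp q (kern g H)" by (rule modgrp_kern[OF H gq])
  have "kern Q (kern g H) = kern Q H" using cong_dvd_mod[OF _ g] by (auto simp: kern_def)
  then have "card (kern g H) = card (red Q (kern g H)) * card (kern Q H)"
    using card_red_kern[OF K Q] by (simp only:)
  then have "card (red Q H) * card (kern Q H) = card (red g H) * card (red Q (kern g H)) * card (kern Q H)"
    using card_red_kern[OF H Q] card_red_kern[OF H gq] by (simp only: mult.assoc)
  moreover have "card (kern Q H) > 0" using modgrp_card[OF modgrp_kern[OF H Q]] .
  ultimately show ?thesis by simp
qed

text \<open>The sum over \<open>H\<close> is an average of sums over the cosets \<open>h K\<close>,
  so a uniform bound on these suffices. This is how later proofs replace \<open>H\<close> by a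
  better subgroup.\<close>

lemma sum_subgroup_average:
  fixes f :: "int \<Rightarrow> complex" and \<eta> :: real
  assumes H: "modgrp q H" and K: "modgrp q K" "K \<subseteq> H"
    and f: "\<And>h. h \<in> H \<Longrightarrow> norm (\<Sum>k\<in>K. f (h * k mod int q)) \<le> \<eta> * card K"
  shows "norm (\<Sum>h\<in>H. f h) \<le> \<eta> * card H"
proof -
  have cK: "card K > 0" by (rule modgrp_card[OF K(1)])
  have "of_nat (card K) * (\<Sum>h\<in>H. f h) = (\<Sum>k\<in>K. \<Sum>h\<in>H. f (k * h mod int q))"
  proof -
    have "(\<Sum>h\<in>H. f (k * h mod int q)) = (\<Sum>h\<in>H. f h)" if "k \<in> K" for k
      using modgrp_mult_bij[OF H, of k] that K by (intro sum.reindex_bij_betw) auto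
    then show ?thesis by simp
  qed
  also have "\<dots> = (\<Sum>h\<in>H. \<Sum>k\<in>K. f (h * k mod int q))" by (subst sum.swap) (simp add: mult.commute)
  finally have "card K * norm (\<Sum>h\<in>H. f h) = norm (\<Sum>h\<in>H. \<Sum>k\<in>K. f (h * k mod int q))"
    by (metis norm_mult norm_of_nat)
  also have "\<dots> \<le> (\<Sum>h\<in>H. \<eta> * card K)" by (intro order_trans[OF norm_sum] sum_mono f)
  finally have "card K * norm (\<Sum>h\<in>H. f h) \<le> card K * (\<eta> * card H)" by (simp add: mult_ac)
  then show ?thesis using cK by simp
qed

lemma card_cong_class_le:
  fixes x :: int
  assumes L: "L dvd k" "k > 0"
  shows "card {y \<in> {0..<int k}. [y = x] (mod int L)} \<le> k div L"
proof -
  have L0: "L > 0" using L by (rule dvd_pos_nat[rotated])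
  have "card {y \<in> {0..<int k}. [y = x] (mod int L)} \<le> card {0..<int (k div L)}"
  proof (rule card_inj_on_le[of "\<lambda>y. y div int L"])
    show "inj_on (\<lambda>y. y div int L) {y \<in> {0..<int k}. [y = x] (mod int L)}"
    proof (rule inj_onI)
      fix y z assume yz: "y \<in> {y \<in> {0..<int k}. [y = x] (mod int L)}" "z \<in> {y \<in> {0..<int k}. [y = x] (mod int L)}"
        "y div int L = z div int L"
      then have "y mod int L = z mod int L" by (simp add: Cong.cong_def)
      then show "y = z" using yz(3) by (metis div_mult_mod_eq)
    qed
    show "(\<lambda>y. y div int L) ` {y \<in> {0..<int k}. [y = x] (mod int L)} \<subseteq> {0..<int (k div L)}"
    proof (rule image_subsetI)
      fix y assume "y \<in> {y \<in> {0..<int k}. [y = x] (mod int L)}"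
      then have y: "0 \<le> y" "y < int k" by auto
      have "int k = int (k div L) * int L" using L by (simp flip: of_nat_mult)
      then have "int L * (y div int L) < int L * int (k div L)"
        using y L0 by (metis div_mult_mod_eq le_less_trans mult.commute le_add_same_cancel1 pos_mod_sign of_nat_0_less_iff)
      then have "y div int L < int (k div L)" using L0 by simp
      then show "y div int L \<in> {0..<int (k div L)}" using y L0 by (simp add: pos_imp_zdiv_nonneg_iff)
    qed
  qed simp
  then show ?thesis by simp
qed

section \<open>Quadratic congruences and divisors for squarefree moduli\<close>

definition ndiv :: "nat \<Rightarrow> nat" where "ndiv k = card {d. d dvd k}"

lemma squarefree_dvd_iff:
  fixes k m :: nat
  assumes k: "squarefree k" and p: "\<And>p. prime p \<Longrightarrow> p dvd k \<Longrightarrow> p dvd m"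
  shows "k dvd m"
proof (cases "m = 0")
  case False
  have k0: "k \<noteq> 0" using k by (metis not_squarefree_0)
  show ?thesis
  proof (rule multiplicity_le_imp_dvd[OF k0])
    fix q :: nat assume q: "prime q"
    have "multiplicity q k \<le> 1" using k k0 q by (simp add: squarefree_factorial_semiring'' not_less_eq_eq)
    moreover have "multiplicity q m \<ge> 1" if "multiplicity q k = 1"
    proof -
      have "q dvd k" using that q k0 by (metis multiplicity_unit_left not_dvd_imp_multiplicity_0 zero_neq_one)
      then have "q dvd m" using p q by blast
      then show ?thesis using q False by (simp add: Suc_le_eq prime_multiplicity_gt_zero_iff)
    qed
    ultimately show "multiplicity q k \<le> multiplicity q m" by linarith
  qed
qed simp

text \<open>Since \<open>k\<close> is squarefree and each of its primes divides one of the factors,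
  \<open>k\<close> divides \<open>gcd c k\<close> times \<open>L\<close>, the lcm of
  \<open>gcd (x - x0) k\<close> and \<open>gcd (x + u) k\<close>. Solutions with the same two gcds
  agree modulo \<open>L\<close>, so at most \<open>k / L \<le> g\<close> of them exist, and there
  are at most \<open>(ndiv k)^2\<close> pairs of gcds.\<close>

lemma quad_count:
  fixes S :: "int set" and c x0 u :: int
  assumes k: "squarefree k" and S: "S \<subseteq> {0..<int k}" and c: "nat (gcd c (int k)) \<le> g"
    and x: "\<And>x. x \<in> S \<Longrightarrow> int k dvd c * (x - x0) * (x + u)"
  shows "card S \<le> g * (ndiv k)\<^sup>2"
proof -
  have k0: "k > 0" using k by (metis gr0I not_squarefree_0)
  define f where "f = (\<lambda>x. (nat (gcd (x - x0) (int k)), nat (gcd (x + u) (int k))))"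
  have fS: "finite S" using S finite_subset by blast
  have fD: "finite {d. d dvd k}" using k0 by simp
  have fib: "card {s \<in> S. f s = f x1} \<le> g" if x1: "x1 \<in> S" for x1
  proof -
    define d1 d2 where "d1 = nat (gcd (x1 - x0) (int k))" and "d2 = nat (gcd (x1 + u) (int k))"
    define L where "L = lcm d1 d2"
    have d: "d1 dvd k" "d2 dvd k" by (auto simp: d1_def d2_def nat_dvd_iff)
    then have Lk: "L dvd k" by (simp add: L_def)
    have "k dvd nat (gcd c (int k)) * L"
    proof (rule squarefree_dvd_iff[OF k])
      fix p :: nat assume p: "prime p" "p dvd k"
      have pk: "int p dvd int k" using p by simp
      have "int p dvd c * (x1 - x0) * (x1 + u)" using x[OF x1] pk by (rule dvd_trans[rotated])
      then have "int p dvd c \<or> int p dvd x1 - x0 \<or> int p dvd x1 + u" using p(1) by (simp add: prime_dvd_mult_iff)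
      then consider "int p dvd gcd c (int k)" | "int p dvd gcd (x1 - x0) (int k)" | "int p dvd gcd (x1 + u) (int k)"
        using pk by auto
      then show "p dvd nat (gcd c (int k)) * L"
      proof cases
        case 1
        then have "p dvd nat (gcd c (int k))" by (simp flip: int_dvd_int_iff)
        then show ?thesis by simp
      next
        case 2
        then have "p dvd d1" by (simp add: d1_def flip: int_dvd_int_iff)
        then show ?thesis by (simp add: L_def)
      next
        case 3
        then have "p dvd d2" by (simp add: d2_def flip: int_dvd_int_iff)
        then show ?thesis by (simp add: L_def)
      qed
    qed
    then have "k \<le> nat (gcd c (int k)) * L" using k0 dvd_pos_nat[OF k0 Lk] by (intro dvd_imp_le) auto
    also have "\<dots> \<le> g * L" using c by (rule mult_le_mono1)
    finally have kg: "k div L \<le> g" using dvd_pos_nat[OF k0 Lk] div_le_mono[of k "g * L" L] by simp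
    have "{s \<in> S. f s = f x1} \<subseteq> {y \<in> {0..<int k}. [y = x1] (mod int L)}"
    proof clarify
      fix s assume s: "s \<in> S" "f s = f x1"
      then have e: "gcd (s - x0) (int k) = int d1" "gcd (s + u) (int k) = int d2"
        by (auto simp: f_def d1_def d2_def) (metis gcd_ge_0_int int_nat_eq nat_int)+
      have e1: "int d1 dvd x1 - x0" "int d2 dvd x1 + u" by (auto simp: d1_def d2_def)
      have ds: "int d1 dvd s - x0" "int d2 dvd s + u" using e by (metis gcd_dvd1)+
      have "int d1 dvd s - x1" "int d2 dvd s - x1"
        using dvd_diff[OF ds(1) e1(1)] dvd_diff[OF ds(2) e1(2)] by simp_all
      then have "int L dvd s - x1" by (simp add: L_def lcm_int_int_eq[symmetric] del: lcm_int_int_eq)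
      then show "s \<in> {0..<int k} \<and> [s = x1] (mod int L)" using s S by (auto simp: cong_iff_dvd_diff)
    qed
    then have "card {s \<in> S. f s = f x1} \<le> card {y \<in> {0..<int k}. [y = x1] (mod int L)}"
      by (intro card_mono) (auto intro: finite_subset[of _ "{0..<int k}"])
    also have "\<dots> \<le> k div L" by (rule card_cong_class_le[OF Lk k0])
    finally show ?thesis using kg by linarith
  qed
  have "card S = (\<Sum>y\<in>f ` S. card {s \<in> S. f s = y})" by (rule sum_card_fibres[OF fS, symmetric])
  also have "\<dots> \<le> (\<Sum>y\<in>f ` S. g)" using fib by (intro sum_mono) auto
  also have "\<dots> = card (f ` S) * g" by simp
  also have "card (f ` S) \<le> card ({d. d dvd k} \<times> {d. d dvd k})"
    using fD by (intro card_mono) (auto simp: f_def nat_dvd_iff)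
  finally show ?thesis by (simp add: ndiv_def card_cartesian_product power2_eq_square mult_ac)
qed

lemma squarefree_eq_prod_primes:
  fixes d :: nat assumes "squarefree d" shows "d = \<Prod>(prime_factors d)"
proof -
  have d0: "d \<noteq> 0" using assms by (metis not_squarefree_0)
  have "d = (\<Prod>p\<in>prime_factors d. p ^ multiplicity p d)" using prime_factorization_nat d0 by blast
  also have "\<dots> = (\<Prod>p\<in>prime_factors d. p)"
  proof (rule prod.cong[OF refl])
    fix p assume p: "p \<in> prime_factors d"
    then have "multiplicity p d \<le> 1" "multiplicity p d \<ge> 1"
      using assms d0 by (auto simp: squarefree_factorial_semiring'' prime_factors_multiplicity)
    then show "p ^ multiplicity p d = p" by (metis le_antisym power_one_right)
  qed
  finally show ?thesis .
qed

text \<open>A squarefree number has at most 2 to the number of its primes divisors. A prime above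
  \<open>P\<close> satisfies \<open>2 \<le> p^\<epsilon>\<close>, and the at most
  \<open>P + 1\<close> smaller ones cost a constant factor.\<close>

lemma divisor_bound:
  fixes \<epsilon> :: real assumes \<epsilon>: "\<epsilon> > 0"
  obtains C :: real where "C \<ge> 1" "\<forall>k. squarefree k \<longrightarrow> real (ndiv k) \<le> C * real k powr \<epsilon>"
proof -
  define P where "P = nat \<lceil>2 powr (1 / \<epsilon>)\<rceil>"
  have big: "2 \<le> real p powr \<epsilon>" if "p > P" for p
  proof -
    have "2 powr (1 / \<epsilon>) \<le> real p" using that unfolding P_def by linarith
    then have "(2 powr (1 / \<epsilon>)) powr \<epsilon> \<le> real p powr \<epsilon>" using \<epsilon> by (intro powr_mono2) auto
    then show ?thesis using \<epsilon> by (simp add: powr_powr)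
  qed
  have "real (ndiv k) \<le> 2 ^ (P + 1) * real k powr \<epsilon>" if k: "squarefree k" for k :: nat
  proof -
    have k0: "k \<noteq> 0" using k by (metis not_squarefree_0)
    have "card {d. d dvd k} \<le> card (Pow (prime_factors k))"
    proof (rule card_inj_on_le[of prime_factors])
      show "inj_on prime_factors {d. d dvd k}"
        using squarefree_eq_prod_primes squarefree_mono[OF _ k] by (metis (no_types, lifting) inj_onI mem_Collect_eq)
      show "prime_factors ` {d. d dvd k} \<subseteq> Pow (prime_factors k)"
        using dvd_prime_factors[OF k0] by auto
    qed simp
    then have "real (ndiv k) \<le> 2 ^ card (prime_factors k)" by (simp add: ndiv_def card_Pow flip: of_nat_power)
    also have "\<dots> = (\<Prod>p\<in>prime_factors k. 2)" by simp
    also have "\<dots> \<le> (\<Prod>p\<in>prime_factors k. (if p \<le> P then 2 else 1) * real p powr \<epsilon>)"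
    proof (rule prod_mono)
      fix p assume "p \<in> prime_factors k"
      then have "prime p" by (simp add: in_prime_factors_iff)
      then have "1 \<le> real p powr \<epsilon>" using \<epsilon> prime_ge_1_nat[of p] by (intro ge_one_powr_ge_zero) auto
      then show "0 \<le> (2::real) \<and> 2 \<le> (if p \<le> P then 2 else 1) * real p powr \<epsilon>"
        using big[of p] by auto
    qed
    also have "\<dots> = (\<Prod>p\<in>prime_factors k. if p \<le> P then 2 else 1) * (\<Prod>p\<in>prime_factors k. real p powr \<epsilon>)"
      by (rule prod.distrib)
    also have "(\<Prod>p\<in>prime_factors k. real p powr \<epsilon>) = real (\<Prod>(prime_factors k)) powr \<epsilon>"
      by (simp add: prod_powr_distrib)
    also have "\<dots> = real k powr \<epsilon>" using squarefree_eq_prod_primes[OF k] by simp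
    also have "(\<Prod>p\<in>prime_factors k. if p \<le> P then 2 else 1) = (2::real) ^ card {p \<in> prime_factors k. p \<le> P}"
      by (subst prod.If_cases) (auto simp: Int_def)
    also have "\<dots> \<le> 2 ^ (P + 1)"
    proof (rule power_increasing)
      have "card {p \<in> prime_factors k. p \<le> P} \<le> card {..P}" by (intro card_mono) auto
      then show "card {p \<in> prime_factors k. p \<le> P} \<le> P + 1" by simp
    qed simp
    finally show ?thesis by (simp add: mult_right_mono)
  qed
  moreover have "(2::real) ^ (P + 1) \<ge> 1" by (rule one_le_power) simp
  ultimately show ?thesis using that by blast
qed

text \<open>The twist arises from cubefree moduli: \<open>cubefree_coset_reduction\<close> turns the
  phase modulo the square part into such a \<open>u\<close>.\<close>

definition modchar :: "nat \<Rightarrow> int set \<Rightarrow> (int \<Rightarrow> complex) \<Rightarrow> bool" where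
  "modchar q H u \<longleftrightarrow> (\<forall>x\<in>H. norm (u x) = 1) \<and> (\<forall>x\<in>H. \<forall>y\<in>H. u (x * y mod int q) = u x * u y)"

lemma modchar_one: "modchar q H (\<lambda>_. 1)" by (simp add: modchar_def)

lemma cong_cancel_gcd:
  fixes c x y :: int
  assumes "[c * x = c * y] (mod int Q)" "Q > 0"
  shows "[x = y] (mod int (Q div nat (gcd c (int Q))))"
proof -
  define g where "g = gcd c (int Q)"
  have g: "g > 0" "g dvd c" "g dvd int Q" using assms(2) by (auto simp: g_def)
  obtain c' where c': "c = g * c'" using g by auto
  obtain Q' where Q': "int Q = g * Q'" using g by auto
  have "coprime (c div g) (int Q div g)" unfolding g_def using assms(2) by (intro div_gcd_coprime) auto
  then have cop: "coprime c' Q'" using g by (simp add: c' Q')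
  have "g * Q' dvd g * (c' * (x - y))" using assms(1) by (simp add: cong_iff_dvd_diff c' Q' algebra_simps)
  then have "Q' dvd c' * (x - y)" using g by simp
  then have "Q' dvd x - y" using cop by (simp add: coprime_commute coprime_dvd_mult_right_iff)
  moreover have "int (Q div nat g) = Q'" using g by (simp add: zdiv_int Q')
  ultimately show ?thesis by (simp add: cong_iff_dvd_diff g_def)
qed

lemma gcd_quot:
  assumes "Q > 0"
  shows "nat (gcd c (int Q)) dvd Q" "Q div (Q div nat (gcd c (int Q))) = nat (gcd c (int Q))" "Q div nat (gcd c (int Q)) dvd Q"
proof -
  show d: "nat (gcd c (int Q)) dvd Q" by (simp add: nat_dvd_iff)
  then show "Q div (Q div nat (gcd c (int Q))) = nat (gcd c (int Q))" using assms by (simp add: div_div_eq_right)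
  show "Q div nat (gcd c (int Q)) dvd Q" using d by (metis dvd_div_mult_self dvd_triv_left)
qed

text \<open>The substitution \<open>h \<mapsto> h1 h\<close> pulls out \<open>u h1\<close>, of
  absolute value 1. One large coefficient therefore brings with it a whole orbit of equally large
  ones.\<close>

lemma twisted_shift:
  assumes H: "modgrp q H" and Q: "Q dvd q" and u: "modchar q H u" and h1: "h1 \<in> H"
  shows "norm (\<Sum>h\<in>H. u h * ue (of_int ((\<alpha> * h1) * h + (\<beta> * minv q h1) * minv q h) / of_nat Q)) =
    norm (\<Sum>h\<in>H. u h * ue (of_int (\<alpha> * h + \<beta> * minv q h) / of_nat Q))"
proof -
  have "(\<Sum>h\<in>H. u h * ue (of_int (\<alpha> * h + \<beta> * minv q h) / of_nat Q)) =
      (\<Sum>h\<in>H. u (h1 * h mod int q) * ue (of_int (\<alpha> * (h1 * h mod int q) + \<beta> * minv q (h1 * h mod int q)) / of_nat Q))"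
    by (rule sum.reindex_bij_betw[OF modgrp_mult_bij[OF H h1], symmetric])
  also have "\<dots> = (\<Sum>h\<in>H. u h1 * (u h * ue (of_int ((\<alpha> * h1) * h + (\<beta> * minv q h1) * minv q h) / of_nat Q)))"
  proof (rule sum.cong[OF refl])
    fix h assume h: "h \<in> H"
    have "[minv q (h1 * h mod int q) = minv q h1 * minv q h] (mod int q)"
    proof (rule cong_trans[OF minv_cong_arg minv_mult])
      show "coprime (h1 * h mod int q) (int q)" using modgrp_coprime[OF H modgrp_mult[OF H h1 h]] .
    qed (use modgrp_coprime[OF H] h h1 in auto)
    then have "[minv q (h1 * h mod int q) = minv q h1 * minv q h] (mod int Q)" using Q by (rule cong_dvd_mod)
    then have "[\<alpha> * (h1 * h mod int q) + \<beta> * minv q (h1 * h mod int q) = \<alpha> * (h1 * h) + \<beta> * (minv q h1 * minv q h)] (mod int Q)"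
      using mod_cong_dvd[OF Q] by (intro cong_add cong_scalar_left)
    then have "ue (of_int (\<alpha> * (h1 * h mod int q) + \<beta> * minv q (h1 * h mod int q)) / of_nat Q) =
        ue (of_int (\<alpha> * (h1 * h) + \<beta> * (minv q h1 * minv q h)) / of_nat Q)" by (rule ue_cong)
    then show "u (h1 * h mod int q) * ue (of_int (\<alpha> * (h1 * h mod int q) + \<beta> * minv q (h1 * h mod int q)) / of_nat Q) =
        u h1 * (u h * ue (of_int ((\<alpha> * h1) * h + (\<beta> * minv q h1) * minv q h) / of_nat Q))"
      using u h h1 by (simp add: modchar_def mult.assoc)
  qed
  also have "\<dots> = u h1 * (\<Sum>h\<in>H. u h * ue (of_int ((\<alpha> * h1) * h + (\<beta> * minv q h1) * minv q h) / of_nat Q))"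
    by (rule sum_distrib_left[symmetric])
  finally have eq: "(\<Sum>h\<in>H. u h * ue (of_int (\<alpha> * h + \<beta> * minv q h) / of_nat Q)) = \<dots>" .
  have "norm (u h1) = 1" using u h1 by (simp add: modchar_def)
  then show ?thesis unfolding eq norm_mult by (simp only: mult_1)
qed

text \<open>Parseval over all frequencies modulo \<open>Q\<close> bounds the total by
  \<open>Q |H| |kern Q H|\<close>, while the orbit of \<open>c\<close> holds at least
  \<open>|red Q H| / gcd c Q\<close> frequencies of equal size. The bound saves something as soon as
  \<open>|red Q H|\<close> is well above the square root of \<open>Q\<close> and the gcd is
  bounded.\<close>

lemma line_twisted:
  fixes c :: int
  assumes H: "modgrp q H" and Q: "Q dvd q" and u: "modchar q H u"
  shows "(norm (\<Sum>h\<in>H. u h * ue (of_int (c * h) / of_nat Q)))\<^sup>2 * (real (card (red Q H)))\<^sup>2 \<le>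
    real (nat (gcd c (int Q))) * real Q * (real (card H))\<^sup>2"
proof -
  define S where "S = (\<lambda>\<xi>. \<Sum>h\<in>H. u h * ue (of_int (\<xi> * h) / of_nat Q))"
  define T where "T = norm (S c)"
  define g where "g = nat (gcd c (int Q))"
  have Q0: "Q > 0" using modgrp_pos[OF H] Q by (rule dvd_pos_nat)
  have fH: "finite H" by (rule modgrp_finite[OF H])
  have nu: "norm (u h) = 1" if "h \<in> H" for h using u that by (simp add: modchar_def)
  have "(\<Sum>\<xi>\<in>{0..<int Q}. complex_of_real ((norm (S \<xi>))\<^sup>2)) =
      (\<Sum>\<xi>\<in>{0..<int Q}. \<Sum>x\<in>H. \<Sum>y\<in>H. (u x * cnj (u y)) * ue (of_int (\<xi> * (x - y)) / of_nat Q))"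
  proof (rule sum.cong[OF refl])
    fix \<xi>
    have "ue (of_int (\<xi> * x) / of_nat Q) * cnj (ue (of_int (\<xi> * y) / of_nat Q)) = ue (of_int (\<xi> * (x - y)) / of_nat Q)" for x y
      by (simp add: cnj_ue diff_divide_distrib right_diff_distrib flip: ue_add)
    then show "complex_of_real ((norm (S \<xi>))\<^sup>2) = (\<Sum>x\<in>H. \<Sum>y\<in>H. (u x * cnj (u y)) * ue (of_int (\<xi> * (x - y)) / of_nat Q))"
      by (simp add: complex_norm_square S_def sum_product mult_ac del: of_real_power)
  qed
  also have "\<dots> = (\<Sum>x\<in>H. \<Sum>y\<in>H. \<Sum>\<xi>\<in>{0..<int Q}. (u x * cnj (u y)) * ue (of_int (\<xi> * (x - y)) / of_nat Q))"
    by (subst sum.swap, rule sum.cong[OF refl], subst sum.swap) simp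
  also have "\<dots> = (\<Sum>x\<in>H. \<Sum>y\<in>H. (u x * cnj (u y)) * (if [x = y] (mod int Q) then of_nat Q else 0))"
    by (simp only: sum_distrib_left[symmetric] sum_ue[OF Q0] cong_iff_dvd_diff)
  finally have eq: "complex_of_real (\<Sum>\<xi>\<in>{0..<int Q}. (norm (S \<xi>))\<^sup>2) = \<dots>" by simp
  have "(\<Sum>\<xi>\<in>{0..<int Q}. (norm (S \<xi>))\<^sup>2) = norm (complex_of_real (\<Sum>\<xi>\<in>{0..<int Q}. (norm (S \<xi>))\<^sup>2))"
    by (simp only: norm_of_real abs_of_nonneg sum_nonneg zero_le_power2)
  also have "\<dots> \<le> (\<Sum>x\<in>H. \<Sum>y\<in>H. norm ((u x * cnj (u y)) * (if [x = y] (mod int Q) then of_nat Q else 0)))"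
    unfolding eq by (intro order_trans[OF norm_sum] sum_mono norm_sum)
  also have "\<dots> = (\<Sum>x\<in>H. \<Sum>y\<in>H. if [x = y] (mod int Q) then real Q else 0)"
    using nu by (intro sum.cong refl) (simp add: norm_mult)
  also have "\<dots> = (\<Sum>p\<in>H \<times> H. if [fst p = snd p] (mod int Q) then real Q else 0)"
    by (simp add: sum.cartesian_product case_prod_beta)
  also have "\<dots> = real Q * card {p \<in> H \<times> H. [fst p = snd p] (mod int Q)}"
    using fH by (simp add: sum.If_cases Collect_conj_eq mult.commute)
  also have "{p \<in> H \<times> H. [fst p = snd p] (mod int Q)} = {(x, y). x \<in> H \<and> y \<in> H \<and> [x = y] (mod int Q)}" by auto
  also have "card \<dots> = card H * card (kern Q H)" by (rule card_cong_pairs[OF H Q])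
  finally have pars: "(\<Sum>\<xi>\<in>{0..<int Q}. (norm (S \<xi>))\<^sup>2) \<le> real Q * (card H * card (kern Q H))" by simp
  define O' where "O' = (\<lambda>r. c * r mod int Q) ` red Q H"
  have fR: "finite (red Q H)" using fH by (rule finite_red)
  have OT: "norm (S \<xi>) = T" if "\<xi> \<in> O'" for \<xi>
  proof -
    obtain h1 where h1: "h1 \<in> H" "\<xi> = c * (h1 mod int Q) mod int Q" using \<open>\<xi> \<in> O'\<close> by (auto simp: O'_def red_def)
    have "[\<xi> * h = (c * h1) * h] (mod int Q)" for h
      by (simp add: h1 Cong.cong_def mod_mult_left_eq mod_mult_right_eq)
    then have "S \<xi> = (\<Sum>h\<in>H. u h * ue (of_int ((c * h1) * h) / of_nat Q))"
      unfolding S_def by (intro sum.cong refl arg_cong2[of _ _ _ _ "(*)"] ue_cong)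
    then show ?thesis using twisted_shift[OF H Q u h1(1), of c 0] by (simp add: T_def S_def)
  qed
  have "card (red Q H) = (\<Sum>y\<in>O'. card {r \<in> red Q H. c * r mod int Q = y})"
    unfolding O'_def by (rule sum_card_fibres[OF fR, symmetric])
  also have "\<dots> \<le> (\<Sum>y\<in>O'. g)"
  proof (rule sum_mono)
    fix y assume "y \<in> O'"
    then obtain r1 where r1: "r1 \<in> red Q H" "y = c * r1 mod int Q" by (auto simp: O'_def)
    have "{r \<in> red Q H. c * r mod int Q = y} \<subseteq> {z \<in> {0..<int Q}. [z = r1] (mod int (Q div g))}"
    proof
      fix r assume "r \<in> {r \<in> red Q H. c * r mod int Q = y}"
      then have r: "r \<in> red Q H" "[c * r = c * r1] (mod int Q)" by (auto simp: r1 Cong.cong_def)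
      then show "r \<in> {z \<in> {0..<int Q}. [z = r1] (mod int (Q div g))}"
        using cong_cancel_gcd[OF r(2) Q0] Q0 by (auto simp: red_def g_def)
    qed
    then have "card {r \<in> red Q H. c * r mod int Q = y} \<le> card {z \<in> {0..<int Q}. [z = r1] (mod int (Q div g))}"
      by (intro card_mono) (auto intro: finite_subset[of _ "{0..<int Q}"])
    also have "\<dots> \<le> Q div (Q div g)" unfolding g_def by (intro card_cong_class_le gcd_quot Q0)
    also have "\<dots> = g" unfolding g_def by (rule gcd_quot(2)[OF Q0])
    finally show "card {r \<in> red Q H. c * r mod int Q = y} \<le> g" .
  qed
  finally have cO: "real (card (red Q H)) \<le> card O' * g" by (simp flip: of_nat_mult)
  have "(\<Sum>\<xi>\<in>O'. (norm (S \<xi>))\<^sup>2) \<le> (\<Sum>\<xi>\<in>{0..<int Q}. (norm (S \<xi>))\<^sup>2)"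
    using Q0 by (intro sum_mono2) (auto simp: O'_def)
  then have "card O' * T\<^sup>2 \<le> real Q * (card H * card (kern Q H))" using pars OT by simp
  then have "(g * card (red Q H)) * (card O' * T\<^sup>2) \<le> (g * card (red Q H)) * (real Q * (card H * card (kern Q H)))"
    by (intro mult_left_mono) auto
  moreover have "(T\<^sup>2 * card (red Q H)) * card (red Q H) \<le> (T\<^sup>2 * card (red Q H)) * (card O' * g)"
    using cO by (intro mult_left_mono) auto
  moreover have "real (card H) = card (red Q H) * card (kern Q H)" using card_red_kern[OF H Q] by simp
  then have "(g * card (red Q H)) * (real Q * (card H * card (kern Q H))) = g * real Q * (real (card H))\<^sup>2"
    by (simp add: power2_eq_square mult_ac)
  moreover have "(T\<^sup>2 * card (red Q H)) * (card O' * g) = (g * card (red Q H)) * (card O' * T\<^sup>2)" by simp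
  ultimately have "(T\<^sup>2 * card (red Q H)) * card (red Q H) \<le> g * real Q * (real (card H))\<^sup>2" by linarith
  then have "T\<^sup>2 * (real (card (red Q H)))\<^sup>2 \<le> g * real Q * (real (card H))\<^sup>2" by (simp only: power2_eq_square mult.assoc)
  then show ?thesis by (simp add: T_def S_def g_def)
qed

text \<open>In lowest terms \<open>c / Q = c' / d\<close> the gcd in \<open>line_twisted\<close>
  becomes 1, and the hypothesis \<open>rob\<close> at the divisor \<open>d\<close> saves
  \<open>d^\<kappa>\<close>. Any divisor can occur as such a denominator, hence the form of
  \<open>rob\<close>.\<close>

lemma untwisted_line:
  fixes \<kappa> :: real
  assumes H: "modgrp q H" and Q: "Q dvd q" and \<kappa>: "\<kappa> > 0"
    and rob: "\<And>d. d dvd Q \<Longrightarrow> real d powr (1 / 2 + \<kappa>) \<le> card (red d H)"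
  shows "norm (\<Sum>h\<in>H. ue (of_int (c * h) / of_nat Q)) \<le> real (Q div nat (gcd c (int Q))) powr (- \<kappa>) * card H"
proof -
  have Q0: "Q > 0" using modgrp_pos[OF H] Q by (rule dvd_pos_nat)
  define g where "g = gcd c (int Q)"
  define d where "d = Q div nat g"
  have g: "g > 0" "g dvd c" "g dvd int Q" using Q0 by (auto simp: g_def)
  obtain c' where c': "c = g * c'" using g by auto
  have dQ: "d dvd Q" using gcd_quot(3)[OF Q0] by (simp add: d_def g_def)
  then have d0: "d > 0" using Q0 dvd_pos_nat by blast
  have Qd: "int Q = g * int d" using g by (simp add: d_def zdiv_int)
  have "coprime (c div g) (int Q div g)" unfolding g_def using Q0 by (intro div_gcd_coprime) auto
  then have cop: "gcd c' (int d) = 1" using g by (simp add: c' Qd)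
  have e: "ue (of_int (c * h) / of_nat Q) = ue (of_int (c' * h) / of_nat d)" for h
  proof -
    have "real Q = of_int g * real d" using Qd by (metis of_int_mult of_int_of_nat_eq)
    then show ?thesis using g by (simp add: c')
  qed
  define T where "T = norm (\<Sum>h\<in>H. ue (of_int (c * h) / of_nat Q))"
  have T: "T = norm (\<Sum>h\<in>H. 1 * ue (of_int (c' * h) / of_nat d))" unfolding T_def e by simp
  have "T\<^sup>2 * (real (card (red d H)))\<^sup>2 \<le> real d * (real (card H))\<^sup>2"
    using line_twisted[OF H dvd_trans[OF dQ Q] modchar_one, of c'] unfolding T by (simp only: cop) simp
  moreover have "T\<^sup>2 * (real d powr (1 / 2 + \<kappa>))\<^sup>2 \<le> T\<^sup>2 * (real (card (red d H)))\<^sup>2"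
    using rob[OF dQ] by (intro mult_left_mono power_mono) auto
  ultimately have "T\<^sup>2 * (real d powr (1 / 2 + \<kappa>))\<^sup>2 \<le> real d * (real (card H))\<^sup>2" by linarith
  moreover have "(real d powr (1 / 2 + \<kappa>))\<^sup>2 = real d * (real d powr \<kappa>)\<^sup>2"
    using d0 by (simp add: powr_add power_mult_distrib powr_half_sqrt)
  ultimately have "real d * (T * real d powr \<kappa>)\<^sup>2 \<le> real d * (real (card H))\<^sup>2"
    by (simp add: power_mult_distrib mult_ac)
  then have "(T * real d powr \<kappa>)\<^sup>2 \<le> (real (card H))\<^sup>2" using d0 by simp
  then have "T * real d powr \<kappa> \<le> card H" by (rule power2_le_imp_le) simp
  then have "T \<le> card H / real d powr \<kappa>" using d0 by (simp add: pos_le_divide_eq)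
  then show ?thesis using d0 by (simp add: T_def d_def g_def powr_minus field_simps)
qed

text \<open>In the difference of two frequencies of one row \<open>b\<close> cancels, so
  \<open>bessel_pairs\<close> yields large line sums, whose denominators are at most
  \<open>D\<close> by \<open>untwisted_line\<close>. A given \<open>i\<close> has at most
  \<open>D^2\<close> such partners: there are at most \<open>D\<close> divisors \<open>d\<close>,
  each allowing at most \<open>d\<close> residues. What matters later is that the bound does not
  depend on \<open>Q\<close> or \<open>b\<close>.\<close>

lemma row_bound:
  fixes \<kappa> \<mu> :: real
  assumes H: "modgrp q H" and Q: "Q dvd q" and \<kappa>: "\<kappa> > 0"
    and rob: "\<And>d. d dvd Q \<Longrightarrow> real d powr (1 / 2 + \<kappa>) \<le> card (red d H)" and \<mu>: "\<mu> > 0"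
  shows "card {a \<in> {0..<int Q}. \<mu> * card H \<le> norm (\<Sum>h\<in>H. ue (of_int (a * h + b * minv q h) / of_nat Q))} \<le>
    2 * ((2 / \<mu>\<^sup>2) powr (1 / \<kappa>))\<^sup>2 / \<mu>\<^sup>2"
proof -
  have Q0: "Q > 0" using modgrp_pos[OF H] Q by (rule dvd_pos_nat)
  define V where "V = {a \<in> {0..<int Q}. \<mu> * card H \<le> norm (\<Sum>h\<in>H. ue (of_int (a * h + b * minv q h) / of_nat Q))}"
  define D where "D = (2 / \<mu>\<^sup>2) powr (1 / \<kappa>)"
  have D0: "D \<ge> 0" by (simp add: D_def)
  have fV: "finite V" by (rule finite_subset[of _ "{0..<int Q}"]) (auto simp: V_def)
  have fH: "finite H" by (rule modgrp_finite[OF H])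
  have cH: "card H > 0" by (rule modgrp_card[OF H])
  then have Hne: "H \<noteq> {}" by auto
  define f where "f = (\<lambda>a h. ue (of_int (a * h + b * minv q h) / of_nat Q))"
  define P where "P = {(i, j). i \<in> V \<and> j \<in> V \<and> \<mu>\<^sup>2 / 2 * card H \<le> norm (\<Sum>h\<in>H. f i h * cnj (f j h))}"
  have "\<mu>\<^sup>2 / 2 * (card V)\<^sup>2 \<le> card P"
    unfolding P_def using \<mu> by (intro bessel_pairs[of V H "\<lambda>_. 1", OF fV fH Hne]) (auto simp: f_def V_def)
  also have "card P \<le> card (SIGMA i:V. \<Union>d\<in>{d. d dvd Q \<and> real d \<le> D}. {y \<in> {0..<int Q}. [y = i] (mod int (Q div d))})"
  proof (rule card_mono)
    show "P \<subseteq> (SIGMA i:V. \<Union>d\<in>{d. d dvd Q \<and> real d \<le> D}. {y \<in> {0..<int Q}. [y = i] (mod int (Q div d))})"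
    proof (rule subrelI)
      fix i j assume "(i, j) \<in> P"
      then have ij: "i \<in> V" "j \<in> V" and big: "\<mu>\<^sup>2 / 2 * card H \<le> norm (\<Sum>h\<in>H. f i h * cnj (f j h))" by (auto simp: P_def)
      have "f i h * cnj (f j h) = ue (of_int ((i - j) * h) / of_nat Q)" for h
        by (simp add: f_def cnj_ue diff_divide_distrib add_divide_distrib left_diff_distrib flip: ue_add)
      then have "\<mu>\<^sup>2 / 2 * card H \<le> norm (\<Sum>h\<in>H. ue (of_int ((i - j) * h) / of_nat Q))" using big by simp
      also note untwisted_line[OF H Q \<kappa> rob, of "i - j"]
      finally have le: "\<mu>\<^sup>2 / 2 * card H \<le> real (Q div nat (gcd (i - j) (int Q))) powr (- \<kappa>) * card H" .
      define d where "d = Q div nat (gcd (i - j) (int Q))"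
      have dQ: "d dvd Q" using gcd_quot(3)[OF Q0] by (simp add: d_def)
      then have d0: "real d > 0" using Q0 dvd_pos_nat by auto
      have "\<mu>\<^sup>2 / 2 \<le> real d powr (- \<kappa>)" using le cH by (simp add: d_def)
      then have "real d powr \<kappa> \<le> 2 / \<mu>\<^sup>2" using \<mu> d0 by (simp add: powr_minus field_simps)
      then have "(real d powr \<kappa>) powr (1 / \<kappa>) \<le> D" unfolding D_def using \<kappa> by (intro powr_mono2) auto
      then have dD: "real d \<le> D" using \<kappa> d0 by (simp add: powr_powr)
      have "int (Q div d) dvd j - i"
      proof -
        have "Q div d = nat (gcd (i - j) (int Q))" unfolding d_def by (rule gcd_quot(2)[OF Q0])
        then have "int (Q div d) dvd i - j" by simp
        then show ?thesis by (simp add: dvd_diff_commute)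
      qed
      then have "j \<in> (\<Union>d\<in>{d. d dvd Q \<and> real d \<le> D}. {y \<in> {0..<int Q}. [y = i] (mod int (Q div d))})"
        using dQ dD ij by (auto simp: V_def cong_iff_dvd_diff)
      then show "(i, j) \<in> (SIGMA i:V. \<Union>d\<in>{d. d dvd Q \<and> real d \<le> D}. {y \<in> {0..<int Q}. [y = i] (mod int (Q div d))})"
        using ij(1) by (rule SigmaI[rotated])
    qed
    have "finite {d. d dvd Q \<and> real d \<le> D}" using Q0 by (auto intro: finite_subset[OF _ finite_divisors_nat])
    moreover have "finite {y \<in> {0..<int Q}. [y = i] (mod int (Q div d))}" for i d by (auto intro: finite_subset[of _ "{0..<int Q}"])
    ultimately show "finite (SIGMA i:V. \<Union>d\<in>{d. d dvd Q \<and> real d \<le> D}. {y \<in> {0..<int Q}. [y = i] (mod int (Q div d))})"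
      using fV by auto
  qed
  also have "real (card (SIGMA i:V. \<Union>d\<in>{d. d dvd Q \<and> real d \<le> D}. {y \<in> {0..<int Q}. [y = i] (mod int (Q div d))})) \<le> card V * D\<^sup>2"
  proof -
    define W where "W = {d. d dvd Q \<and> real d \<le> D}"
    have fW: "finite W" using Q0 by (auto simp: W_def intro: finite_subset[OF _ finite_divisors_nat])
    have "card W \<le> card {1..nat \<lfloor>D\<rfloor>}"
    proof (rule card_mono)
      show "W \<subseteq> {1..nat \<lfloor>D\<rfloor>}"
      proof
        fix d assume d: "d \<in> W"
        then have "d > 0" using Q0 dvd_pos_nat by (auto simp: W_def)
        moreover have "d \<le> nat \<lfloor>D\<rfloor>" using d by (simp add: W_def le_nat_floor)
        ultimately show "d \<in> {1..nat \<lfloor>D\<rfloor>}" by simp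
      qed
    qed simp
    then have cW: "real (card W) \<le> D" using D0 by (simp add: le_nat_floor) linarith
    have fib: "real (card (\<Union>d\<in>W. {y \<in> {0..<int Q}. [y = i] (mod int (Q div d))})) \<le> D * D" for i
    proof -
      have "card (\<Union>d\<in>W. {y \<in> {0..<int Q}. [y = i] (mod int (Q div d))}) \<le> (\<Sum>d\<in>W. card {y \<in> {0..<int Q}. [y = i] (mod int (Q div d))})"
        by (rule card_UN_le[OF fW])
      also have "\<dots> \<le> (\<Sum>d\<in>W. d)"
      proof (rule sum_mono)
        fix d assume d: "d \<in> W"
        have "card {y \<in> {0..<int Q}. [y = i] (mod int (Q div d))} \<le> Q div (Q div d)"
          using d Q0 by (intro card_cong_class_le) (auto simp: W_def)
        also have "\<dots> = d" using d Q0 by (auto simp: W_def div_div_eq_right)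
        finally show "card {y \<in> {0..<int Q}. [y = i] (mod int (Q div d))} \<le> d" .
      qed
      finally have "real (card (\<Union>d\<in>W. {y \<in> {0..<int Q}. [y = i] (mod int (Q div d))})) \<le> real (\<Sum>d\<in>W. d)"
        by (rule of_nat_mono)
      also have "\<dots> = (\<Sum>d\<in>W. real d)" by simp
      also have "\<dots> \<le> (\<Sum>d\<in>W. D)" by (intro sum_mono) (auto simp: W_def)
      also have "\<dots> = card W * D" by simp
      also have "\<dots> \<le> D * D" using cW D0 by (rule mult_right_mono)
      finally show ?thesis .
    qed
    have fin2: "finite (\<Union>d\<in>W. {y \<in> {0..<int Q}. [y = i] (mod int (Q div d))})" for i
      using fW by (auto intro: finite_subset[of _ "{0..<int Q}"])
    have "real (card (SIGMA i:V. \<Union>d\<in>W. {y \<in> {0..<int Q}. [y = i] (mod int (Q div d))})) =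
        (\<Sum>i\<in>V. real (card (\<Union>d\<in>W. {y \<in> {0..<int Q}. [y = i] (mod int (Q div d))})))"
      using fV fin2 by (simp add: card_SigmaI)
    also have "\<dots> \<le> (\<Sum>i\<in>V. D * D)" by (intro sum_mono fib)
    finally show ?thesis by (simp add: W_def power2_eq_square)
  qed
  finally have le: "real (card V) * (\<mu>\<^sup>2 * card V) \<le> real (card V) * (2 * D\<^sup>2)" by (simp add: power2_eq_square mult_ac)
  have "real (card V) \<le> 2 * D\<^sup>2 / \<mu>\<^sup>2"
  proof (cases "card V = 0")
    case False
    then have "\<mu>\<^sup>2 * card V \<le> 2 * D\<^sup>2" using le by (simp only: mult_le_cancel_left_pos of_nat_0_less_iff neq0_conv)
    then show ?thesis using \<mu> by (simp add: field_simps)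
  qed simp
  then show ?thesis by (simp add: V_def D_def)
qed

text \<open>By Bezout the product of the two gcds is a combination of \<open>x y\<close> and
  \<open>k\<close>.\<close>

lemma gcd_mult_le:
  fixes x y k :: int assumes "k > 0"
  shows "nat (gcd (x * y) k) \<le> nat (gcd x k) * nat (gcd y k)"
proof -
  obtain a b where ab: "a * x + b * k = gcd x k" using bezout_int by blast
  obtain c d where cd: "c * y + d * k = gcd y k" using bezout_int by blast
  have "gcd x k * gcd y k = (a * x + b * k) * (c * y + d * k)" using ab cd by simp
  also have "\<dots> = (a * c) * (x * y) + (a * x * d + b * (c * y + d * k)) * k" by (simp add: algebra_simps)
  finally have "gcd (x * y) k dvd gcd x k * gcd y k" by (metis dvd_add dvd_mult gcd_dvd1 gcd_dvd2)
  moreover have "gcd x k * gcd y k > 0" using assms by simp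
  ultimately have "gcd (x * y) k \<le> gcd x k * gcd y k" by (rule zdvd_imp_le)
  then show ?thesis by (simp add: nat_mult_distrib[symmetric] nat_le_eq_zle)
qed

text \<open>Put \<open>s = r0 - r0'\<close>. Multiplied by \<open>\<alpha> r r' r0 r0'\<close>, the
  condition on the inverses becomes
  \<open>\<alpha> \<beta> s r r' = \<alpha> \<beta> s r0 r0'\<close> with the help of the other one,
  which also replaces \<open>\<alpha> r'\<close> by \<open>\<alpha> (r - s)\<close>. The resulting
  quadratic \<open>r (r - s) - r0 r0'\<close> has the known root \<open>r0\<close>, and its other
  root is \<open>- r0'\<close>.\<close>

lemma hyperbola_difference:
  fixes \<alpha> \<beta> r r' r0 r0' i i' i0 i0' :: int
  assumes inv: "[r * i = 1] (mod m)" "[r' * i' = 1] (mod m)" "[r0 * i0 = 1] (mod m)" "[r0' * i0' = 1] (mod m)"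
    and a: "[\<alpha> * (r - r') = \<alpha> * (r0 - r0')] (mod m)" and b: "[\<beta> * (i - i') = \<beta> * (i0 - i0')] (mod m)"
  shows "m dvd (\<alpha> * \<beta> * (r0 - r0')) * (r - r0) * (r + r0')"
proof -
  define s where "s = r0 - r0'"
  have diff: "[x * y * (j' - j) = x - y] (mod m)" if "[x * j = 1] (mod m)" "[y * j' = 1] (mod m)" for x y j j' :: int
  proof -
    have "[x * (y * j') - y * (x * j) = x * 1 - y * 1] (mod m)" using that by (intro cong_diff cong_scalar_left)
    then show ?thesis by (simp add: algebra_simps)
  qed
  have c1: "[r * r' * (i' - i) = r - r'] (mod m)" using diff inv by blast
  have c0: "[r0 * r0' * (i0' - i0) = s] (mod m)" unfolding s_def using diff inv by blast
  have b': "[\<beta> * (i0' - i0) = \<beta> * (i' - i)] (mod m)"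
    using cong_minus_minus_iff[of "\<beta> * (i - i')" "\<beta> * (i0 - i0')" m] b by (simp add: algebra_simps cong_sym_eq)
  have a': "[\<alpha> * (r - r') = \<alpha> * s] (mod m)" using a by (simp add: s_def)
  have "[(\<alpha> * \<beta> * (r * r')) * s = (\<alpha> * \<beta> * (r * r')) * (r0 * r0' * (i0' - i0))] (mod m)"
    using c0 by (intro cong_scalar_left) (rule cong_sym)
  also have "(\<alpha> * \<beta> * (r * r')) * (r0 * r0' * (i0' - i0)) = (\<alpha> * (r * r') * (r0 * r0')) * (\<beta> * (i0' - i0))"
    by (simp add: mult_ac)
  also have "[\<dots> = (\<alpha> * (r * r') * (r0 * r0')) * (\<beta> * (i' - i))] (mod m)" using b' by (rule cong_scalar_left)
  also have "(\<alpha> * (r * r') * (r0 * r0')) * (\<beta> * (i' - i)) = (\<alpha> * \<beta> * (r0 * r0')) * (r * r' * (i' - i))" by (simp add: mult_ac)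
  also have "[\<dots> = (\<alpha> * \<beta> * (r0 * r0')) * (r - r')] (mod m)" using c1 by (rule cong_scalar_left)
  also have "(\<alpha> * \<beta> * (r0 * r0')) * (r - r') = (\<beta> * (r0 * r0')) * (\<alpha> * (r - r'))" by (simp add: mult_ac)
  also have "[\<dots> = (\<beta> * (r0 * r0')) * (\<alpha> * s)] (mod m)" using a' by (rule cong_scalar_left)
  finally have 1: "[(\<alpha> * \<beta> * (r * r')) * s = (\<beta> * (r0 * r0')) * (\<alpha> * s)] (mod m)" .
  have "[\<alpha> * r - \<alpha> * (r - r') = \<alpha> * r - \<alpha> * s] (mod m)" using a' by (intro cong_diff) auto
  then have "[(\<beta> * s * r) * (\<alpha> * r - \<alpha> * (r - r')) = (\<beta> * s * r) * (\<alpha> * r - \<alpha> * s)] (mod m)" by (rule cong_scalar_left)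
  moreover have "(\<beta> * s * r) * (\<alpha> * r - \<alpha> * (r - r')) = (\<alpha> * \<beta> * (r * r')) * s" by (simp add: algebra_simps)
  ultimately have "[(\<beta> * s * r) * (\<alpha> * r - \<alpha> * s) = (\<beta> * (r0 * r0')) * (\<alpha> * s)] (mod m)"
    using 1 by (metis cong_sym cong_trans)
  then have "m dvd (\<beta> * s * r) * (\<alpha> * r - \<alpha> * s) - (\<beta> * (r0 * r0')) * (\<alpha> * s)" by (simp only: cong_iff_dvd_diff)
  moreover have "(\<beta> * s * r) * (\<alpha> * r - \<alpha> * s) - (\<beta> * (r0 * r0')) * (\<alpha> * s) = (\<alpha> * \<beta> * s) * (r - r0) * (r + r0')"
    by (simp add: s_def algebra_simps)
  ultimately show ?thesis by (simp only: s_def)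
qed

text \<open>By \<open>hyperbola_difference\<close>, \<open>r\<close> solves a quadratic congruence
  whose leading coefficient has gcd at most \<open>M * M * G\<close> with \<open>Q\<close>; the
  bound on \<open>gcd (r - r') Q\<close> keeps it from degenerating. Given \<open>r\<close>, the
  value of \<open>\<alpha> r'\<close> leaves at most \<open>M\<close> choices for \<open>r'\<close>,
  the third factor \<open>M\<close>.\<close>

lemma pair_multiplicity:
  assumes R: "modgrp Q R" and sf: "squarefree Q"
    and \<alpha>: "nat (gcd \<alpha> (int Q)) \<le> M" and \<beta>: "nat (gcd \<beta> (int Q)) \<le> M"
  shows "card {(r, r'). r \<in> R \<and> r' \<in> R \<and> nat (gcd (r - r') (int Q)) \<le> G \<and>
     \<alpha> * (r - r') mod int Q = A \<and> \<beta> * (minv Q r - minv Q r') mod int Q = B} \<le> M ^ 3 * G * (ndiv Q)\<^sup>2"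
proof -
  define S where "S = {(r, r'). r \<in> R \<and> r' \<in> R \<and> nat (gcd (r - r') (int Q)) \<le> G \<and>
     \<alpha> * (r - r') mod int Q = A \<and> \<beta> * (minv Q r - minv Q r') mod int Q = B}"
  have Q0: "Q > 0" by (rule modgrp_pos[OF R])
  have fR: "finite R" by (rule modgrp_finite[OF R])
  have fS: "finite S" by (rule finite_subset[of _ "R \<times> R"]) (use fR in \<open>auto simp: S_def\<close>)
  show ?thesis
    unfolding S_def[symmetric]
  proof (cases "S = {}")
    case False
    then obtain r0 r0' where "(r0, r0') \<in> S" by auto
    then have r0: "r0 \<in> R" "r0' \<in> R" "nat (gcd (r0 - r0') (int Q)) \<le> G"
      "\<alpha> * (r0 - r0') mod int Q = A" "\<beta> * (minv Q r0 - minv Q r0') mod int Q = B" by (auto simp: S_def)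
    have "card (fst ` S) \<le> (M * M * G) * (ndiv Q)\<^sup>2"
    proof (rule quad_count[OF sf])
      show "fst ` S \<subseteq> {0..<int Q}" using modgrp_range[OF R] by (auto simp: S_def)
      have "nat (gcd (\<alpha> * \<beta> * (r0 - r0')) (int Q)) \<le> nat (gcd (\<alpha> * \<beta>) (int Q)) * nat (gcd (r0 - r0') (int Q))"
        using Q0 by (intro gcd_mult_le) auto
      also have "\<dots> \<le> (nat (gcd \<alpha> (int Q)) * nat (gcd \<beta> (int Q))) * G"
        using Q0 r0(3) by (intro mult_le_mono gcd_mult_le) auto
      also have "\<dots> \<le> M * M * G" using \<alpha> \<beta> by (intro mult_le_mono) auto
      finally show "nat (gcd (\<alpha> * \<beta> * (r0 - r0')) (int Q)) \<le> M * M * G" .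
      fix r assume "r \<in> fst ` S"
      then obtain r' where r: "r \<in> R" "r' \<in> R" "\<alpha> * (r - r') mod int Q = A" "\<beta> * (minv Q r - minv Q r') mod int Q = B"
        by (auto simp: S_def)
      show "int Q dvd (\<alpha> * \<beta> * (r0 - r0')) * (r - r0) * (r + r0')"
        by (rule hyperbola_difference[OF modgrp_minv_cong[OF R r(1)] modgrp_minv_cong[OF R r(2)]
              modgrp_minv_cong[OF R r0(1)] modgrp_minv_cong[OF R r0(2)]])
           (use r r0 in \<open>simp_all add: Cong.cong_def\<close>)
    qed
    moreover have "card {s \<in> S. fst s = r} \<le> M" if "r \<in> fst ` S" for r
    proof -
      obtain s0 where s0: "s0 \<in> S" "r = fst s0" using \<open>r \<in> fst ` S\<close> by blast
      define r1 where "r1 = snd s0"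
      have r1: "(r, r1) \<in> S" using s0 by (simp add: r1_def)
      have "card {s \<in> S. fst s = r} \<le> card {z \<in> {0..<int Q}. [z = r1] (mod int (Q div nat (gcd \<alpha> (int Q))))}"
      proof (rule card_inj_on_le[of snd])
        show "inj_on snd {s \<in> S. fst s = r}" by (auto simp: inj_on_def)
        show "snd ` {s \<in> S. fst s = r} \<subseteq> {z \<in> {0..<int Q}. [z = r1] (mod int (Q div nat (gcd \<alpha> (int Q))))}"
        proof (rule image_subsetI)
          fix s assume "s \<in> {s \<in> S. fst s = r}"
          then have s: "(r, snd s) \<in> S" by auto
          have "[\<alpha> * (r - snd s) = \<alpha> * (r - r1)] (mod int Q)" using s r1 by (simp add: S_def Cong.cong_def)
          then have "[\<alpha> * r - \<alpha> * (r - snd s) = \<alpha> * r - \<alpha> * (r - r1)] (mod int Q)" by (intro cong_diff) auto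
          then have "[\<alpha> * snd s = \<alpha> * r1] (mod int Q)" by (simp add: algebra_simps)
          then show "snd s \<in> {z \<in> {0..<int Q}. [z = r1] (mod int (Q div nat (gcd \<alpha> (int Q))))}"
            using cong_cancel_gcd[OF _ Q0] s modgrp_range[OF R] by (auto simp: S_def)
        qed
      qed (auto intro: finite_subset[of _ "{0..<int Q}"])
      also have "\<dots> \<le> Q div (Q div nat (gcd \<alpha> (int Q)))" by (intro card_cong_class_le gcd_quot Q0)
      also have "\<dots> \<le> M" using \<alpha> gcd_quot(2)[OF Q0] by simp
      finally show ?thesis .
    qed
    then have "(\<Sum>y\<in>fst ` S. card {s \<in> S. fst s = y}) \<le> (\<Sum>y\<in>fst ` S. M)" by (rule sum_mono)
    then have "card S \<le> card (fst ` S) * M" using sum_card_fibres[OF fS, of fst] by simp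
    moreover have "card (fst ` S) * M \<le> ((M * M * G) * (ndiv Q)\<^sup>2) * M" using calculation(1) by (rule mult_le_mono1)
    ultimately have "card S \<le> ((M * M * G) * (ndiv Q)\<^sup>2) * M" by linarith
    also have "\<dots> = M ^ 3 * G * (ndiv Q)\<^sup>2" by (simp add: power3_eq_cube)
    finally show "card S \<le> M ^ 3 * G * (ndiv Q)\<^sup>2" .
  qed simp
qed

text \<open>The pairs congruent modulo a divisor \<open>d\<close> number
  \<open>|R|^2 / |red d R|\<close>, and \<open>rob\<close> makes the denominator at least the square
  root of \<open>d\<close>, hence of \<open>G\<close>. Summing over the divisors costs
  \<open>ndiv Q\<close>.\<close>

lemma close_pairs:
  fixes \<kappa> :: real
  assumes R: "modgrp Q R" and \<kappa>: "\<kappa> > 0" and G: "G > 0"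
    and rob: "\<And>d. d dvd Q \<Longrightarrow> real d powr (1 / 2 + \<kappa>) \<le> card (red d R)"
  shows "real (card {(r, r'). r \<in> R \<and> r' \<in> R \<and> nat (gcd (r - r') (int Q)) > G}) * sqrt G \<le> ndiv Q * (real (card R))\<^sup>2"
proof -
  have Q0: "Q > 0" by (rule modgrp_pos[OF R])
  have fR: "finite R" by (rule modgrp_finite[OF R])
  define W where "W = {d. d dvd Q \<and> d > G}"
  have fW: "finite W" using Q0 by (auto simp: W_def intro: finite_subset[OF _ finite_divisors_nat])
  define E where "E = (\<lambda>d. {(x, y). x \<in> R \<and> y \<in> R \<and> [x = y] (mod int d)})"
  have fE: "finite (E d)" for d by (rule finite_subset[of _ "R \<times> R"]) (use fR in \<open>auto simp: E_def\<close>)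
  have "{(r, r'). r \<in> R \<and> r' \<in> R \<and> nat (gcd (r - r') (int Q)) > G} \<subseteq> (\<Union>d\<in>W. E d)"
  proof (rule subrelI)
    fix r r' assume "(r, r') \<in> {(r, r'). r \<in> R \<and> r' \<in> R \<and> nat (gcd (r - r') (int Q)) > G}"
    then have "nat (gcd (r - r') (int Q)) \<in> W" "(r, r') \<in> E (nat (gcd (r - r') (int Q)))"
      by (auto simp: W_def E_def nat_dvd_iff cong_iff_dvd_diff)
    then show "(r, r') \<in> (\<Union>d\<in>W. E d)" by blast
  qed
  then have "card {(r, r'). r \<in> R \<and> r' \<in> R \<and> nat (gcd (r - r') (int Q)) > G} \<le> card (\<Union>d\<in>W. E d)"
    using fW fE by (intro card_mono) auto
  also have "\<dots> \<le> (\<Sum>d\<in>W. card (E d))" by (rule card_UN_le[OF fW])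
  finally have "real (card {(r, r'). r \<in> R \<and> r' \<in> R \<and> nat (gcd (r - r') (int Q)) > G}) \<le> real (\<Sum>d\<in>W. card (E d))"
    by (rule of_nat_mono)
  then have "real (card {(r, r'). r \<in> R \<and> r' \<in> R \<and> nat (gcd (r - r') (int Q)) > G}) * sqrt G \<le> real (\<Sum>d\<in>W. card (E d)) * sqrt G"
    by (rule mult_right_mono) simp
  also have "\<dots> = (\<Sum>d\<in>W. real (card (E d)) * sqrt G)" by (simp add: sum_distrib_right)
  also have "\<dots> \<le> (\<Sum>d\<in>W. (real (card R))\<^sup>2)"
  proof (rule sum_mono)
    fix d assume d: "d \<in> W"
    then have dQ: "d dvd Q" and dG: "d > G" by (auto simp: W_def)
    have "sqrt G \<le> sqrt d" using dG by simp
    also have "\<dots> = real d powr (1 / 2)" by (simp add: powr_half_sqrt)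
    also have "\<dots> \<le> real d powr (1 / 2 + \<kappa>)" using dG G \<kappa> by (intro powr_mono) auto
    also have "\<dots> \<le> card (red d R)" by (rule rob[OF dQ])
    finally have sq: "sqrt G \<le> card (red d R)" .
    have "card (E d) = card R * card (kern d R)" unfolding E_def by (rule card_cong_pairs[OF R dQ])
    then have "real (card (E d)) * sqrt G \<le> real (card R * card (kern d R)) * card (red d R)"
      using sq by (simp add: mult_left_mono)
    also have "\<dots> = real (card R) * real (card (red d R) * card (kern d R))" by simp
    also have "\<dots> = (real (card R))\<^sup>2" using card_red_kern[OF R dQ] by (simp only: power2_eq_square)
    finally show "real (card (E d)) * sqrt G \<le> (real (card R))\<^sup>2" .
  qed
  also have "\<dots> = card W * (real (card R))\<^sup>2" by simp
  also have "\<dots> \<le> ndiv Q * (real (card R))\<^sup>2"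
  proof (rule mult_right_mono)
    show "real (card W) \<le> real (ndiv Q)" unfolding ndiv_def W_def
      using Q0 by (intro of_nat_mono card_mono) auto
  qed simp
  finally show ?thesis .
qed

lemma red_red: "d dvd Q \<Longrightarrow> red d (red Q H) = red d H"
  by (simp add: red_def image_image mod_mod_cancel)

text \<open>One large coefficient spreads over the orbit \<open>(\<alpha> h, \<beta> h\<^sup>-\<^sup>1)\<close>, and Bessel makes many differences of
  orbit points large frequencies of the untwisted sum; \<open>row_bound\<close> limits their number. The parameter
  \<open>G\<close> separates off the pairs \<open>h, h'\<close> for which \<open>gcd (h - h', Q) \<ge> G\<close>.\<close>

lemma robust_inequality:
  fixes \<kappa> \<eta> :: real
  assumes H: "modgrp q H" and Q: "Q dvd q" and sf: "squarefree Q" and \<kappa>: "\<kappa> > 0"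
    and rob: "\<And>d. d dvd Q \<Longrightarrow> real d powr (1 / 2 + \<kappa>) \<le> card (red d H)" and u: "modchar q H u"
    and \<alpha>: "nat (gcd \<alpha> (int Q)) \<le> M" and \<beta>: "nat (gcd \<beta> (int Q)) \<le> M" and G: "G > 0" and \<eta>: "\<eta> > 0"
    and big: "\<eta> * card H \<le> norm (\<Sum>h\<in>H. u h * ue (of_int (\<alpha> * h + \<beta> * minv q h) / of_nat Q))"
    and \<mu>: "\<mu> = \<eta>\<^sup>2 / 2" and C: "C = 2 * ((2 / \<mu>\<^sup>2) powr (1 / \<kappa>))\<^sup>2 / \<mu>\<^sup>2"
  shows "\<mu> * (real (card (red Q H)))\<^sup>2 * sqrt G \<le> ndiv Q * (real (card (red Q H)))\<^sup>2 +
    real Q * C * (M ^ 3 * G * (ndiv Q)\<^sup>2) * sqrt G"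
proof -
  have Q0: "Q > 0" using modgrp_pos[OF H] Q by (rule dvd_pos_nat)
  define R where "R = red Q H"
  have R: "modgrp Q R" unfolding R_def by (rule modgrp_red[OF H Q])
  have fR: "finite R" by (rule modgrp_finite[OF R])
  have fH: "finite H" by (rule modgrp_finite[OF H])
  have "card H > 0" by (rule modgrp_card[OF H])
  then have Hne: "H \<noteq> {}" by auto
  have \<mu>0: "\<mu> > 0" using \<eta> by (simp add: \<mu>)
  define f where "f = (\<lambda>r h. ue (of_int ((\<alpha> * r) * h + (\<beta> * minv Q r) * minv q h) / of_nat Q))"
  have shift: "norm (\<Sum>h\<in>H. u h * f r h) = norm (\<Sum>h\<in>H. u h * ue (of_int (\<alpha> * h + \<beta> * minv q h) / of_nat Q))" if "r \<in> R" for r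
  proof -
    obtain h1 where h1: "h1 \<in> H" "r = h1 mod int Q" using \<open>r \<in> R\<close> by (auto simp: R_def red_def)
    have "[h1 * minv q h1 = 1] (mod int Q)" using modgrp_minv_cong[OF H h1(1)] Q by (rule cong_dvd_mod)
    then have "[r * minv q h1 = 1] (mod int Q)" by (simp add: h1 Cong.cong_def mod_mult_left_eq)
    then have i: "[minv Q r = minv q h1] (mod int Q)" by (rule minv_unique)
    have "f r h = ue (of_int ((\<alpha> * h1) * h + (\<beta> * minv q h1) * minv q h) / of_nat Q)" for h
      unfolding f_def using i by (intro ue_cong cong_add cong_scalar_right cong_scalar_left) (simp_all add: h1)
    then show ?thesis using twisted_shift[OF H Q u h1(1), of \<alpha> \<beta>] by simp
  qed
  define P where "P = {(r, r'). r \<in> R \<and> r' \<in> R \<and> \<eta>\<^sup>2 / 2 * card H \<le> norm (\<Sum>h\<in>H. f r h * cnj (f r' h))}"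
  have P1: "\<mu> * (card R)\<^sup>2 \<le> card P"
    unfolding P_def \<mu>
  proof (rule bessel_pairs[OF fR fH Hne])
    show "norm (u h) \<le> 1" if "h \<in> H" for h using u that by (simp add: modchar_def)
    show "norm (f r h) \<le> 1" for r h by (simp add: f_def)
    show "\<eta> \<ge> 0" using \<eta> by simp
    show "\<eta> * card H \<le> norm (\<Sum>h\<in>H. u h * f r h)" if "r \<in> R" for r using shift[OF that] big by simp
  qed
  define bad where "bad = {(r, r'). r \<in> R \<and> r' \<in> R \<and> nat (gcd (r - r') (int Q)) > G}"
  have fbad: "finite bad" by (rule finite_subset[of _ "R \<times> R"]) (use fR in \<open>auto simp: bad_def\<close>)
  have fP: "finite P" by (rule finite_subset[of _ "R \<times> R"]) (use fR in \<open>auto simp: P_def\<close>)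
  define V where "V = (\<lambda>b. {a \<in> {0..<int Q}. \<mu> * card H \<le> norm (\<Sum>h\<in>H. ue (of_int (a * h + b * minv q h) / of_nat Q))})"
  have fV: "finite (V b)" for b by (rule finite_subset[of _ "{0..<int Q}"]) (auto simp: V_def)
  have cV: "real (card (V b)) \<le> C" for b unfolding V_def C by (rule row_bound[OF H Q \<kappa> rob \<mu>0])
  \<comment> \<open>All large frequencies of the untwisted sum, counted row by row, number at most
    \<open>Q * C\<close>. Against them stand at least \<open>\<mu> |R|^2\<close> pairs; this
    comparison is where the exponent above 1/2 is needed.\<close>
  define L where "L = (SIGMA b:{0..<int Q}. V b)"
  have fL: "finite L" using fV by (simp add: L_def)
  have "real (card L) = (\<Sum>b\<in>{0..<int Q}. real (card (V b)))" using fV by (simp add: L_def card_SigmaI)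
  also have "\<dots> \<le> (\<Sum>b\<in>{0..<int Q}. C)" by (intro sum_mono cV)
  finally have cL: "real (card L) \<le> real Q * C" by simp
  define F where "F = (\<lambda>(r, r'). (\<beta> * (minv Q r - minv Q r') mod int Q, \<alpha> * (r - r') mod int Q))"
  have PF: "F ` (P - bad) \<subseteq> L"
  proof (rule image_subsetI)
    fix p assume "p \<in> P - bad"
    then obtain r r' where p: "p = (r, r')" "r \<in> R" "r' \<in> R" "\<mu> * card H \<le> norm (\<Sum>h\<in>H. f r h * cnj (f r' h))"
      by (auto simp: P_def \<mu>)
    have "f r h * cnj (f r' h) = ue (of_int ((\<alpha> * (r - r') mod int Q) * h + (\<beta> * (minv Q r - minv Q r') mod int Q) * minv q h) / of_nat Q)" for h
    proof -
      have "f r h * cnj (f r' h) = ue (of_int ((\<alpha> * (r - r')) * h + (\<beta> * (minv Q r - minv Q r')) * minv q h) / of_nat Q)"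
        unfolding f_def cnj_ue ue_add[symmetric] by (simp add: algebra_simps add_divide_distrib diff_divide_distrib)
      also have "\<dots> = ue (of_int ((\<alpha> * (r - r') mod int Q) * h + (\<beta> * (minv Q r - minv Q r') mod int Q) * minv q h) / of_nat Q)"
        by (intro ue_cong cong_add cong_scalar_right) auto
      finally show ?thesis .
    qed
    then show "F p \<in> L" using p(4) Q0 by (simp add: L_def V_def F_def p(1))
  qed
  have "card (P - bad) = (\<Sum>y\<in>F ` (P - bad). card {s \<in> P - bad. F s = y})"
    using fP by (intro sum_card_fibres[symmetric]) auto
  also have "\<dots> \<le> (\<Sum>y\<in>F ` (P - bad). M ^ 3 * G * (ndiv Q)\<^sup>2)"
  proof (rule sum_mono)
    fix y :: "int \<times> int"
    obtain B A where y: "y = (B, A)" by (cases y)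
    have sub: "{s \<in> P - bad. F s = y} \<subseteq> {(r, r'). r \<in> R \<and> r' \<in> R \<and> nat (gcd (r - r') (int Q)) \<le> G \<and>
       \<alpha> * (r - r') mod int Q = A \<and> \<beta> * (minv Q r - minv Q r') mod int Q = B}"
      by (auto simp: P_def bad_def F_def y)
    have fin: "finite {(r, r'). r \<in> R \<and> r' \<in> R \<and> nat (gcd (r - r') (int Q)) \<le> G \<and>
       \<alpha> * (r - r') mod int Q = A \<and> \<beta> * (minv Q r - minv Q r') mod int Q = B}"
      by (rule finite_subset[of _ "R \<times> R"]) (use fR in auto)
    show "card {s \<in> P - bad. F s = y} \<le> M ^ 3 * G * (ndiv Q)\<^sup>2"
      by (rule order_trans[OF card_mono[OF fin sub] pair_multiplicity[OF R sf \<alpha> \<beta>]])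
  qed
  also have "\<dots> = card (F ` (P - bad)) * (M ^ 3 * G * (ndiv Q)\<^sup>2)" by simp
  also have "\<dots> \<le> card L * (M ^ 3 * G * (ndiv Q)\<^sup>2)" by (intro mult_le_mono1 card_mono fL PF)
  finally have "real (card (P - bad)) \<le> real (card L * (M ^ 3 * G * (ndiv Q)\<^sup>2))" by (rule of_nat_mono)
  also have "\<dots> \<le> real Q * C * (M ^ 3 * G * (ndiv Q)\<^sup>2)"
    unfolding of_nat_mult using cL by (intro mult_right_mono) auto
  finally have good: "real (card (P - bad)) \<le> real Q * C * (M ^ 3 * G * (ndiv Q)\<^sup>2)" .
  have "card P \<le> card (bad \<union> (P - bad))" using fP fbad by (intro card_mono) auto
  also have "\<dots> \<le> card bad + card (P - bad)" by (rule card_Un_le)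
  finally have "real (card P) \<le> card bad + real (card (P - bad))" by (simp flip: of_nat_add)
  then have "\<mu> * (card R)\<^sup>2 \<le> card bad + real Q * C * (M ^ 3 * G * (ndiv Q)\<^sup>2)" using P1 good by linarith
  then have "\<mu> * (card R)\<^sup>2 * sqrt G \<le> (card bad + real Q * C * (M ^ 3 * G * (ndiv Q)\<^sup>2)) * sqrt G"
    by (rule mult_right_mono) simp
  also have "\<dots> = card bad * sqrt G + real Q * C * (M ^ 3 * G * (ndiv Q)\<^sup>2) * sqrt G" by (rule distrib_right)
  also have "card bad * sqrt G \<le> ndiv Q * (real (card R))\<^sup>2"
    unfolding bad_def
  proof (rule close_pairs[OF R \<kappa> G])
    show "real d powr (1 / 2 + \<kappa>) \<le> card (red d R)" if "d dvd Q" for d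
      unfolding R_def red_red[OF that] by (rule rob[OF that])
  qed
  finally show ?thesis by (simp add: R_def)
qed

text \<open>Take \<open>G\<close> about \<open>Q^\<kappa>\<close> in
  \<open>robust_inequality\<close>. Close pairs are negligible because \<open>ndiv Q\<close> is at
  most a constant times \<open>Q^(\<kappa> / 8)\<close> while the root of \<open>G\<close> is at
  least \<open>Q^(\<kappa> / 2)\<close>. The other term costs
  \<open>Q^(1 + \<kappa> + \<kappa> / 4)\<close> against
  \<open>|red Q H|^2 \<ge> Q^(1 + 2 \<kappa>)\<close>.\<close>

lemma robust_twisted:
  fixes \<kappa> \<eta> :: real and M :: nat
  assumes \<kappa>: "\<kappa> > 0" and \<eta>: "\<eta> > 0"
  obtains Q0 :: nat where "\<forall>q H Q u \<alpha> \<beta>. modgrp q H \<longrightarrow> Q dvd q \<longrightarrow> squarefree Q \<longrightarrow> Q0 \<le> Q \<longrightarrow>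
    (\<forall>d. d dvd Q \<longrightarrow> real d powr (1 / 2 + \<kappa>) \<le> card (red d H)) \<longrightarrow> modchar q H u \<longrightarrow>
    nat (gcd \<alpha> (int Q)) \<le> M \<longrightarrow> nat (gcd \<beta> (int Q)) \<le> M \<longrightarrow>
    norm (\<Sum>h\<in>H. u h * ue (of_int (\<alpha> * h + \<beta> * minv q h) / of_nat Q)) \<le> \<eta> * card H"
proof -
  define \<mu> where "\<mu> = \<eta>\<^sup>2 / 2"
  define C where "C = 2 * ((2 / \<mu>\<^sup>2) powr (1 / \<kappa>))\<^sup>2 / \<mu>\<^sup>2"
  have \<mu>: "\<mu> > 0" using \<eta> by (simp add: \<mu>_def)
  have C0: "C \<ge> 0" by (simp add: C_def)
  have k8: "\<kappa> / 8 > 0" using \<kappa> by simp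
  obtain T :: real where T: "T \<ge> 1" "\<forall>k. squarefree k \<longrightarrow> real (ndiv k) \<le> T * real k powr (\<kappa> / 8)"
    by (rule divisor_bound[OF k8])
  have lt1: "\<kappa> / 8 < \<kappa> / 2" and lt2: "1 + \<kappa> + \<kappa> / 4 < 1 + 2 * \<kappa>" using \<kappa> by simp_all
  obtain P1 where P1: "\<forall>p\<ge>P1. (2 * T / \<mu>) * real p powr (\<kappa> / 8) < real p powr (\<kappa> / 2)"
    by (rule powr_dominates[OF lt1])
  obtain P2 where P2: "\<forall>p\<ge>P2. (4 * C * real M ^ 3 * T\<^sup>2 / \<mu>) * real p powr (1 + \<kappa> + \<kappa> / 4) < real p powr (1 + 2 * \<kappa>)"
    by (rule powr_dominates[OF lt2])
  have "norm (\<Sum>h\<in>H. u h * ue (of_int (\<alpha> * h + \<beta> * minv q h) / of_nat Q)) \<le> \<eta> * card H"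
    if H: "modgrp q H" and Q: "Q dvd q" and sf: "squarefree Q" and Q0: "max 1 (max P1 P2) \<le> Q"
      and rob: "\<forall>d. d dvd Q \<longrightarrow> real d powr (1 / 2 + \<kappa>) \<le> card (red d H)" and u: "modchar q H u"
      and \<alpha>: "nat (gcd \<alpha> (int Q)) \<le> M" and \<beta>: "nat (gcd \<beta> (int Q)) \<le> M"
    for q H Q u \<alpha> \<beta>
  proof (rule ccontr)
    assume "\<not> ?thesis"
    then have big: "\<eta> * card H \<le> norm (\<Sum>h\<in>H. u h * ue (of_int (\<alpha> * h + \<beta> * minv q h) / of_nat Q))" by simp
    define G where "G = nat \<lceil>real Q powr \<kappa>\<rceil>"
    have Q1: "real Q \<ge> 1" using Q0 by simp
    have Qk: "real Q powr \<kappa> \<ge> 1" using Q1 \<kappa> by (simp add: ge_one_powr_ge_zero)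
    have Glo: "real Q powr \<kappa> \<le> G" unfolding G_def by (rule real_nat_ceiling_ge)
    have Ghi: "real G \<le> 2 * real Q powr \<kappa>" unfolding G_def using Qk by linarith
    have G0: "G > 0" using Glo Qk by (metis less_le_trans of_nat_0_less_iff zero_less_one)
    define x where "x = (real (card (red Q H)))\<^sup>2"
    define s where "s = sqrt (real G)"
    have s0: "s > 0" using G0 by (simp add: s_def)
    have ineq: "\<mu> * x * s \<le> ndiv Q * x + real Q * C * (M ^ 3 * G * (ndiv Q)\<^sup>2) * s"
      unfolding x_def s_def
      by (rule robust_inequality[OF H Q sf \<kappa> rob[rule_format] u \<alpha> \<beta> G0 \<eta> big \<mu>_def C_def])
    have "(real Q powr (1 / 2 + \<kappa>))\<^sup>2 \<le> x" unfolding x_def using rob by (intro power_mono) auto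
    moreover have "(real Q powr (1 / 2 + \<kappa>))\<^sup>2 = real Q powr (1 + 2 * \<kappa>)"
      by (simp add: power2_eq_square algebra_simps flip: powr_add)
    ultimately have xlo: "real Q powr (1 + 2 * \<kappa>) \<le> x" by simp
    moreover have "real Q powr (1 + 2 * \<kappa>) > 0" using Q1 by simp
    ultimately have x0: "x > 0" by linarith
    have nd: "real (ndiv Q) \<le> T * real Q powr (\<kappa> / 8)" using T(2) sf by blast
    have "real Q powr (\<kappa> / 2) = sqrt (real Q powr \<kappa>)"
      by (simp add: powr_powr flip: powr_half_sqrt)
    then have slo: "real Q powr (\<kappa> / 2) \<le> s" using Glo by (simp add: s_def)
    have 1: "ndiv Q * x < (\<mu> / 2) * x * s"
    proof -
      have "(2 * T / \<mu>) * real Q powr (\<kappa> / 8) < s" using P1 Q0 slo by (meson le_less_trans less_le_trans max.bounded_iff)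
      then have "T * real Q powr (\<kappa> / 8) < (\<mu> / 2) * s" using \<mu> by (simp add: field_simps)
      then have "ndiv Q < (\<mu> / 2) * s" using nd by linarith
      then have "ndiv Q * x < (\<mu> / 2) * s * x" using x0 by (rule mult_strict_right_mono)
      then show ?thesis by (simp add: mult_ac)
    qed
    have 2: "real Q * C * (M ^ 3 * G * (ndiv Q)\<^sup>2) * s \<le> (\<mu> / 2) * x * s"
    proof -
      have nd2: "(real (ndiv Q))\<^sup>2 \<le> T\<^sup>2 * real Q powr (\<kappa> / 4)"
      proof -
        have "(real (ndiv Q))\<^sup>2 \<le> (T * real Q powr (\<kappa> / 8))\<^sup>2" using nd by (intro power_mono) auto
        also have "\<dots> = T\<^sup>2 * real Q powr (\<kappa> / 4)"
          by (simp add: power_mult_distrib power2_eq_square[of "real Q powr (\<kappa> / 8)"] flip: powr_add)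
        finally show ?thesis .
      qed
      have "real G * (real (ndiv Q))\<^sup>2 \<le> (2 * real Q powr \<kappa>) * (T\<^sup>2 * real Q powr (\<kappa> / 4))"
        using Ghi nd2 by (intro mult_mono) auto
      then have "(real Q * C * real M ^ 3) * (real G * (real (ndiv Q))\<^sup>2) \<le> (real Q * C * real M ^ 3) * ((2 * real Q powr \<kappa>) * (T\<^sup>2 * real Q powr (\<kappa> / 4)))"
        using C0 by (intro mult_left_mono) auto
      also have "\<dots> = (2 * C * real M ^ 3 * T\<^sup>2) * (real Q powr 1 * real Q powr \<kappa> * real Q powr (\<kappa> / 4))" using Q1 by simp
      also have "\<dots> = (2 * C * real M ^ 3 * T\<^sup>2) * real Q powr (1 + \<kappa> + \<kappa> / 4)" by (simp only: powr_add)
      also have "\<dots> \<le> (\<mu> / 2) * real Q powr (1 + 2 * \<kappa>)"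
      proof -
        have "(4 * C * real M ^ 3 * T\<^sup>2 / \<mu>) * real Q powr (1 + \<kappa> + \<kappa> / 4) < real Q powr (1 + 2 * \<kappa>)" using P2 Q0 by simp
        then show ?thesis using \<mu> by (simp add: field_simps)
      qed
      also have "\<dots> \<le> (\<mu> / 2) * x" using xlo \<mu> by (intro mult_left_mono) auto
      finally have "real Q * C * (M ^ 3 * G * (ndiv Q)\<^sup>2) \<le> (\<mu> / 2) * x" by (simp add: mult_ac)
      then show ?thesis using s0 by (intro mult_right_mono) auto
    qed
    show False using ineq 1 2 by linarith
  qed
  then show ?thesis using that by blast
qed

lemma bezout_coprime_nat:
  fixes a b :: nat assumes "coprime a b"
  obtains x y :: int where "x * int a + y * int b = 1"
proof -
  have "gcd (int a) (int b) = 1" using assms by simp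
  then show ?thesis using that bezout_int[of "int a" "int b"] by metis
qed

lemma coprime_left_combination:
  fixes v d x Q' :: int
  assumes "x * Q' + v * d = 1" shows "coprime v Q'"
proof (rule coprimeI)
  fix c assume "c dvd v" "c dvd Q'"
  then have "c dvd x * Q' + v * d" by simp
  then show "is_unit c" using assms by simp
qed

lemma gcd_coprime_mult:
  fixes c x Q :: int assumes "coprime c Q" shows "gcd (c * x) Q = gcd x Q"
  using assms by (simp add: gcd_mult_left_left_cancel coprime_commute)

text \<open>The Chinese remainder theorem for phases.\<close>

lemma split_phase:
  fixes x y :: int and a b :: nat
  assumes "u * int a + v * int b = 1" "a > 0" "b > 0"
  shows "ue (of_int x / of_nat (a * b)) = ue (of_int (v * x) / of_nat a) * ue (of_int (u * x) / of_nat b)"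
proof -
  have "real_of_int x = of_int (x * (u * int a + v * int b))" by (simp add: assms(1))
  then have "real_of_int x / of_nat (a * b) = of_int (v * x) / of_nat a + of_int (u * x) / of_nat b"
    using assms(2,3) by (simp add: field_simps)
  then show ?thesis by (simp add: ue_add)
qed

lemma modchar_mono: "modchar q H u \<Longrightarrow> K \<subseteq> H \<Longrightarrow> modchar q K u"
  by (auto simp: modchar_def)

text \<open>The robustness needed in \<open>robust_twisted\<close> is forced by passing to \<open>kern d H\<close> for the \<open>d\<close> that
  maximizes \<open>card (red Q (kern d H)) * d\<^bsup>1/2 + \<kappa>\<^esup>\<close>.\<close>

lemma twisted_small:
  fixes \<kappa> \<eta> :: real and M :: nat
  assumes \<kappa>: "\<kappa> > 0" and \<eta>: "\<eta> > 0"
  obtains Q0 :: nat where "\<forall>q H Q u \<alpha> \<beta>. modgrp q H \<longrightarrow> Q dvd q \<longrightarrow> squarefree Q \<longrightarrow> Q0 \<le> Q \<longrightarrow>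
    real Q powr (1 / 2 + 2 * \<kappa>) \<le> card (red Q H) \<longrightarrow> modchar q H u \<longrightarrow>
    nat (gcd \<alpha> (int Q)) \<le> M \<longrightarrow> nat (gcd \<beta> (int Q)) \<le> M \<longrightarrow>
    norm (\<Sum>h\<in>H. u h * ue (of_int (\<alpha> * h + \<beta> * minv q h) / of_nat Q)) \<le> \<eta> * card H"
proof -
  obtain Q1 where Q1: "\<forall>q H Q u \<alpha> \<beta>. modgrp q H \<longrightarrow> Q dvd q \<longrightarrow> squarefree Q \<longrightarrow> Q1 \<le> Q \<longrightarrow>
    (\<forall>d. d dvd Q \<longrightarrow> real d powr (1 / 2 + \<kappa>) \<le> card (red d H)) \<longrightarrow> modchar q H u \<longrightarrow>
    nat (gcd \<alpha> (int Q)) \<le> M \<longrightarrow> nat (gcd \<beta> (int Q)) \<le> M \<longrightarrow>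
    norm (\<Sum>h\<in>H. u h * ue (of_int (\<alpha> * h + \<beta> * minv q h) / of_nat Q)) \<le> \<eta> * card H"
    by (rule robust_twisted[OF \<kappa> \<eta>])
  obtain P where P: "\<forall>p\<ge>P. real Q1 * real p powr 0 < real p powr \<kappa>" by (rule powr_dominates[OF \<kappa>])
  have "norm (\<Sum>h\<in>H. u h * ue (of_int (\<alpha> * h + \<beta> * minv q h) / of_nat Q)) \<le> \<eta> * card H"
    if H: "modgrp q H" and Q: "Q dvd q" and sf: "squarefree Q" and QP: "max P 1 \<le> Q"
      and large: "real Q powr (1 / 2 + 2 * \<kappa>) \<le> card (red Q H)" and u: "modchar q H u"
      and \<alpha>: "nat (gcd \<alpha> (int Q)) \<le> M" and \<beta>: "nat (gcd \<beta> (int Q)) \<le> M"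
    for q H Q u \<alpha> \<beta>
  proof -
    define \<theta> where "\<theta> = 1 / 2 + \<kappa>"
    have Q0: "Q > 0" using QP by simp
    define w where "w = (\<lambda>d. real (card (red Q (kern d H))) * real d powr \<theta>)"
    have "finite {d. d dvd Q}" "{d. d dvd Q} \<noteq> {}" using Q0 by auto
    then obtain d where d: "d dvd Q" and mx: "\<And>e. e dvd Q \<Longrightarrow> w e \<le> w d"
      using ex_is_arg_min_if_finite[of "{d. d dvd Q}" "\<lambda>d. - w d"] by (auto simp: is_arg_min_linorder)
    have d0: "d > 0" using d Q0 dvd_pos_nat by blast
    define K where "K = kern d H"
    have dq: "d dvd q" using d Q by (rule dvd_trans)
    have K: "modgrp q K" unfolding K_def by (rule modgrp_kern[OF H dq])
    define Q' where "Q' = Q div d"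
    have QQ: "Q = Q' * d" using d by (simp add: Q'_def)
    have Q'0: "Q' > 0" using Q0 QQ by simp
    have Q'Q: "Q' dvd Q" using QQ by simp
    have Q'q: "Q' dvd q" using Q'Q Q by (rule dvd_trans)
    have sf': "squarefree Q'" using sf Q'Q squarefree_mono by blast
    have cop: "coprime Q' d"
    proof (rule coprimeI)
      fix c assume c: "c dvd Q'" "c dvd d"
      then have c2: "c ^ 2 dvd Q" unfolding QQ power2_eq_square by (intro mult_dvd_mono)
      show "is_unit c" by (rule squarefreeD[OF sf c2])
    qed
    \<comment> \<open>Compare \<open>w\<close> at \<open>d\<close> and at \<open>d * g\<close>,
      using \<open>kern g K = kern (d * g) H\<close>, and divide by \<open>card_red_split\<close>
      for \<open>g\<close>. Coprimality of \<open>d\<close> and \<open>g\<close> is due to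
      \<open>Q\<close> being squarefree.\<close>
    have rob: "real g powr (1 / 2 + \<kappa>) \<le> card (red g K)" if g: "g dvd Q'" for g
    proof -
      have gQ: "g dvd Q" using g Q'Q by (rule dvd_trans)
      have g0: "g > 0" using gQ Q0 dvd_pos_nat by blast
      have "coprime d g" using cop g by (meson coprime_commute coprime_divisors dvd_refl)
      then have kk: "kern g K = kern (d * g) H" unfolding K_def by (rule kern_mult)
      have "d * g dvd Q" using g unfolding QQ by (simp add: mult.commute)
      then have "w (d * g) \<le> w d" by (rule mx)
      then have le: "real (card (red Q (kern g K))) * real g powr \<theta> \<le> card (red Q K)"
        using d0 g0 by (simp add: w_def kk[unfolded K_def] K_def powr_mult)
      have pos: "card (red Q (kern g K)) > 0"
        using modgrp_card[OF modgrp_red[OF modgrp_kern[OF K dvd_trans[OF gQ Q]] Q]] .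
      have "real (card (red Q K)) = real (card (red Q (kern g K))) * card (red g K)"
        using card_red_split[OF K gQ Q] by simp
      then have "real (card (red Q (kern g K))) * real g powr \<theta> \<le> real (card (red Q (kern g K))) * card (red g K)"
        using le by simp
      then show ?thesis using pos by (simp add: \<theta>_def)
    qed
    \<comment> \<open>Comparison with the divisor 1 gives
      \<open>|red Q H| \<le> w d \<le> Q' Q^\<theta>\<close>, hence
      \<open>Q' \<ge> Q^\<kappa>\<close>. Of the excess \<open>2 \<kappa>\<close> in the hypothesis
      one half buys robustness and the other keeps \<open>Q'\<close> large.\<close>
    have "Q1 \<le> Q'"
    proof -
      have "kern 1 H = H" by (auto simp: kern_def)
      then have "real (card (red Q H)) \<le> w d" using mx[of 1] by (simp add: w_def)
      also have "w d \<le> real Q' * real Q powr \<theta>"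
      proof -
        have "red Q K \<subseteq> {y \<in> {0..<int Q}. [y = 1] (mod int d)}"
        proof
          fix y assume "y \<in> red Q K"
          then obtain k where k: "k \<in> K" "y = k mod int Q" by (auto simp: red_def)
          then have "[y = 1] (mod int d)" using mod_cong_dvd[OF d, of k] by (auto simp: K_def kern_def intro: cong_trans)
          then show "y \<in> {y \<in> {0..<int Q}. [y = 1] (mod int d)}" using k Q0 by simp
        qed
        then have "card (red Q K) \<le> card {y \<in> {0..<int Q}. [y = 1] (mod int d)}"
          by (intro card_mono) (auto intro: finite_subset[of _ "{0..<int Q}"])
        also have "\<dots> \<le> Q'" unfolding Q'_def by (rule card_cong_class_le[OF d Q0])
        finally have 1: "card (red Q K) \<le> Q'" .
        have 2: "real d powr \<theta> \<le> real Q powr \<theta>" using dvd_imp_le[OF d Q0] \<kappa> by (intro powr_mono2) (auto simp: \<theta>_def)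
        show ?thesis unfolding w_def K_def[symmetric] using 1 2 by (intro mult_mono) auto
      qed
      finally have "real Q powr (\<theta> + \<kappa>) \<le> real Q' * real Q powr \<theta>" using large by (simp add: \<theta>_def add.assoc)
      then have "real Q powr \<theta> * real Q powr \<kappa> \<le> real Q powr \<theta> * real Q'" by (simp add: powr_add mult.commute)
      then have "real Q powr \<kappa> \<le> real Q'" using Q0 by simp
      moreover have "real Q1 < real Q powr \<kappa>" using P[rule_format, of Q] QP by simp
      ultimately show ?thesis by linarith
    qed
    obtain x v where xv: "x * int Q' + v * int d = 1" by (rule bezout_coprime_nat[OF cop])
    have copv: "coprime v (int Q')" using coprime_left_combination[OF xv] .
    have "norm (\<Sum>h\<in>H. u h * ue (of_int (\<alpha> * h + \<beta> * minv q h) / of_nat Q)) \<le> \<eta> * card H"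
    proof (rule sum_subgroup_average[OF H K])
      show "K \<subseteq> H" unfolding K_def by (rule kern_sub)
      fix h assume h: "h \<in> H"
      define c where "c = u h * ue (of_int (x * (\<alpha> * h + \<beta> * minv q h)) / of_nat d)"
      have summand: "u (h * k mod int q) * ue (of_int (\<alpha> * (h * k mod int q) + \<beta> * minv q (h * k mod int q)) / of_nat Q) =
          c * (u k * ue (of_int ((v * \<alpha> * h) * k + (v * \<beta> * minv q h) * minv q k) / of_nat Q'))" if k: "k \<in> K" for k
      proof -
        have kH: "k \<in> H" and k1: "[k = 1] (mod int d)" using k by (auto simp: K_def kern_def)
        have kinv: "[minv q k = 1] (mod int d)"
          using modgrp_minv[OF K k] by (simp add: K_def kern_def)
        have "[minv q (h * k mod int q) = minv q h * minv q k] (mod int q)"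
        proof (rule cong_trans[OF minv_cong_arg minv_mult])
          show "coprime (h * k mod int q) (int q)" using modgrp_coprime[OF H modgrp_mult[OF H h kH]] .
        qed (use modgrp_coprime[OF H] h kH in auto)
        then have i: "[minv q (h * k mod int q) = minv q h * minv q k] (mod int Q)" using Q by (rule cong_dvd_mod)
        define z where "z = \<alpha> * (h * k) + \<beta> * (minv q h * minv q k)"
        have "[\<alpha> * (h * k mod int q) + \<beta> * minv q (h * k mod int q) = z] (mod int Q)"
          unfolding z_def using i mod_cong_dvd[OF Q] by (intro cong_add cong_scalar_left)
        then have "ue (of_int (\<alpha> * (h * k mod int q) + \<beta> * minv q (h * k mod int q)) / of_nat Q) = ue (of_int z / of_nat Q)"
          by (rule ue_cong)
        also have "\<dots> = ue (of_int (v * z) / of_nat Q') * ue (of_int (x * z) / of_nat d)"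
          unfolding QQ by (rule split_phase[OF xv Q'0 d0])
        \<comment> \<open>On \<open>K\<close> both \<open>k\<close> and its inverse are 1 modulo
          \<open>d\<close>, so the phase modulo \<open>d\<close> is constant and joins the factor
          \<open>c\<close>.\<close>
        also have "ue (of_int (x * z) / of_nat d) = ue (of_int (x * (\<alpha> * (h * 1) + \<beta> * (minv q h * 1))) / of_nat d)"
          unfolding z_def using k1 kinv by (intro ue_cong cong_scalar_left cong_add)
        also have "v * z = (v * \<alpha> * h) * k + (v * \<beta> * minv q h) * minv q k" by (simp add: z_def algebra_simps)
        finally show ?thesis using u h kH by (simp add: modchar_def c_def mult_ac)
      qed
      have "norm c = 1" using u h by (simp add: c_def modchar_def norm_mult)
      have "norm (\<Sum>k\<in>K. u (h * k mod int q) * ue (of_int (\<alpha> * (h * k mod int q) + \<beta> * minv q (h * k mod int q)) / of_nat Q))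
         = norm (\<Sum>k\<in>K. u k * ue (of_int ((v * \<alpha> * h) * k + (v * \<beta> * minv q h) * minv q k) / of_nat Q'))"
        using summand by (simp add: sum_distrib_left[symmetric] norm_mult \<open>norm c = 1\<close> cong: sum.cong)
      also have "\<dots> \<le> \<eta> * card K"
      proof (rule Q1[rule_format, OF K Q'q sf' \<open>Q1 \<le> Q'\<close> rob modchar_mono[OF u]])
        show "K \<subseteq> H" unfolding K_def by (rule kern_sub)
        have ch: "coprime h (int Q')" "coprime (minv q h) (int Q')"
          using modgrp_coprime[OF H h] modgrp_coprime[OF H modgrp_minv[OF H h]] Q'q
          by (meson coprime_divisors dvd_refl of_nat_dvd_iff)+
        have mono: "nat (gcd a (int Q')) \<le> nat (gcd a (int Q))" for a
          using Q'Q Q0 by (intro nat_mono zdvd_imp_le gcd_mono) auto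
        have "gcd (v * \<alpha> * h) (int Q') = gcd \<alpha> (int Q')"
          using gcd_coprime_mult[OF coprime_mult_left_iff[THEN iffD2, OF conjI[OF copv ch(1)]], of \<alpha>] by (simp add: mult_ac)
        then show "nat (gcd (v * \<alpha> * h) (int Q')) \<le> M" using mono[of \<alpha>] \<alpha> by simp
        have "gcd (v * \<beta> * minv q h) (int Q') = gcd \<beta> (int Q')"
          using gcd_coprime_mult[OF coprime_mult_left_iff[THEN iffD2, OF conjI[OF copv ch(2)]], of \<beta>] by (simp add: mult_ac)
        then show "nat (gcd (v * \<beta> * minv q h) (int Q')) \<le> M" using mono[of \<beta>] \<beta> by simp
      qed
      finally show "norm (\<Sum>k\<in>K. u (h * k mod int q) * ue (of_int (\<alpha> * (h * k mod int q) + \<beta> * minv q (h * k mod int q)) / of_nat Q)) \<le> \<eta> * card K" .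
    qed
    then show ?thesis .
  qed
  then show ?thesis using that by blast
qed

section \<open>Exponential sums modulo a cubefree number\<close>

text \<open>A prime dividing both \<open>q1\<close> and \<open>q2\<close>, or one whose square
  divides \<open>q2\<close>, would have its cube dividing \<open>q\<close>.\<close>

lemma cubefree_decomposition:
  assumes q: "cubefree q"
  obtains q1 q2 where "q = q1 * q2\<^sup>2" "squarefree q1" "squarefree q2" "coprime q1 q2"
proof -
  have q0: "q \<noteq> 0" and cf: "\<And>p. prime p \<Longrightarrow> \<not> p ^ 3 dvd q" using q by (auto simp: cubefree_def)
  define q1 q2 where "q1 = squarefree_part q" and "q2 = square_part q"
  have e: "q = q1 * q2\<^sup>2" unfolding q1_def q2_def by (rule squarefree_decompose)
  have cop: "coprime q1 q2"
  proof (rule ccontr)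
    assume "\<not> coprime q1 q2"
    then obtain p where p: "prime p" "p dvd q1" "p dvd q2"
      using q0 e by (metis coprime_iff_gcd_eq_1 gcd_dvd1 gcd_dvd2 dvd_trans prime_factor_nat)
    have "p * p ^ 2 dvd q1 * q2\<^sup>2" using p by (intro mult_dvd_mono dvd_power_same)
    moreover have "p * p ^ 2 = p ^ 3" by (simp add: power3_eq_cube power2_eq_square)
    ultimately show False using cf[OF p(1)] e by simp
  qed
  have q20: "q2 \<noteq> 0" using e q0 by auto
  have "squarefree q2" unfolding squarefree_factorial_semiring[OF q20]
  proof (intro allI impI notI)
    fix p :: nat assume p: "prime p" "p\<^sup>2 dvd q2"
    have "p ^ 3 dvd (p\<^sup>2)\<^sup>2" by (simp add: le_imp_power_dvd flip: power_mult)
    also have "(p\<^sup>2)\<^sup>2 dvd q2\<^sup>2" using p(2) by (rule dvd_power_same)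
    also have "q2\<^sup>2 dvd q" using e by simp
    finally show False using cf[OF p(1)] by simp
  qed
  moreover have "squarefree q1" using q0 by (simp add: q1_def)
  ultimately show ?thesis using that[OF e _ _ cop] by simp
qed

text \<open>Periodicity supplies the negatives, as \<open>t * x\<close> may be formed with a natural
  representative of \<open>t\<close> modulo \<open>N\<close>. The least positive member is then a
  generator.\<close>

lemma periodic_submonoid_int:
  fixes J :: "int set" and N :: nat
  assumes N: "N > 0" and zero: "0 \<in> J" and add: "\<And>x y. x \<in> J \<Longrightarrow> y \<in> J \<Longrightarrow> x + y \<in> J"
    and per: "\<And>x y. [x = y] (mod int N) \<Longrightarrow> x \<in> J \<Longrightarrow> y \<in> J"
  obtains g :: nat where "g dvd N" "\<And>x. x \<in> J \<longleftrightarrow> int g dvd x"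
proof -
  have nmult: "int n * x \<in> J" if "x \<in> J" for n x
    by (induction n) (use zero add[OF that] in \<open>simp_all add: distrib_right\<close>)
  have mult: "t * x \<in> J" if "x \<in> J" for t x
  proof (rule per)
    show "int (nat (t mod int N)) * x \<in> J" by (rule nmult[OF that])
    show "[int (nat (t mod int N)) * x = t * x] (mod int N)"
      using N by (intro cong_scalar_right) (simp add: Cong.cong_def)
  qed
  have "int N \<in> J" using per[OF _ zero, of "int N"] by (simp add: Cong.cong_def)
  then have ex: "\<exists>n. n > 0 \<and> int n \<in> J" using N by blast
  define g where "g = (LEAST n. n > 0 \<and> int n \<in> J)"
  have g: "g > 0" "int g \<in> J" using LeastI_ex[OF ex] by (auto simp: g_def)
  have iff: "x \<in> J \<longleftrightarrow> int g dvd x" for x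
  proof
    assume x: "x \<in> J"
    have "x + (- (x div int g)) * int g \<in> J" by (intro add x mult g)
    then have "int (nat (x mod int g)) \<in> J" using g by (simp add: minus_div_mult_eq_mod)
    moreover have "nat (x mod int g) < g" using g by (simp add: nat_less_iff)
    ultimately have "\<not> nat (x mod int g) > 0" using not_less_Least g_def by blast
    moreover have "x mod int g \<ge> 0" using g by simp
    ultimately show "int g dvd x" by (simp add: dvd_eq_mod_eq_0)
  next
    assume "int g dvd x"
    then show "x \<in> J" using mult[OF g(2)] by (auto simp: mult.commute)
  qed
  have "g dvd N" using iff[of "int N"] \<open>int N \<in> J\<close> by simp
  then show ?thesis using that iff by blast
qed

lemma one_plus_mult_cong:
  fixes r x y q :: int
  assumes "q dvd r\<^sup>2" shows "[(1 + r * x) * (1 + r * y) = 1 + r * (x + y)] (mod q)"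
proof -
  have "(1 + r * x) * (1 + r * y) - (1 + r * (x + y)) = r\<^sup>2 * (x * y)" by (simp add: algebra_simps power2_eq_square)
  then show ?thesis using assms by (simp add: cong_iff_dvd_diff)
qed

text \<open>Since \<open>q\<close> divides \<open>r\<^sup>2\<close>, the map \<open>j \<mapsto> 1 + r j\<close> turns addition into multiplication; \<open>g\<close> generates
  the subgroup of those \<open>j\<close> that land in \<open>H\<close>.\<close>

lemma unipotent_part:
  assumes H: "modgrp q H" and q: "q = r * s" and sq: "q dvd r\<^sup>2"
  obtains g k where "s = g * k" "g > 0" "k > 0" "\<forall>j. (1 + int r * j) mod int q \<in> H \<longleftrightarrow> int g dvd j"
    "card (kern r H) \<le> k"
proof -
  have q0: "q > 0" by (rule modgrp_pos[OF H])
  then have s0: "s > 0" and r0: "r > 0" using q by (auto simp: zero_less_mult_iff)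
  have sq': "int q dvd (int r)\<^sup>2" using sq by (metis int_dvd_int_iff of_nat_power)
  define J where "J = {j. (1 + int r * j) mod int q \<in> H}"
  have "0 \<in> J" using modgrp_one[OF H] by (simp add: J_def)
  moreover have "x + y \<in> J" if "x \<in> J" "y \<in> J" for x y
  proof -
    have "((1 + int r * x) mod int q) * ((1 + int r * y) mod int q) mod int q \<in> H"
      using that by (intro modgrp_mult[OF H]) (auto simp: J_def)
    also have "((1 + int r * x) mod int q) * ((1 + int r * y) mod int q) mod int q = (1 + int r * (x + y)) mod int q"
      using one_plus_mult_cong[OF sq', of x y] by (simp add: Cong.cong_def mod_mult_eq)
    finally show ?thesis by (simp add: J_def)
  qed
  moreover have "y \<in> J" if "[x = y] (mod int s)" "x \<in> J" for x y
  proof -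
    have "[int r * x = int r * y] (mod (int r * int s))"
      using that(1) by (simp add: cong_iff_dvd_diff flip: right_diff_distrib)
    then have "[1 + int r * x = 1 + int r * y] (mod int q)" by (simp add: q cong_add_lcancel)
    then show ?thesis using that(2) by (simp add: J_def Cong.cong_def)
  qed
  ultimately obtain g where g: "g dvd s" "\<And>x. x \<in> J \<longleftrightarrow> int g dvd x"
    using periodic_submonoid_int[OF s0, of J] by blast
  then obtain k where k: "s = g * k" by blast
  have k0: "k > 0" and g0: "g > 0" using k s0 by auto
  have form: "\<exists>t. h = 1 + int r * (int g * t)" if h: "h \<in> kern r H" for h
  proof -
    have "int r dvd h - 1" using h by (simp add: kern_def cong_iff_dvd_diff)
    then obtain j where "h - 1 = int r * j" by blast
    then have j: "h = 1 + int r * j" by simp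
    have hH: "h \<in> H" using h by (simp add: kern_def)
    then have "h mod int q = h" using modgrp_range[OF H] by simp
    then have "j \<in> J" using hH j by (simp add: J_def)
    then have "int g dvd j" using g(2) by simp
    then obtain t where "j = int g * t" by (rule dvdE)
    then show ?thesis using j by (intro exI[of _ t]) simp
  qed
  then have "\<forall>h\<in>kern r H. \<exists>t. h = 1 + int r * (int g * t)" by (rule ballI)
  from bchoice[OF this] obtain t where t: "\<forall>h\<in>kern r H. h = 1 + int r * (int g * t h)" by (rule exE)
  \<comment> \<open>Modulo \<open>q = r g k\<close> the element \<open>1 + r g t\<close> is
    determined by \<open>t\<close> modulo \<open>k\<close>.\<close>
  have "card (kern r H) \<le> card {0..<int k}"
  proof (rule card_inj_on_le[of "\<lambda>h. t h mod int k"])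
    show "inj_on (\<lambda>h. t h mod int k) (kern r H)"
    proof (rule inj_onI)
      fix x y assume xy: "x \<in> kern r H" "y \<in> kern r H" "t x mod int k = t y mod int k"
      then have "int k dvd t x - t y" by (simp add: mod_eq_dvd_iff)
      then have "int r * int g * int k dvd int r * int g * (t x - t y)" by (rule mult_dvd_mono[OF dvd_refl])
      moreover have "x - y = int r * int g * (t x - t y)"
      proof -
        have "x = 1 + int r * (int g * t x)" "y = 1 + int r * (int g * t y)" using t xy(1,2) by blast+
        then have "x - y = (1 + int r * (int g * t x)) - (1 + int r * (int g * t y))" by (rule arg_cong2)
        then show ?thesis by (simp add: algebra_simps)
      qed
      ultimately have "[x = y] (mod int q)" by (simp add: cong_iff_dvd_diff q k mult.assoc)
      then show "x = y" using xy modgrp_range[OF H] eq_if_cong by (auto simp: kern_def)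
    qed
    show "(\<lambda>h. t h mod int k) ` kern r H \<subseteq> {0..<int k}" using k0 by auto
  qed simp
  then show ?thesis using that[OF k g0 k0] g(2) by (simp add: J_def)
qed

text \<open>Discrete stationary phase: multiplying \<open>h\<close> by \<open>1 + r g t\<close>
  changes the phase by exactly \<open>t (A h - B minv q h) / k\<close>, because \<open>q\<close>
  divides \<open>r^2\<close>. Averaging over \<open>t\<close> modulo \<open>k\<close> removes every
  \<open>h\<close> for which this is not always an integer.\<close>

lemma sum_le_stationary:
  assumes H: "modgrp q H" and q: "q = r * (g * k)" and sq: "q dvd r\<^sup>2"
    and w: "\<And>j. int g dvd j \<Longrightarrow> (1 + int r * j) mod int q \<in> H"
  shows "norm (\<Sum>h\<in>H. ue (of_int (A * h + B * minv q h) / of_nat q)) \<le>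
    card {h \<in> H. int k dvd A * h - B * minv q h}"
proof -
  define F where "F = (\<lambda>h. ue (of_int (A * h + B * minv q h) / of_nat q))"
  have q0: "q > 0" by (rule modgrp_pos[OF H])
  then have k0: "k > 0" and r0: "r > 0" and g0: "g > 0" using q by (auto simp: zero_less_mult_iff)
  have sq': "int q dvd (int r)\<^sup>2" using sq by (metis int_dvd_int_iff of_nat_power)
  define w where "w = (\<lambda>t. (1 + int r * (int g * t)) mod int q)"
  have wH: "w t \<in> H" for t using w[of "int g * t"] by (simp add: w_def)
  have winv: "[minv q (w t) = 1 + int r * (int g * (- t))] (mod int q)" for t
  proof (rule minv_unique)
    have "[w t * (1 + int r * (int g * (- t))) = (1 + int r * (int g * t)) * (1 + int r * (int g * (- t)))] (mod int q)"
      by (rule cong_scalar_right) (simp add: w_def)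
    also have "[(1 + int r * (int g * t)) * (1 + int r * (int g * (- t))) = 1 + int r * (int g * t + int g * (- t))] (mod int q)"
      by (rule one_plus_mult_cong[OF sq'])
    finally show "[w t * (1 + int r * (int g * (- t))) = 1] (mod int q)" by simp
  qed
  have F: "F (w t * h mod int q) = F h * ue (of_int (t * (A * h - B * minv q h)) / of_nat k)" if h: "h \<in> H" for t h
  proof -
    have i: "[minv q (w t * h mod int q) = minv q (w t) * minv q h] (mod int q)"
    proof (rule cong_trans[OF minv_cong_arg minv_mult])
      show "coprime (w t * h mod int q) (int q)" using modgrp_coprime[OF H modgrp_mult[OF H wH h]] .
    qed (use modgrp_coprime[OF H] h wH in auto)
    have "[A * (w t * h mod int q) + B * minv q (w t * h mod int q) =
        A * ((1 + int r * (int g * t)) * h) + B * ((1 + int r * (int g * (- t))) * minv q h)] (mod int q)"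
    proof (intro cong_add cong_scalar_left)
      show "[w t * h mod int q = (1 + int r * (int g * t)) * h] (mod int q)"
        by (simp add: w_def Cong.cong_def mod_mult_left_eq)
      show "[minv q (w t * h mod int q) = (1 + int r * (int g * (- t))) * minv q h] (mod int q)"
        using i cong_scalar_right[OF winv] by (rule cong_trans)
    qed
    then have "F (w t * h mod int q) = ue (of_int (A * ((1 + int r * (int g * t)) * h) +
        B * ((1 + int r * (int g * (- t))) * minv q h)) / of_nat q)" unfolding F_def by (rule ue_cong)
    also have "real_of_int (A * ((1 + int r * (int g * t)) * h) + B * ((1 + int r * (int g * (- t))) * minv q h)) / of_nat q =
        of_int (A * h + B * minv q h) / of_nat q + of_int (t * (A * h - B * minv q h)) / of_nat k"
      using k0 r0 g0 by (simp add: q field_simps)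
    finally show ?thesis by (simp add: F_def ue_add)
  qed
  have "of_nat k * (\<Sum>h\<in>H. F h) = (\<Sum>t\<in>{0..<int k}. \<Sum>h\<in>H. F (w t * h mod int q))"
  proof -
    have "(\<Sum>h\<in>H. F (w t * h mod int q)) = (\<Sum>h\<in>H. F h)" for t
      by (rule sum.reindex_bij_betw[OF modgrp_mult_bij[OF H wH]])
    then show ?thesis by simp
  qed
  also have "\<dots> = (\<Sum>t\<in>{0..<int k}. \<Sum>h\<in>H. F h * ue (of_int (t * (A * h - B * minv q h)) / of_nat k))"
    using F by (intro sum.cong refl) auto
  also have "\<dots> = (\<Sum>h\<in>H. F h * (\<Sum>t\<in>{0..<int k}. ue (of_int (t * (A * h - B * minv q h)) / of_nat k)))"
    by (subst sum.swap) (simp add: sum_distrib_left)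
  also have "\<dots> = (\<Sum>h\<in>H. F h * (if int k dvd A * h - B * minv q h then of_nat k else 0))"
    by (simp only: sum_ue[OF k0])
  also have "\<dots> = of_nat k * (\<Sum>h\<in>H. if int k dvd A * h - B * minv q h then F h else 0)"
    unfolding sum_distrib_left by (intro sum.cong refl) auto
  finally have "(\<Sum>h\<in>H. F h) = (\<Sum>h\<in>H. if int k dvd A * h - B * minv q h then F h else 0)"
    using k0 by simp
  also have "\<dots> = (\<Sum>h\<in>{h \<in> H. int k dvd A * h - B * minv q h}. F h)"
    by (rule sum.inter_filter[OF modgrp_finite[OF H], symmetric])
  finally have "norm (\<Sum>h\<in>H. F h) \<le> (\<Sum>h\<in>{h \<in> H. int k dvd A * h - B * minv q h}. norm (F h))"
    by (simp only: norm_sum)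
  then show ?thesis by (simp add: F_def)
qed

text \<open>Multiplication by \<open>h\<close> turns the condition into \<open>A h^2 = B\<close>
  modulo \<open>k\<close>. With one solution \<open>h0\<close> all others satisfy
  \<open>A (x - h0) (x + h0) = 0\<close>, so \<open>quad_count\<close> limits the residues modulo
  \<open>k\<close>, and each has at most \<open>card (kern k H)\<close> lifts to solutions in
  \<open>H\<close>.\<close>

lemma stationary_count:
  assumes H: "modgrp q H" and k: "k dvd q" and sf: "squarefree k"
  shows "card {h \<in> H. int k dvd A * h - B * minv q h} * card (red k H) \<le> nat (gcd A (int k)) * (ndiv k)\<^sup>2 * card H"
proof -
  define E where "E = {h \<in> H. int k dvd A * h - B * minv q h}"
  have fE: "finite E" using modgrp_finite[OF H] by (simp add: E_def)
  have k0: "k > 0" using modgrp_pos[OF H] k by (rule dvd_pos_nat)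
  have sqr: "[A * h\<^sup>2 = B] (mod int k)" if h: "h \<in> E" for h
  proof -
    have hH: "h \<in> H" using h by (simp add: E_def)
    have "[A * h = B * minv q h] (mod int k)" using h by (simp add: E_def cong_iff_dvd_diff)
    then have "[h * (A * h) = h * (B * minv q h)] (mod int k)" by (rule cong_scalar_left)
    moreover have "[B * (h * minv q h) = B * 1] (mod int k)"
      using cong_dvd_mod[OF modgrp_minv_cong[OF H hH] k] by (rule cong_scalar_left)
    ultimately show ?thesis by (simp add: power2_eq_square mult_ac Cong.cong_def)
  qed
  have R: "card ((\<lambda>h. h mod int k) ` E) \<le> nat (gcd A (int k)) * (ndiv k)\<^sup>2"
  proof (cases "E = {}")
    case False
    then obtain h0 where h0: "h0 \<in> E" by blast
    show ?thesis
    proof (rule quad_count[where ?x0.0 = h0 and u = h0, OF sf _ order_refl])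
      show "(\<lambda>h. h mod int k) ` E \<subseteq> {0..<int k}" using k0 by auto
      fix x assume "x \<in> (\<lambda>h. h mod int k) ` E"
      then obtain h where h: "h \<in> E" "x = h mod int k" by blast
      have "[A * (x - h0) * (x + h0) = A * (h - h0) * (h + h0)] (mod int k)"
        unfolding h(2) by (intro cong_mult cong_add cong_diff cong_refl) (simp_all add: Cong.cong_def)
      moreover have "A * (h - h0) * (h + h0) = A * h\<^sup>2 - A * h0\<^sup>2" by (simp add: power2_eq_square algebra_simps)
      moreover have "[A * h\<^sup>2 - A * h0\<^sup>2 = B - B] (mod int k)" using sqr[OF h(1)] sqr[OF h0] by (rule cong_diff)
      ultimately have "[A * (x - h0) * (x + h0) = 0] (mod int k)" by (simp add: Cong.cong_def)
      then show "int k dvd A * (x - h0) * (x + h0)" by (simp add: cong_0_iff)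
    qed
  qed simp
  have "card E = (\<Sum>y\<in>(\<lambda>h. h mod int k) ` E. card {x \<in> E. x mod int k = y})"
    by (rule sum_card_fibres[OF fE, symmetric])
  also have "\<dots> \<le> (\<Sum>y\<in>(\<lambda>h. h mod int k) ` E. card (kern k H))"
  proof (rule sum_mono)
    fix y assume "y \<in> (\<lambda>h. h mod int k) ` E"
    then obtain h where h: "h \<in> H" "y = h mod int k" by (auto simp: E_def)
    have "card {x \<in> E. x mod int k = y} \<le> card {x \<in> H. x mod int k = h mod int k}"
      using modgrp_finite[OF H] by (intro card_mono) (auto simp: E_def h)
    then show "card {x \<in> E. x mod int k = y} \<le> card (kern k H)" using card_fibre[OF H k h(1)] by simp
  qed
  also have "\<dots> = card ((\<lambda>h. h mod int k) ` E) * card (kern k H)" by simp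
  also have "\<dots> \<le> nat (gcd A (int k)) * (ndiv k)\<^sup>2 * card (kern k H)" using R by (rule mult_le_mono1)
  finally have "card E * card (red k H) \<le> nat (gcd A (int k)) * (ndiv k)\<^sup>2 * card (kern k H) * card (red k H)"
    by (rule mult_le_mono1)
  then show ?thesis using card_red_kern[OF H k] by (simp add: E_def mult_ac)
qed

text \<open>\<open>k\<close> is \<open>q2\<close> divided by the generator \<open>g\<close> of
  \<open>unipotent_part\<close>. The stationary bound is strong when \<open>H\<close> is large
  modulo \<open>k\<close>. For the size of \<open>H\<close>: \<open>kern k H\<close> has at most
  \<open>g\<close> classes modulo \<open>q2\<close>, and \<open>kern r H\<close>, the part of
  \<open>kern q2 H\<close> trivial modulo \<open>q1\<close>, has at most \<open>k\<close> elements.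
  The two losses combine to \<open>g k = q2\<close>.\<close>

lemma cubefree_dichotomy:
  assumes H: "modgrp q H" and q: "q = q1 * q2\<^sup>2" and sf: "squarefree q2" and cop: "coprime q1 q2"
  obtains k where "squarefree k" "k dvd q"
    "\<forall>A B. norm (\<Sum>h\<in>H. ue (of_int (A * h + B * minv q h) / of_nat q)) * card (red k H) \<le>
      nat (gcd A (int k)) * (ndiv k)\<^sup>2 * card H"
    "card H \<le> card (red k H) * q2 * card (red q1 (kern q2 H))"
proof -
  define r where "r = q1 * q2"
  have qr: "q = r * q2" and sq: "q dvd r\<^sup>2" by (simp_all add: q r_def power2_eq_square)
  obtain g k where gk: "q2 = g * k" "g > 0" "k > 0" "\<forall>j. (1 + int r * j) mod int q \<in> H \<longleftrightarrow> int g dvd j"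
    "card (kern r H) \<le> k"
    by (rule unipotent_part[OF H qr sq])
  have kq2: "k dvd q2" using gk(1) by simp
  have q2q: "q2 dvd q" using qr by simp
  have q1q: "q1 dvd q" using q by simp
  have kq: "k dvd q" using kq2 q2q by (rule dvd_trans)
  have sfk: "squarefree k" using sf kq2 squarefree_mono by blast
  have 1: "norm (\<Sum>h\<in>H. ue (of_int (A * h + B * minv q h) / of_nat q)) * card (red k H) \<le>
      nat (gcd A (int k)) * (ndiv k)\<^sup>2 * card H" for A B
  proof -
    have "norm (\<Sum>h\<in>H. ue (of_int (A * h + B * minv q h) / of_nat q)) \<le> card {h \<in> H. int k dvd A * h - B * minv q h}"
      using gk(4) by (intro sum_le_stationary[OF H qr[unfolded gk(1)] sq]) blast
    then have "norm (\<Sum>h\<in>H. ue (of_int (A * h + B * minv q h) / of_nat q)) * card (red k H) \<le>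
        real (card {h \<in> H. int k dvd A * h - B * minv q h}) * card (red k H)"
      by (rule mult_right_mono) simp
    also have "\<dots> \<le> nat (gcd A (int k)) * (ndiv k)\<^sup>2 * card H"
      using of_nat_mono[OF stationary_count[OF H kq sfk, of A B], where 'a = real] by simp
    finally show ?thesis .
  qed
  have K2: "modgrp q (kern q2 H)" by (rule modgrp_kern[OF H q2q])
  have "card (red q2 (kern k H)) \<le> g"
  proof -
    have q20: "q2 > 0" using gk by simp
    have "red q2 (kern k H) \<subseteq> {y \<in> {0..<int q2}. [y = 1] (mod int k)}"
    proof
      fix y assume "y \<in> red q2 (kern k H)"
      then obtain x where x: "x \<in> kern k H" "y = x mod int q2" by (auto simp: red_def)
      then have "[y = 1] (mod int k)" using mod_cong_dvd[OF kq2, of x] by (auto simp: kern_def intro: cong_trans)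
      then show "y \<in> {y \<in> {0..<int q2}. [y = 1] (mod int k)}" using x q20 by simp
    qed
    then have "card (red q2 (kern k H)) \<le> card {y \<in> {0..<int q2}. [y = 1] (mod int k)}"
      by (intro card_mono) (auto intro: finite_subset[of _ "{0..<int q2}"])
    also have "\<dots> \<le> q2 div k" by (rule card_cong_class_le[OF kq2 q20])
    finally show ?thesis using gk by simp
  qed
  then have a: "card (red q2 H) \<le> card (red k H) * g" using card_red_split[OF H kq2 q2q] by simp
  have "kern q1 (kern q2 H) = kern r H"
    using kern_mult[of q2 q1 H] cop by (simp add: r_def coprime_commute mult.commute)
  then have b: "card (kern q2 H) \<le> card (red q1 (kern q2 H)) * k"
    using card_red_kern[OF K2 q1q] gk(5) by simp
  have "card H = card (red q2 H) * card (kern q2 H)" by (rule card_red_kern[OF H q2q])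
  also have "\<dots> \<le> (card (red k H) * g) * (card (red q1 (kern q2 H)) * k)" using a b by (rule mult_le_mono)
  also have "\<dots> = card (red k H) * q2 * card (red q1 (kern q2 H))" by (simp add: gk(1) mult_ac)
  finally show ?thesis using that[of k] sfk kq 1 by blast
qed

text \<open>Elements of \<open>kern q2 H\<close> are 1 modulo \<open>q2\<close>, hence
  \<open>x x' = x + x' - 1\<close> modulo \<open>q2^2\<close>. So the phase modulo
  \<open>q2^2\<close>, normalised at \<open>x = 1\<close>, is additive and gives a character
  \<open>u\<close>, and a twisted sum modulo \<open>q1\<close> remains. The coset representative and
  the Bezout factor multiply the frequencies by units, which preserves their gcds with
  \<open>q1\<close>.\<close>

lemma cubefree_coset_reduction:
  fixes \<eta> :: real
  assumes H: "modgrp q H" and q: "q = q1 * q2\<^sup>2" and cop: "coprime q1 q2"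
    and small: "\<forall>u \<alpha> \<beta>. modchar q (kern q2 H) u \<longrightarrow> gcd \<alpha> (int q1) = gcd A (int q1) \<longrightarrow>
      gcd \<beta> (int q1) = gcd B (int q1) \<longrightarrow>
      norm (\<Sum>x\<in>kern q2 H. u x * ue (of_int (\<alpha> * x + \<beta> * minv q x) / of_nat q1)) \<le> \<eta> * card (kern q2 H)"
  shows "norm (\<Sum>h\<in>H. ue (of_int (A * h + B * minv q h) / of_nat q)) \<le> \<eta> * card H"
proof -
  define K where "K = kern q2 H"
  have q0: "q > 0" by (rule modgrp_pos[OF H])
  then have q10: "q1 > 0" and q20: "q2\<^sup>2 > 0" using q by (auto simp: zero_less_mult_iff)
  have q2q: "q2 dvd q" and q1q: "q1 dvd q" and q22q: "q2\<^sup>2 dvd q" by (simp_all add: q power2_eq_square)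
  have K: "modgrp q K" unfolding K_def by (rule modgrp_kern[OF H q2q])
  have KH: "K \<subseteq> H" unfolding K_def by (rule kern_sub)
  have "coprime q1 (q2\<^sup>2)" using cop by simp
  then obtain y v where yv: "y * int q1 + v * int (q2\<^sup>2) = 1" by (rule bezout_coprime_nat)
  have copv: "coprime v (int q1)" using coprime_left_combination[OF yv] .
  show ?thesis
  proof (rule sum_subgroup_average[OF H K KH])
    fix h assume h: "h \<in> H"
    define z where "z = (\<lambda>x. A * (h * x) + B * (minv q h * minv q x))"
    define u where "u = (\<lambda>x. ue (of_int (y * (z x - z 1)) / of_nat (q2\<^sup>2)))"
    define c where "c = ue (of_int (y * z 1) / of_nat (q2\<^sup>2))"
    have inv1: "[minv q 1 = 1] (mod int q)" by (rule minv_unique) simp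
    have add1: "[x * x' = x + x' - 1] (mod int (q2\<^sup>2))" if "[x = 1] (mod int q2)" "[x' = 1] (mod int q2)" for x x' :: int
    proof -
      have "int q2 * int q2 dvd (x - 1) * (x' - 1)"
        using that by (intro mult_dvd_mono) (auto simp: cong_iff_dvd_diff)
      moreover have "x * x' - (x + x' - 1) = (x - 1) * (x' - 1)" by (simp add: algebra_simps)
      ultimately show ?thesis by (simp add: cong_iff_dvd_diff power2_eq_square)
    qed
    have kinv: "[minv q x = 1] (mod int q2)" if "x \<in> K" for x
      using modgrp_minv[OF K that] by (simp add: K_def kern_def)
    have char: "modchar q K u"
      unfolding modchar_def
    proof (intro conjI ballI)
      fix x x' assume x: "x \<in> K" "x' \<in> K"
      have x1: "[x = 1] (mod int q2)" "[x' = 1] (mod int q2)" using x by (auto simp: K_def kern_def)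
      have i: "[minv q (x * x' mod int q) = minv q x * minv q x'] (mod int q)"
      proof (rule cong_trans[OF minv_cong_arg minv_mult])
        show "coprime (x * x' mod int q) (int q)" using modgrp_coprime[OF K modgrp_mult[OF K x]] .
      qed (use modgrp_coprime[OF K] x in auto)
      have a: "[x * x' mod int q = x + x' - 1] (mod int (q2\<^sup>2))"
        using mod_cong_dvd[OF q22q] add1[OF x1] by (rule cong_trans)
      have b: "[minv q (x * x' mod int q) = minv q x + minv q x' - 1] (mod int (q2\<^sup>2))"
        using cong_dvd_mod[OF i q22q] add1[OF kinv[OF x(1)] kinv[OF x(2)]] by (rule cong_trans)
      have one: "[minv q 1 = 1] (mod int (q2\<^sup>2))" using inv1 q22q by (rule cong_dvd_mod)
      have "[z (x * x' mod int q) - z 1 = (A * (h * (x + x' - 1)) + B * (minv q h * (minv q x + minv q x' - 1))) - (A * (h * 1) + B * (minv q h * 1))] (mod int (q2\<^sup>2))"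
        unfolding z_def using a b one by (intro cong_diff cong_add cong_scalar_left cong_refl)
      also have "[(A * (h * (x + x' - 1)) + B * (minv q h * (minv q x + minv q x' - 1))) - (A * (h * 1) + B * (minv q h * 1)) =
          (A * (h * x) + B * (minv q h * minv q x) - (A * (h * 1) + B * (minv q h * 1))) +
          (A * (h * x') + B * (minv q h * minv q x') - (A * (h * 1) + B * (minv q h * 1)))] (mod int (q2\<^sup>2))"
        by (simp add: algebra_simps)
      also have "[(A * (h * x) + B * (minv q h * minv q x) - (A * (h * 1) + B * (minv q h * 1))) +
          (A * (h * x') + B * (minv q h * minv q x') - (A * (h * 1) + B * (minv q h * 1))) = (z x - z 1) + (z x' - z 1)] (mod int (q2\<^sup>2))"
        unfolding z_def using one by (intro cong_diff cong_add cong_scalar_left cong_refl) (rule cong_sym, assumption)+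
      finally have "[y * (z (x * x' mod int q) - z 1) = y * ((z x - z 1) + (z x' - z 1))] (mod int (q2\<^sup>2))"
        by (rule cong_scalar_left)
      then have "u (x * x' mod int q) = ue (of_int (y * ((z x - z 1) + (z x' - z 1))) / of_nat (q2\<^sup>2))"
        unfolding u_def by (rule ue_cong)
      also have "\<dots> = ue (of_int (y * (z x - z 1)) / of_nat (q2\<^sup>2) + of_int (y * (z x' - z 1)) / of_nat (q2\<^sup>2))"
        by (simp only: distrib_left of_int_add add_divide_distrib)
      also have "\<dots> = u x * u x'" unfolding u_def by (rule ue_add)
      finally show "u (x * x' mod int q) = u x * u x'" .
    qed (simp add: u_def)
    have summand: "ue (of_int (A * (h * x mod int q) + B * minv q (h * x mod int q)) / of_nat q) =
        c * (u x * ue (of_int ((v * A * h) * x + (v * B * minv q h) * minv q x) / of_nat q1))" if x: "x \<in> K" for x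
    proof -
      have xH: "x \<in> H" using x KH by blast
      have "[minv q (h * x mod int q) = minv q h * minv q x] (mod int q)"
      proof (rule cong_trans[OF minv_cong_arg minv_mult])
        show "coprime (h * x mod int q) (int q)" using modgrp_coprime[OF H modgrp_mult[OF H h xH]] .
      qed (use modgrp_coprime[OF H] h xH in auto)
      then have "[A * (h * x mod int q) + B * minv q (h * x mod int q) = z x] (mod int q)"
        unfolding z_def using mod_cong_dvd[OF dvd_refl] by (intro cong_add cong_scalar_left)
      then have "ue (of_int (A * (h * x mod int q) + B * minv q (h * x mod int q)) / of_nat q) = ue (of_int (z x) / of_nat q)"
        by (rule ue_cong)
      also have "\<dots> = ue (of_int (v * z x) / of_nat q1) * ue (of_int (y * z x) / of_nat (q2\<^sup>2))"
        unfolding q by (rule split_phase[OF yv q10 q20])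
      also have "ue (of_int (y * z x) / of_nat (q2\<^sup>2)) = c * u x"
      proof -
        have "y * z x = y * z 1 + y * (z x - z 1)" by (simp add: algebra_simps)
        then have "real_of_int (y * z x) / of_nat (q2\<^sup>2) = of_int (y * z 1) / of_nat (q2\<^sup>2) + of_int (y * (z x - z 1)) / of_nat (q2\<^sup>2)"
          by (simp only: of_int_add add_divide_distrib)
        then show ?thesis unfolding c_def u_def by (simp only: ue_add)
      qed
      also have "v * z x = (v * A * h) * x + (v * B * minv q h) * minv q x" by (simp add: z_def algebra_simps)
      finally show ?thesis by (simp add: mult_ac)
    qed
    have ch: "coprime h (int q1)" "coprime (minv q h) (int q1)"
      using modgrp_coprime[OF H h] modgrp_coprime[OF H modgrp_minv[OF H h]] q1q
      by (meson coprime_divisors dvd_refl of_nat_dvd_iff)+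
    have gA: "gcd (v * A * h) (int q1) = gcd A (int q1)"
      using gcd_coprime_mult[OF coprime_mult_left_iff[THEN iffD2, OF conjI[OF copv ch(1)]], of A] by (simp add: mult_ac)
    have gB: "gcd (v * B * minv q h) (int q1) = gcd B (int q1)"
      using gcd_coprime_mult[OF coprime_mult_left_iff[THEN iffD2, OF conjI[OF copv ch(2)]], of B] by (simp add: mult_ac)
    have nc: "norm c = 1" by (simp add: c_def)
    have "norm (\<Sum>x\<in>K. ue (of_int (A * (h * x mod int q) + B * minv q (h * x mod int q)) / of_nat q))
       = norm (\<Sum>x\<in>K. u x * ue (of_int ((v * A * h) * x + (v * B * minv q h) * minv q x) / of_nat q1))"
      using summand by (simp add: sum_distrib_left[symmetric] norm_mult nc cong: sum.cong)
    also have "\<dots> \<le> \<eta> * card K"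
      using small char gA gB unfolding K_def by blast
    finally show "norm (\<Sum>x\<in>K. ue (of_int (A * (h * x mod int q) + B * minv q (h * x mod int q)) / of_nat q)) \<le> \<eta> * card K" .
  qed
qed

text \<open>If \<open>Q\<close> divides \<open>\<beta>\<close>, its gcd with \<open>Q\<close> is
  unbounded, but the sum is one-dimensional and \<open>line_twisted\<close> suffices:
  \<open>|red Q H|^2 \<ge> Q^(1 + 4 \<kappa>)\<close> beats \<open>M Q\<close>. The case arises from
  characters with \<open>n = 0\<close>.\<close>

lemma twisted_small_axis:
  fixes \<kappa> \<eta> :: real and M :: nat
  assumes \<kappa>: "\<kappa> > 0" and \<eta>: "\<eta> > 0"
  obtains Q0 :: nat where "\<forall>q H Q u \<alpha> \<beta>. modgrp q H \<longrightarrow> Q dvd q \<longrightarrow> squarefree Q \<longrightarrow> Q0 \<le> Q \<longrightarrow>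
    real Q powr (1 / 2 + 2 * \<kappa>) \<le> card (red Q H) \<longrightarrow> modchar q H u \<longrightarrow>
    nat (gcd \<alpha> (int Q)) \<le> M \<longrightarrow> nat (gcd \<beta> (int Q)) \<le> M \<or> int Q dvd \<beta> \<longrightarrow>
    norm (\<Sum>h\<in>H. u h * ue (of_int (\<alpha> * h + \<beta> * minv q h) / of_nat Q)) \<le> \<eta> * card H"
proof -
  obtain Q1 where Q1: "\<forall>q H Q u \<alpha> \<beta>. modgrp q H \<longrightarrow> Q dvd q \<longrightarrow> squarefree Q \<longrightarrow> Q1 \<le> Q \<longrightarrow>
    real Q powr (1 / 2 + 2 * \<kappa>) \<le> card (red Q H) \<longrightarrow> modchar q H u \<longrightarrow>
    nat (gcd \<alpha> (int Q)) \<le> M \<longrightarrow> nat (gcd \<beta> (int Q)) \<le> M \<longrightarrow>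
    norm (\<Sum>h\<in>H. u h * ue (of_int (\<alpha> * h + \<beta> * minv q h) / of_nat Q)) \<le> \<eta> * card H"
    by (rule twisted_small[OF \<kappa> \<eta>])
  have lt: "1 < 1 + 4 * \<kappa>" using \<kappa> by simp
  obtain P where P: "\<forall>p\<ge>P. (M / \<eta>\<^sup>2) * real p powr 1 < real p powr (1 + 4 * \<kappa>)" by (rule powr_dominates[OF lt])
  have key: "norm (\<Sum>h\<in>H. u h * ue (of_int (\<alpha> * h + \<beta> * minv q h) / of_nat Q)) \<le> \<eta> * card H"
    if H: "modgrp q H" and Q: "Q dvd q" and sf: "squarefree Q" and QP: "max P Q1 \<le> Q"
      and large: "real Q powr (1 / 2 + 2 * \<kappa>) \<le> card (red Q H)" and u: "modchar q H u"
      and \<alpha>: "nat (gcd \<alpha> (int Q)) \<le> M" and \<beta>: "nat (gcd \<beta> (int Q)) \<le> M \<or> int Q dvd \<beta>"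
    for q H Q u \<alpha> \<beta>
    using \<beta>
  proof
    assume "nat (gcd \<beta> (int Q)) \<le> M"
    then show ?thesis using Q1 H Q sf QP large u \<alpha> by simp
  next
    assume d: "int Q dvd \<beta>"
    have Q0: "Q > 0" using modgrp_pos[OF H] Q by (rule dvd_pos_nat)
    have e: "ue (of_int (\<alpha> * h + \<beta> * minv q h) / of_nat Q) = ue (of_int (\<alpha> * h) / of_nat Q)" for h
      using d by (intro ue_cong) (simp add: cong_iff_dvd_diff)
    define T where "T = norm (\<Sum>h\<in>H. u h * ue (of_int (\<alpha> * h) / of_nat Q))"
    have "T\<^sup>2 * (real (card (red Q H)))\<^sup>2 \<le> real (nat (gcd \<alpha> (int Q))) * real Q * (real (card H))\<^sup>2"
      unfolding T_def by (rule line_twisted[OF H Q u])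
    also have "\<dots> \<le> real M * real Q * (real (card H))\<^sup>2"
      using \<alpha> by (intro mult_right_mono) auto
    also have "\<dots> \<le> (\<eta>\<^sup>2 * real Q powr (1 + 4 * \<kappa>)) * (real (card H))\<^sup>2"
    proof (intro mult_right_mono)
      have "(M / \<eta>\<^sup>2) * real Q powr 1 < real Q powr (1 + 4 * \<kappa>)" using P QP by simp
      then show "real M * real Q \<le> \<eta>\<^sup>2 * real Q powr (1 + 4 * \<kappa>)" using \<eta> Q0 by (simp add: field_simps)
    qed simp
    finally have 1: "T\<^sup>2 * (real (card (red Q H)))\<^sup>2 \<le> (\<eta>\<^sup>2 * real Q powr (1 + 4 * \<kappa>)) * (real (card H))\<^sup>2" .
    have "(real Q powr (1 / 2 + 2 * \<kappa>))\<^sup>2 \<le> (real (card (red Q H)))\<^sup>2" using large by (intro power_mono) auto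
    moreover have "(real Q powr (1 / 2 + 2 * \<kappa>))\<^sup>2 = real Q powr (1 + 4 * \<kappa>)"
      by (simp add: power2_eq_square algebra_simps flip: powr_add)
    ultimately have "T\<^sup>2 * real Q powr (1 + 4 * \<kappa>) \<le> T\<^sup>2 * (real (card (red Q H)))\<^sup>2"
      by (intro mult_left_mono) auto
    then have "T\<^sup>2 * real Q powr (1 + 4 * \<kappa>) \<le> (\<eta> * card H)\<^sup>2 * real Q powr (1 + 4 * \<kappa>)"
      using 1 by (simp add: power_mult_distrib mult_ac)
    moreover have "real Q powr (1 + 4 * \<kappa>) > 0" using Q0 by simp
    ultimately have "T\<^sup>2 \<le> (\<eta> * card H)\<^sup>2" by (rule mult_right_le_imp_le)
    then have "T \<le> \<eta> * card H" by (rule power2_le_imp_le) (use \<eta> in simp)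
    then show ?thesis unfolding e T_def .
  qed
  show ?thesis by (rule that[of "max P Q1"], intro allI impI, rule key) assumption+
qed

lemma gcd_unit_mult_le:
  fixes m a :: int
  assumes "coprime a (int Q)" "m \<noteq> 0" shows "nat (gcd (m * a) (int Q)) \<le> nat \<bar>m\<bar>"
proof -
  have "gcd (m * a) (int Q) = gcd m (int Q)" using gcd_coprime_mult[OF assms(1), of m] by (simp add: mult.commute)
  also have "\<dots> \<le> \<bar>m\<bar>" using assms(2) by (intro zdvd_imp_le) auto
  finally show ?thesis by (rule nat_mono)
qed

text \<open>Put \<open>X = q^(\<delta> / 2)\<close>. If \<open>H\<close> has at least
  \<open>X\<close> classes modulo \<open>k\<close>, the stationary bound saves \<open>X\<close> and
  loses only a constant times \<open>q^(\<delta> / 4)\<close> through gcd and divisors. Otherwise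
  \<open>|H| \<ge> c0 q^(1/2) X^2\<close> and \<open>q^(1/2) = q1^(1/2) q2\<close> leave
  \<open>kern q2 H\<close> with at least \<open>c0 X q1^(1/2)\<close> classes modulo
  \<open>q1\<close>, which exceeds \<open>q1^(1/2 + 2 \<kappa>)\<close> for large
  \<open>q\<close>.\<close>

lemma cubefree_sum_small_axis:
  fixes \<delta> c0 \<eta> :: real and m n :: int
  assumes \<delta>: "\<delta> > 0" and c0: "c0 > 0" and \<eta>: "\<eta> > 0" and m: "m \<noteq> 0"
  obtains P :: nat where "\<forall>q\<ge>P. \<forall>H a b. cubefree q \<longrightarrow> modgrp q H \<longrightarrow> c0 * real q powr (1 / 2 + \<delta>) \<le> card H \<longrightarrow>
    coprime a (int q) \<longrightarrow> coprime b (int q) \<longrightarrow>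
    norm (\<Sum>h\<in>H. ue (of_int (m * a * h + n * b * minv q h) / of_nat q)) \<le> \<eta> * card H"
proof -
  define \<kappa> where "\<kappa> = \<delta> / 8"
  have \<kappa>: "\<kappa> > 0" using \<delta> by (simp add: \<kappa>_def)
  define M where "M = max (nat \<bar>m\<bar>) (nat \<bar>n\<bar>)"
  obtain Q0 where Q0: "\<forall>q H Q u \<alpha> \<beta>. modgrp q H \<longrightarrow> Q dvd q \<longrightarrow> squarefree Q \<longrightarrow> Q0 \<le> Q \<longrightarrow>
    real Q powr (1 / 2 + 2 * \<kappa>) \<le> card (red Q H) \<longrightarrow> modchar q H u \<longrightarrow>
    nat (gcd \<alpha> (int Q)) \<le> M \<longrightarrow> nat (gcd \<beta> (int Q)) \<le> M \<or> int Q dvd \<beta> \<longrightarrow>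
    norm (\<Sum>h\<in>H. u h * ue (of_int (\<alpha> * h + \<beta> * minv q h) / of_nat Q)) \<le> \<eta> * card H"
    by (rule twisted_small_axis[OF \<kappa> \<eta>])
  obtain T :: real where T: "T \<ge> 1" "\<forall>k. squarefree k \<longrightarrow> real (ndiv k) \<le> T * real k powr \<kappa>"
    by (rule divisor_bound[OF \<kappa>])
  have lt1: "2 * \<kappa> < \<delta> / 2" and lt2: "2 * \<kappa> < \<delta> / 2" and lt3: "0 < \<delta> / 2" using \<delta> by (simp_all add: \<kappa>_def)
  obtain P1 where P1: "\<forall>p\<ge>P1. (M * T\<^sup>2 / \<eta>) * real p powr (2 * \<kappa>) < real p powr (\<delta> / 2)"
    by (rule powr_dominates[OF lt1])
  obtain P2 where P2: "\<forall>p\<ge>P2. (1 / c0) * real p powr (2 * \<kappa>) < real p powr (\<delta> / 2)"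
    by (rule powr_dominates[OF lt2])
  obtain P3 where P3: "\<forall>p\<ge>P3. (Q0 / c0) * real p powr 0 < real p powr (\<delta> / 2)"
    by (rule powr_dominates[OF lt3])
  have key: "norm (\<Sum>h\<in>H. ue (of_int (m * a * h + n * b * minv q h) / of_nat q)) \<le> \<eta> * card H"
    if qP: "max P1 (max P2 P3) \<le> q" and cf: "cubefree q" and H: "modgrp q H"
      and large: "c0 * real q powr (1 / 2 + \<delta>) \<le> card H"
      and a: "coprime a (int q)" and b: "coprime b (int q)" for q H a b
  proof -
    obtain q1 q2 where d: "q = q1 * q2\<^sup>2" "squarefree q1" "squarefree q2" "coprime q1 q2"
      by (rule cubefree_decomposition[OF cf])
    have q0: "q > 0" by (rule modgrp_pos[OF H])
    then have q10: "q1 > 0" and q20: "q2 > 0" using d(1) by (auto simp: zero_less_mult_iff)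
    have q1q: "q1 dvd q" and q2q: "q2 dvd q" by (simp_all add: d(1) power2_eq_square)
    have copdvd: "coprime x (int Q)" if "coprime x (int q)" "Q dvd q" for x Q
      using that by (meson coprime_divisors dvd_refl of_nat_dvd_iff)
    have gm: "nat (gcd (m * a) (int Q)) \<le> M" if "Q dvd q" for Q
      using gcd_unit_mult_le[OF copdvd[OF a that] m] by (simp add: M_def)
    obtain k where k: "squarefree k" "k dvd q"
      "\<forall>A B. norm (\<Sum>h\<in>H. ue (of_int (A * h + B * minv q h) / of_nat q)) * card (red k H) \<le>
        nat (gcd A (int k)) * (ndiv k)\<^sup>2 * card H"
      "card H \<le> card (red k H) * q2 * card (red q1 (kern q2 H))"
      by (rule cubefree_dichotomy[OF H d(1,3,4)])
    define X where "X = real q powr (\<delta> / 2)"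
    have X0: "X > 0" using q0 by (simp add: X_def)
    define S where "S = norm (\<Sum>h\<in>H. ue (of_int (m * a * h + n * b * minv q h) / of_nat q))"
    have cH: "card H > 0" by (rule modgrp_card[OF H])
    show ?thesis
    proof (cases "X \<le> card (red k H)")
      case True
      have "S * X \<le> S * card (red k H)" using True by (intro mult_left_mono) (auto simp: S_def)
      also have "\<dots> \<le> nat (gcd (m * a) (int k)) * (ndiv k)\<^sup>2 * card H" unfolding S_def using k(3) by blast
      also have "\<dots> \<le> (M * (T * real q powr \<kappa>)\<^sup>2) * card H"
      proof -
        have "k \<le> q" using k(2) q0 by (rule dvd_imp_le)
        then have "T * real k powr \<kappa> \<le> T * real q powr \<kappa>" using T(1) \<kappa> by (intro mult_left_mono powr_mono2) auto
        moreover have "real (ndiv k) \<le> T * real k powr \<kappa>" using T(2) k(1) by blast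
        ultimately have "real (ndiv k) \<le> T * real q powr \<kappa>" by linarith
        then have "real (nat (gcd (m * a) (int k))) * (real (ndiv k))\<^sup>2 * real (card H) \<le> (real M * (T * real q powr \<kappa>)\<^sup>2) * real (card H)"
          using gm[OF k(2)] by (intro mult_right_mono mult_mono power_mono) auto
        then show ?thesis by simp
      qed
      also have "\<dots> = M * T\<^sup>2 * real q powr (2 * \<kappa>) * card H"
        by (simp add: power_mult_distrib power2_eq_square mult_ac flip: powr_add)
      also have "\<dots> \<le> (\<eta> * X) * card H"
      proof (rule mult_right_mono)
        have "(M * T\<^sup>2 / \<eta>) * real q powr (2 * \<kappa>) < X" unfolding X_def using P1 qP by simp
        then show "M * T\<^sup>2 * real q powr (2 * \<kappa>) \<le> \<eta> * X" using \<eta> by (simp add: field_simps)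
      qed simp
      finally have "S * X \<le> (\<eta> * card H) * X" by (simp add: mult_ac)
      then show ?thesis using X0 by (simp add: S_def)
    next
      case False
      define R where "R = real (card (red q1 (kern q2 H)))"
      have R0: "R \<ge> 0" by (simp add: R_def)
      have "c0 * real q powr (1 / 2 + \<delta>) \<le> card H" by (rule large)
      also have "\<dots> \<le> real (card (red k H)) * real q2 * R"
        using of_nat_mono[OF k(4), where 'a = real] by (simp add: R_def)
      also have "\<dots> \<le> X * real q2 * R" using False R0 by (intro mult_right_mono) auto
      finally have le: "c0 * real q powr (1 / 2 + \<delta>) \<le> X * real q2 * R" .
      have "real q powr (1 / 2 + \<delta>) = real q powr (1 / 2) * (X * X)"
        unfolding X_def by (simp flip: powr_add)
      also have "real q powr (1 / 2) = real q1 powr (1 / 2) * real q2"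
        using q20 by (simp add: d(1) powr_mult powr_powr flip: powr_numeral)
      finally have "X * real q2 * (c0 * (real q1 powr (1 / 2) * X)) \<le> X * real q2 * R" using le by (simp add: mult_ac)
      then have Rlo: "real q1 powr (1 / 2) * (c0 * X) \<le> R" using X0 q20 by (simp add: mult_ac)
      have c1: "real q powr (2 * \<kappa>) \<le> c0 * X"
      proof -
        have "(1 / c0) * real q powr (2 * \<kappa>) < X" unfolding X_def using P2 qP by simp
        then show ?thesis using c0 by (simp add: field_simps)
      qed
      have q1le: "q1 \<le> q" using q1q q0 by (rule dvd_imp_le)
      have "real q1 powr (1 / 2 + 2 * \<kappa>) = real q1 powr (1 / 2) * real q1 powr (2 * \<kappa>)" by (rule powr_add)
      also have "\<dots> \<le> real q1 powr (1 / 2) * (c0 * X)"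
      proof (rule mult_left_mono)
        have "real q1 powr (2 * \<kappa>) \<le> real q powr (2 * \<kappa>)" using q1le \<kappa> by (intro powr_mono2) auto
        then show "real q1 powr (2 * \<kappa>) \<le> c0 * X" using c1 by linarith
      qed simp
      also have "\<dots> \<le> R" by (rule Rlo)
      finally have dense: "real q1 powr (1 / 2 + 2 * \<kappa>) \<le> card (red q1 (kern q2 H))" by (simp add: R_def)
      \<comment> \<open>A large \<open>q\<close> could still have a small \<open>q1\<close>. In this
        case, however, the classes modulo \<open>q1\<close> number at least \<open>c0 X\<close> and
        at most \<open>q1\<close>, so \<open>q1\<close> grows with \<open>q\<close>.\<close>
      have "Q0 \<le> q1"
      proof -
        have "red q1 (kern q2 H) \<subseteq> {0..<int q1}" using q10 by (auto simp: red_def)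
        then have "card (red q1 (kern q2 H)) \<le> card {0..<int q1}" by (intro card_mono) auto
        then have R1: "R \<le> q1" by (simp add: R_def)
        have "(Q0 / c0) * real q powr 0 < X" unfolding X_def using P3 qP by simp
        then have "real Q0 \<le> c0 * X" using c0 q0 by (simp add: field_simps)
        also have "\<dots> \<le> real q1 powr (1 / 2) * (c0 * X)"
        proof -
          have "1 \<le> real q1 powr (1 / 2)" using q10 by (intro ge_one_powr_ge_zero) auto
          then have "1 * (c0 * X) \<le> real q1 powr (1 / 2) * (c0 * X)" using c0 X0 by (intro mult_right_mono) auto
          then show ?thesis by simp
        qed
        finally show ?thesis using Rlo R1 by linarith
      qed
      have K: "modgrp q (kern q2 H)" by (rule modgrp_kern[OF H q2q])
      show ?thesis
      proof (rule cubefree_coset_reduction[OF H d(1,4)], intro allI impI)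
        fix u \<alpha> \<beta> assume u: "modchar q (kern q2 H) u" and \<alpha>: "gcd \<alpha> (int q1) = gcd (m * a) (int q1)"
          and \<beta>: "gcd \<beta> (int q1) = gcd (n * b) (int q1)"
        have "nat (gcd \<alpha> (int q1)) \<le> M" unfolding \<alpha> by (rule gm[OF q1q])
        moreover have "nat (gcd \<beta> (int q1)) \<le> M \<or> int q1 dvd \<beta>"
        proof (cases "n = 0")
          case True
          then have "gcd \<beta> (int q1) = int q1" using \<beta> by simp
          then show ?thesis by (metis gcd_dvd1)
        next
          case False
          have "nat (gcd \<beta> (int q1)) \<le> nat \<bar>n\<bar>" unfolding \<beta> by (rule gcd_unit_mult_le[OF copdvd[OF b q1q] False])
          then show ?thesis by (simp add: M_def le_max_iff_disj)
        qed
        ultimately show "norm (\<Sum>x\<in>kern q2 H. u x * ue (of_int (\<alpha> * x + \<beta> * minv q x) / of_nat q1)) \<le> \<eta> * card (kern q2 H)"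
          using Q0[rule_format, OF K q1q d(2) \<open>Q0 \<le> q1\<close> dense u] by blast
      qed
    qed
  qed
  show ?thesis by (rule that[of "max P1 (max P2 P3)"], intro allI impI, rule key) assumption+
qed

text \<open>Inversion permutes \<open>H\<close>, so for \<open>m = 0\<close> the two frequencies can
  be exchanged to meet the demand of the axis lemma for a nonzero first one.\<close>

lemma cubefree_sum_small:
  fixes \<delta> c0 \<eta> :: real and m n :: int
  assumes \<delta>: "\<delta> > 0" and c0: "c0 > 0" and \<eta>: "\<eta> > 0" and mn: "m \<noteq> 0 \<or> n \<noteq> 0"
  obtains P :: nat where "\<forall>q\<ge>P. \<forall>H a b. cubefree q \<longrightarrow> modgrp q H \<longrightarrow> c0 * real q powr (1 / 2 + \<delta>) \<le> card H \<longrightarrow>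
    coprime a (int q) \<longrightarrow> coprime b (int q) \<longrightarrow>
    norm (\<Sum>h\<in>H. ue (of_int (m * a * h + n * b * minv q h) / of_nat q)) \<le> \<eta> * card H"
proof (cases "m = 0")
  case False
  show ?thesis by (rule cubefree_sum_small_axis[OF \<delta> c0 \<eta> False, of n]) (rule that)
next
  case True
  then have n: "n \<noteq> 0" using mn by simp
  obtain P where P: "\<forall>q\<ge>P. \<forall>H a b. cubefree q \<longrightarrow> modgrp q H \<longrightarrow> c0 * real q powr (1 / 2 + \<delta>) \<le> card H \<longrightarrow>
    coprime a (int q) \<longrightarrow> coprime b (int q) \<longrightarrow>
    norm (\<Sum>h\<in>H. ue (of_int (n * a * h + 0 * b * minv q h) / of_nat q)) \<le> \<eta> * card H"
    by (rule cubefree_sum_small_axis[OF \<delta> c0 \<eta> n, of 0])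
  have key: "norm (\<Sum>h\<in>H. ue (of_int (m * a * h + n * b * minv q h) / of_nat q)) \<le> \<eta> * card H"
    if "P \<le> q" "cubefree q" "modgrp q H" "c0 * real q powr (1 / 2 + \<delta>) \<le> card H"
      "coprime b (int q)" for q H a b
  proof -
    have "(\<Sum>h\<in>H. ue (of_int (n * b * minv q h) / of_nat q)) = (\<Sum>h\<in>H. ue (of_int (n * b * h) / of_nat q))"
      by (rule sum.reindex_bij_betw[OF modgrp_minv_bij[OF that(3)]])
    then show ?thesis using P[rule_format, OF that(1-4) that(5) that(5)] True by simp
  qed
  show ?thesis by (rule that[of P], intro allI impI, rule key) assumption+
qed

section \<open>Equidistribution\<close>

lemma subgroup_modgrp:
  assumes q: "q > 0" and H: "subgroup H (unit_group q)" shows "modgrp q H"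
  unfolding modgrp_def
proof (intro conjI ballI)
  show "q > 0" by (rule q)
  have sub: "H \<subseteq> carrier (unit_group q)" using H by (rule subgroup.subset)
  then show "H \<subseteq> {0..<int q}" by (auto simp: carrier_unit_group[OF q])
  show "1 mod int q \<in> H" using subgroup.one_closed[OF H] by (simp add: one_unit_group)
  show "x * y mod int q \<in> H" if "x \<in> H" "y \<in> H" for x y
    using subgroup.m_closed[OF H that] by (simp add: mult_unit_group)
  show "\<exists>y\<in>H. [x * y = 1] (mod int q)" if x: "x \<in> H" for x
  proof (rule bexI)
    have xc: "x \<in> carrier (unit_group q)" using x sub by blast
    then show "[x * minv q x = 1] (mod int q)" by (intro minv_cong) (simp add: carrier_unit_group[OF q])
    show "minv q x \<in> H" using subgroup.m_inv_closed[OF H x] coset_point_inv[OF q xc] by simp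
  qed
qed

text \<open>Writing \<open>d = a h\<close> moves the coset representative into the frequencies,
  where it acts by units; the estimates are uniform in these.\<close>

lemma sum_coset:
  assumes q: "q > 0" and H: "subgroup H (unit_group q)" and a: "a \<in> carrier (unit_group q)"
  shows "(\<Sum>d\<in>a <#\<^bsub>unit_group q\<^esub> H. ue (of_int (m * d + n * minv q d) / of_nat q)) =
    (\<Sum>h\<in>H. ue (of_int (m * a * h + n * minv q a * minv q h) / of_nat q))"
proof -
  have G: "modgrp q H" by (rule subgroup_modgrp[OF q H])
  have ca: "coprime a (int q)" using a by (simp add: carrier_unit_group[OF q])
  have D: "a <#\<^bsub>unit_group q\<^esub> H = (\<lambda>h. a * h mod int q) ` H"
    by (auto simp: l_coset_def mult_unit_group)
  have inj: "inj_on (\<lambda>h. a * h mod int q) H"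
  proof (rule inj_onI)
    fix x y assume xy: "x \<in> H" "y \<in> H" "a * x mod int q = a * y mod int q"
    then have "[a * x = a * y] (mod int q)" by (simp add: Cong.cong_def)
    then have "[x = y] (mod int q)" using cong_mult_lcancel[OF ca] by blast
    then show "x = y" using modgrp_range[OF G] xy eq_if_cong by blast
  qed
  have "ue (of_int (m * (a * h mod int q) + n * minv q (a * h mod int q)) / of_nat q) =
      ue (of_int (m * a * h + n * minv q a * minv q h) / of_nat q)" if h: "h \<in> H" for h
  proof (rule ue_cong)
    have ch: "coprime h (int q)" by (rule modgrp_coprime[OF G h])
    have "[minv q (a * h mod int q) = minv q a * minv q h] (mod int q)"
    proof (rule cong_trans[OF minv_cong_arg minv_mult[OF ca ch]])
      show "coprime (a * h mod int q) (int q)" using ca ch q by simp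
    qed simp
    then have "[m * (a * h mod int q) + n * minv q (a * h mod int q) = m * (a * h) + n * (minv q a * minv q h)] (mod int q)"
      by (intro cong_add cong_scalar_left) simp_all
    then show "[m * (a * h mod int q) + n * minv q (a * h mod int q) = m * a * h + n * minv q a * minv q h] (mod int q)"
      by (simp only: mult.assoc)
  qed
  then show ?thesis unfolding D by (simp add: sum.reindex[OF inj])
qed

lemma equidistribution_if_sums_small:
  fixes H :: "nat \<Rightarrow> int set" and a :: "nat \<Rightarrow> int"
  assumes H: "\<And>q. q \<in> S \<Longrightarrow> q > 0 \<and> subgroup (H q) (unit_group q) \<and> a q \<in> carrier (unit_group q)"
    and small: "\<And>m n (\<eta>::real). m \<noteq> 0 \<or> n \<noteq> 0 \<Longrightarrow> 0 < \<eta> \<Longrightarrow> \<eta> \<le> 1 \<Longrightarrow> \<exists>P. \<forall>q\<ge>P. q \<in> S \<longrightarrow>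
      norm (\<Sum>h\<in>H q. ue (of_int (m * a q * h + n * minv q (a q) * minv q h) / of_nat q)) \<le> \<eta> * card (H q)"
  shows "torus_weak_conv (\<lambda>q. coset_measure q (a q <#\<^bsub>unit_group q\<^esub> H q)) torus_lebesgue (sequentially \<sqinter> principal S)"
proof (rule torus_weak_conv_criterion[OF H])
  fix m n :: int assume mn: "m \<noteq> 0 \<or> n \<noteq> 0"
  show "((\<lambda>q. 1 / of_nat (card (H q)) * (\<Sum>d\<in>a q <#\<^bsub>unit_group q\<^esub> H q.
      ue (of_int (m * d + n * minv q d) / of_nat q))) \<longlongrightarrow> 0) (sequentially \<sqinter> principal S)"
  proof (rule tendstoI)
    fix e :: real assume e: "e > 0"
    \<comment> \<open>Half of \<open>e\<close> leaves room for the strict inequality, and the cap at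
      1 meets the range in \<open>small\<close>.\<close>
    have e': "0 < min 1 (e / 2)" "min 1 (e / 2) \<le> 1" using e by simp_all
    obtain P where P: "\<forall>q\<ge>P. q \<in> S \<longrightarrow>
      norm (\<Sum>h\<in>H q. ue (of_int (m * a q * h + n * minv q (a q) * minv q h) / of_nat q)) \<le> min 1 (e / 2) * card (H q)"
      using small[OF mn e'] by (rule exE)
    have "dist (1 / of_nat (card (H q)) * (\<Sum>d\<in>a q <#\<^bsub>unit_group q\<^esub> H q.
      ue (of_int (m * d + n * minv q d) / of_nat q))) 0 < e" if q: "q \<ge> P" "q \<in> S" for q
    proof -
      have s: "q > 0" "subgroup (H q) (unit_group q)" "a q \<in> carrier (unit_group q)" using H[OF q(2)] by auto
      have c: "card (H q) > 0" by (rule modgrp_card[OF subgroup_modgrp[OF s(1,2)]])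
      define T where "T = norm (\<Sum>d\<in>a q <#\<^bsub>unit_group q\<^esub> H q. ue (of_int (m * d + n * minv q d) / of_nat q))"
      have "T \<le> min 1 (e / 2) * card (H q)" unfolding T_def sum_coset[OF s] using P q by blast
      also have "\<dots> < e * card (H q)" using e c by (intro mult_strict_right_mono) auto
      finally have "T / card (H q) < e" using c by (simp add: pos_divide_less_eq)
      then show ?thesis unfolding dist_norm diff_0_right norm_mult T_def[symmetric] by (simp add: norm_divide)
    qed
    then show "\<forall>\<^sub>F q in sequentially \<sqinter> principal S. dist (1 / of_nat (card (H q)) * (\<Sum>d\<in>a q <#\<^bsub>unit_group q\<^esub> H q.
      ue (of_int (m * d + n * minv q d) / of_nat q))) 0 < e"
      unfolding eventually_inf_principal eventually_sequentially by (intro exI[of _ P]) simp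
  qed
qed

text \<open>Once \<open>q\<close> exceeds \<open>|m|\<close> and \<open>|n|\<close>, a nonzero
  frequency stays nonzero modulo \<open>q\<close>, also after multiplication by a unit. If one
  frequency vanishes, the line estimate applies, after inverting \<open>H\<close> when it is the
  first.\<close>

lemma prime_sum_small:
  fixes \<delta> c0 \<eta> :: real and m n :: int
  assumes \<delta>: "\<delta> > 0" and c0: "c0 > 0" and \<eta>: "0 < \<eta>" "\<eta> \<le> 1" and mn: "m \<noteq> 0 \<or> n \<noteq> 0"
  obtains P :: nat where "\<forall>q\<ge>P. \<forall>H a b. prime q \<longrightarrow> modgrp q H \<longrightarrow> c0 * real q powr \<delta> \<le> card H \<longrightarrow>
    coprime a (int q) \<longrightarrow> coprime b (int q) \<longrightarrow>
    norm (\<Sum>h\<in>H. ue (of_int (m * a * h + n * b * minv q h) / of_nat q)) \<le> \<eta> * card H"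
proof -
  obtain P1 :: nat where P1: "\<forall>p\<ge>P1. \<forall>H m n. prime p \<longrightarrow> modgrp p H \<longrightarrow> c0 * real p powr \<delta> \<le> card H \<longrightarrow>
    \<not> int p dvd m \<longrightarrow> \<not> int p dvd n \<longrightarrow> norm (\<Sum>h\<in>H. ue (of_int (m * h + n * minv p h) / of_nat p)) < \<eta> * card H"
    by (rule prime_plane_sum_small[OF \<delta> c0 \<eta>])
  obtain P2 :: nat where P2: "\<forall>p\<ge>P2. \<forall>H m. prime p \<longrightarrow> modgrp p H \<longrightarrow> c0 * real p powr \<delta> \<le> card H \<longrightarrow>
    \<not> int p dvd m \<longrightarrow> norm (\<Sum>h\<in>H. ue (of_int (m * h) / of_nat p)) < \<eta> * card H"
    by (rule prime_line_sum_small[OF \<delta> c0 \<eta>])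
  define P where "P = max (max P1 P2) (nat \<bar>m\<bar> + nat \<bar>n\<bar> + 1)"
  have key: "norm (\<Sum>h\<in>H. ue (of_int (m * a * h + n * b * minv q h) / of_nat q)) \<le> \<eta> * card H"
    if qP: "P \<le> q" and pr: "prime q" and H: "modgrp q H" and large: "c0 * real q powr \<delta> \<le> card H"
      and a: "coprime a (int q)" and b: "coprime b (int q)" for q H a b
  proof -
    have pP: "q \<ge> P1" "q \<ge> P2" "\<bar>m\<bar> < int q" "\<bar>n\<bar> < int q" using qP by (auto simp: P_def)
    have nd: "\<not> int q dvd x * y" if "x \<noteq> 0" "\<bar>x\<bar> < int q" "coprime y (int q)" for x y
    proof
      assume "int q dvd x * y"
      then have "int q dvd x" using that(3) by (simp add: coprime_commute coprime_dvd_mult_left_iff)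
      then show False using that(1,2) zdvd_not_zless[of "\<bar>x\<bar>" "int q"] by simp
    qed
    consider "m \<noteq> 0" "n \<noteq> 0" | "n = 0" "m \<noteq> 0" | "m = 0" "n \<noteq> 0" using mn by blast
    then show ?thesis
    proof cases
      case 1
      show ?thesis using P1[rule_format, OF pP(1) pr H large nd[OF 1(1) pP(3) a] nd[OF 1(2) pP(4) b]] by (rule less_imp_le)
    next
      case 2
      then show ?thesis using P2[rule_format, OF pP(2) pr H large nd[OF 2(2) pP(3) a]] by simp
    next
      case 3
      have "(\<Sum>h\<in>H. ue (of_int (n * b * minv q h) / of_nat q)) = (\<Sum>h\<in>H. ue (of_int (n * b * h) / of_nat q))"
        by (rule sum.reindex_bij_betw[OF modgrp_minv_bij[OF H]])
      then show ?thesis using P2[rule_format, OF pP(2) pr H large nd[OF 3(2) pP(4) b]] 3(1) by simp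
    qed
  qed
  show ?thesis by (rule that[of P], intro allI impI, rule key) assumption+
qed

lemma coprime_coset_minv:
  assumes "q > 0" "a \<in> carrier (unit_group q)"
  shows "coprime a (int q)" "coprime (minv q a) (int q)"
  using assms coprime_modular_inverse by (auto simp: carrier_unit_group)

theorem theorem1p5:
  fixes \<delta> :: real
  assumes "\<delta> > 0"
  shows
    "(\<forall>(H :: nat \<Rightarrow> int set) (a :: nat \<Rightarrow> int).
        (\<forall>q. cubefree q \<longrightarrow> subgroup (H q) (unit_group q) \<and> a q \<in> carrier (unit_group q)) \<longrightarrow>
        (\<exists>c>0. \<forall>q. cubefree q \<longrightarrow> real (card (H q)) \<ge> c * real q powr (1 / 2 + \<delta>)) \<longrightarrow>
        torus_weak_conv (\<lambda>q. coset_measure q (a q <#\<^bsub>unit_group q\<^esub> H q)) torus_lebesgue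
          (sequentially \<sqinter> principal {q. cubefree q})) \<and>
     (\<forall>(H :: nat \<Rightarrow> int set) (a :: nat \<Rightarrow> int).
        (\<forall>q. prime q \<longrightarrow> subgroup (H q) (unit_group q) \<and> a q \<in> carrier (unit_group q)) \<longrightarrow>
        (\<exists>c>0. \<forall>q. prime q \<longrightarrow> real (card (H q)) \<ge> c * real q powr \<delta>) \<longrightarrow>
        torus_weak_conv (\<lambda>q. coset_measure q (a q <#\<^bsub>unit_group q\<^esub> H q)) torus_lebesgue
          (sequentially \<sqinter> principal {q. prime q}))"
proof (intro conjI allI impI; elim exE conjE)
  fix H :: "nat \<Rightarrow> int set" and a :: "nat \<Rightarrow> int" and c :: real
  assume H: "\<forall>q. cubefree q \<longrightarrow> subgroup (H q) (unit_group q) \<and> a q \<in> carrier (unit_group q)"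
    and c: "c > 0" "\<forall>q. cubefree q \<longrightarrow> real (card (H q)) \<ge> c * real q powr (1 / 2 + \<delta>)"
  have H': "q > 0 \<and> subgroup (H q) (unit_group q) \<and> a q \<in> carrier (unit_group q)" if "q \<in> {q. cubefree q}" for q
    using H that by (auto simp: cubefree_def)
  show "torus_weak_conv (\<lambda>q. coset_measure q (a q <#\<^bsub>unit_group q\<^esub> H q)) torus_lebesgue
          (sequentially \<sqinter> principal {q. cubefree q})"
  proof (rule equidistribution_if_sums_small[OF H'])
    fix m n :: int and \<eta> :: real assume mn: "m \<noteq> 0 \<or> n \<noteq> 0" and \<eta>: "0 < \<eta>" "\<eta> \<le> 1"
    obtain P where P: "\<forall>q\<ge>P. \<forall>H a b. cubefree q \<longrightarrow> modgrp q H \<longrightarrow> c * real q powr (1 / 2 + \<delta>) \<le> card H \<longrightarrow>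
      coprime a (int q) \<longrightarrow> coprime b (int q) \<longrightarrow>
      norm (\<Sum>h\<in>H. ue (of_int (m * a * h + n * b * minv q h) / of_nat q)) \<le> \<eta> * card H"
      by (rule cubefree_sum_small[OF assms c(1) \<eta>(1) mn])
    show "\<exists>P. \<forall>q\<ge>P. q \<in> {q. cubefree q} \<longrightarrow>
      norm (\<Sum>h\<in>H q. ue (of_int (m * a q * h + n * minv q (a q) * minv q h) / of_nat q)) \<le> \<eta> * card (H q)"
    proof (intro exI allI impI)
      fix q assume q: "P \<le> q" "q \<in> {q. cubefree q}"
      have s: "q > 0" "subgroup (H q) (unit_group q)" "a q \<in> carrier (unit_group q)" using H'[OF q(2)] by auto
      show "norm (\<Sum>h\<in>H q. ue (of_int (m * a q * h + n * minv q (a q) * minv q h) / of_nat q)) \<le> \<eta> * card (H q)"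
        using q c(2) by (intro P[rule_format] subgroup_modgrp[OF s(1,2)] coprime_coset_minv[OF s(1,3)]) auto
    qed
  qed
next
  fix H :: "nat \<Rightarrow> int set" and a :: "nat \<Rightarrow> int" and c :: real
  assume H: "\<forall>q. prime q \<longrightarrow> subgroup (H q) (unit_group q) \<and> a q \<in> carrier (unit_group q)"
    and c: "c > 0" "\<forall>q. prime q \<longrightarrow> real (card (H q)) \<ge> c * real q powr \<delta>"
  have H': "q > 0 \<and> subgroup (H q) (unit_group q) \<and> a q \<in> carrier (unit_group q)" if "q \<in> {q. prime q}" for q
    using H that by (auto simp: prime_gt_0_nat)
  show "torus_weak_conv (\<lambda>q. coset_measure q (a q <#\<^bsub>unit_group q\<^esub> H q)) torus_lebesgue
          (sequentially \<sqinter> principal {q. prime q})"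
  proof (rule equidistribution_if_sums_small[OF H'])
    fix m n :: int and \<eta> :: real assume mn: "m \<noteq> 0 \<or> n \<noteq> 0" and \<eta>: "0 < \<eta>" "\<eta> \<le> 1"
    obtain P where P: "\<forall>q\<ge>P. \<forall>H a b. prime q \<longrightarrow> modgrp q H \<longrightarrow> c * real q powr \<delta> \<le> card H \<longrightarrow>
      coprime a (int q) \<longrightarrow> coprime b (int q) \<longrightarrow>
      norm (\<Sum>h\<in>H. ue (of_int (m * a * h + n * b * minv q h) / of_nat q)) \<le> \<eta> * card H"
      by (rule prime_sum_small[OF assms c(1) \<eta> mn])
    show "\<exists>P. \<forall>q\<ge>P. q \<in> {q. prime q} \<longrightarrow>
      norm (\<Sum>h\<in>H q. ue (of_int (m * a q * h + n * minv q (a q) * minv q h) / of_nat q)) \<le> \<eta> * card (H q)"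
    proof (intro exI allI impI)
      fix q assume q: "P \<le> q" "q \<in> {q. prime q}"
      have s: "q > 0" "subgroup (H q) (unit_group q)" "a q \<in> carrier (unit_group q)" using H'[OF q(2)] by auto
      show "norm (\<Sum>h\<in>H q. ue (of_int (m * a q * h + n * minv q (a q) * minv q h) / of_nat q)) \<le> \<eta> * card (H q)"
        using q c(2) by (intro P[rule_format] subgroup_modgrp[OF s(1,2)] coprime_coset_minv[OF s(1,3)]) auto
    qed
  qed
qed

end
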